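(* Let $s\in\mathbb{R}$ and $p\in(1,\infty)$. Let $U$ and $V$ be nonempty open sets in $\mathbb{R}^n$ and let $T:U\to V$ be a $C^\infty$-diffeomorphism (if $s\ge0$ it is enough to assume that $T$ is a $C^{\lfloor s\rfloor+1}$-diffeomorphism). Let $B\subseteq U$ be a nonempty bounded open set such that $B\subseteq\bar B\subseteq U$. Let $u\in W^{s,p}(V)$ be such that $\mathrm{supp}\,u\subseteq T(B)$. 1. If $s$ is not a noninteger less than $-1$, then $\|u\circ T\|_{W^{s,p}(U)}\le C\,\|u\|_{W^{s,p}(V)}$, where the constant $C$ may depend on $B$ but otherwise is independent of $u$. 2. If each of $U$ and $V$ is Lipschitz or equal to $\mathbb{R}^n$, then the same result holds for all $s\in\mathbb{R}$.
   Context: A Lipschitz domain is a nonempty bounded open set in $\mathbb{R}^n$ with Lipschitz continuous boundary. For nonempty open $\Omega\subseteq\mathbb{R}^n$, $1<p<\infty$: for $k\in\mathbb{N}_0$, $\|u\|_{W^{k,p}(\Omega)}=\sum_{|\nu|\le k}\|\partial^\nu u\|_{L^p(\Omega)}$; for $s=k+\theta$, $\theta\in(0,1)$, $\|u\|_{W^{s,p}(\Omega)}=\|u\|_{W^{k,p}(\Omega)}+\sum_{|\nu|=k}\big(\iint_{\Omega\times\Omega}\frac{|\partial^\nu u(x)-\partial^\nu u(y)|^p}{|x-y|^{n+\theta p}}dx\,dy\big)^{1/p}$; $W^{s,p}(\Omega)$ is the set of $u\in L^p(\Omega)$ with finite norm. For $s\ge0$, $W^{s,p}_0(\Omega)$ is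 the closure of $C_c^\infty(\Omega)$ in $W^{s,p}(\Omega)$. For $s<0$, $W^{s,p}(\Omega)=(W_0^{-s,p'}(\Omega))^*$, $1/p+1/p'=1$, viewed as a subspace of $D'(\Omega)$ by restriction to $C_c^\infty(\Omega)$. For a distribution $u\in D'(V)$, $u\circ T=T^*u\in D'(U)$ is the pullback $\langle T^*u,\varphi\rangle=\langle u,|\det(T^{-1})'|\,\varphi\circ T^{-1}\rangle$, $\varphi\in C_c^\infty(U)$. The support is the distributional support in $V$. *)

theory Defs
  imports "HOL-Analysis.Analysis"
begin

section \<open>Classical derivatives\<close>

text \<open>All functions and distributions are real-valued. A function on an open set \<open>\<Omega>\<close> is a total
  function whose values outside \<open>\<Omega>\<close> are irrelevant; only test functions are required to vanish
  outside.\<close>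

definition partial_deriv :: "'n \<Rightarrow> (real^'n \<Rightarrow> real) \<Rightarrow> real^'n \<Rightarrow> real" where
  "partial_deriv i f x = deriv (\<lambda>t. f (x + t *\<^sub>R axis i 1)) 0"

fun Ck_on :: "nat \<Rightarrow> (real^'n) set \<Rightarrow> (real^'n \<Rightarrow> real) \<Rightarrow> bool" where
  "Ck_on 0 \<Omega> f \<longleftrightarrow> continuous_on \<Omega> f"
| "Ck_on (Suc k) \<Omega> f \<longleftrightarrow> continuous_on \<Omega> f \<and>
     (\<forall>i. (\<forall>x\<in>\<Omega>. (\<lambda>t. f (x + t *\<^sub>R axis i 1)) differentiable (at 0)) \<and>
          Ck_on k \<Omega> (partial_deriv i f))"

definition Ck_diffeo :: "nat \<Rightarrow> (real^'n) set \<Rightarrow> (real^'n) set \<Rightarrow> (real^'n \<Rightarrow> real^'n) \<Rightarrow> bool" where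
  "Ck_diffeo k U V T \<longleftrightarrow> bij_betw T U V \<and>
     (\<forall>i. Ck_on k U (\<lambda>x. T x $ i)) \<and> (\<forall>i. Ck_on k V (\<lambda>y. inv_into U T y $ i))"

definition smooth_diffeo :: "(real^'n) set \<Rightarrow> (real^'n) set \<Rightarrow> (real^'n \<Rightarrow> real^'n) \<Rightarrow> bool" where
  "smooth_diffeo U V T \<longleftrightarrow> (\<forall>k. Ck_diffeo k U V T)"

text \<open>A multi-index is a function \<open>\<nu> :: 'n \<Rightarrow> nat\<close>. The partial derivatives are applied in a fixed
  arbitrary order of the coordinates; on smooth functions (the only ones \<open>\<partial>\<^sup>\<nu>\<close> is applied to) the
  order is immaterial.\<close>

definition mi_order :: "('n::finite \<Rightarrow> nat) \<Rightarrow> nat" where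
  "mi_order \<nu> = (\<Sum>i\<in>UNIV. \<nu> i)"

definition coords :: "'n::finite list" where
  "coords = (SOME xs. distinct xs \<and> set xs = UNIV)"

definition mi_deriv :: "('n::finite \<Rightarrow> nat) \<Rightarrow> (real^'n \<Rightarrow> real) \<Rightarrow> real^'n \<Rightarrow> real" where
  "mi_deriv \<nu> f = foldr (\<lambda>i g. (partial_deriv i ^^ \<nu> i) g) coords f"

lemma coords: "distinct (coords :: 'n::finite list)" "set (coords :: 'n::finite list) = UNIV"
proof -
  have "\<exists>xs :: 'n list. distinct xs \<and> set xs = UNIV"
    using finite_distinct_list[of "UNIV :: 'n set"] by auto
  then have "distinct (coords :: 'n list) \<and> set (coords :: 'n list) = UNIV"
    unfolding coords_def by (rule someI_ex)
  then show "distinct (coords :: 'n list)" "set (coords :: 'n list) = UNIV" by auto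
qed

lemma finite_mi_order_le: "finite {\<nu> :: 'n::finite \<Rightarrow> nat. mi_order \<nu> \<le> k}"
proof (rule finite_subset)
  show "{\<nu> :: 'n \<Rightarrow> nat. mi_order \<nu> \<le> k} \<subseteq> PiE UNIV (\<lambda>_. {..k})"
  proof (rule subsetI)
    fix \<nu> :: "'n \<Rightarrow> nat" assume "\<nu> \<in> {\<nu>. mi_order \<nu> \<le> k}"
    then have "\<nu> i \<le> k" for i
      using member_le_sum[of i UNIV \<nu>] by (simp add: mi_order_def)
    then show "\<nu> \<in> PiE UNIV (\<lambda>_. {..k})" by (auto simp: PiE_def)
  qed
  show "finite (PiE (UNIV :: 'n set) (\<lambda>_. {..k}))" by (intro finite_PiE) auto
qed


section \<open>Distributions\<close>

definition test_functions :: "(real^'n) set \<Rightarrow> (real^'n \<Rightarrow> real) set" where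
  "test_functions \<Omega> = {\<phi>. (\<forall>k. Ck_on k UNIV \<phi>) \<and>
     compact (closure {x. \<phi> x \<noteq> 0}) \<and> closure {x. \<phi> x \<noteq> 0} \<subseteq> \<Omega>}"

text \<open>\<open>D'(\<Omega>)\<close>: functionals that are linear on \<open>C\<^sub>c\<^sup>\<infinity>(\<Omega>)\<close> and continuous for its inductive limit
  topology. Values on arguments that are not test functions in \<open>\<Omega>\<close> are irrelevant.\<close>

definition distributions :: "(real^'n) set \<Rightarrow> ((real^'n \<Rightarrow> real) \<Rightarrow> real) set" where
  "distributions \<Omega> = {u.
     (\<forall>\<phi>\<in>test_functions \<Omega>. \<forall>\<psi>\<in>test_functions \<Omega>. \<forall>a b.
        u (\<lambda>x. a * \<phi> x + b * \<psi> x) = a * u \<phi> + b * u \<psi>) \<and>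
     (\<forall>K. compact K \<and> K \<subseteq> \<Omega> \<longrightarrow> (\<exists>C N. \<forall>\<phi>\<in>test_functions \<Omega>. closure {x. \<phi> x \<noteq> 0} \<subseteq> K \<longrightarrow>
        \<bar>u \<phi>\<bar> \<le> C * (\<Sum>\<nu> | mi_order \<nu> \<le> N. SUP x. \<bar>mi_deriv \<nu> \<phi> x\<bar>)))}"

definition regular_distribution :: "(real^'n) set \<Rightarrow> (real^'n \<Rightarrow> real) \<Rightarrow> (real^'n \<Rightarrow> real) \<Rightarrow> real" where
  "regular_distribution \<Omega> f \<phi> = (LINT x:\<Omega>|lebesgue. f x * \<phi> x)"

definition dist_support :: "(real^'n) set \<Rightarrow> ((real^'n \<Rightarrow> real) \<Rightarrow> real) \<Rightarrow> (real^'n) set" where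
  "dist_support \<Omega> u =
     {x\<in>\<Omega>. \<forall>W. open W \<and> x \<in> W \<and> W \<subseteq> \<Omega> \<longrightarrow> (\<exists>\<phi>\<in>test_functions W. u \<phi> \<noteq> 0)}"

definition dist_pullback :: "(real^'n) set \<Rightarrow> (real^'n) set \<Rightarrow> (real^'n \<Rightarrow> real^'n) \<Rightarrow>
    ((real^'n \<Rightarrow> real) \<Rightarrow> real) \<Rightarrow> (real^'n \<Rightarrow> real) \<Rightarrow> real" where
  "dist_pullback U V T u \<phi> = u (\<lambda>y. if y \<in> V
     then \<bar>det (jacobian (inv_into U T) (at y))\<bar> * \<phi> (inv_into U T y)
     else 0)"


section \<open>Sobolev-Slobodeckij spaces\<close>

definition ennreal_root :: "real \<Rightarrow> ennreal \<Rightarrow> ennreal" where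
  "ennreal_root p a = (if a = \<infinity> then \<infinity> else ennreal (enn2real a powr (1 / p)))"

definition Lp_norm :: "(real^'n) set \<Rightarrow> real \<Rightarrow> (real^'n \<Rightarrow> real) \<Rightarrow> ennreal" where
  "Lp_norm \<Omega> p f = ennreal_root p (\<integral>\<^sup>+x. ennreal (\<bar>f x\<bar> powr p) \<partial>lebesgue_on \<Omega>)"

definition Lp_space :: "(real^'n) set \<Rightarrow> real \<Rightarrow> (real^'n \<Rightarrow> real) set" where
  "Lp_space \<Omega> p = {f \<in> borel_measurable (lebesgue_on \<Omega>). Lp_norm \<Omega> p f < \<infinity>}"

definition gagliardo :: "(real^'n) set \<Rightarrow> real \<Rightarrow> real \<Rightarrow> (real^'n \<Rightarrow> real) \<Rightarrow> ennreal" where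
  "gagliardo \<Omega> \<theta> p f = ennreal_root p
     (\<integral>\<^sup>+(x, y). ennreal (\<bar>f x - f y\<bar> powr p / norm (x - y) powr (real CARD('n) + \<theta> * p))
        \<partial>lebesgue_on (\<Omega> \<times> \<Omega>))"

definition locally_integrable_on :: "(real^'n \<Rightarrow> real) \<Rightarrow> (real^'n) set \<Rightarrow> bool" where
  "locally_integrable_on f \<Omega> \<longleftrightarrow> (\<forall>K. compact K \<and> K \<subseteq> \<Omega> \<longrightarrow> f absolutely_integrable_on K)"

definition weak_derivs :: "(real^'n) set \<Rightarrow> ('n \<Rightarrow> nat) \<Rightarrow> (real^'n \<Rightarrow> real) \<Rightarrow> (real^'n \<Rightarrow> real) set" where
  "weak_derivs \<Omega> \<nu> f = {g. locally_integrable_on g \<Omega> \<and>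
     (\<forall>\<phi>\<in>test_functions \<Omega>. regular_distribution \<Omega> g \<phi> =
        (-1) ^ mi_order \<nu> * regular_distribution \<Omega> f (mi_deriv \<nu> \<phi>))}"

text \<open>The elements of \<^term>\<open>weak_derivs \<Omega> \<nu> u\<close> agree almost everywhere on \<open>\<Omega>\<close>, so the infima below
  range over at most one value; they are \<open>\<infinity>\<close> if \<open>\<partial>\<^sup>\<nu>u\<close> is not a function. The norm is used for
  \<open>s \<ge> 0\<close> only.\<close>

definition sobolev_norm :: "(real^'n) set \<Rightarrow> real \<Rightarrow> real \<Rightarrow> (real^'n \<Rightarrow> real) \<Rightarrow> ennreal" where
  "sobolev_norm \<Omega> s p u =
     (\<Sum>\<nu> | mi_order \<nu> \<le> nat \<lfloor>s\<rfloor>. INF g\<in>weak_derivs \<Omega> \<nu> u. Lp_norm \<Omega> p g) +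
     (if s \<in> \<int> then 0
      else \<Sum>\<nu> | mi_order \<nu> = nat \<lfloor>s\<rfloor>. INF g\<in>weak_derivs \<Omega> \<nu> u. gagliardo \<Omega> (frac s) p g)"

definition sobolev :: "(real^'n) set \<Rightarrow> real \<Rightarrow> real \<Rightarrow> (real^'n \<Rightarrow> real) set" where
  "sobolev \<Omega> s p = {u \<in> Lp_space \<Omega> p. sobolev_norm \<Omega> s p u < \<infinity>}"

definition sobolev0 :: "(real^'n) set \<Rightarrow> real \<Rightarrow> real \<Rightarrow> (real^'n \<Rightarrow> real) set" where
  "sobolev0 \<Omega> s p = {u \<in> sobolev \<Omega> s p.
     \<forall>e>0. \<exists>\<phi>\<in>test_functions \<Omega>. sobolev_norm \<Omega> s p (\<lambda>x. u x - \<phi> x) < ennreal e}"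

text \<open>The dual space of \<open>W\<^sub>0\<^sup>s\<^sup>,\<^sup>p(\<Omega>)\<close>. Boundedness forces a functional to respect equality almost
  everywhere.\<close>

definition sobolev0_dual_norm ::
    "(real^'n) set \<Rightarrow> real \<Rightarrow> real \<Rightarrow> ((real^'n \<Rightarrow> real) \<Rightarrow> real) \<Rightarrow> ennreal" where
  "sobolev0_dual_norm \<Omega> s p F =
     (SUP v\<in>{v \<in> sobolev0 \<Omega> s p. sobolev_norm \<Omega> s p v \<le> 1}. ennreal \<bar>F v\<bar>)"

definition sobolev0_dual :: "(real^'n) set \<Rightarrow> real \<Rightarrow> real \<Rightarrow> ((real^'n \<Rightarrow> real) \<Rightarrow> real) set" where
  "sobolev0_dual \<Omega> s p = {F.
     (\<forall>v\<in>sobolev0 \<Omega> s p. \<forall>w\<in>sobolev0 \<Omega> s p. \<forall>a b.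
        F (\<lambda>x. a * v x + b * w x) = a * F v + b * F w) \<and>
     sobolev0_dual_norm \<Omega> s p F < \<infinity>}"

text \<open>The spaces of negative order \<open>s < 0\<close>, as spaces of distributions, where \<open>p / (p - 1)\<close> is the
  exponent conjugate to \<open>p\<close>. The extension \<open>F\<close> of a given \<open>u\<close> is unique on \<open>W\<^sub>0\<close> by density of the
  test functions, so the infimum defining the norm again ranges over at most one value.\<close>

definition dual_extensions ::
    "(real^'n) set \<Rightarrow> real \<Rightarrow> real \<Rightarrow> ((real^'n \<Rightarrow> real) \<Rightarrow> real) \<Rightarrow> ((real^'n \<Rightarrow> real) \<Rightarrow> real) set" where
  "dual_extensions \<Omega> s p u =
     {F \<in> sobolev0_dual \<Omega> (-s) (p / (p - 1)). \<forall>\<phi>\<in>test_functions \<Omega>. F \<phi> = u \<phi>}"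

definition neg_sobolev :: "(real^'n) set \<Rightarrow> real \<Rightarrow> real \<Rightarrow> ((real^'n \<Rightarrow> real) \<Rightarrow> real) set" where
  "neg_sobolev \<Omega> s p = {u \<in> distributions \<Omega>. dual_extensions \<Omega> s p u \<noteq> {}}"

definition neg_sobolev_norm ::
    "(real^'n) set \<Rightarrow> real \<Rightarrow> real \<Rightarrow> ((real^'n \<Rightarrow> real) \<Rightarrow> real) \<Rightarrow> ennreal" where
  "neg_sobolev_norm \<Omega> s p u =
     (INF F\<in>dual_extensions \<Omega> s p u. sobolev0_dual_norm \<Omega> (-s) (p / (p - 1)) F)"


section \<open>Lipschitz domains\<close>

text \<open>Near each boundary point, \<open>\<Omega>\<close> is the region on one side of the graph of a Lipschitz function
  over the hyperplane orthogonal to a unit vector \<open>e\<close>.\<close>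

definition lipschitz_domain :: "(real^'n) set \<Rightarrow> bool" where
  "lipschitz_domain \<Omega> \<longleftrightarrow> \<Omega> \<noteq> {} \<and> bounded \<Omega> \<and> open \<Omega> \<and>
     (\<forall>z\<in>frontier \<Omega>. \<exists>r>0. \<exists>e L \<gamma>. norm e = 1 \<and> L-lipschitz_on {y. e \<bullet> y = 0} \<gamma> \<and>
        \<Omega> \<inter> ball z r = {x \<in> ball z r. \<gamma> (x - (e \<bullet> x) *\<^sub>R e) < e \<bullet> x})"


section \<open>The composition estimate\<close>

text \<open>For \<open>s \<ge> 0\<close> the elements of \<open>W\<^sup>s\<^sup>,\<^sup>p\<close> are functions and \<open>u \<circ> T\<close> is composition (which makes sense
  also for \<open>T\<close> of finite smoothness); for \<open>s < 0\<close> they are distributions and \<open>u \<circ> T\<close> is the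
  pullback.\<close>

definition composition_bounded ::
    "real \<Rightarrow> real \<Rightarrow> (real^'n) set \<Rightarrow> (real^'n) set \<Rightarrow> (real^'n \<Rightarrow> real^'n) \<Rightarrow> (real^'n) set \<Rightarrow> bool" where
  "composition_bounded s p U V T B \<longleftrightarrow>
     (if 0 \<le> s then
        \<exists>C::real. \<forall>u\<in>sobolev V s p. dist_support V (regular_distribution V u) \<subseteq> T ` B \<longrightarrow>
          u \<circ> T \<in> sobolev U s p \<and>
          sobolev_norm U s p (u \<circ> T) \<le> ennreal C * sobolev_norm V s p u
      else
        \<exists>C::real. \<forall>u\<in>neg_sobolev V s p. dist_support V u \<subseteq> T ` B \<longrightarrow>
          dist_pullback U V T u \<in> neg_sobolev U s p \<and>
          neg_sobolev_norm U s p (dist_pullback U V T u) \<le> ennreal C * neg_sobolev_norm V s p u)"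

end

theory Submission
  imports Defs
begin

text \<open>
  The estimate is local. Since \<open>u\<close> is supported in \<open>T(B)\<close> and \<open>closure B\<close> is a compact subset of \<open>U\<close>, the function
  \<open>u \<circ> T\<close> does not change if it is multiplied by a smooth cutoff function that is supported in \<open>U\<close> and equal to
  one near \<open>closure B\<close>. So the central object is the operator \<open>v \<mapsto> a (v \<circ> T)\<close> with a coefficient \<open>a\<close> that vanishes
  outside a compact set \<open>K \<subseteq> U\<close>. On \<open>K\<close> the diffeomorphism is bi-Lipschitz, whatever it does near the boundary of \<open>U\<close>.

  For \<open>s \<ge> 0\<close> this operator is bounded from \<open>W\<^sup>s\<^sup>,\<^sup>p(V)\<close> to \<open>W\<^sup>s\<^sup>,\<^sup>p(U)\<close> (\<open>sobolev_mult_compose_bounded\<close>). Iterated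
  product and chain rules give \<open>\<partial>\<^sup>\<nu>(a (f \<circ> T)) = \<Sum> c\<^sub>\<mu> (\<partial>\<^sup>\<mu>f \<circ> T)\<close> for smooth \<open>f\<close>, the sum being over \<open>|\<mu>| \<le> |\<nu>|\<close>,
  with coefficients that do not depend on \<open>f\<close> and vanish off \<open>K\<close> (\<open>mi_deriv_mult_compose\<close>). Mollification extends the
  formula to weak derivatives (\<open>weak_deriv_mult_compose\<close>), and each of its terms is estimated separately. A
  bi-Lipschitz map distorts Lebesgue measure by at most a constant factor (\<open>nn_integral_lipschitz_inverse\<close>), which
  settles the \<open>L\<^sup>p\<close> norms and, applied to \<open>(x, y) \<mapsto> (T x, T y)\<close>, the part of the double integral that comes from
  increments of \<open>v\<close>. The part that comes from increments of \<open>c\<^sub>\<mu>\<close> is an \<open>L\<^sup>p\<close> norm, because these coefficients are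
  bounded and Lipschitz and the kernel \<open>min(1, |z|)\<^sup>p / |z|\<^sup>n\<^sup>+\<^sup>\<theta>\<^sup>p\<close> is integrable (\<open>slobodeckij_kernel_integrable\<close>).

  There remains the fractional seminorm of a derivative \<open>\<partial>\<^sup>\<mu>v\<close> of order \<open>|\<mu>| < \<lfloor>s\<rfloor>\<close>, which is not a summand of the norm
  of \<open>v\<close>. It is needed on the compact set \<open>T(K) \<subseteq> V\<close> only, and there it is controlled by the \<open>L\<^sup>p\<close> norms of \<open>\<partial>\<^sup>\<mu>v\<close> and
  its first weak derivatives (\<open>gagliardo_local_bound\<close>): pairs of points that are close are joined by segments inside
  \<open>V\<close>, and for pairs at a distance the kernel is harmless.

  For \<open>s < 0\<close> the estimate is dual to the one for the inverse map. With \<open>S = T\<^sup>-\<^sup>1\<close> and \<open>a = \<eta> |det S'|\<close>, \<open>\<eta>\<close> being a cutoff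
  function near \<open>T(closure B)\<close>, the operator \<open>M v = a (v \<circ> S)\<close> is bounded from \<open>W\<^sub>0\<^sup>-\<^sup>s\<^sup>,\<^sup>q(U)\<close> to \<open>W\<^sub>0\<^sup>-\<^sup>s\<^sup>,\<^sup>q(V)\<close>, where
  \<open>1/p + 1/q = 1\<close>. If \<open>F\<close> is an extension of \<open>u\<close> to \<open>W\<^sub>0\<^sup>-\<^sup>s\<^sup>,\<^sup>q(V)\<close>, then \<open>F \<circ> M\<close> is an extension of \<open>u \<circ> T\<close>: on test functions
  the definition of the pullback differs from \<open>u \<circ> M\<close> by the value of \<open>u\<close> at a test function vanishing near the
  support of \<open>u\<close>, and this value is zero by a partition of unity (\<open>distribution_zero_off_support\<close>).
\<close>

section \<open>Calculus of functions of class \<open>C\<^sup>k\<close>\<close>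

text \<open>Partial differentiability at a point together with the value of the derivative, which makes the rules of
  the one-variable calculus directly available.\<close>

definition has_partial :: "'n \<Rightarrow> (real^'n \<Rightarrow> real) \<Rightarrow> real \<Rightarrow> real^'n \<Rightarrow> bool" where
  "has_partial i f D x \<longleftrightarrow> ((\<lambda>t. f (x + t *\<^sub>R axis i 1)) has_real_derivative D) (at 0)"

lemma has_partial_imp_eq: "has_partial i f D x \<Longrightarrow> partial_deriv i f x = D"
  unfolding has_partial_def partial_deriv_def by (rule DERIV_imp_deriv)

lemma line_differentiable_iff:
  "(\<lambda>t. f (x + t *\<^sub>R axis i 1)) differentiable (at 0) \<longleftrightarrow> has_partial i f (partial_deriv i f x) x"
  unfolding has_partial_def partial_deriv_def by (simp add: DERIV_deriv_iff_real_differentiable)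

lemma has_partial_line:
  assumes "has_partial i f D (x + s *\<^sub>R axis i 1)"
  shows "((\<lambda>t. f (x + t *\<^sub>R axis i 1)) has_real_derivative D) (at s)"
proof -
  have "((\<lambda>t. f (x + (t + s) *\<^sub>R axis i 1)) has_real_derivative D) (at 0)"
    using assms unfolding has_partial_def by (simp add: algebra_simps)
  then show ?thesis using DERIV_shift[of "\<lambda>t. f (x + t *\<^sub>R axis i 1)" D 0 s] by simp
qed

lemma eventually_line_in_open:
  fixes x :: "real^'n"
  assumes "open \<Omega>" "x \<in> \<Omega>"
  shows "\<forall>\<^sub>F t in nhds 0. x + t *\<^sub>R axis i 1 \<in> \<Omega>"
proof -
  have "((\<lambda>t. x + t *\<^sub>R axis i 1) \<longlongrightarrow> x + 0 *\<^sub>R axis i (1::real)) (nhds 0)"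
    by (intro tendsto_intros filterlim_ident)
  then show ?thesis using assms by (simp add: tendsto_def)
qed

lemma has_partial_cong:
  assumes "open \<Omega>" "x \<in> \<Omega>" "\<And>y. y \<in> \<Omega> \<Longrightarrow> f y = g y" "has_partial i f D x"
  shows "has_partial i g D x"
proof -
  have "\<forall>\<^sub>F t in nhds 0. f (x + t *\<^sub>R axis i 1) = g (x + t *\<^sub>R axis i 1)"
    using eventually_line_in_open[OF assms(1,2)] by eventually_elim (use assms(3) in auto)
  then show ?thesis using assms(4) unfolding has_partial_def by (subst DERIV_cong_ev[symmetric]) auto
qed

lemma partial_deriv_cong:
  assumes "open \<Omega>" "x \<in> \<Omega>" "\<And>y. y \<in> \<Omega> \<Longrightarrow> f y = g y"
  shows "partial_deriv i f x = partial_deriv i g x"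
  unfolding partial_deriv_def
proof (rule deriv_cong_ev)
  show "\<forall>\<^sub>F t in nhds 0. f (x + t *\<^sub>R axis i 1) = g (x + t *\<^sub>R axis i 1)"
    using eventually_line_in_open[OF assms(1,2)] by eventually_elim (use assms(3) in auto)
qed simp

lemma Ck_on_Suc_iff:
  "Ck_on (Suc k) \<Omega> f \<longleftrightarrow> continuous_on \<Omega> f \<and>
     (\<forall>i. (\<forall>x\<in>\<Omega>. has_partial i f (partial_deriv i f x) x) \<and> Ck_on k \<Omega> (partial_deriv i f))"
  by (simp add: line_differentiable_iff)

lemma Ck_on_cong:
  assumes "open \<Omega>" "\<And>y. y \<in> \<Omega> \<Longrightarrow> f y = g y" "Ck_on k \<Omega> f"
  shows "Ck_on k \<Omega> g"
  using assms
proof (induction k arbitrary: f g)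
  case 0 then show ?case by (auto intro: continuous_on_eq)
next
  case (Suc k)
  have eq: "partial_deriv i f x = partial_deriv i g x" if "x \<in> \<Omega>" for i x
    by (rule partial_deriv_cong[OF Suc.prems(1) that Suc.prems(2)])
  show ?case unfolding Ck_on_Suc_iff
  proof (intro conjI allI ballI)
    show "continuous_on \<Omega> g" using Suc.prems by (auto intro: continuous_on_eq)
    fix i
    show "Ck_on k \<Omega> (partial_deriv i g)"
      using Suc.prems Suc.IH[of "partial_deriv i f"] eq unfolding Ck_on_Suc_iff by blast
    fix x assume "x \<in> \<Omega>"
    then show "has_partial i g (partial_deriv i g x) x"
      using has_partial_cong[OF Suc.prems(1), of x f g i] Suc.prems eq unfolding Ck_on_Suc_iff by metis
  qed
qed

lemma Ck_on_SucI:
  assumes "open \<Omega>" "continuous_on \<Omega> f"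
    "\<And>i x. x \<in> \<Omega> \<Longrightarrow> has_partial i f (f' i x) x" "\<And>i. Ck_on k \<Omega> (f' i)"
  shows "Ck_on (Suc k) \<Omega> f"
proof -
  have "f' i x = partial_deriv i f x" if "x \<in> \<Omega>" for i x
    using assms(3)[OF that] has_partial_imp_eq by metis
  then show ?thesis unfolding Ck_on_Suc_iff using assms Ck_on_cong[OF assms(1)] by metis
qed

lemma Ck_on_imp_continuous: "Ck_on k \<Omega> f \<Longrightarrow> continuous_on \<Omega> f"
  by (cases k) auto

lemma Ck_on_SucD: "Ck_on (Suc k) \<Omega> f \<Longrightarrow> Ck_on k \<Omega> f"
proof (induction k arbitrary: f)
  case (Suc k) then show ?case using Ck_on_Suc_iff[of "Suc k"] Ck_on_Suc_iff[of k] by metis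
qed auto

lemma Ck_on_mono: "Ck_on k \<Omega> f \<Longrightarrow> j \<le> k \<Longrightarrow> Ck_on j \<Omega> f"
  by (induction k) (auto simp: le_Suc_eq simp del: Ck_on.simps dest: Ck_on_SucD)

lemma Ck_on_subset: "Ck_on k \<Omega> f \<Longrightarrow> \<Omega>' \<subseteq> \<Omega> \<Longrightarrow> Ck_on k \<Omega>' f"
  by (induction k arbitrary: f) (auto intro: continuous_on_subset)

lemma Ck_on_partial: "Ck_on (Suc k) \<Omega> f \<Longrightarrow> Ck_on k \<Omega> (partial_deriv i f)"
  by simp

lemma Ck_on_has_partial:
  "Ck_on k \<Omega> f \<Longrightarrow> 1 \<le> k \<Longrightarrow> x \<in> \<Omega> \<Longrightarrow> has_partial i f (partial_deriv i f x) x"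
  by (cases k) (auto simp: Ck_on_Suc_iff simp del: Ck_on.simps)

lemma Ck_on_Un:
  assumes "open A" "open B" "Ck_on k A f" "Ck_on k B f"
  shows "Ck_on k (A \<union> B) f"
  using assms(3,4)
proof (induction k arbitrary: f)
  case 0 then show ?case using assms by (auto intro: continuous_on_open_Un)
next
  case (Suc k) then show ?case
    using continuous_on_open_Un[OF assms(1,2), of f] by auto
qed

lemma has_partial_const: "has_partial i (\<lambda>x. c) 0 x"
  unfolding has_partial_def by simp

lemma has_partial_add:
  "has_partial i f D x \<Longrightarrow> has_partial i g E x \<Longrightarrow> has_partial i (\<lambda>x. f x + g x) (D + E) x"
  unfolding has_partial_def by (rule DERIV_add)

lemma has_partial_mult:
  "has_partial i f D x \<Longrightarrow> has_partial i g E x \<Longrightarrow> has_partial i (\<lambda>x. f x * g x) (D * g x + f x * E) x"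
  unfolding has_partial_def by (drule (1) DERIV_mult) (simp add: algebra_simps)

lemma has_partial_sum:
  "(\<And>a. a \<in> I \<Longrightarrow> has_partial i (f a) (D a) x) \<Longrightarrow> has_partial i (\<lambda>x. \<Sum>a\<in>I. f a x) (\<Sum>a\<in>I. D a) x"
  unfolding has_partial_def by (intro DERIV_sum) auto

lemma has_partial_coord: "has_partial i (\<lambda>x. x $ j) (if i = j then 1 else 0) x"
  unfolding has_partial_def by (auto simp: axis_def intro!: derivative_eq_intros)

lemma Ck_on_const [simp, intro]: "Ck_on k \<Omega> (\<lambda>x. c)"
proof (induction k arbitrary: c)
  case (Suc k)
  have "partial_deriv i (\<lambda>x. c) = (\<lambda>x. 0)" for i :: 'a
    by (rule ext) (rule has_partial_imp_eq[OF has_partial_const])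
  then show ?case unfolding Ck_on_Suc_iff using Suc by (simp add: has_partial_const)
qed simp

lemma Ck_on_add:
  assumes "open \<Omega>" "Ck_on k \<Omega> f" "Ck_on k \<Omega> g"
  shows "Ck_on k \<Omega> (\<lambda>x. f x + g x)"
  using assms(2,3)
proof (induction k arbitrary: f g)
  case 0 then show ?case by (auto intro: continuous_intros)
next
  case (Suc k)
  show ?case
  proof (rule Ck_on_SucI[OF assms(1)])
    show "continuous_on \<Omega> (\<lambda>x. f x + g x)" using Suc.prems by (auto intro: continuous_intros)
    show "Ck_on k \<Omega> (\<lambda>x. partial_deriv i f x + partial_deriv i g x)" for i
      using Suc by simp
    show "has_partial i (\<lambda>x. f x + g x) (partial_deriv i f x + partial_deriv i g x) x"
      if "x \<in> \<Omega>" for i x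
      using that Suc.prems by (intro has_partial_add Ck_on_has_partial[of "Suc k" \<Omega>]) auto
  qed
qed

lemma Ck_on_mult:
  assumes "open \<Omega>" "Ck_on k \<Omega> f" "Ck_on k \<Omega> g"
  shows "Ck_on k \<Omega> (\<lambda>x. f x * g x)"
  using assms(2,3)
proof (induction k arbitrary: f g)
  case 0 then show ?case by (auto intro: continuous_intros)
next
  case (Suc k)
  show ?case
  proof (rule Ck_on_SucI[OF assms(1)])
    show "continuous_on \<Omega> (\<lambda>x. f x * g x)" using Suc.prems by (auto intro: continuous_intros)
    show "Ck_on k \<Omega> (\<lambda>x. partial_deriv i f x * g x + f x * partial_deriv i g x)" for i
      using Suc.prems by (intro Ck_on_add assms Suc.IH Ck_on_partial) (auto intro: Ck_on_SucD simp del: Ck_on.simps)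
    show "has_partial i (\<lambda>x. f x * g x) (partial_deriv i f x * g x + f x * partial_deriv i g x) x"
      if "x \<in> \<Omega>" for i x
      using that Suc.prems by (intro has_partial_mult Ck_on_has_partial[of "Suc k" \<Omega>]) auto
  qed
qed

lemma Ck_on_sum:
  assumes "open \<Omega>" "\<And>a. a \<in> I \<Longrightarrow> Ck_on k \<Omega> (f a)"
  shows "Ck_on k \<Omega> (\<lambda>x. \<Sum>a\<in>I. f a x)"
  using assms(2) by (induction I rule: infinite_finite_induct) (auto intro: Ck_on_add assms(1))

lemma Ck_on_prod:
  assumes "open \<Omega>" "\<And>a. a \<in> I \<Longrightarrow> Ck_on k \<Omega> (f a)"
  shows "Ck_on k \<Omega> (\<lambda>x. \<Prod>a\<in>I. f a x)"
  using assms(2) by (induction I rule: infinite_finite_induct) (auto intro: Ck_on_mult assms(1))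

lemma Ck_on_cmult: "open \<Omega> \<Longrightarrow> Ck_on k \<Omega> f \<Longrightarrow> Ck_on k \<Omega> (\<lambda>x. c * f x)"
  by (intro Ck_on_mult) auto

lemma Ck_on_uminus: "open \<Omega> \<Longrightarrow> Ck_on k \<Omega> f \<Longrightarrow> Ck_on k \<Omega> (\<lambda>x. - f x)"
  using Ck_on_cmult[of \<Omega> k f "-1"] by simp

lemma Ck_on_diff: "open \<Omega> \<Longrightarrow> Ck_on k \<Omega> f \<Longrightarrow> Ck_on k \<Omega> g \<Longrightarrow> Ck_on k \<Omega> (\<lambda>x. f x - g x)"
  using Ck_on_add[of \<Omega> k f "\<lambda>x. - g x"] Ck_on_uminus[of \<Omega> k g] by simp

lemma Ck_on_coord: "open \<Omega> \<Longrightarrow> Ck_on k \<Omega> (\<lambda>x. x $ j)"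
proof (cases k)
  case 0 then show ?thesis by (auto intro: continuous_intros)
next
  case (Suc l)
  assume "open \<Omega>"
  then show ?thesis unfolding Suc
    by (intro Ck_on_SucI[where f' = "\<lambda>i x. if i = j then 1 else 0"] has_partial_coord)
       (auto intro: continuous_intros)
qed

text \<open>Increments are split into steps along the coordinate axes; along each step the mean value
  theorem applies, and the partial derivatives there are close to those at \<open>x\<close>.\<close>

lemma C1_has_derivative:
  fixes f :: "real^'n \<Rightarrow> real"
  assumes "open \<Omega>" "Ck_on 1 \<Omega> f" "x \<in> \<Omega>"
  shows "(f has_derivative (\<lambda>h. \<Sum>i\<in>UNIV. partial_deriv i f x * h $ i)) (at x)"
proof (rule has_derivativeI_sandwich[where H = "\<lambda>y. if y = x then 0 else
    norm (f y - f x - (\<Sum>i\<in>UNIV. partial_deriv i f x * (y - x) $ i)) / norm (y - x)" and e = 1])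
  show "bounded_linear (\<lambda>h. \<Sum>i\<in>UNIV. partial_deriv i f x * h $ i)"
    by (intro bounded_linear_sum bounded_linear_const_mult bounded_linear_vec_nth)
  let ?d = "\<lambda>i. partial_deriv i f x"
  show "((\<lambda>y. if y = x then 0 else norm (f y - f x - (\<Sum>i\<in>UNIV. ?d i * (y - x) $ i)) / norm (y - x))
     \<longlongrightarrow> 0) (at x)"
  proof (rule tendstoI)
    fix e :: real assume "e > 0"
    define e' where "e' = e / (2 * real CARD('n))"
    have e': "e' > 0" using \<open>e > 0\<close> by (simp add: e'_def)
    have "\<forall>i. \<forall>\<^sub>F y in nhds x. dist (partial_deriv i f y) (?d i) < e'"
    proof
      fix i
      have "continuous_on \<Omega> (partial_deriv i f)" using assms(2) by simp
      then have ic: "isCont (partial_deriv i f) x" using assms continuous_on_eq_continuous_at by blast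
      then show "\<forall>\<^sub>F y in nhds x. dist (partial_deriv i f y) (?d i) < e'"
        using e' tendstoD[OF ic[unfolded isCont_def] e'] by (simp add: eventually_nhds_conv_at)
    qed
    then have "\<forall>\<^sub>F y in nhds x. y \<in> \<Omega> \<and> (\<forall>i. dist (partial_deriv i f y) (?d i) < e')"
      using assms(1,3) by (simp add: eventually_conj_iff eventually_all_finite eventually_nhds_in_open)
    then obtain r where r: "r > 0" "\<And>y. dist y x < r \<Longrightarrow> y \<in> \<Omega>"
        "\<And>y i. dist y x < r \<Longrightarrow> \<bar>partial_deriv i f y - ?d i\<bar> < e'"
      unfolding eventually_nhds_metric by (auto simp: dist_real_def)
    have main: "\<bar>f (x + h) - f x - (\<Sum>i\<in>UNIV. ?d i * h $ i)\<bar> \<le> real CARD('n) * (e' * norm h)"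
      if h: "norm h < r" for h
    proof -
      define P where "P A = (\<chi> i. if i \<in> A then h $ i else 0)" for A
      have nP: "norm (P A + t *\<^sub>R axis i 1) \<le> norm h" if "i \<notin> A" "\<bar>t\<bar> \<le> \<bar>h $ i\<bar>" for A i t
        using that by (intro norm_le_componentwise_cart) (auto simp: P_def axis_def)
      have "\<bar>f (x + P A) - f x - (\<Sum>i\<in>A. ?d i * h $ i)\<bar> \<le> real (card A) * (e' * norm h)"
        if "finite A" for A
        using that
      proof (induction A rule: finite_induct)
        case empty
        have "P {} = 0" by (simp add: P_def vec_eq_iff)
        then show ?case by simp
      next
        case (insert i A)
        let ?g = "\<lambda>t. f (x + P A + t *\<^sub>R axis i 1) - t * ?d i"
        have PI: "P (insert i A) = P A + h $ i *\<^sub>R axis i 1"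
          using insert by (auto simp: P_def axis_def vec_eq_iff)
        have "norm (?g (h $ i) - ?g 0) \<le> e' * norm (h $ i - 0)"
        proof (rule field_differentiable_bound[of "closed_segment 0 (h $ i)"
               ?g "\<lambda>t. partial_deriv i f (x + P A + t *\<^sub>R axis i 1) - ?d i"])
          fix t assume t: "t \<in> closed_segment 0 (h $ i)"
          then have "\<bar>t\<bar> \<le> \<bar>h $ i\<bar>" by (auto simp: closed_segment_eq_real_ivl split: if_splits)
          then have "norm (P A + t *\<^sub>R axis i 1) < r" using nP insert h by fastforce
          then have d: "dist (x + P A + t *\<^sub>R axis i 1) x < r" by (simp add: dist_norm algebra_simps)
          then show "norm (partial_deriv i f (x + P A + t *\<^sub>R axis i 1) - ?d i) \<le> e'"
            using r(3) by (simp add: less_imp_le)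
          have "has_partial i f (partial_deriv i f (x + P A + t *\<^sub>R axis i 1)) (x + P A + t *\<^sub>R axis i 1)"
            using Ck_on_has_partial[OF assms(2)] r(2)[OF d] by simp
          then have "(?g has_real_derivative (partial_deriv i f (x + P A + t *\<^sub>R axis i 1) - ?d i)) (at t)"
            by (intro DERIV_diff has_partial_line) (auto intro!: derivative_eq_intros)
          then show "(?g has_field_derivative (partial_deriv i f (x + P A + t *\<^sub>R axis i 1) - ?d i))
              (at t within closed_segment 0 (h $ i))"
            by (rule has_field_derivative_at_within)
        qed auto
        also have "\<dots> \<le> e' * norm h"
          using e' by (simp add: component_le_norm_cart)
        finally have "\<bar>f (x + P (insert i A)) - f (x + P A) - ?d i * h $ i\<bar> \<le> e' * norm h"
          unfolding PI by (simp add: algebra_simps)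
        then show ?case using insert by (simp add: algebra_simps abs_le_iff)
      qed
      from this[of UNIV] show ?thesis by (simp add: P_def)
    qed
    have "dist (if y = x then 0 else norm (f y - f x - (\<Sum>i\<in>UNIV. ?d i * (y - x) $ i)) / norm (y - x)) 0 < e"
      if "y \<noteq> x" "dist y x < r" for y
    proof -
      have "\<bar>f y - f x - (\<Sum>i\<in>UNIV. ?d i * (y - x) $ i)\<bar> \<le> (e / 2) * norm (y - x)"
        using main[of "y - x"] that by (simp add: dist_norm e'_def)
      also have "\<dots> < e * norm (y - x)" using that \<open>e > 0\<close> by simp
      finally show ?thesis using that by (simp add: divide_less_eq)
    qed
    then show "\<forall>\<^sub>F y in at x. dist (if y = x then 0 else
        norm (f y - f x - (\<Sum>i\<in>UNIV. ?d i * (y - x) $ i)) / norm (y - x)) 0 < e"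
      unfolding eventually_at using r(1) by blast
  qed
qed auto

text \<open>Both mixed partial derivatives approximate the second difference
  \<open>f(x + te\<^sub>i + te\<^sub>j) - f(x + te\<^sub>i) - f(x + te\<^sub>j) + f(x)\<close> up to \<open>o(t\<^sup>2)\<close>.\<close>

lemma second_difference_bound:
  fixes f :: "real^'n \<Rightarrow> real"
  assumes "Ck_on 2 \<Omega> f" "0 < t" "\<And>s r. 0 \<le> s \<Longrightarrow> s \<le> t \<Longrightarrow> 0 \<le> r \<Longrightarrow> r \<le> t \<Longrightarrow>
      x + s *\<^sub>R axis i 1 + r *\<^sub>R axis j 1 \<in> \<Omega> \<and>
      \<bar>partial_deriv j (partial_deriv i f) (x + s *\<^sub>R axis i 1 + r *\<^sub>R axis j 1) - D\<bar> \<le> e"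
  shows "\<bar>f (x + t *\<^sub>R axis i 1 + t *\<^sub>R axis j 1) - f (x + t *\<^sub>R axis i 1)
      - f (x + t *\<^sub>R axis j 1) + f x - t * t * D\<bar> \<le> e * t * t"
proof -
  have C: "Ck_on 1 \<Omega> (partial_deriv i f)" using assms(1) by (simp add: numeral_2_eq_2)
  have C1: "Ck_on 1 \<Omega> f" by (rule Ck_on_mono[OF assms(1)]) simp
  have inner: "\<bar>partial_deriv i f (x + s *\<^sub>R axis i 1 + t *\<^sub>R axis j 1)
      - partial_deriv i f (x + s *\<^sub>R axis i 1) - t * D\<bar> \<le> e * t" if s: "0 \<le> s" "s \<le> t" for s
  proof -
    let ?g = "\<lambda>r. partial_deriv i f (x + s *\<^sub>R axis i 1 + r *\<^sub>R axis j 1) - r * D"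
    have "norm (?g t - ?g 0) \<le> e * norm (t - 0)"
    proof (rule field_differentiable_bound[of "{0..t}" ?g
        "\<lambda>r. partial_deriv j (partial_deriv i f) (x + s *\<^sub>R axis i 1 + r *\<^sub>R axis j 1) - D"])
      fix r assume r: "r \<in> {0..t}"
      then show "norm (partial_deriv j (partial_deriv i f) (x + s *\<^sub>R axis i 1 + r *\<^sub>R axis j 1) - D) \<le> e"
        using assms(3)[of s r] s by simp
      have "(?g has_real_derivative
          (partial_deriv j (partial_deriv i f) (x + s *\<^sub>R axis i 1 + r *\<^sub>R axis j 1) - D)) (at r)"
        using assms(3)[of s r] s r Ck_on_has_partial[OF C]
        by (intro DERIV_diff has_partial_line) (auto intro!: derivative_eq_intros)
      then show "(?g has_real_derivative
          (partial_deriv j (partial_deriv i f) (x + s *\<^sub>R axis i 1 + r *\<^sub>R axis j 1) - D)) (at r within {0..t})"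
        by (rule has_field_derivative_at_within)
    qed (use assms(2) in auto)
    then show ?thesis using assms(2) by (simp add: algebra_simps)
  qed
  let ?h = "\<lambda>s. f (x + t *\<^sub>R axis j 1 + s *\<^sub>R axis i 1) - f (x + s *\<^sub>R axis i 1) - s * (t * D)"
  have "norm (?h t - ?h 0) \<le> (e * t) * norm (t - 0)"
  proof (rule field_differentiable_bound[of "{0..t}" ?h
      "\<lambda>s. partial_deriv i f (x + t *\<^sub>R axis j 1 + s *\<^sub>R axis i 1)
      - partial_deriv i f (x + s *\<^sub>R axis i 1) - t * D"])
    fix s assume s: "s \<in> {0..t}"
    have c: "x + t *\<^sub>R axis j 1 + s *\<^sub>R axis i 1 = x + s *\<^sub>R axis i 1 + t *\<^sub>R axis j 1" by simp
    show "norm (partial_deriv i f (x + t *\<^sub>R axis j 1 + s *\<^sub>R axis i 1)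
      - partial_deriv i f (x + s *\<^sub>R axis i 1) - t * D) \<le> e * t"
      unfolding c using inner s by simp
    have "x + t *\<^sub>R axis j 1 + s *\<^sub>R axis i 1 \<in> \<Omega>" "x + s *\<^sub>R axis i 1 \<in> \<Omega>"
      using assms(3)[of s t] assms(3)[of s 0] s assms(2) unfolding c by auto
    then have "(?h has_real_derivative (partial_deriv i f (x + t *\<^sub>R axis j 1 + s *\<^sub>R axis i 1)
      - partial_deriv i f (x + s *\<^sub>R axis i 1) - t * D)) (at s)"
      using Ck_on_has_partial[OF C1]
      by (intro DERIV_diff has_partial_line) (auto intro!: derivative_eq_intros)
    then show "(?h has_real_derivative (partial_deriv i f (x + t *\<^sub>R axis j 1 + s *\<^sub>R axis i 1)
      - partial_deriv i f (x + s *\<^sub>R axis i 1) - t * D)) (at s within {0..t})"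
      by (rule has_field_derivative_at_within)
  qed (use assms(2) in auto)
  then show ?thesis using assms(2) by (simp add: algebra_simps)
qed

lemma partial_deriv_commute:
  fixes f :: "real^'n \<Rightarrow> real"
  assumes "open \<Omega>" "Ck_on 2 \<Omega> f" "x \<in> \<Omega>"
  shows "partial_deriv i (partial_deriv j f) x = partial_deriv j (partial_deriv i f) x"
proof (rule ccontr)
  let ?A = "partial_deriv j (partial_deriv i f)" and ?B = "partial_deriv i (partial_deriv j f)"
  assume ne: "?B x \<noteq> ?A x"
  define e where "e = \<bar>?B x - ?A x\<bar> / 3"
  have e: "e > 0" using ne by (simp add: e_def)
  have c: "continuous_on \<Omega> ?A" "continuous_on \<Omega> ?B" using assms(2) by (simp_all add: numeral_2_eq_2)
  obtain r where r: "r > 0" "ball x r \<subseteq> \<Omega>" "\<And>y. y \<in> ball x r \<Longrightarrow> \<bar>?A y - ?A x\<bar> \<le> e \<and> \<bar>?B y - ?B x\<bar> \<le> e"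
  proof -
    have "open (\<Omega> \<inter> ?A -` ball (?A x) e)" "open (\<Omega> \<inter> ?B -` ball (?B x) e)"
      using c assms(1) by (auto intro: continuous_open_preimage)
    then have "open ((\<Omega> \<inter> ?A -` ball (?A x) e) \<inter> (\<Omega> \<inter> ?B -` ball (?B x) e))" by blast
    moreover have "x \<in> (\<Omega> \<inter> ?A -` ball (?A x) e) \<inter> (\<Omega> \<inter> ?B -` ball (?B x) e)" using e assms by auto
    ultimately obtain r where "r > 0" "ball x r \<subseteq> (\<Omega> \<inter> ?A -` ball (?A x) e) \<inter> (\<Omega> \<inter> ?B -` ball (?B x) e)"
      by (meson open_contains_ball)
    then show ?thesis by (intro that[of r]) (fastforce simp: dist_real_def abs_minus_commute)+
  qed
  define t where "t = r / 3"
  have t: "t > 0" using r by (simp add: t_def)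
  have inb: "x + s *\<^sub>R axis k 1 + u *\<^sub>R axis l 1 \<in> ball x r"
    if "0 \<le> s" "s \<le> t" "0 \<le> u" "u \<le> t" for s u and k l :: 'n
  proof -
    have "norm (s *\<^sub>R axis k 1 + u *\<^sub>R axis l (1::real)) \<le> s + u"
      using that by (intro norm_triangle_le) simp
    also have "\<dots> < r" using that r(1) by (simp add: t_def)
    finally show ?thesis unfolding mem_ball dist_commute[of x] by (simp add: dist_norm algebra_simps)
  qed
  let ?\<Delta> = "f (x + t *\<^sub>R axis i 1 + t *\<^sub>R axis j 1) - f (x + t *\<^sub>R axis i 1) - f (x + t *\<^sub>R axis j 1) + f x"
  have "\<bar>?\<Delta> - t * t * ?A x\<bar> \<le> e * t * t"
    using second_difference_bound[OF assms(2) t, of x i j "?A x" e] inb r by blast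
  moreover have "\<bar>f (x + t *\<^sub>R axis j 1 + t *\<^sub>R axis i 1) - f (x + t *\<^sub>R axis j 1) - f (x + t *\<^sub>R axis i 1) + f x
      - t * t * ?B x\<bar> \<le> e * t * t"
    using second_difference_bound[OF assms(2) t, of x j i "?B x" e] inb r by blast
  moreover have "x + t *\<^sub>R axis j 1 + t *\<^sub>R axis i 1 = x + t *\<^sub>R axis i 1 + t *\<^sub>R axis j 1" by simp
  ultimately have "\<bar>t * t * ?B x - t * t * ?A x\<bar> \<le> 2 * (e * t * t)" by (simp add: abs_le_iff)
  then have "t * t * \<bar>?B x - ?A x\<bar> \<le> t * t * (2 * e)"
    using t by (simp add: abs_mult flip: right_diff_distrib)
  then have "\<bar>?B x - ?A x\<bar> \<le> 2 * e" using t by simp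
  then show False using e by (simp add: e_def)
qed

lemma C1_chain_rule:
  fixes T :: "real^'n \<Rightarrow> real^'m" and f :: "real^'m \<Rightarrow> real"
  assumes "open V" "Ck_on 1 V f" "\<And>j. has_partial i (\<lambda>x. T x $ j) (D j) x" "T x \<in> V"
  shows "has_partial i (\<lambda>x. f (T x)) (\<Sum>j\<in>UNIV. partial_deriv j f (T x) * D j) x"
proof -
  let ?\<gamma> = "\<lambda>t. T (x + t *\<^sub>R axis i 1)"
  have "(?\<gamma> has_derivative (\<lambda>t. t *\<^sub>R (\<chi> j. D j))) (at 0)"
  proof (subst has_derivative_componentwise_within, rule ballI)
    fix b :: "real^'m" assume "b \<in> Basis"
    then obtain j where b: "b = axis j 1" by (auto simp: Basis_vec_def)
    have "((\<lambda>t. ?\<gamma> t $ j) has_derivative (\<lambda>t. t * D j)) (at 0)"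
      using assms(3)[of j] unfolding has_partial_def has_field_derivative_def
      by (simp add: mult.commute[of _ "D j"] mult_commute_abs)
    then show "((\<lambda>t. ?\<gamma> t \<bullet> b) has_derivative (\<lambda>t. (t *\<^sub>R (\<chi> j. D j)) \<bullet> b)) (at 0)"
      by (simp add: b inner_axis)
  qed
  moreover have "(f has_derivative (\<lambda>h. \<Sum>j\<in>UNIV. partial_deriv j f (?\<gamma> 0) * h $ j)) (at (?\<gamma> 0))"
    using C1_has_derivative[OF assms(1,2,4)] by simp
  ultimately have "((\<lambda>t. f (?\<gamma> t)) has_derivative
      (\<lambda>t. \<Sum>j\<in>UNIV. partial_deriv j f (?\<gamma> 0) * (t *\<^sub>R (\<chi> j. D j)) $ j)) (at 0)"
    by (rule has_derivative_compose)
  moreover have "(\<lambda>t. \<Sum>j\<in>UNIV. partial_deriv j f (?\<gamma> 0) * (t *\<^sub>R (\<chi> j. D j)) $ j)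
      = (*) (\<Sum>j\<in>UNIV. partial_deriv j f (T x) * D j)"
    by (rule ext) (simp add: sum_distrib_left mult_ac)
  ultimately show ?thesis unfolding has_partial_def has_field_derivative_def by simp
qed

lemma continuous_on_components:
  fixes T :: "'a::topological_space \<Rightarrow> real^'n"
  shows "(\<And>j. continuous_on U (\<lambda>x. T x $ j)) \<Longrightarrow> continuous_on U T"
  using continuous_on_vec_lambda[of U "\<lambda>j x. T x $ j"] by simp

lemma Ck_on_compose:
  fixes T :: "real^'n \<Rightarrow> real^'m" and f :: "real^'m \<Rightarrow> real"
  assumes "open U" "open V" "T ` U \<subseteq> V" "Ck_on k V f" "\<And>j. Ck_on k U (\<lambda>x. T x $ j)"
  shows "Ck_on k U (\<lambda>x. f (T x))"
  using assms(4,5)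
proof (induction k arbitrary: f)
  case 0
  then show ?case
    using continuous_on_compose2[of V f U T] continuous_on_components[of U T] assms(3) by simp
next
  case (Suc k)
  have cT: "continuous_on U T"
    by (rule continuous_on_components) (rule Ck_on_imp_continuous[OF Suc.prems(2)])
  have Tk: "Ck_on k U (\<lambda>x. T x $ j)" for j using Suc.prems(2) by (rule Ck_on_SucD)
  show ?case
  proof (rule Ck_on_SucI[OF assms(1), where f' = "\<lambda>i x. \<Sum>j\<in>UNIV. partial_deriv j f (T x) * partial_deriv i (\<lambda>x. T x $ j) x"])
    show "continuous_on U (\<lambda>x. f (T x))"
      using continuous_on_compose2[OF Ck_on_imp_continuous[OF Suc.prems(1)] cT] assms(3) by blast
    show "has_partial i (\<lambda>x. f (T x)) (\<Sum>j\<in>UNIV. partial_deriv j f (T x) * partial_deriv i (\<lambda>x. T x $ j) x) x"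
      if "x \<in> U" for i x
      using that Ck_on_has_partial[OF Suc.prems(2)] assms(2,3) Ck_on_mono[OF Suc.prems(1), of 1]
      by (intro C1_chain_rule[of V]) auto
    show "Ck_on k U (\<lambda>x. \<Sum>j\<in>UNIV. partial_deriv j f (T x) * partial_deriv i (\<lambda>x. T x $ j) x)" for i
    proof (rule Ck_on_sum[OF assms(1)], rule Ck_on_mult[OF assms(1)])
      fix j
      show "Ck_on k U (\<lambda>x. partial_deriv j f (T x))"
        by (rule Suc.IH[OF Ck_on_partial[OF Suc.prems(1)] Tk])
      show "Ck_on k U (partial_deriv i (\<lambda>x. T x $ j))"
        by (rule Ck_on_partial[OF Suc.prems(2)])
    qed
  qed
qed

text \<open>The sets \<open>U\<close> and \<open>- K\<close> are open and cover the space, and \<open>f\<close> is smooth on each of them.\<close>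

lemma Ck_on_zero_extension:
  assumes "open U" "closed K" "K \<subseteq> U" "Ck_on k U f" "\<And>x. x \<notin> K \<Longrightarrow> f x = 0"
  shows "Ck_on k UNIV f"
proof -
  have "Ck_on k (- K) f"
    by (rule Ck_on_cong[where f = "\<lambda>x. 0"]) (use assms in auto)
  then have "Ck_on k (U \<union> - K) f" using assms by (intro Ck_on_Un) auto
  moreover have "U \<union> - K = UNIV" using assms by auto
  ultimately show ?thesis by simp
qed

lemma partial_deriv_zero_outside:
  assumes "closed K" "\<And>x. x \<notin> K \<Longrightarrow> f x = 0" "x \<notin> K"
  shows "partial_deriv i f x = 0"
proof -
  have "partial_deriv i f x = partial_deriv i (\<lambda>x. 0) x"
    using assms by (intro partial_deriv_cong[of "- K"]) auto
  then show ?thesis using has_partial_imp_eq[OF has_partial_const] by simp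
qed

lemma compact_thickening:
  fixes K :: "'a::euclidean_space set"
  assumes "compact K" shows "compact (\<Union>x\<in>K. cball x \<delta>)"
proof -
  have "(\<Union>x\<in>K. cball x \<delta>) = (\<lambda>(x, y). x + y) ` (K \<times> cball 0 \<delta>)"
  proof (intro equalityI subsetI)
    fix z assume "z \<in> (\<Union>x\<in>K. cball x \<delta>)"
    then obtain x where "x \<in> K" "dist x z \<le> \<delta>" by auto
    then show "z \<in> (\<lambda>(x, y). x + y) ` (K \<times> cball 0 \<delta>)"
      by (intro image_eqI[of _ _ "(x, z - x)"]) (auto simp: dist_norm norm_minus_commute)
  next
    fix z assume "z \<in> (\<lambda>(x, y). x + y) ` (K \<times> cball 0 \<delta>)"
    then obtain x y where "x \<in> K" "norm y \<le> \<delta>" "z = x + y" by auto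
    then show "z \<in> (\<Union>x\<in>K. cball x \<delta>)" by (auto simp: dist_norm intro!: bexI[of _ x])
  qed
  moreover have "compact \<dots>"
    by (intro compact_continuous_image compact_Times assms compact_cball)
       (auto simp: case_prod_unfold intro!: continuous_intros)
  ultimately show ?thesis by simp
qed

lemma compact_open_thickening:
  fixes K U :: "'a::euclidean_space set"
  assumes "compact K" "open U" "K \<subseteq> U"
  obtains \<delta> where "\<delta> > 0" "\<delta> \<le> 1" "(\<Union>x\<in>K. cball x \<delta>) \<subseteq> U"
proof -
  obtain e where "e > 0" "(\<Union>x\<in>K. ball x e) \<subseteq> U"
    using compact_subset_open_imp_ball_epsilon_subset[OF assms] by blast
  then have "(\<Union>x\<in>K. cball x (min 1 (e / 2))) \<subseteq> U" by fastforce
  then show ?thesis using \<open>e > 0\<close> by (intro that[of "min 1 (e / 2)"]) auto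
qed

lemma continuous_on_compact_bound:
  fixes f :: "'a::topological_space \<Rightarrow> 'b::real_normed_vector"
  assumes "compact K" "continuous_on K f"
  obtains M where "M \<ge> 0" "\<And>x. x \<in> K \<Longrightarrow> norm (f x) \<le> M"
proof -
  have "bounded (f ` K)" using assms by (intro compact_imp_bounded compact_continuous_image)
  then obtain M where "\<And>x. x \<in> K \<Longrightarrow> norm (f x) \<le> M" by (auto simp: bounded_iff)
  then show ?thesis by (intro that[of "max 0 M"]) (auto intro: max.coboundedI2)
qed

text \<open>The set \<open>K\<close> need not be convex: points at distance less than \<open>\<delta>\<close> are joined by a segment
  inside a compact thickening of \<open>K\<close>, and for the others boundedness suffices.\<close>

lemma C1_lipschitz_on_compact:
  fixes f :: "real^'n \<Rightarrow> real"
  assumes "open U" "compact K" "K \<subseteq> U" "Ck_on 1 U f"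
  obtains L where "L \<ge> 0" "\<And>x y. x \<in> K \<Longrightarrow> y \<in> K \<Longrightarrow> \<bar>f x - f y\<bar> \<le> L * norm (x - y)"
proof -
  obtain \<delta> where \<delta>: "\<delta> > 0" "(\<Union>x\<in>K. cball x \<delta>) \<subseteq> U"
    using compact_open_thickening[OF assms(2,1,3)] by metis
  let ?K = "\<Union>x\<in>K. cball x \<delta>"
  have K: "compact ?K" using compact_thickening[OF assms(2)] .
  have "\<exists>M\<ge>0. \<forall>x\<in>?K. \<bar>partial_deriv i f x\<bar> \<le> M" for i
  proof -
    have "continuous_on ?K (partial_deriv i f)"
      using assms(4) by (intro continuous_on_subset[OF _ \<delta>(2)]) simp
    from continuous_on_compact_bound[OF K this] show ?thesis by (metis real_norm_def)
  qed
  then obtain M where M: "\<And>i. M i \<ge> 0" "\<And>i x. x \<in> ?K \<Longrightarrow> \<bar>partial_deriv i f x\<bar> \<le> M i" by metis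
  have "continuous_on K f" using assms Ck_on_imp_continuous continuous_on_subset by blast
  from continuous_on_compact_bound[OF assms(2) this]
  obtain B where B: "B \<ge> 0" "\<And>x. x \<in> K \<Longrightarrow> \<bar>f x\<bar> \<le> B" by (metis real_norm_def)
  have "\<bar>f x - f y\<bar> \<le> ((\<Sum>i\<in>UNIV. M i) + 2 * B / \<delta>) * norm (x - y)" if xy: "x \<in> K" "y \<in> K" for x y
  proof (cases "dist x y \<le> \<delta>")
    case True
    have "norm (f x - f y) \<le> (\<Sum>i\<in>UNIV. M i) * norm (x - y)"
    proof (rule differentiable_bound[of "cball x \<delta>" f "\<lambda>z h. \<Sum>i\<in>UNIV. partial_deriv i f z * h $ i"])
      fix z assume z: "z \<in> cball x \<delta>"
      then have "z \<in> ?K" using xy by auto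
      then show "(f has_derivative (\<lambda>h. \<Sum>i\<in>UNIV. partial_deriv i f z * h $ i)) (at z within cball x \<delta>)"
        using C1_has_derivative[OF assms(1,4), of z] \<delta>(2) by (blast intro: has_derivative_at_withinI)
      show "onorm (\<lambda>h. \<Sum>i\<in>UNIV. partial_deriv i f z * h $ i) \<le> (\<Sum>i\<in>UNIV. M i)"
      proof (rule onorm_le)
        fix h :: "real^'n"
        have "norm (\<Sum>i\<in>UNIV. partial_deriv i f z * h $ i) \<le> (\<Sum>i\<in>UNIV. M i * norm h)"
          using M(2)[OF \<open>z \<in> ?K\<close>] M(1)
          by (intro sum_norm_le) (auto simp: abs_mult component_le_norm_cart intro!: mult_mono)
        then show "norm (\<Sum>i\<in>UNIV. partial_deriv i f z * h $ i) \<le> (\<Sum>i\<in>UNIV. M i) * norm h"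
          by (simp add: sum_distrib_right)
      qed
    qed (use True \<delta> in \<open>auto simp: dist_commute\<close>)
    also have "\<dots> \<le> ((\<Sum>i\<in>UNIV. M i) + 2 * B / \<delta>) * norm (x - y)"
      using B \<delta> by (intro mult_right_mono) auto
    finally show ?thesis by simp
  next
    case False
    have "\<bar>f x - f y\<bar> \<le> 2 * B / \<delta> * \<delta>" using B(2)[OF xy(1)] B(2)[OF xy(2)] \<delta> by simp
    also have "\<dots> \<le> 2 * B / \<delta> * norm (x - y)"
      using False B \<delta> by (intro mult_left_mono) (auto simp: dist_norm)
    also have "\<dots> \<le> ((\<Sum>i\<in>UNIV. M i) + 2 * B / \<delta>) * norm (x - y)"
      using M(1) by (intro mult_right_mono) (auto intro: sum_nonneg)
    finally show ?thesis .
  qed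
  moreover have "0 \<le> (\<Sum>i\<in>UNIV. M i) + 2 * B / \<delta>"
    using M(1) B \<delta> by (intro add_nonneg_nonneg sum_nonneg) auto
  ultimately show ?thesis by (rule that[rotated])
qed

lemma C1_map_lipschitz_on_compact:
  fixes T :: "real^'n \<Rightarrow> real^'m"
  assumes "open U" "compact K" "K \<subseteq> U" "\<And>j. Ck_on 1 U (\<lambda>x. T x $ j)"
  obtains L where "L > 0" "\<And>x y. x \<in> K \<Longrightarrow> y \<in> K \<Longrightarrow> norm (T x - T y) \<le> L * norm (x - y)"
proof -
  have "\<exists>L\<ge>0. \<forall>x\<in>K. \<forall>y\<in>K. \<bar>T x $ j - T y $ j\<bar> \<le> L * norm (x - y)" for j
    using C1_lipschitz_on_compact[OF assms] by metis
  then obtain L where L: "\<And>j. L j \<ge> 0" "\<And>j x y. x \<in> K \<Longrightarrow> y \<in> K \<Longrightarrow> \<bar>T x $ j - T y $ j\<bar> \<le> L j * norm (x - y)"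
    by metis
  have "norm (T x - T y) \<le> ((\<Sum>j\<in>UNIV. L j) + 1) * norm (x - y)" if "x \<in> K" "y \<in> K" for x y
  proof -
    have "norm (T x - T y) \<le> (\<Sum>j\<in>UNIV. \<bar>(T x - T y) $ j\<bar>)" by (rule norm_le_l1_cart)
    also have "\<dots> \<le> (\<Sum>j\<in>UNIV. L j * norm (x - y))" using L(2)[OF that] by (intro sum_mono) simp
    also have "\<dots> \<le> ((\<Sum>j\<in>UNIV. L j) + 1) * norm (x - y)" by (simp add: sum_distrib_right algebra_simps)
    finally show ?thesis .
  qed
  then show ?thesis using L(1) by (intro that[of "(\<Sum>j\<in>UNIV. L j) + 1"]) (auto intro!: add_nonneg_pos sum_nonneg)
qed

section \<open>Multi-index derivatives\<close>

text \<open>The coordinate directions in the order in which \<open>mi_deriv\<close> differentiates, with repetitions. On this list the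
  partial derivatives can be permuted one transposition at a time.\<close>

definition mi_list :: "('n::finite \<Rightarrow> nat) \<Rightarrow> 'n list" where
  "mi_list \<nu> = concat (map (\<lambda>i. replicate (\<nu> i) i) coords)"

lemma mi_deriv_eq_foldr: "mi_deriv \<nu> f = foldr partial_deriv (mi_list \<nu>) f"
proof -
  have "foldr (\<lambda>i g. (partial_deriv i ^^ \<nu> i) g) xs f
      = foldr partial_deriv (concat (map (\<lambda>i. replicate (\<nu> i) i) xs)) f" for xs
    by (induction xs) simp_all
  then show ?thesis unfolding mi_deriv_def mi_list_def .
qed

lemma length_mi_list: "length (mi_list \<nu>) = mi_order \<nu>"
  unfolding mi_list_def mi_order_def
  by (simp add: length_concat comp_def sum_list_distinct_conv_sum_set coords)

lemma mi_list_upd: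
  obtains xs ys where "mi_list \<nu> = xs @ ys" "mi_list (\<nu>(i := Suc (\<nu> i))) = xs @ i # ys"
proof -
  obtain as bs where c: "coords = as @ i # bs" using coords(2) by (metis UNIV_I split_list)
  have "distinct (as @ i # bs)" by (rule subst[OF c]) (rule coords)
  then have "i \<notin> set as" "i \<notin> set bs" by simp_all
  then have e: "map (\<lambda>j. replicate ((\<nu>(i := Suc (\<nu> i))) j) j) as = map (\<lambda>j. replicate (\<nu> j) j) as"
     "map (\<lambda>j. replicate ((\<nu>(i := Suc (\<nu> i))) j) j) bs = map (\<lambda>j. replicate (\<nu> j) j) bs" by auto
  show ?thesis
    by (rule that[of "concat (map (\<lambda>j. replicate (\<nu> j) j) as)"
          "replicate (\<nu> i) i @ concat (map (\<lambda>j. replicate (\<nu> j) j) bs)"])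
       (simp_all add: mi_list_def c e del: fun_upd_apply, simp_all)
qed

lemma mi_order_upd: "mi_order (\<nu>(i := Suc (\<nu> i))) = Suc (mi_order \<nu>)"
proof -
  obtain xs ys where "mi_list \<nu> = xs @ ys" "mi_list (\<nu>(i := Suc (\<nu> i))) = xs @ i # ys"
    by (rule mi_list_upd)
  then show ?thesis unfolding length_mi_list[symmetric] by (simp del: fun_upd_apply)
qed

lemma mi_order_zero [simp]: "mi_order (\<lambda>_. 0) = 0"
  by (simp add: mi_order_def)

lemma mi_order_eq_0_iff: "mi_order \<nu> = 0 \<longleftrightarrow> \<nu> = (\<lambda>_. 0)"
  by (auto simp: mi_order_def)

text \<open>Multi-indices are built up by raising one entry at a time, in any order of the coordinates.\<close>

lemma mi_induct [case_names zero upd]: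
  assumes "P (\<lambda>_. 0)" "\<And>\<nu> i. P \<nu> \<Longrightarrow> P (\<nu>(i := Suc (\<nu> i)))"
  shows "P (\<nu> :: 'n::finite \<Rightarrow> nat)"
proof (induction "mi_order \<nu>" arbitrary: \<nu>)
  case 0
  then have "\<nu> = (\<lambda>_. 0)" by (simp add: mi_order_eq_0_iff)
  then show ?case using assms(1) by simp
next
  case (Suc n)
  have "\<nu> \<noteq> (\<lambda>_. 0)" using Suc(2) mi_order_eq_0_iff[of \<nu>] by simp
  then obtain i where i: "\<nu> i \<noteq> 0" by auto
  define \<mu> where "\<mu> = \<nu>(i := \<nu> i - 1)"
  have e: "\<mu>(i := Suc (\<mu> i)) = \<nu>" using i by (auto simp: \<mu>_def)
  have "n = mi_order \<mu>" using Suc(2) mi_order_upd[of \<mu> i] unfolding e by simp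
  then have "P \<mu>" by (rule Suc(1))
  from assms(2)[OF this, of i] show ?case unfolding e .
qed

lemma mi_deriv_zero [simp]: "mi_deriv (\<lambda>_. 0) f = f"
proof -
  have "mi_list (\<lambda>_::'a. 0) = []" using length_mi_list[of "\<lambda>_::'a. 0"] by simp
  then show ?thesis by (simp add: mi_deriv_eq_foldr)
qed

lemma Ck_on_foldr_partial:
  "Ck_on (m + length is) \<Omega> f \<Longrightarrow> Ck_on m \<Omega> (foldr partial_deriv is f)"
proof (induction "is" arbitrary: m)
  case (Cons i "is")
  have "Ck_on (Suc m) \<Omega> (foldr partial_deriv is f)"
    by (rule Cons.IH) (rule Ck_on_mono[OF Cons.prems], simp)
  then show ?case by simp
qed simp

lemma Ck_on_mi_deriv: "Ck_on (m + mi_order \<nu>) \<Omega> f \<Longrightarrow> Ck_on m \<Omega> (mi_deriv \<nu> f)"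
  unfolding mi_deriv_eq_foldr by (rule Ck_on_foldr_partial) (simp add: length_mi_list)

text \<open>By the symmetry of second derivatives, an additional derivative can be moved to the front of the list. So the
  fixed order of differentiation does no harm.\<close>

lemma foldr_partial_insert:
  assumes "open \<Omega>"
  shows "Ck_on (Suc (length xs + length ys)) \<Omega> f \<Longrightarrow> x \<in> \<Omega> \<Longrightarrow>
    foldr partial_deriv (xs @ i # ys) f x = foldr partial_deriv (i # xs @ ys) f x"
proof (induction xs arbitrary: x)
  case (Cons j xs)
  have "Ck_on (2 + length (xs @ ys)) \<Omega> f" by (rule Ck_on_mono[OF Cons.prems(1)]) simp
  then have C: "Ck_on 2 \<Omega> (foldr partial_deriv (xs @ ys) f)" by (rule Ck_on_foldr_partial)
  have C': "Ck_on (Suc (length xs + length ys)) \<Omega> f" by (rule Ck_on_mono[OF Cons.prems(1)]) simp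
  have "partial_deriv j (foldr partial_deriv (xs @ i # ys) f) x
      = partial_deriv j (foldr partial_deriv (i # xs @ ys) f) x"
    by (rule partial_deriv_cong[OF assms Cons.prems(2)]) (rule Cons.IH[OF C'])
  also have "\<dots> = partial_deriv j (partial_deriv i (foldr partial_deriv (xs @ ys) f)) x"
    by (simp del: foldr_append)
  also have "\<dots> = partial_deriv i (partial_deriv j (foldr partial_deriv (xs @ ys) f)) x"
    by (rule partial_deriv_commute[OF assms C Cons.prems(2)])
  finally show ?case by (simp del: foldr_append)
qed simp

lemma mi_deriv_upd:
  assumes "open \<Omega>" "Ck_on (Suc (mi_order \<nu>)) \<Omega> f" "x \<in> \<Omega>"
  shows "mi_deriv (\<nu>(i := Suc (\<nu> i))) f x = partial_deriv i (mi_deriv \<nu> f) x"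
proof -
  obtain xs ys where l: "mi_list \<nu> = xs @ ys" "mi_list (\<nu>(i := Suc (\<nu> i))) = xs @ i # ys"
    by (rule mi_list_upd)
  then have "mi_order \<nu> = length xs + length ys" by (metis length_append length_mi_list)
  then show ?thesis unfolding mi_deriv_eq_foldr l
    using foldr_partial_insert[OF assms(1), of xs ys f x i] assms by (simp del: Ck_on.simps)
qed

lemma mi_deriv_upd':
  assumes "open \<Omega>" "Ck_on (Suc (mi_order \<nu>)) \<Omega> f" "x \<in> \<Omega>"
  shows "mi_deriv (\<nu>(i := Suc (\<nu> i))) f x = mi_deriv \<nu> (partial_deriv i f) x"
proof -
  have "Ck_on (Suc (length (mi_list \<nu>) + length [])) \<Omega> f"
    by (rule Ck_on_mono[OF assms(2)]) (simp add: length_mi_list)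
  from foldr_partial_insert[OF assms(1) this assms(3), of i]
  have "mi_deriv \<nu> (partial_deriv i f) x = partial_deriv i (mi_deriv \<nu> f) x"
    unfolding mi_deriv_eq_foldr by simp
  then show ?thesis using mi_deriv_upd[OF assms, of i] by argo
qed

text \<open>Iterating the product rule and the chain rule, \<open>\<partial>\<^sup>\<nu>(a (f \<circ> T))\<close> becomes a linear combination of the
  functions \<open>\<partial>\<^sup>\<mu>f \<circ> T\<close>. What matters is that the coefficients do not depend on \<open>f\<close>, inherit the support
  of \<open>a\<close>, and lose one order of smoothness per derivative.\<close>

lemma mi_deriv_mult_compose:
  fixes T :: "real^'n \<Rightarrow> real^'n" and a :: "real^'n \<Rightarrow> real"
  assumes "open U" "open V" "T ` U \<subseteq> V" "closed K" "K \<subseteq> U"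
    and T: "\<And>j. Ck_on m U (\<lambda>x. T x $ j)" and a: "Ck_on m U a" "\<And>x. x \<notin> K \<Longrightarrow> a x = 0"
    and "mi_order \<nu> \<le> m"
  shows "\<exists>c. (\<forall>\<mu>. Ck_on (m - mi_order \<nu>) U (c \<mu>) \<and> (\<forall>x. x \<notin> K \<longrightarrow> c \<mu> x = 0)) \<and>
    (\<forall>f. (\<forall>k. Ck_on k V f) \<longrightarrow> (\<forall>x\<in>U. mi_deriv \<nu> (\<lambda>x. a x * f (T x)) x =
      (\<Sum>\<mu> | mi_order \<mu> \<le> mi_order \<nu>. c \<mu> x * mi_deriv \<mu> f (T x))))"
  using assms(9)
proof (induction \<nu> rule: mi_induct)
  case zero
  have "{\<mu> :: 'n \<Rightarrow> nat. mi_order \<mu> \<le> 0} = {\<lambda>_. 0}" by (auto simp: mi_order_eq_0_iff)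
  then show ?case using a by (intro exI[of _ "\<lambda>\<mu>. a"]) simp
next
  case (upd \<nu> i)
  define n where "n = mi_order \<nu>"
  let ?M = "{\<mu> :: 'n \<Rightarrow> nat. mi_order \<mu> \<le> n}" and ?M' = "{\<mu> :: 'n \<Rightarrow> nat. mi_order \<mu> \<le> Suc n}"
  let ?T = "\<lambda>j. partial_deriv i (\<lambda>x. T x $ j)"
  have nm: "Suc n \<le> m" using upd.prems unfolding mi_order_upd n_def .
  then obtain c where c: "\<And>\<mu>. Ck_on (m - n) U (c \<mu>)" "\<And>\<mu> x. x \<notin> K \<Longrightarrow> c \<mu> x = 0"
    and cf: "\<And>f x. (\<And>k. Ck_on k V f) \<Longrightarrow> x \<in> U \<Longrightarrow> mi_deriv \<nu> (\<lambda>x. a x * f (T x)) x =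
      (\<Sum>\<mu>\<in>?M. c \<mu> x * mi_deriv \<mu> f (T x))"
  proof -
    have "mi_order \<nu> \<le> m" using nm by (simp add: n_def)
    from upd.IH[OF this] show ?thesis using that unfolding n_def by blast
  qed
  define u where "u \<mu> j = \<mu>(j := Suc (\<mu> j))" for \<mu> :: "'n \<Rightarrow> nat" and j
  \<comment> \<open>By the product rule and the chain rule, the coefficient of \<open>\<partial>\<^sup>\<mu>'f\<close> receives the derivative of the old one and, for
    each \<open>\<mu>\<close> with \<open>\<mu>' = \<mu> + e\<^sub>j\<close>, the old coefficient of \<open>\<partial>\<^sup>\<mu>f\<close> times \<open>\<partial>\<^sub>iT\<^sub>j\<close>.\<close>
  define c' where "c' \<mu>' x = (if \<mu>' \<in> ?M then partial_deriv i (c \<mu>') x else 0) +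
     (\<Sum>j\<in>UNIV. \<Sum>\<mu>\<in>?M. if u \<mu> j = \<mu>' then c \<mu> x * ?T j x else 0)" for \<mu>' x
  have fin: "finite ?M" "finite ?M'" by (rule finite_mi_order_le)+
  have uM: "u \<mu> j \<in> ?M'" if "\<mu> \<in> ?M" for \<mu> j
    using that unfolding u_def mem_Collect_eq mi_order_upd by simp
  have mn: "m - n = Suc (m - Suc n)" using nm by simp
  have Cc: "Ck_on (m - Suc n) U (c \<mu>)" "Ck_on (m - Suc n) U (partial_deriv i (c \<mu>))" for \<mu>
    using c(1)[of \<mu>] unfolding mn by (auto intro: Ck_on_SucD simp del: Ck_on.simps intro: Ck_on_partial)
  have CT: "Ck_on (m - Suc n) U (?T j)" for j
    using Ck_on_mono[OF T, of "Suc (m - Suc n)" j] nm by (intro Ck_on_partial) simp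
  have C': "Ck_on (m - Suc n) U (c' \<mu>')" for \<mu>'
  proof -
    have "Ck_on (m - Suc n) U (\<lambda>x. if u \<mu> j = \<mu>' then c \<mu> x * ?T j x else 0)" for \<mu> j
      using Ck_on_mult[OF assms(1) Cc(1) CT] by (cases "u \<mu> j = \<mu>'") simp_all
    moreover have "Ck_on (m - Suc n) U (\<lambda>x. if \<mu>' \<in> ?M then partial_deriv i (c \<mu>') x else 0)"
      using Cc(2) by (cases "\<mu>' \<in> ?M") simp_all
    ultimately show ?thesis unfolding c'_def by (intro Ck_on_add Ck_on_sum assms)
  qed
  have Z': "c' \<mu>' x = 0" if "x \<notin> K" for \<mu>' x
    using partial_deriv_zero_outside[OF assms(4) c(2) that] c(2)[OF that] unfolding c'_def
    by (simp cong: sum.cong if_cong)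
  have "mi_deriv (\<nu>(i := Suc (\<nu> i))) (\<lambda>x. a x * f (T x)) x = (\<Sum>\<mu>'\<in>?M'. c' \<mu>' x * mi_deriv \<mu>' f (T x))"
    if f: "\<And>k. Ck_on k V f" and x: "x \<in> U" for f x
  proof -
    let ?D = "\<lambda>\<mu>. mi_deriv \<mu> f (T x)"
    have "Ck_on m U (\<lambda>x. a x * f (T x))"
      by (intro Ck_on_mult assms a Ck_on_compose[of U V]) (auto intro: T f)
    then have "Ck_on (Suc (mi_order \<nu>)) U (\<lambda>x. a x * f (T x))"
      by (rule Ck_on_mono) (use nm n_def in simp)
    then have "mi_deriv (\<nu>(i := Suc (\<nu> i))) (\<lambda>x. a x * f (T x)) x
        = partial_deriv i (mi_deriv \<nu> (\<lambda>x. a x * f (T x))) x"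
      by (rule mi_deriv_upd[OF assms(1) _ x])
    also have "\<dots> = partial_deriv i (\<lambda>x. \<Sum>\<mu>\<in>?M. c \<mu> x * mi_deriv \<mu> f (T x)) x"
      using cf[OF f] by (intro partial_deriv_cong[OF assms(1) x])
    also have "\<dots> = (\<Sum>\<mu>\<in>?M. partial_deriv i (c \<mu>) x * ?D \<mu> +
        c \<mu> x * (\<Sum>j\<in>UNIV. partial_deriv j (mi_deriv \<mu> f) (T x) * ?T j x))"
    proof (intro has_partial_imp_eq has_partial_sum has_partial_mult)
      fix \<mu>
      show "has_partial i (c \<mu>) (partial_deriv i (c \<mu>) x) x"
        using c(1) mn by (intro Ck_on_has_partial[of "m - n" U] x) auto
      show "has_partial i (\<lambda>x. mi_deriv \<mu> f (T x)) (\<Sum>j\<in>UNIV. partial_deriv j (mi_deriv \<mu> f) (T x) * ?T j x) x"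
      proof (rule C1_chain_rule[OF assms(2)])
        show "Ck_on 1 V (mi_deriv \<mu> f)" by (rule Ck_on_mi_deriv) (rule f)
        show "has_partial i (\<lambda>x. T x $ j) (?T j x) x" for j
          using nm by (intro Ck_on_has_partial[OF T] x) auto
      qed (use x assms(3) in auto)
    qed
    also have "\<dots> = (\<Sum>\<mu>\<in>?M. partial_deriv i (c \<mu>) x * ?D \<mu>) + (\<Sum>j\<in>UNIV. \<Sum>\<mu>\<in>?M. c \<mu> x * ?T j x * ?D (u \<mu> j))"
    proof -
      have "partial_deriv j (mi_deriv \<mu> f) (T x) = ?D (u \<mu> j)" for j \<mu>
        unfolding u_def using mi_deriv_upd[OF assms(2) f] x assms(3) by auto
      then have "(\<Sum>\<mu>\<in>?M. c \<mu> x * (\<Sum>j\<in>UNIV. partial_deriv j (mi_deriv \<mu> f) (T x) * ?T j x))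
          = (\<Sum>\<mu>\<in>?M. \<Sum>j\<in>UNIV. c \<mu> x * ?T j x * ?D (u \<mu> j))"
        by (simp add: sum_distrib_left mult_ac)
      also have "\<dots> = (\<Sum>j\<in>UNIV. \<Sum>\<mu>\<in>?M. c \<mu> x * ?T j x * ?D (u \<mu> j))" by (rule sum.swap)
      finally show ?thesis by (simp add: sum.distrib)
    qed
    also have "\<dots> = (\<Sum>\<mu>'\<in>?M'. c' \<mu>' x * ?D \<mu>')"
    proof -
      have sub: "?M \<subseteq> ?M'" by auto
      have "(\<Sum>\<mu>'\<in>?M'. (if \<mu>' \<in> ?M then partial_deriv i (c \<mu>') x else 0) * ?D \<mu>')
          = (\<Sum>\<mu>\<in>?M. partial_deriv i (c \<mu>) x * ?D \<mu>)"
        by (rule sum.mono_neutral_cong_right[OF fin(2) sub]) auto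
      moreover have "(\<Sum>\<mu>'\<in>?M'. (\<Sum>j\<in>UNIV. \<Sum>\<mu>\<in>?M. if u \<mu> j = \<mu>' then c \<mu> x * ?T j x else 0) * ?D \<mu>')
          = (\<Sum>j\<in>UNIV. \<Sum>\<mu>\<in>?M. c \<mu> x * ?T j x * ?D (u \<mu> j))"
      proof -
        have "(\<Sum>\<mu>'\<in>?M'. (\<Sum>j\<in>UNIV. \<Sum>\<mu>\<in>?M. if u \<mu> j = \<mu>' then c \<mu> x * ?T j x else 0) * ?D \<mu>')
            = (\<Sum>\<mu>'\<in>?M'. \<Sum>j\<in>UNIV. \<Sum>\<mu>\<in>?M. if u \<mu> j = \<mu>' then c \<mu> x * ?T j x * ?D \<mu>' else 0)"
          by (auto simp: sum_distrib_right intro!: sum.cong)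
        also have "\<dots> = (\<Sum>j\<in>UNIV. \<Sum>\<mu>'\<in>?M'. \<Sum>\<mu>\<in>?M. if u \<mu> j = \<mu>' then c \<mu> x * ?T j x * ?D \<mu>' else 0)"
          by (rule sum.swap)
        also have "\<dots> = (\<Sum>j\<in>UNIV. \<Sum>\<mu>\<in>?M. \<Sum>\<mu>'\<in>?M'. if u \<mu> j = \<mu>' then c \<mu> x * ?T j x * ?D \<mu>' else 0)"
          by (intro sum.cong refl sum.swap)
        also have "\<dots> = (\<Sum>j\<in>UNIV. \<Sum>\<mu>\<in>?M. c \<mu> x * ?T j x * ?D (u \<mu> j))"
          using uM fin by (intro sum.cong refl) simp
        finally show ?thesis .
      qed
      ultimately show ?thesis by (simp add: c'_def distrib_right sum.distrib)
    qed
    finally show ?thesis .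
  qed
  then show ?case unfolding mi_order_upd n_def[symmetric] using C' Z' by (intro exI[of _ c']) blast
qed

section \<open>Test functions\<close>

lemma test_functionsI:
  assumes "\<And>k. Ck_on k UNIV \<phi>" "compact K" "K \<subseteq> \<Omega>" "\<And>x. x \<notin> K \<Longrightarrow> \<phi> x = 0"
  shows "\<phi> \<in> test_functions \<Omega>"
proof -
  have sub: "closure {x. \<phi> x \<noteq> 0} \<subseteq> K"
    using assms(2,4) by (intro closure_minimal) (auto intro: compact_imp_closed)
  then have "compact (closure {x. \<phi> x \<noteq> 0})"
    using compact_Int_closed[OF assms(2), of "closure {x. \<phi> x \<noteq> 0}"] by (simp add: Int_absorb1)
  then show ?thesis using sub assms unfolding test_functions_def by auto
qed

lemma test_functionsE:
  assumes "\<phi> \<in> test_functions \<Omega>"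
  obtains K where "compact K" "K \<subseteq> \<Omega>" "\<And>x. x \<notin> K \<Longrightarrow> \<phi> x = 0"
  using assms that[of "closure {x. \<phi> x \<noteq> 0}"] closure_subset[of "{x. \<phi> x \<noteq> 0}"]
  unfolding test_functions_def by blast

lemma test_functions_Ck: "\<phi> \<in> test_functions \<Omega> \<Longrightarrow> Ck_on k \<Omega>' \<phi>"
  unfolding test_functions_def by (auto intro: Ck_on_subset)

lemma test_functions_mono: "\<phi> \<in> test_functions \<Omega> \<Longrightarrow> \<Omega> \<subseteq> \<Omega>' \<Longrightarrow> \<phi> \<in> test_functions \<Omega>'"
  unfolding test_functions_def by auto

lemma test_functions_outside: "\<phi> \<in> test_functions \<Omega> \<Longrightarrow> x \<notin> \<Omega> \<Longrightarrow> \<phi> x = 0"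
  by (metis test_functionsE subsetD)

lemma test_functions_partial:
  assumes "\<phi> \<in> test_functions \<Omega>" shows "partial_deriv i \<phi> \<in> test_functions \<Omega>"
proof -
  obtain K where K: "compact K" "K \<subseteq> \<Omega>" "\<And>x. x \<notin> K \<Longrightarrow> \<phi> x = 0" by (rule test_functionsE[OF assms]) blast
  show ?thesis
    by (rule test_functionsI[OF _ K(1,2)])
       (auto intro: Ck_on_partial test_functions_Ck[OF assms] partial_deriv_zero_outside[OF compact_imp_closed[OF K(1)] K(3)])
qed

lemma test_functions_foldr:
  "\<phi> \<in> test_functions \<Omega> \<Longrightarrow> foldr partial_deriv is \<phi> \<in> test_functions \<Omega>"
  by (induction "is") (simp_all add: test_functions_partial)

lemma test_functions_mi_deriv: "\<phi> \<in> test_functions \<Omega> \<Longrightarrow> mi_deriv \<nu> \<phi> \<in> test_functions \<Omega>"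
  unfolding mi_deriv_eq_foldr by (rule test_functions_foldr)

lemma test_functions_mult:
  assumes "\<phi> \<in> test_functions \<Omega>" "\<And>k. Ck_on k UNIV a"
  shows "(\<lambda>x. a x * \<phi> x) \<in> test_functions \<Omega>"
proof -
  obtain K where K: "compact K" "K \<subseteq> \<Omega>" "\<And>x. x \<notin> K \<Longrightarrow> \<phi> x = 0" by (rule test_functionsE[OF assms(1)]) blast
  show ?thesis
    by (rule test_functionsI[OF _ K(1,2)]) (auto intro: Ck_on_mult assms test_functions_Ck[OF assms(1)] simp: K(3))
qed

lemma test_functions_lincomb:
  assumes "\<phi> \<in> test_functions \<Omega>" "\<psi> \<in> test_functions \<Omega>"
  shows "(\<lambda>x. a * \<phi> x + b * \<psi> x) \<in> test_functions \<Omega>"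
proof -
  obtain K where K: "compact K" "K \<subseteq> \<Omega>" "\<And>x. x \<notin> K \<Longrightarrow> \<phi> x = 0" by (rule test_functionsE[OF assms(1)]) blast
  obtain L where L: "compact L" "L \<subseteq> \<Omega>" "\<And>x. x \<notin> L \<Longrightarrow> \<psi> x = 0" by (rule test_functionsE[OF assms(2)]) blast
  show ?thesis
    by (rule test_functionsI[of _ "K \<union> L"])
       (auto intro!: Ck_on_add Ck_on_cmult test_functions_Ck[OF assms(1)] test_functions_Ck[OF assms(2)] compact_Un
          simp: K L dest: subsetD[OF K(2)] subsetD[OF L(2)])
qed

lemma test_functions_continuous: "\<phi> \<in> test_functions \<Omega> \<Longrightarrow> continuous_on A \<phi>"
  by (rule Ck_on_imp_continuous[OF test_functions_Ck])

text \<open>A \<open>C\<^sup>1\<close> function of compact support is bounded and globally Lipschitz; both facts together form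
  the estimate that makes \<open>|f(x) - f(y)|\<^sup>p / |x - y|\<^sup>n\<^sup>+\<^sup>\<theta>\<^sup>p\<close> integrable near and far from the
  diagonal.\<close>

lemma C1_compact_support_bound:
  fixes f :: "real^'n \<Rightarrow> real"
  assumes "Ck_on 1 UNIV f" "compact K" "\<And>x. x \<notin> K \<Longrightarrow> f x = 0"
  obtains L where "L > 0" "\<And>x. \<bar>f x\<bar> \<le> L" "\<And>x y. \<bar>f x - f y\<bar> \<le> L * min 1 (norm (x - y))"
proof -
  let ?K = "\<Union>x\<in>K. cball x 1"
  obtain L where L: "L \<ge> 0" "\<And>x y. x \<in> ?K \<Longrightarrow> y \<in> ?K \<Longrightarrow> \<bar>f x - f y\<bar> \<le> L * norm (x - y)"
    using C1_lipschitz_on_compact[OF open_UNIV compact_thickening[OF assms(2)] subset_UNIV assms(1)] by metis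
  obtain M where M: "M \<ge> 0" "\<And>x. x \<in> K \<Longrightarrow> norm (f x) \<le> M"
    using continuous_on_compact_bound[OF assms(2) continuous_on_subset[OF Ck_on_imp_continuous[OF assms(1)] subset_UNIV]] by metis
  have B: "\<bar>f x\<bar> \<le> M" for x using M assms(3)[of x] by (cases "x \<in> K") auto
  define N where "N = L + 2 * M + 1"
  show ?thesis
  proof (rule that[of N])
    show "N > 0" using L M by (simp add: N_def)
    show "\<bar>f x\<bar> \<le> N" for x using B[of x] L M by (simp add: N_def)
    fix x y :: "real^'n"
    show "\<bar>f x - f y\<bar> \<le> N * min 1 (norm (x - y))"
    proof (cases "norm (x - y) \<le> 1")
      case True
      have "\<bar>f x - f y\<bar> \<le> L * norm (x - y)"
      proof (cases "x \<in> K \<or> y \<in> K")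
        case T: True
        \<comment> \<open>The unit thickening of \<open>K\<close> contains both points as soon as \<open>K\<close> contains one of them.\<close>
        have "x \<in> ?K" "y \<in> ?K" using T True by (auto simp: dist_norm norm_minus_commute intro: bexI[of _ x] bexI[of _ y])
        then show ?thesis by (rule L(2))
      qed (use assms(3)[of x] assms(3)[of y] L in auto)
      also have "\<dots> \<le> N * norm (x - y)" using M by (intro mult_right_mono) (auto simp: N_def)
      finally show ?thesis using True by simp
    next
      case False
      then show ?thesis using B[of x] B[of y] L by (simp add: N_def)
    qed
  qed
qed

lemma test_functions_bound:
  assumes "\<phi> \<in> test_functions \<Omega>"
  obtains L where "L > 0" "\<And>x. \<bar>\<phi> x\<bar> \<le> L" "\<And>x y. \<bar>\<phi> x - \<phi> y\<bar> \<le> L * norm (x - y)"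
proof -
  obtain K where K: "compact K" "K \<subseteq> \<Omega>" "\<And>x. x \<notin> K \<Longrightarrow> \<phi> x = 0" by (rule test_functionsE[OF assms]) blast
  obtain L where L: "L > 0" "\<And>x. \<bar>\<phi> x\<bar> \<le> L" "\<And>x y. \<bar>\<phi> x - \<phi> y\<bar> \<le> L * min 1 (norm (x - y))"
    using C1_compact_support_bound[OF test_functions_Ck[OF assms] K(1,3)] by metis
  have "\<bar>\<phi> x - \<phi> y\<bar> \<le> L * norm (x - y)" for x y
    by (rule order_trans[OF L(3)]) (use L(1) in \<open>simp add: min_le_iff_disj\<close>)
  then show ?thesis using L that by blast
qed

lemma has_partial_reflect:
  assumes "has_partial i \<phi> D (y - z)" shows "has_partial i (\<lambda>z. \<phi> (y - z)) (- D) z"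
proof -
  have "((\<lambda>t. \<phi> (y - z + t *\<^sub>R axis i 1)) has_real_derivative D) (at (- 0))"
    using assms unfolding has_partial_def by simp
  then have "((\<lambda>t. \<phi> (y - z + (- t) *\<^sub>R axis i 1)) has_real_derivative - D) (at 0)"
    by (subst (asm) DERIV_mirror)
  then show ?thesis unfolding has_partial_def by (simp add: algebra_simps)
qed

lemma test_functions_reflect:
  assumes "\<phi> \<in> test_functions UNIV" shows "(\<lambda>z. \<phi> (y - z)) \<in> test_functions UNIV"
proof -
  obtain K where K: "compact K" "\<And>x. x \<notin> K \<Longrightarrow> \<phi> x = 0" by (rule test_functionsE[OF assms]) blast
  have "compact ((\<lambda>x. y - x) ` K)" by (intro compact_continuous_image continuous_intros K)
  moreover have "\<phi> (y - z) = 0" if "z \<notin> (\<lambda>x. y - x) ` K" for z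
    using that K(2)[of "y - z"] by force
  moreover have "Ck_on k UNIV (\<lambda>z. \<phi> (y - z))" for k
    by (rule Ck_on_compose[OF open_UNIV open_UNIV subset_UNIV test_functions_Ck[OF assms]])
       (auto intro!: Ck_on_diff Ck_on_coord)
  ultimately show ?thesis by (intro test_functionsI[of _ "(\<lambda>x. y - x) ` K"]) auto
qed

lemma mi_deriv_reflect:
  assumes "\<phi> \<in> test_functions UNIV"
  shows "mi_deriv \<mu> (\<lambda>z. \<phi> (y - z)) z = (-1) ^ mi_order \<mu> * mi_deriv \<mu> \<phi> (y - z)"
proof -
  have "foldr partial_deriv is (\<lambda>z. \<phi> (y - z)) = (\<lambda>z. (-1) ^ length is * foldr partial_deriv is \<phi> (y - z))" for "is"
  proof (induction "is")
    case (Cons i "is")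
    have "has_partial i (\<lambda>z. (-1) ^ length is * foldr partial_deriv is \<phi> (y - z))
       (0 * foldr partial_deriv is \<phi> (y - z) + (-1) ^ length is * - partial_deriv i (foldr partial_deriv is \<phi>) (y - z)) z" for z
      by (intro has_partial_mult has_partial_const has_partial_reflect
          Ck_on_has_partial[of 1 UNIV, OF test_functions_Ck[OF test_functions_foldr[OF assms]]]) auto
    from has_partial_imp_eq[OF this] show ?case using Cons by simp
  qed simp
  then show ?thesis by (simp add: mi_deriv_eq_foldr length_mi_list)
qed

section \<open>A smooth bump function\<close>

text \<open>The family \<open>e\<^sup>-\<^sup>1\<^sup>/\<^sup>t t\<^sup>-\<^sup>m\<close>, cut off at \<open>t \<le> 0\<close>, is closed under differentiation up to linear combinations; this
  gives smoothness without computing the higher derivatives of \<open>e\<^sup>-\<^sup>1\<^sup>/\<^sup>t\<close>.\<close>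

definition flat :: "nat \<Rightarrow> real \<Rightarrow> real" where
  "flat m t = (if t > 0 then exp (- 1 / t) / t ^ m else 0)"

lemma power_le_fact_exp:
  assumes "(x::real) \<ge> 0" shows "x ^ n \<le> fact n * exp x"
proof -
  have "(\<Sum>k\<in>{n}. x ^ k /\<^sub>R fact k) \<le> (\<Sum>k. x ^ k /\<^sub>R fact k)"
    by (rule sum_le_suminf[OF summable_exp_generic]) (use assms in auto)
  then show ?thesis by (simp add: exp_def field_simps)
qed

lemma flat_bound: "\<bar>flat m t\<bar> \<le> fact (m + 2) * t\<^sup>2"
proof (cases "t > 0")
  case True
  have "(1 / t) ^ (m + 2) \<le> fact (m + 2) * exp (1 / t)" using True by (intro power_le_fact_exp) simp
  then have "1 \<le> fact (m + 2) * exp (1 / t) * t ^ (m + 2)" using True by (simp add: power_divide divide_le_eq)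
  then have "exp (- 1 / t) \<le> fact (m + 2) * t ^ (m + 2)"
    by (simp add: exp_minus field_simps)
  then have "exp (- 1 / t) / t ^ m \<le> fact (m + 2) * t\<^sup>2"
    using True by (simp add: power_add divide_le_eq mult_ac power2_eq_square)
  then show ?thesis using True by (simp add: flat_def)
qed (simp add: flat_def)

lemma DERIV_flat: "(flat m has_real_derivative - real m * flat (m + 1) t + flat (m + 2) t) (at t)"
proof -
  consider "t > 0" | "t < 0" | "t = 0" by linarith
  then show ?thesis
  proof cases
    case 1
    have "((\<lambda>t. exp (- 1 / t) / t ^ m) has_real_derivative - real m * flat (m + 1) t + flat (m + 2) t) (at t)"
    proof -
      have "m > 0 \<Longrightarrow> t ^ (m - Suc 0) = t ^ m / t" using 1 by (cases m) auto
      then show ?thesis using 1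
        by (cases "m = 0") (auto intro!: derivative_eq_intros simp: flat_def field_simps power2_eq_square)
    qed
    then show ?thesis
      by (rule has_field_derivative_transform_within_open[of _ _ _ "{0<..}"]) (use 1 in \<open>auto simp: flat_def\<close>)
  next
    case 2
    have "((\<lambda>t. 0) has_real_derivative - real m * flat (m + 1) t + flat (m + 2) t) (at t)"
      using 2 by (simp add: flat_def)
    then show ?thesis
      by (rule has_field_derivative_transform_within_open[of _ _ _ "{..<0}"]) (use 2 in \<open>auto simp: flat_def\<close>)
  next
    case 3
    have "((\<lambda>h. (flat m (0 + h) - flat m 0) / h) \<longlongrightarrow> 0) (at 0)"
    proof (rule Lim_null_comparison)
      have "\<bar>flat m h / h\<bar> \<le> fact (m + 2) * \<bar>h\<bar>" if "h \<noteq> 0" for h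
      proof -
        have "\<bar>flat m h\<bar> \<le> (fact (m + 2) * \<bar>h\<bar>) * \<bar>h\<bar>"
          using flat_bound[of m h] by (metis power2_abs power2_eq_square mult.assoc)
        then show ?thesis using that by (simp only: abs_divide divide_le_eq) simp
      qed
      then show "\<forall>\<^sub>F h in at 0. norm ((flat m (0 + h) - flat m 0) / h) \<le> fact (m + 2) * \<bar>h\<bar>"
        by (auto simp: eventually_at flat_def intro!: exI[of _ 1])
      have "((\<lambda>h::real. fact (m + 2) * \<bar>h\<bar>) \<longlongrightarrow> fact (m + 2) * \<bar>0\<bar>) (at 0)"
        by (intro tendsto_intros)
      then show "((\<lambda>h::real. fact (m + 2) * \<bar>h\<bar>) \<longlongrightarrow> 0) (at 0)" by simp
    qed
    then show ?thesis unfolding 3 DERIV_def by (simp add: flat_def)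
  qed
qed

lemma Ck_on_flat:
  assumes "open \<Omega>" "\<And>k. Ck_on k \<Omega> q"
  shows "Ck_on k \<Omega> (\<lambda>x. flat m (q x))"
proof (induction k arbitrary: m)
  have cont: "continuous_on \<Omega> (\<lambda>x. flat m (q x))" for m
    by (rule continuous_on_compose2[of UNIV "flat m", OF _ Ck_on_imp_continuous[OF assms(2)]])
       (auto intro: DERIV_continuous_on DERIV_flat DERIV_isCont simp: continuous_on_eq_continuous_at)
  { case 0 then show ?case using cont by simp }
  case (Suc k)
  show ?case
  proof (rule Ck_on_SucI[OF assms(1) cont])
    show "Ck_on k \<Omega> (\<lambda>x. (- real m * flat (m + 1) (q x) + flat (m + 2) (q x)) * partial_deriv i q x)" for i
      by (intro Ck_on_mult Ck_on_add Ck_on_cmult Suc.IH Ck_on_partial assms)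
    show "has_partial i (\<lambda>x. flat m (q x)) ((- real m * flat (m + 1) (q x) + flat (m + 2) (q x)) * partial_deriv i q x) x"
      if "x \<in> \<Omega>" for i x
      using DERIV_chain2[of "flat m" _ "\<lambda>t. q (x + t *\<^sub>R axis i 1)" 0]
        DERIV_flat[of m "q (x + 0 *\<^sub>R axis i 1)"] Ck_on_has_partial[OF assms(2)[of 1] _ that, of i]
      unfolding has_partial_def by fastforce
  qed
qed

definition bump :: "real \<Rightarrow> real^'n \<Rightarrow> real" where
  "bump \<epsilon> x = flat 0 (\<epsilon>\<^sup>2 - x \<bullet> x)"

lemma bump_pos_iff: "\<epsilon> > 0 \<Longrightarrow> bump \<epsilon> x > 0 \<longleftrightarrow> norm x < \<epsilon>"
proof -
  assume "\<epsilon> > 0"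
  have "\<epsilon>\<^sup>2 - x \<bullet> x > 0 \<longleftrightarrow> (norm x)\<^sup>2 < \<epsilon>\<^sup>2" by (simp add: power2_norm_eq_inner)
  also have "\<dots> \<longleftrightarrow> norm x < \<epsilon>"
    using \<open>\<epsilon> > 0\<close> power_strict_mono[of "norm x" \<epsilon> 2] power2_less_imp_less[of "norm x" \<epsilon>] by auto
  finally show ?thesis by (simp add: bump_def flat_def)
qed

lemma bump_nonneg: "bump \<epsilon> x \<ge> 0"
  by (simp add: bump_def flat_def)

lemma bump_zero: "\<epsilon> > 0 \<Longrightarrow> \<not> norm x < \<epsilon> \<Longrightarrow> bump \<epsilon> x = 0"
  using bump_pos_iff[of \<epsilon> x] bump_nonneg[of \<epsilon> x] by simp

lemma bump_test: "\<epsilon> > 0 \<Longrightarrow> bump \<epsilon> \<in> test_functions UNIV"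
proof (rule test_functionsI[of _ "cball 0 \<epsilon>"])
  have "Ck_on k UNIV (\<lambda>x :: real^'n. \<epsilon>\<^sup>2 - x \<bullet> x)" for k
    unfolding inner_vec_def by (intro Ck_on_diff Ck_on_sum Ck_on_const open_UNIV) (auto intro!: Ck_on_mult Ck_on_coord)
  then show "Ck_on k UNIV (bump \<epsilon> :: real^'n \<Rightarrow> real)" for k
    using Ck_on_flat[OF open_UNIV, of "\<lambda>x. \<epsilon>\<^sup>2 - x \<bullet> x" k 0] unfolding bump_def by blast
qed (auto intro: bump_zero)

section \<open>Convolution with smooth functions\<close>

lemma borel_measurable_lebesgue_continuous:
  fixes f :: "'a::euclidean_space \<Rightarrow> 'b::topological_space"
  shows "continuous_on UNIV f \<Longrightarrow> f \<in> borel_measurable lebesgue"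
  by (intro measurable_completion) (simp add: borel_measurable_continuous_onI)

lemma integrable_mult_bounded:
  fixes f g :: "'a \<Rightarrow> real"
  assumes "integrable M f" "g \<in> borel_measurable M" "\<And>x. \<bar>g x\<bar> \<le> B"
  shows "integrable M (\<lambda>x. f x * g x)"
proof (rule Bochner_Integration.integrable_bound[of M "\<lambda>x. B * f x"])
  show "AE x in M. norm (f x * g x) \<le> norm (B * f x)"
  proof (rule AE_I2)
    fix x
    have "\<bar>f x\<bar> * \<bar>g x\<bar> \<le> \<bar>f x\<bar> * \<bar>B\<bar>" using assms(3)[of x] by (intro mult_left_mono) auto
    then show "norm (f x * g x) \<le> norm (B * f x)" by (simp add: abs_mult mult.commute)
  qed
qed (use assms in auto)

definition convolution :: "(real^'n \<Rightarrow> real) \<Rightarrow> (real^'n \<Rightarrow> real) \<Rightarrow> real^'n \<Rightarrow> real" where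
  "convolution f \<phi> x = (LINT y|lebesgue. f y * \<phi> (x - y))"

lemma convolution_integrable:
  assumes "integrable lebesgue f" "\<phi> \<in> test_functions \<Omega>"
  shows "integrable lebesgue (\<lambda>y. f y * \<phi> (x - y))"
proof -
  obtain L where "\<And>x. \<bar>\<phi> x\<bar> \<le> L" by (rule test_functions_bound[OF assms(2)]) blast
  moreover have "continuous_on UNIV (\<lambda>y. \<phi> (x - y))"
    by (rule continuous_on_compose2[OF test_functions_continuous[OF assms(2)]]) (auto intro!: continuous_intros)
  ultimately show ?thesis
    by (intro integrable_mult_bounded[OF assms(1)] borel_measurable_lebesgue_continuous)
qed

lemma convolution_has_partial:
  assumes f: "integrable lebesgue f" and \<phi>: "\<phi> \<in> test_functions UNIV"
  shows "has_partial i (convolution f \<phi>) (convolution f (partial_deriv i \<phi>) x) x"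
proof -
  have mf: "f \<in> borel_measurable lebesgue" using f by auto
  have m\<phi>: "(\<lambda>y. \<psi> (x - y)) \<in> borel_measurable lebesgue" if "\<psi> \<in> test_functions UNIV" for x \<psi>
    by (intro borel_measurable_lebesgue_continuous continuous_on_compose2[OF test_functions_continuous[OF that]])
       (auto intro!: continuous_intros)
  obtain L where L: "L > 0" "\<And>x y. \<bar>\<phi> x - \<phi> y\<bar> \<le> L * norm (x - y)" by (rule test_functions_bound[OF \<phi>]) blast
  let ?F = "\<lambda>t. convolution f \<phi> (x + t *\<^sub>R axis i 1)"
  have "((\<lambda>h. (?F (0 + h) - ?F 0) / h) \<longlongrightarrow> convolution f (partial_deriv i \<phi>) x) (at 0)"
    unfolding tendsto_at_iff_sequentially
  proof (intro allI impI)
    fix X :: "nat \<Rightarrow> real" assume X: "\<forall>n. X n \<in> UNIV - {0}" "X \<longlonglongrightarrow> 0"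
    let ?q = "\<lambda>n y. f y * ((\<phi> (x + X n *\<^sub>R axis i 1 - y) - \<phi> (x - y)) / X n)"
    have q: "(?F (0 + X n) - ?F 0) / X n = (LINT y|lebesgue. ?q n y)" for n
    proof -
      have "?F (0 + X n) - ?F 0 = (LINT y|lebesgue. f y * \<phi> (x + X n *\<^sub>R axis i 1 - y) - f y * \<phi> (x - y))"
        unfolding convolution_def
        by (subst Bochner_Integration.integral_diff) (auto intro: convolution_integrable[OF f \<phi>])
      then have "(?F (0 + X n) - ?F 0) / X n
          = (LINT y|lebesgue. (f y * \<phi> (x + X n *\<^sub>R axis i 1 - y) - f y * \<phi> (x - y)) / X n)"
        by simp
      then show ?thesis by (simp add: algebra_simps)
    qed
    have "(\<lambda>n. LINT y|lebesgue. ?q n y) \<longlonglongrightarrow> (LINT y|lebesgue. f y * partial_deriv i \<phi> (x - y))"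
    proof (rule integral_dominated_convergence[where w = "\<lambda>y. L * \<bar>f y\<bar>"])
      show "(\<lambda>y. f y * partial_deriv i \<phi> (x - y)) \<in> borel_measurable lebesgue"
        by (intro borel_measurable_times mf m\<phi> test_functions_partial \<phi>)
      show "?q n \<in> borel_measurable lebesgue" for n
        by (intro borel_measurable_times borel_measurable_divide borel_measurable_diff mf m\<phi> \<phi> borel_measurable_const)
      show "integrable lebesgue (\<lambda>y. L * \<bar>f y\<bar>)" using f by simp
      show "AE y in lebesgue. (\<lambda>n. ?q n y) \<longlonglongrightarrow> f y * partial_deriv i \<phi> (x - y)"
      proof (intro AE_I2 tendsto_mult tendsto_const)
        fix y
        have "has_partial i \<phi> (partial_deriv i \<phi> (x - y)) (x - y)"
          by (intro Ck_on_has_partial[of 1 UNIV, OF test_functions_Ck[OF \<phi>]]) auto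
        then have "((\<lambda>h. (\<phi> (x - y + h *\<^sub>R axis i 1) - \<phi> (x - y)) / h) \<longlongrightarrow> partial_deriv i \<phi> (x - y)) (at 0)"
          unfolding has_partial_def DERIV_def by simp
        then have "(\<lambda>n. (\<phi> (x - y + X n *\<^sub>R axis i 1) - \<phi> (x - y)) / X n) \<longlonglongrightarrow> partial_deriv i \<phi> (x - y)"
          unfolding tendsto_at_iff_sequentially using X unfolding comp_def by blast
        then show "(\<lambda>n. (\<phi> (x + X n *\<^sub>R axis i 1 - y) - \<phi> (x - y)) / X n) \<longlonglongrightarrow> partial_deriv i \<phi> (x - y)"
          by (simp add: algebra_simps)
      qed
      show "AE y in lebesgue. norm (?q n y) \<le> L * \<bar>f y\<bar>" for n
      proof (rule AE_I2)
        fix y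
        have "\<bar>\<phi> (x + X n *\<^sub>R axis i 1 - y) - \<phi> (x - y)\<bar> \<le> L * norm (X n *\<^sub>R axis i (1::real))"
          using L(2)[of "x + X n *\<^sub>R axis i 1 - y" "x - y"] by simp
        then have "\<bar>(\<phi> (x + X n *\<^sub>R axis i 1 - y) - \<phi> (x - y)) / X n\<bar> \<le> L"
          using X(1) by (simp add: divide_le_eq)
        then have "\<bar>f y\<bar> * \<bar>(\<phi> (x + X n *\<^sub>R axis i 1 - y) - \<phi> (x - y)) / X n\<bar> \<le> \<bar>f y\<bar> * L"
          by (rule mult_left_mono) simp
        then show "norm (?q n y) \<le> L * \<bar>f y\<bar>" by (simp add: abs_mult mult.commute)
      qed
    qed
    then show "((\<lambda>h. (?F (0 + h) - ?F 0) / h) \<circ> X) \<longlonglongrightarrow> convolution f (partial_deriv i \<phi>) x"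
      unfolding comp_def q by (simp add: convolution_def)
  qed
  then show ?thesis unfolding has_partial_def DERIV_def .
qed

lemma convolution_continuous:
  assumes f: "integrable lebesgue f" and \<phi>: "\<phi> \<in> test_functions UNIV"
  shows "continuous_on A (convolution f \<phi>)"
proof -
  obtain L where L: "L > 0" "\<And>x y. \<bar>\<phi> x - \<phi> y\<bar> \<le> L * norm (x - y)" by (rule test_functions_bound[OF \<phi>]) blast
  let ?I = "LINT y|lebesgue. \<bar>f y\<bar>"
  have "\<bar>convolution f \<phi> x - convolution f \<phi> x'\<bar> \<le> (L * ?I) * norm (x - x')" for x x'
  proof -
    have "convolution f \<phi> x - convolution f \<phi> x' = (LINT y|lebesgue. f y * \<phi> (x - y) - f y * \<phi> (x' - y))"
      unfolding convolution_def
      by (subst Bochner_Integration.integral_diff) (auto intro: convolution_integrable[OF f \<phi>])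
    also have "\<bar>\<dots>\<bar> \<le> (LINT y|lebesgue. \<bar>f y * \<phi> (x - y) - f y * \<phi> (x' - y)\<bar>)"
      by (rule integral_abs_bound)
    also have "\<dots> \<le> (LINT y|lebesgue. \<bar>f y\<bar> * (L * norm (x - x')))"
    proof (rule Bochner_Integration.integral_mono)
      show "integrable lebesgue (\<lambda>y. \<bar>f y * \<phi> (x - y) - f y * \<phi> (x' - y)\<bar>)"
        by (intro integrable_abs Bochner_Integration.integrable_diff convolution_integrable[OF f \<phi>])
      show "integrable lebesgue (\<lambda>y. \<bar>f y\<bar> * (L * norm (x - x')))" using f by simp
      fix y
      have "\<bar>f y\<bar> * \<bar>\<phi> (x - y) - \<phi> (x' - y)\<bar> \<le> \<bar>f y\<bar> * (L * norm (x - x'))"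
        using L(2)[of "x - y" "x' - y"] by (intro mult_left_mono) auto
      then show "\<bar>f y * \<phi> (x - y) - f y * \<phi> (x' - y)\<bar> \<le> \<bar>f y\<bar> * (L * norm (x - x'))"
        by (simp add: abs_mult flip: right_diff_distrib)
    qed
    finally show ?thesis by (simp add: mult_ac)
  qed
  then have "(L * ?I)-lipschitz_on A (convolution f \<phi>)"
    using L(1) by (intro lipschitz_onI) (auto simp: dist_norm)
  then show ?thesis by (rule lipschitz_on_continuous_on)
qed

lemma partial_deriv_convolution:
  "integrable lebesgue f \<Longrightarrow> \<phi> \<in> test_functions UNIV \<Longrightarrow>
    partial_deriv i (convolution f \<phi>) = convolution f (partial_deriv i \<phi>)"
  by (rule ext) (rule has_partial_imp_eq[OF convolution_has_partial])

lemma Ck_on_convolution: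
  assumes "integrable lebesgue f" "\<phi> \<in> test_functions UNIV"
  shows "Ck_on k UNIV (convolution f \<phi>)"
  using assms(2)
proof (induction k arbitrary: \<phi>)
  case 0 then show ?case using convolution_continuous[OF assms(1)] by simp
next
  case (Suc k)
  show ?case
    by (rule Ck_on_SucI[OF open_UNIV convolution_continuous[OF assms(1) Suc.prems]
          convolution_has_partial[OF assms(1) Suc.prems] Suc.IH[OF test_functions_partial[OF Suc.prems]]])
qed

lemma mi_deriv_convolution:
  assumes "integrable lebesgue f" "\<phi> \<in> test_functions UNIV"
  shows "mi_deriv \<mu> (convolution f \<phi>) = convolution f (mi_deriv \<mu> \<phi>)"
proof -
  have "foldr partial_deriv is (convolution f \<phi>) = convolution f (foldr partial_deriv is \<phi>)" for "is"
    by (induction "is") (simp_all add: partial_deriv_convolution[OF assms(1)] test_functions_foldr assms(2))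
  then show ?thesis unfolding mi_deriv_eq_foldr .
qed

lemma integrable_continuous_compact_support:
  fixes f :: "'a::euclidean_space \<Rightarrow> real"
  assumes "continuous_on UNIV f" "compact K" "\<And>x. x \<notin> K \<Longrightarrow> f x = 0"
  shows "integrable lebesgue f"
proof -
  have "integrable lborel (\<lambda>x. indicator K x *\<^sub>R f x)"
    by (rule borel_integrable_compact[OF assms(2) continuous_on_subset[OF assms(1) subset_UNIV]])
  moreover have "(\<lambda>x. indicator K x *\<^sub>R f x) = f"
    by (rule ext) (use assms(3) in \<open>auto simp: indicator_def\<close>)
  ultimately have "integrable lborel f" by simp
  then show ?thesis
    using integrable_completion[of f lborel] by (metis borel_measurable_integrable)
qed

lemma test_functions_integrable:
  assumes "\<phi> \<in> test_functions \<Omega>" shows "integrable lebesgue \<phi>"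
proof -
  obtain K where K: "compact K" "K \<subseteq> \<Omega>" "\<And>x. x \<notin> K \<Longrightarrow> \<phi> x = 0" by (rule test_functionsE[OF assms]) blast
  show ?thesis by (rule integrable_continuous_compact_support[OF test_functions_continuous[OF assms] K(1,3)])
qed

definition mollifier :: "real \<Rightarrow> real^'n \<Rightarrow> real" where
  "mollifier \<epsilon> x = bump \<epsilon> x / (LINT y|lebesgue. bump \<epsilon> (y :: real^'n))"

lemma integral_bump_pos:
  assumes "\<epsilon> > 0" shows "(LINT y|lebesgue. bump \<epsilon> (y :: real^'n)) > 0"
proof -
  let ?I = "LINT y|lebesgue. bump \<epsilon> (y :: real^'n)"
  have i: "integrable lebesgue (bump \<epsilon> :: real^'n \<Rightarrow> real)" by (rule test_functions_integrable[OF bump_test[OF assms]])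
  have "?I \<noteq> 0"
  proof
    assume "?I = 0"
    then have "AE y in lebesgue. bump \<epsilon> (y :: real^'n) = 0"
      using integral_nonneg_eq_0_iff_AE[OF i] bump_nonneg by auto
    then have "AE y in lebesgue. y \<notin> ball (0 :: real^'n) \<epsilon>"
    proof eventually_elim
      case (elim y)
      then show ?case using bump_pos_iff[OF assms, of y] by auto
    qed
    then have "negligible (ball (0 :: real^'n) \<epsilon>)"
      by (simp add: negligible_iff_null_sets AE_iff_null_sets)
    then show False using open_not_negligible[of "ball (0 :: real^'n) \<epsilon>"] assms by auto
  qed
  moreover have "?I \<ge> 0" by (rule Bochner_Integration.integral_nonneg) (rule bump_nonneg)
  ultimately show ?thesis by simp
qed

lemma mollifier_test: "\<epsilon> > 0 \<Longrightarrow> mollifier \<epsilon> \<in> test_functions UNIV"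
proof -
  assume "\<epsilon> > 0"
  then have "(\<lambda>x. (1 / (LINT y|lebesgue. bump \<epsilon> (y :: real^'n))) * bump \<epsilon> x) \<in> test_functions UNIV"
    by (intro test_functions_mult bump_test) auto
  then show ?thesis by (simp add: mollifier_def[abs_def])
qed

lemma mollifier_nonneg: "mollifier \<epsilon> x \<ge> 0"
  unfolding mollifier_def by (intro divide_nonneg_nonneg bump_nonneg Bochner_Integration.integral_nonneg)

lemma mollifier_zero: "\<epsilon> > 0 \<Longrightarrow> \<not> norm (x::real^'n) < \<epsilon> \<Longrightarrow> mollifier \<epsilon> x = 0"
  unfolding mollifier_def by (simp add: bump_zero)

lemma mollifier_integral: "\<epsilon> > 0 \<Longrightarrow> (LINT y|lebesgue. mollifier \<epsilon> (y :: real^'n)) = 1"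
  unfolding mollifier_def using integral_bump_pos[of \<epsilon>, where ?'n = 'n] by simp

section \<open>Product integrals, Jensen's inequality and mollification in \<open>L\<^sup>1\<close>\<close>

lemma nn_integral_lborel_shift:
  fixes g :: "'a::euclidean_space \<Rightarrow> ennreal"
  assumes [measurable]: "g \<in> borel_measurable borel"
  shows "(\<integral>\<^sup>+x. g (x - c) \<partial>lborel) = (\<integral>\<^sup>+x. g x \<partial>lborel)"
proof -
  have "(\<integral>\<^sup>+x. g x \<partial>lborel) = (\<integral>\<^sup>+x. g x \<partial>distr lborel borel ((+) (- c)))"
    by (simp only: lborel_distr_plus)
  also have "\<dots> = (\<integral>\<^sup>+x. g (- c + x) \<partial>lborel)" by (rule nn_integral_distr) simp_all
  finally show ?thesis by simp
qed

lemma lborel_distr_reflect: "distr lborel borel (\<lambda>x. c - x) = (lborel :: 'a::euclidean_space measure)"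
  using lborel_affine[of "-1" c] by (simp add: density_1)

lemma nn_integral_lborel_reflect:
  fixes g :: "'a::euclidean_space \<Rightarrow> ennreal"
  assumes [measurable]: "g \<in> borel_measurable borel"
  shows "(\<integral>\<^sup>+x. g (c - x) \<partial>lborel) = (\<integral>\<^sup>+x. g x \<partial>lborel)"
proof -
  have "(\<integral>\<^sup>+x. g x \<partial>lborel) = (\<integral>\<^sup>+x. g x \<partial>distr lborel borel (\<lambda>x. c - x))"
    by (simp only: lborel_distr_reflect)
  also have "\<dots> = (\<integral>\<^sup>+x. g (c - x) \<partial>lborel)" by (rule nn_integral_distr) simp_all
  finally show ?thesis by simp
qed

lemma integral_mollifier_reflect:
  assumes "\<epsilon> > 0" shows "(LINT y|lebesgue. mollifier \<epsilon> (x - y :: real^'n)) = 1"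
proof -
  have m: "(mollifier \<epsilon> :: real^'n \<Rightarrow> real) \<in> borel_measurable borel"
    by (rule borel_measurable_continuous_onI[OF test_functions_continuous[OF mollifier_test[OF assms]]])
  then have m': "(\<lambda>y. mollifier \<epsilon> (x - y :: real^'n)) \<in> borel_measurable borel" by measurable
  have "(LINT y|lborel. mollifier \<epsilon> (y :: real^'n)) = (LINT y|distr lborel borel (\<lambda>y. x - y). mollifier \<epsilon> y)"
    by (simp only: lborel_distr_reflect)
  also have "\<dots> = (LINT y|lborel. mollifier \<epsilon> (x - y))" using m by (intro integral_distr) auto
  finally show ?thesis using mollifier_integral[OF assms, where ?'n = 'n] m m'
    by (simp add: integral_completion)
qed

text \<open>Between completed measure spaces, a Borel measurable map is measurable if preimages of null sets are null sets.\<close>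

lemma measurable_lebesgue_I:
  assumes "f \<in> lebesgue \<rightarrow>\<^sub>M borel"
    "\<And>N. N \<in> null_sets lborel \<Longrightarrow> emeasure lebesgue (f -` N) = 0"
  shows "f \<in> lebesgue \<rightarrow>\<^sub>M lebesgue"
proof (rule completion.measurable_completion2)
  show "f \<in> lebesgue \<rightarrow>\<^sub>M lborel" using assms(1) by simp
  show "null_sets lborel \<subseteq> null_sets (distr lebesgue lborel f)"
  proof
    fix N :: "'b set" assume N: "N \<in> null_sets lborel"
    then have "emeasure (distr lebesgue lborel f) N = emeasure lebesgue (f -` N \<inter> space lebesgue)"
      using assms(1) by (intro emeasure_distr) auto
    then show "N \<in> null_sets (distr lebesgue lborel f)"
      using assms(2)[OF N] N by (auto simp: null_sets_def)
  qed
qed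

lemma measurable_fst_lebesgue [measurable]:
  "(fst :: 'a::euclidean_space \<times> 'b::euclidean_space \<Rightarrow> 'a) \<in> lebesgue \<rightarrow>\<^sub>M lebesgue"
proof (rule measurable_lebesgue_I)
  show "(fst :: 'a \<times> 'b \<Rightarrow> 'a) \<in> lebesgue \<rightarrow>\<^sub>M borel"
    by (intro borel_measurable_lebesgue_continuous continuous_intros)
  fix N :: "'a set" assume N: "N \<in> null_sets lborel"
  have "fst -` N = N \<times> (UNIV :: 'b set)" by auto
  moreover have "emeasure (lborel \<Otimes>\<^sub>M lborel) (N \<times> (UNIV :: 'b set)) = 0"
    using N by (subst lborel.emeasure_pair_measure_Times) auto
  moreover have "N \<times> (UNIV :: 'b set) \<in> sets borel" using N by (auto simp: null_sets_def intro: borel_Times)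
  ultimately show "emeasure lebesgue (fst -` N :: ('a \<times> 'b) set) = 0"
    by (simp add: lborel_prod)
qed

lemma measurable_snd_lebesgue [measurable]:
  "(snd :: 'a::euclidean_space \<times> 'b::euclidean_space \<Rightarrow> 'b) \<in> lebesgue \<rightarrow>\<^sub>M lebesgue"
proof (rule measurable_lebesgue_I)
  show "(snd :: 'a \<times> 'b \<Rightarrow> 'b) \<in> lebesgue \<rightarrow>\<^sub>M borel"
    by (intro borel_measurable_lebesgue_continuous continuous_intros)
  fix N :: "'b set" assume N: "N \<in> null_sets lborel"
  have "snd -` N = (UNIV :: 'a set) \<times> N" by auto
  moreover have "emeasure (lborel \<Otimes>\<^sub>M lborel) ((UNIV :: 'a set) \<times> N) = 0"
    using N by (subst lborel.emeasure_pair_measure_Times) auto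
  moreover have "(UNIV :: 'a set) \<times> N \<in> sets borel" using N by (auto simp: null_sets_def intro: borel_Times)
  ultimately show "emeasure lebesgue (snd -` N :: ('a \<times> 'b) set) = 0"
    by (simp add: lborel_prod)
qed

lemma AE_lebesgue_prod_swap:
  fixes P :: "'a::euclidean_space \<times> 'b::euclidean_space \<Rightarrow> bool"
  assumes "AE z in lborel. P z"
  shows "AE x in lborel. AE y in lborel. P (x, y)" "AE y in lborel. AE x in lborel. P (x, y)"
proof -
  obtain N where N: "N \<in> null_sets lborel" "{z. \<not> P z} \<subseteq> N"
    using assms unfolding eventually_ae_filter by auto
  then have "N \<in> null_sets (lborel \<Otimes>\<^sub>M lborel)" by (simp add: lborel_prod)
  then have "AE z in lborel \<Otimes>\<^sub>M lborel. z \<notin> N" by (rule AE_not_in)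
  from lborel_pair.AE_pair[OF this] have 1: "AE x in lborel. AE y in lborel. (x, y) \<notin> N" .
  have [measurable]: "N \<in> sets borel" using N by (simp add: null_sets_def)
  have "AE y in lborel. AE x in lborel. (x, y) \<notin> N"
  proof (subst lborel_pair.AE_commute[symmetric])
    have "{z \<in> space (lborel \<Otimes>\<^sub>M lborel). (fst z, snd z) \<notin> N} = - N" by (auto simp: lborel_prod)
    moreover have "- N \<in> sets (lborel \<Otimes>\<^sub>M lborel)" unfolding lborel_prod by (simp add: borel_comp)
    ultimately show "{z \<in> space (lborel \<Otimes>\<^sub>M lborel). (fst z, snd z) \<notin> N} \<in> sets (lborel \<Otimes>\<^sub>M lborel)"
      by metis
  qed (rule 1)
  then show "AE y in lborel. AE x in lborel. P (x, y)"
    by (rule AE_mp) (rule AE_I2, rule impI, erule AE_mp, rule AE_I2, use N(2) in blast)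
  show "AE x in lborel. AE y in lborel. P (x, y)"
    using 1 by (rule AE_mp) (rule AE_I2, rule impI, erule AE_mp, rule AE_I2, use N(2) in blast)
qed

text \<open>Tonelli's theorem for Lebesgue measurable functions, whose sections are measurable only
  almost everywhere.\<close>

lemma nn_integral_lebesgue_prod:
  fixes h :: "'a::euclidean_space \<times> 'b::euclidean_space \<Rightarrow> ennreal"
  assumes "h \<in> borel_measurable lebesgue"
  shows "(\<integral>\<^sup>+z. h z \<partial>lborel) = (\<integral>\<^sup>+x. \<integral>\<^sup>+y. h (x, y) \<partial>lborel \<partial>lborel)"
    and "(\<integral>\<^sup>+z. h z \<partial>lborel) = (\<integral>\<^sup>+y. \<integral>\<^sup>+x. h (x, y) \<partial>lborel \<partial>lborel)"
proof -
  obtain h' where h': "h' \<in> borel_measurable lborel" "AE z in lborel. h z = h' z"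
    using completion_ex_borel_measurable[OF assms] by blast
  have m: "h' \<in> borel_measurable (lborel \<Otimes>\<^sub>M lborel)" using h'(1) by (simp add: lborel_prod)
  have e: "(\<integral>\<^sup>+z. h z \<partial>lborel) = (\<integral>\<^sup>+z. h' z \<partial>(lborel \<Otimes>\<^sub>M lborel))"
    unfolding lborel_prod using h'(2) by (rule nn_integral_cong_AE)
  have 1: "(\<integral>\<^sup>+z. h' z \<partial>(lborel \<Otimes>\<^sub>M lborel)) = (\<integral>\<^sup>+x. \<integral>\<^sup>+y. h' (x, y) \<partial>lborel \<partial>lborel)"
    by (rule lborel.nn_integral_fst[OF m, symmetric])
  also have "\<dots> = (\<integral>\<^sup>+x. \<integral>\<^sup>+y. h (x, y) \<partial>lborel \<partial>lborel)"
  proof (rule nn_integral_cong_AE)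
    show "AE x in lborel. (\<integral>\<^sup>+y. h' (x, y) \<partial>lborel) = (\<integral>\<^sup>+y. h (x, y) \<partial>lborel)"
      using AE_lebesgue_prod_swap(1)[OF h'(2)]
      by (rule AE_mp) (rule AE_I2, rule impI, rule nn_integral_cong_AE, erule AE_mp, rule AE_I2, simp)
  qed
  finally show "(\<integral>\<^sup>+z. h z \<partial>lborel) = (\<integral>\<^sup>+x. \<integral>\<^sup>+y. h (x, y) \<partial>lborel \<partial>lborel)" using e by simp
  have "(\<integral>\<^sup>+x. \<integral>\<^sup>+y. h' (x, y) \<partial>lborel \<partial>lborel) = (\<integral>\<^sup>+y. \<integral>\<^sup>+x. h' (x, y) \<partial>lborel \<partial>lborel)"
    by (rule lborel_pair.Fubini'[symmetric]) (use m in simp)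
  also have "\<dots> = (\<integral>\<^sup>+y. \<integral>\<^sup>+x. h (x, y) \<partial>lborel \<partial>lborel)"
  proof (rule nn_integral_cong_AE)
    show "AE y in lborel. (\<integral>\<^sup>+x. h' (x, y) \<partial>lborel) = (\<integral>\<^sup>+x. h (x, y) \<partial>lborel)"
      using AE_lebesgue_prod_swap(2)[OF h'(2)]
      by (rule AE_mp) (rule AE_I2, rule impI, rule nn_integral_cong_AE, erule AE_mp, rule AE_I2, simp)
  qed
  finally show "(\<integral>\<^sup>+z. h z \<partial>lborel) = (\<integral>\<^sup>+y. \<integral>\<^sup>+x. h (x, y) \<partial>lborel \<partial>lborel)" using e 1 by simp
qed

text \<open>The graph of \<open>t \<mapsto> t\<^sup>p\<close> lies above its tangent at \<open>m\<close>; this is Young's inequality for \<open>t\<close> and \<open>m\<^sup>p\<^sup>-\<^sup>1\<close>.\<close>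

lemma powr_tangent:
  fixes p t m :: real
  assumes "p \<ge> 1" "t \<ge> 0" "m \<ge> 0"
  shows "m powr p + p * m powr (p - 1) * (t - m) \<le> t powr p"
proof (cases "p = 1 \<or> m = 0")
  case True
  then show ?thesis using assms by (cases "m = 0") auto
next
  case False
  then have p: "p > 1" and m: "m > 0" using assms by auto
  define q where "q = p / (p - 1)"
  have q: "q > 1" "1 / p + 1 / q = 1" using p by (auto simp: q_def field_simps)
  have "t * m powr (p - 1) \<le> t powr p / p + (m powr (p - 1)) powr q / q"
    using Youngs_inequality[OF p q, of t "m powr (p - 1)"] assms by simp
  moreover have "(m powr (p - 1)) powr q = m powr p" using p by (simp add: powr_powr q_def)
  moreover have "m powr (p - 1) * m = m powr p" using m by (simp add: powr_diff)
  moreover have "m powr p / q = m powr p - m powr p / p"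
    using q(2) p by (simp add: q_def field_simps)
  ultimately have "p * (t * m powr (p - 1)) \<le> p * (t powr p / p + (m powr p - m powr p / p))"
    using p by (intro mult_left_mono) auto
  then have "p * (t * m powr (p - 1)) \<le> t powr p + p * m powr p - m powr p"
    using p by (simp add: distrib_left right_diff_distrib)
  moreover have "p * m powr (p - 1) * (t - m) = p * (t * m powr (p - 1)) - p * (m powr (p - 1) * m)"
    by (simp add: algebra_simps)
  ultimately show ?thesis using \<open>m powr (p - 1) * m = m powr p\<close> by simp
qed

text \<open>Jensen's inequality for the power function: integrate the tangent inequality at the mean value.\<close>

lemma jensen_powr:
  fixes f \<rho> :: "'a \<Rightarrow> real"
  assumes "p \<ge> 1" "f \<in> borel_measurable M" "\<And>x. f x \<ge> 0" "\<And>x. \<rho> x \<ge> 0" "integrable M \<rho>"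
    "(LINT x|M. \<rho> x) = 1" "integrable M (\<lambda>x. f x * \<rho> x)"
  shows "ennreal ((LINT x|M. f x * \<rho> x) powr p) \<le> (\<integral>\<^sup>+x. ennreal (f x powr p * \<rho> x) \<partial>M)"
proof (cases "(\<integral>\<^sup>+x. ennreal (f x powr p * \<rho> x) \<partial>M) = \<infinity>")
  case False
  have meas: "(\<lambda>x. f x powr p * \<rho> x) \<in> borel_measurable M" using assms by measurable
  have i: "integrable M (\<lambda>x. f x powr p * \<rho> x)"
    by (rule integrableI_nonneg[OF meas]) (use False assms in \<open>auto simp: less_top\<close>)
  define m where "m = (LINT x|M. f x * \<rho> x)"
  have m: "m \<ge> 0" unfolding m_def using assms by (intro Bochner_Integration.integral_nonneg) auto
  have "m powr p = (LINT x|M. (m powr p - p * m powr (p - 1) * m) * \<rho> x + p * m powr (p - 1) * (f x * \<rho> x))"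
    using assms by (simp add: m_def)
  also have "\<dots> \<le> (LINT x|M. f x powr p * \<rho> x)"
  proof (rule Bochner_Integration.integral_mono[OF _ i])
    show "integrable M (\<lambda>x. (m powr p - p * m powr (p - 1) * m) * \<rho> x + p * m powr (p - 1) * (f x * \<rho> x))"
      using assms by (intro Bochner_Integration.integrable_add integrable_mult_right) auto
    fix x
    have "(m powr p + p * m powr (p - 1) * (f x - m)) * \<rho> x \<le> f x powr p * \<rho> x"
      using assms m by (intro mult_right_mono powr_tangent) auto
    then show "(m powr p - p * m powr (p - 1) * m) * \<rho> x + p * m powr (p - 1) * (f x * \<rho> x) \<le> f x powr p * \<rho> x"
      by (simp add: algebra_simps)
  qed
  finally have "ennreal (m powr p) \<le> ennreal (LINT x|M. f x powr p * \<rho> x)" by (rule ennreal_leI)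
  also have "\<dots> = (\<integral>\<^sup>+x. ennreal (f x powr p * \<rho> x) \<partial>M)"
    using i assms by (intro nn_integral_eq_integral[symmetric]) auto
  finally show ?thesis unfolding m_def .
qed simp

text \<open>Young's inequality for a kernel of total mass one: Jensen's inequality at each point, then Tonelli's theorem.\<close>

lemma convolution_mollifier_Lp:
  fixes f :: "real^'n \<Rightarrow> real"
  assumes f: "integrable lebesgue f" and "\<epsilon> > 0" "p \<ge> 1"
  shows "(\<integral>\<^sup>+x. ennreal (\<bar>convolution f (mollifier \<epsilon>) x\<bar> powr p) \<partial>lborel) \<le> (\<integral>\<^sup>+x. ennreal (\<bar>f x\<bar> powr p) \<partial>lborel)"
proof -
  let ?\<rho> = "mollifier \<epsilon> :: real^'n \<Rightarrow> real"
  have \<rho>: "?\<rho> \<in> test_functions UNIV" by (rule mollifier_test[OF assms(2)])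
  have [measurable]: "f \<in> borel_measurable lebesgue" using f by auto
  have m\<rho>[measurable]: "?\<rho> \<in> borel_measurable borel"
    by (rule borel_measurable_continuous_onI[OF test_functions_continuous[OF \<rho>]])
  have pw: "ennreal (\<bar>convolution f ?\<rho> x\<bar> powr p) \<le> (\<integral>\<^sup>+y. ennreal (\<bar>f y\<bar> powr p * ?\<rho> (x - y)) \<partial>lborel)" for x
  proof -
    have i: "integrable lebesgue (\<lambda>y. \<bar>f y\<bar> * ?\<rho> (x - y))"
      using integrable_abs[OF convolution_integrable[OF f \<rho>, of x]] by (simp add: abs_mult mollifier_nonneg)
    have "\<bar>convolution f ?\<rho> x\<bar> \<le> (LINT y|lebesgue. \<bar>f y * ?\<rho> (x - y)\<bar>)"
      unfolding convolution_def by (rule integral_abs_bound)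
    also have "\<dots> = (LINT y|lebesgue. \<bar>f y\<bar> * ?\<rho> (x - y))"
      by (simp add: abs_mult mollifier_nonneg)
    finally have "\<bar>convolution f ?\<rho> x\<bar> powr p \<le> (LINT y|lebesgue. \<bar>f y\<bar> * ?\<rho> (x - y)) powr p"
      using assms(3) by (intro powr_mono2) auto
    then have "ennreal (\<bar>convolution f ?\<rho> x\<bar> powr p) \<le> ennreal ((LINT y|lebesgue. \<bar>f y\<bar> * ?\<rho> (x - y)) powr p)"
      by (rule ennreal_leI)
    also have "\<dots> \<le> (\<integral>\<^sup>+y. ennreal (\<bar>f y\<bar> powr p * ?\<rho> (x - y)) \<partial>lebesgue)"
      by (rule jensen_powr[OF assms(3) _ _ _ _ _ i])
         (auto simp: mollifier_nonneg integral_mollifier_reflect[OF assms(2)]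
          intro: test_functions_integrable[OF test_functions_reflect[OF \<rho>]])
    finally show ?thesis by (simp add: nn_integral_completion)
  qed
  let ?h = "\<lambda>z. ennreal (\<bar>f (snd z)\<bar> powr p) * ennreal (?\<rho> (fst z - snd z))"
  have "(\<lambda>z::(real^'n)\<times>(real^'n). ?\<rho> (fst z - snd z)) \<in> borel_measurable lebesgue"
    by (intro borel_measurable_lebesgue_continuous continuous_on_compose2[OF test_functions_continuous[OF \<rho>]])
       (auto intro!: continuous_intros)
  moreover have "(\<lambda>z::(real^'n)\<times>(real^'n). f (snd z)) \<in> borel_measurable lebesgue" by measurable
  ultimately have h: "?h \<in> borel_measurable lebesgue" by measurable
  have "(\<integral>\<^sup>+x. ennreal (\<bar>convolution f ?\<rho> x\<bar> powr p) \<partial>lborel) \<le> (\<integral>\<^sup>+x. \<integral>\<^sup>+y. ?h (x, y) \<partial>lborel \<partial>lborel)"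
    using pw by (intro nn_integral_mono) (simp add: ennreal_mult mollifier_nonneg)
  also have "\<dots> = (\<integral>\<^sup>+y. \<integral>\<^sup>+x. ?h (x, y) \<partial>lborel \<partial>lborel)"
    using nn_integral_lebesgue_prod[OF h] by simp
  also have "\<dots> = (\<integral>\<^sup>+y. ennreal (\<bar>f y\<bar> powr p) * (\<integral>\<^sup>+x. ennreal (?\<rho> (x - y)) \<partial>lborel) \<partial>lborel)"
    by (intro nn_integral_cong) (simp add: nn_integral_cmult)
  also have "\<dots> = (\<integral>\<^sup>+y. ennreal (\<bar>f y\<bar> powr p) * 1 \<partial>lborel)"
  proof -
    have "(\<integral>\<^sup>+x. ennreal (?\<rho> (x - y)) \<partial>lborel) = 1" for y
    proof -
      have "(\<integral>\<^sup>+x. ennreal (?\<rho> (x - y)) \<partial>lborel) = (\<integral>\<^sup>+x. ennreal (?\<rho> x) \<partial>lebesgue)"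
        using nn_integral_lborel_shift[of "\<lambda>x. ennreal (?\<rho> x)" y] by (simp add: nn_integral_completion)
      also have "\<dots> = ennreal (LINT x|lebesgue. ?\<rho> x)"
        by (intro nn_integral_eq_integral test_functions_integrable[OF \<rho>]) (simp add: mollifier_nonneg)
      finally show ?thesis using mollifier_integral[OF assms(2), where ?'n = 'n] by simp
    qed
    then show ?thesis by simp
  qed
  finally show ?thesis by simp
qed

text \<open>Continuous functions of compact support are dense in \<open>L\<^sup>1\<close>: truncate \<open>f\<close>, approximate it almost
  everywhere by continuous functions, truncate these, and use dominated convergence twice.\<close>

lemma L1_continuous_dense:
  fixes f :: "real^'n \<Rightarrow> real"
  assumes f: "integrable lebesgue f" and R: "\<And>x. norm x \<ge> R \<Longrightarrow> f x = 0" and "e > 0"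
  obtains g where "continuous_on UNIV g" "\<And>x. norm x \<ge> R + 1 \<Longrightarrow> g x = 0"
    "(\<integral>\<^sup>+x. ennreal \<bar>f x - g x\<bar> \<partial>lebesgue) \<le> ennreal e"
proof -
  have fm[measurable]: "f \<in> borel_measurable lebesgue" using f by auto
  define c where "c n t = max (- real n) (min (real n) t)" for n and t :: real
  have cb: "\<bar>c n t\<bar> \<le> real n" "\<bar>c n t\<bar> \<le> \<bar>t\<bar>" for n t by (auto simp: c_def)
  have "(\<lambda>n. \<integral>\<^sup>+x. norm (f x - c n (f x)) \<partial>lebesgue) \<longlonglongrightarrow> 0"
  proof (rule nn_integral_dominated_convergence_norm[where w = "\<lambda>x. \<bar>f x\<bar>"])
    show "(\<lambda>x. c n (f x)) \<in> borel_measurable lebesgue" for n unfolding c_def by measurable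
    show "(\<integral>\<^sup>+x. ennreal \<bar>f x\<bar> \<partial>lebesgue) < \<infinity>" using f by (simp add: integrable_iff_bounded)
    show "AE x in lebesgue. (\<lambda>n. c n (f x)) \<longlonglongrightarrow> f x"
    proof (rule AE_I2)
      fix x
      obtain N where N: "\<bar>f x\<bar> \<le> real N" using real_arch_simple by blast
      have "\<forall>\<^sub>F n in sequentially. c n (f x) = f x"
        using eventually_ge_at_top[of N] by eventually_elim (use N in \<open>auto simp: c_def\<close>)
      then show "(\<lambda>n. c n (f x)) \<longlonglongrightarrow> f x" by (rule tendsto_eventually)
    qed
  qed (auto intro: cb)
  moreover have "0 < ennreal (e / 2)" using assms(3) by simp
  ultimately have "\<forall>\<^sub>F n in sequentially. (\<integral>\<^sup>+x. norm (f x - c n (f x)) \<partial>lebesgue) < ennreal (e / 2)"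
    by (rule order_tendstoD)
  then obtain n where n: "(\<integral>\<^sup>+x. ennreal \<bar>f x - c n (f x)\<bar> \<partial>lebesgue) < ennreal (e / 2)"
    by (auto simp: eventually_sequentially)
  have cm[measurable]: "(\<lambda>x. c n (f x)) \<in> borel_measurable lebesgue" unfolding c_def by measurable
  then have "(\<lambda>x. c n (f x)) measurable_on UNIV" by (intro lebesgue_measurable_imp_measurable_on) auto
  then obtain N g where g: "negligible N" "\<And>k. continuous_on UNIV (g k)"
    "\<And>x. x \<notin> N \<Longrightarrow> (\<lambda>k. g k x) \<longlonglongrightarrow> c n (f x)"
    unfolding measurable_on_def by auto
  define \<eta> where "\<eta> x = max 0 (min 1 (R + 1 - norm x))" for x :: "real^'n"
  define h where "h k x = c n (g k x) * \<eta> x" for k x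
  have hc: "continuous_on UNIV (h k)" for k
    unfolding h_def c_def \<eta>_def by (intro continuous_intros g continuous_on_max continuous_on_min)
  have h0: "h k x = 0" if "norm x \<ge> R + 1" for k x using that by (simp add: h_def \<eta>_def)
  have hb: "\<bar>h k x\<bar> \<le> real n * indicator (cball 0 (R + 1)) x" for k x
  proof (cases "norm x \<le> R + 1")
    case True
    have "\<bar>c n (g k x)\<bar> * \<bar>\<eta> x\<bar> \<le> real n * 1" by (intro mult_mono cb) (auto simp: \<eta>_def)
    then show ?thesis using True by (simp add: h_def abs_mult)
  qed (simp add: h0)
  have "(\<lambda>k. \<integral>\<^sup>+x. norm (c n (f x) - h k x) \<partial>lebesgue) \<longlonglongrightarrow> 0"
  proof (rule nn_integral_dominated_convergence_norm[where w = "\<lambda>x. real n * indicator (cball 0 (R + 1)) x"])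
    show "h k \<in> borel_measurable lebesgue" for k by (rule borel_measurable_lebesgue_continuous[OF hc])
    have "cball (0::real^'n) (R + 1) \<in> sets lebesgue" by simp
    then show "(\<lambda>x::real^'n. real n * indicator (cball 0 (R + 1)) x) \<in> borel_measurable lebesgue"
      by (intro borel_measurable_times borel_measurable_const borel_measurable_indicator)
    show "AE x in lebesgue. norm (h k x) \<le> real n * indicator (cball 0 (R + 1)) x" for k using hb by simp
    have "(\<integral>\<^sup>+x. ennreal (real n * indicator (cball (0::real^'n) (R + 1)) x) \<partial>lebesgue)
        = ennreal (real n) * emeasure lebesgue (cball (0::real^'n) (R + 1))"
      by (simp add: ennreal_mult' ennreal_indicator nn_integral_cmult_indicator)
    also have "\<dots> < \<infinity>" using emeasure_bounded_finite[of "cball (0::real^'n) (R + 1)"]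
      by (simp add: ennreal_mult_less_top less_top)
    finally show "(\<integral>\<^sup>+x. ennreal (real n * indicator (cball (0::real^'n) (R + 1)) x) \<partial>lebesgue) < \<infinity>" .
    have "AE x in lebesgue. x \<notin> N" using g(1) by (simp add: AE_not_in negligible_iff_null_sets)
    then show "AE x in lebesgue. (\<lambda>k. h k x) \<longlonglongrightarrow> c n (f x)"
    proof eventually_elim
      case (elim x)
      have "(\<lambda>k. h k x) \<longlonglongrightarrow> c n (c n (f x)) * \<eta> x"
        unfolding h_def c_def using g(3)[OF elim]
        by (intro tendsto_intros tendsto_max tendsto_min) (simp add: c_def)
      moreover have "c n (c n (f x)) * \<eta> x = c n (f x)"
        using R[of x] by (cases "norm x \<ge> R") (auto simp: c_def \<eta>_def)
      ultimately show ?case by simp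
    qed
  qed measurable
  moreover have "0 < ennreal (e / 2)" using assms(3) by simp
  ultimately have "\<forall>\<^sub>F k in sequentially. (\<integral>\<^sup>+x. norm (c n (f x) - h k x) \<partial>lebesgue) < ennreal (e / 2)"
    by (rule order_tendstoD)
  then obtain k where k: "(\<integral>\<^sup>+x. ennreal \<bar>c n (f x) - h k x\<bar> \<partial>lebesgue) < ennreal (e / 2)"
    by (auto simp: eventually_sequentially)
  have [measurable]: "h k \<in> borel_measurable lebesgue" by (rule borel_measurable_lebesgue_continuous[OF hc])
  have "(\<integral>\<^sup>+x. ennreal \<bar>f x - h k x\<bar> \<partial>lebesgue)
      \<le> (\<integral>\<^sup>+x. ennreal \<bar>f x - c n (f x)\<bar> + ennreal \<bar>c n (f x) - h k x\<bar> \<partial>lebesgue)"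
    by (intro nn_integral_mono) (simp flip: ennreal_plus add: ennreal_leI)
  also have "\<dots> = (\<integral>\<^sup>+x. ennreal \<bar>f x - c n (f x)\<bar> \<partial>lebesgue) + (\<integral>\<^sup>+x. ennreal \<bar>c n (f x) - h k x\<bar> \<partial>lebesgue)"
    by (rule nn_integral_add) measurable
  also have "\<dots> \<le> ennreal (e / 2) + ennreal (e / 2)" using n k by (intro add_mono) auto
  also have "\<dots> = ennreal e" using assms(3) by (simp flip: ennreal_plus)
  finally show ?thesis using that[of "h k"] hc h0 by blast
qed

lemma convolution_diff:
  assumes "integrable lebesgue f" "integrable lebesgue g" "\<phi> \<in> test_functions UNIV"
  shows "convolution (\<lambda>x. f x - g x) \<phi> x = convolution f \<phi> x - convolution g \<phi> x"
  unfolding convolution_def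
  by (subst Bochner_Integration.integral_diff[symmetric])
     (auto intro: convolution_integrable assms simp: left_diff_distrib)

text \<open>Convolution with the mollifier is a contraction in \<open>L\<^sup>1\<close>, so it suffices to approximate \<open>f\<close> by a continuous function of
  compact support, for which uniform continuity gives uniform convergence.\<close>

lemma mollifier_tendsto_L1:
  fixes f :: "real^'n \<Rightarrow> real"
  assumes f: "integrable lebesgue f" and R: "\<And>x. norm x \<ge> R \<Longrightarrow> f x = 0" and "e > 0"
  shows "\<exists>\<delta>>0. \<forall>\<epsilon>. 0 < \<epsilon> \<longrightarrow> \<epsilon> < \<delta> \<longrightarrow> (\<integral>\<^sup>+x. ennreal \<bar>convolution f (mollifier \<epsilon>) x - f x\<bar> \<partial>lborel) \<le> ennreal e"
proof -
  obtain g where g: "continuous_on UNIV g" "\<And>x. norm x \<ge> R + 1 \<Longrightarrow> g x = 0"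
    "(\<integral>\<^sup>+x. ennreal \<bar>f x - g x\<bar> \<partial>lebesgue) \<le> ennreal (e / 3)"
    using L1_continuous_dense[OF f R, of R "e / 3"] assms(3) by force
  have gm: "g \<in> borel_measurable lebesgue" by (rule borel_measurable_lebesgue_continuous[OF g(1)])
  have gi: "integrable lebesgue g"
    by (rule integrable_continuous_compact_support[OF g(1) compact_cball[of 0 "R + 1"]]) (simp add: g(2))
  let ?B = "cball (0 :: real^'n) (R + 2)"
  define v where "v = measure lborel ?B + 1"
  have v: "v > 0" by (simp add: v_def add_nonneg_pos)
  have "uniformly_continuous_on ?B g"
    by (rule compact_uniformly_continuous[OF continuous_on_subset[OF g(1) subset_UNIV] compact_cball])
  moreover have "e / (3 * v) > 0" using assms(3) v by simp
  ultimately obtain \<delta> where \<delta>: "\<delta> > 0" "\<And>x y. x \<in> ?B \<Longrightarrow> y \<in> ?B \<Longrightarrow> dist y x < \<delta> \<Longrightarrow> dist (g y) (g x) < e / (3 * v)"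
    unfolding uniformly_continuous_on_def by metis
  \<comment> \<open>The bound vanishes outside \<open>?B\<close>: if one of two points at distance less than one lies outside \<open>?B\<close>, then \<open>g\<close>
    vanishes at both.\<close>
  have close: "\<bar>g y - g x\<bar> \<le> e / (3 * v) * indicator ?B x" if xy: "norm (x - y) < min 1 \<delta>" for x y
  proof (cases "norm x \<le> R + 2 \<and> norm y \<le> R + 2")
    case True
    then show ?thesis using \<delta>(2)[of x y] xy by (simp add: dist_norm norm_minus_commute)
  next
    case False
    have "norm x \<le> norm (x - y) + norm y" "norm y \<le> norm (x - y) + norm x"
      using norm_triangle_ineq[of "x - y" y] norm_triangle_ineq[of "y - x" x] by (auto simp: norm_minus_commute)
    then have "norm x \<ge> R + 1" "norm y \<ge> R + 1" using False xy by auto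
    then show ?thesis using g(2) assms(3) v by simp
  qed
  show ?thesis
  proof (intro exI[of _ "min 1 \<delta>"] conjI allI impI)
    show "min 1 \<delta> > 0" using \<delta> by simp
    fix \<epsilon> :: real assume e: "0 < \<epsilon>" "\<epsilon> < min 1 \<delta>"
    let ?\<rho> = "mollifier \<epsilon> :: real^'n \<Rightarrow> real"
    have \<rho>: "?\<rho> \<in> test_functions UNIV" by (rule mollifier_test[OF e(1)])
    have cm: "convolution k ?\<rho> \<in> borel_measurable lebesgue" if "integrable lebesgue k" for k
      by (rule borel_measurable_lebesgue_continuous[OF convolution_continuous[OF that \<rho>]])
    have gpt: "\<bar>convolution g ?\<rho> x - g x\<bar> \<le> e / (3 * v) * indicator ?B x" for x
    proof -
      have i1: "integrable lebesgue (\<lambda>y. ?\<rho> (x - y))" by (rule test_functions_integrable[OF test_functions_reflect[OF \<rho>]])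
      have "convolution g ?\<rho> x - g x = (LINT y|lebesgue. g y * ?\<rho> (x - y)) - (LINT y|lebesgue. g x * ?\<rho> (x - y))"
        using integral_mollifier_reflect[OF e(1), of x] by (simp add: convolution_def)
      also have "\<dots> = (LINT y|lebesgue. g y * ?\<rho> (x - y) - g x * ?\<rho> (x - y))"
        by (rule Bochner_Integration.integral_diff[symmetric]) (use i1 convolution_integrable[OF gi \<rho>] in auto)
      also have "\<bar>\<dots>\<bar> \<le> (LINT y|lebesgue. \<bar>g y * ?\<rho> (x - y) - g x * ?\<rho> (x - y)\<bar>)" by (rule integral_abs_bound)
      also have "\<dots> \<le> (LINT y|lebesgue. (e / (3 * v) * indicator ?B x) * ?\<rho> (x - y))"
      proof (rule Bochner_Integration.integral_mono)
        show "integrable lebesgue (\<lambda>y. \<bar>g y * ?\<rho> (x - y) - g x * ?\<rho> (x - y)\<bar>)"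
          using i1 convolution_integrable[OF gi \<rho>] by (intro integrable_abs Bochner_Integration.integrable_diff) auto
        show "integrable lebesgue (\<lambda>y. (e / (3 * v) * indicator ?B x) * ?\<rho> (x - y))" using i1 by simp
        fix y
        show "\<bar>g y * ?\<rho> (x - y) - g x * ?\<rho> (x - y)\<bar> \<le> (e / (3 * v) * indicator ?B x) * ?\<rho> (x - y)"
        proof (cases "norm (x - y) < \<epsilon>")
          case True
          then have "\<bar>g y - g x\<bar> * ?\<rho> (x - y) \<le> (e / (3 * v) * indicator ?B x) * ?\<rho> (x - y)"
            using e by (intro mult_right_mono close) (auto simp: mollifier_nonneg)
          then show ?thesis by (simp add: abs_mult mollifier_nonneg flip: left_diff_distrib)
        qed (simp add: mollifier_zero[OF e(1)])
      qed
      finally show ?thesis using integral_mollifier_reflect[OF e(1), of x] by simp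
    qed
    have "(\<integral>\<^sup>+x. ennreal \<bar>convolution g ?\<rho> x - g x\<bar> \<partial>lebesgue) \<le> (\<integral>\<^sup>+x. ennreal (e / (3 * v)) * indicator ?B x \<partial>lebesgue)"
      using gpt by (intro nn_integral_mono) (simp flip: ennreal_indicator ennreal_mult'' add: ennreal_leI)
    also have "\<dots> = ennreal (e / (3 * v)) * emeasure lborel ?B" by (simp add: nn_integral_cmult_indicator)
    also have "\<dots> = ennreal (e / (3 * v) * measure lborel ?B)"
      using emeasure_bounded_finite[of ?B] assms(3) v
      by (subst emeasure_eq_ennreal_measure) (auto simp flip: ennreal_mult)
    also have "\<dots> \<le> ennreal (e / 3)"
    proof (rule ennreal_leI)
      have "e / (3 * v) * measure lborel ?B \<le> e / (3 * v) * v"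
        using assms(3) v by (intro mult_left_mono) (auto simp: v_def)
      then show "e / (3 * v) * measure lborel ?B \<le> e / 3" using v by simp
    qed
    finally have I2: "(\<integral>\<^sup>+x. ennreal \<bar>convolution g ?\<rho> x - g x\<bar> \<partial>lebesgue) \<le> ennreal (e / 3)" .
    have fg: "integrable lebesgue (\<lambda>x. f x - g x)" using f gi by auto
    have I1: "(\<integral>\<^sup>+x. ennreal \<bar>convolution f ?\<rho> x - convolution g ?\<rho> x\<bar> \<partial>lebesgue) \<le> ennreal (e / 3)"
      using convolution_mollifier_Lp[OF fg e(1), of 1] g(3)
      by (simp add: convolution_diff[OF f gi \<rho>] nn_integral_completion)
    have "(\<integral>\<^sup>+x. ennreal \<bar>convolution f ?\<rho> x - f x\<bar> \<partial>lebesgue)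
      \<le> (\<integral>\<^sup>+x. ennreal \<bar>convolution f ?\<rho> x - convolution g ?\<rho> x\<bar> + (ennreal \<bar>convolution g ?\<rho> x - g x\<bar>
           + ennreal \<bar>f x - g x\<bar>) \<partial>lebesgue)"
      by (intro nn_integral_mono) (simp flip: ennreal_plus add: ennreal_leI)
    also have "\<dots> = (\<integral>\<^sup>+x. ennreal \<bar>convolution f ?\<rho> x - convolution g ?\<rho> x\<bar> \<partial>lebesgue)
       + ((\<integral>\<^sup>+x. ennreal \<bar>convolution g ?\<rho> x - g x\<bar> \<partial>lebesgue) + (\<integral>\<^sup>+x. ennreal \<bar>f x - g x\<bar> \<partial>lebesgue))"
      using cm[OF f] cm[OF gi] gm borel_measurable_integrable[OF f]
      by (subst nn_integral_add, measurable, subst nn_integral_add, measurable)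
    also have "\<dots> \<le> ennreal (e / 3) + (ennreal (e / 3) + ennreal (e / 3))"
      by (intro add_mono I1 I2 g(3))
    also have "\<dots> = ennreal e" using assms(3) by (simp flip: ennreal_plus)
    finally show "(\<integral>\<^sup>+x. ennreal \<bar>convolution f ?\<rho> x - f x\<bar> \<partial>lborel) \<le> ennreal e"
      by (simp add: nn_integral_completion)
  qed
qed

section \<open>Weak derivatives and mollification\<close>

text \<open>Functions on an open set have arbitrary values elsewhere; cutting off at a compact subset turns a locally
  integrable one into an integrable function on the whole space.\<close>

definition zero_outside :: "'a set \<Rightarrow> ('a \<Rightarrow> real) \<Rightarrow> 'a \<Rightarrow> real" where
  "zero_outside K f x = indicator K x * f x"

lemma zero_outside_simps [simp]: "x \<in> K \<Longrightarrow> zero_outside K f x = f x" "x \<notin> K \<Longrightarrow> zero_outside K f x = 0"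
  by (simp_all add: zero_outside_def)

lemma integrable_zero_outside:
  "f absolutely_integrable_on K \<Longrightarrow> integrable lebesgue (zero_outside K f)"
  unfolding set_integrable_def by (simp add: zero_outside_def[abs_def])

lemma locally_integrable_zero_outside:
  "locally_integrable_on f \<Omega> \<Longrightarrow> compact K \<Longrightarrow> K \<subseteq> \<Omega> \<Longrightarrow> integrable lebesgue (zero_outside K f)"
  unfolding locally_integrable_on_def by (blast intro: integrable_zero_outside)

lemma regular_distribution_zero_outside:
  assumes "K \<subseteq> \<Omega>" "\<And>x. x \<notin> K \<Longrightarrow> \<phi> x = 0"
  shows "regular_distribution \<Omega> f \<phi> = (LINT x|lebesgue. zero_outside K f x * \<phi> x)"
  unfolding regular_distribution_def set_lebesgue_integral_def
proof (rule Bochner_Integration.integral_cong[OF refl])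
  fix x show "indicator \<Omega> x *\<^sub>R (f x * \<phi> x) = zero_outside K f x * \<phi> x"
    using assms by (cases "x \<in> K") auto
qed

lemma integrable_zero_outside_test:
  assumes "locally_integrable_on f \<Omega>" "compact K" "K \<subseteq> \<Omega>" "\<phi> \<in> test_functions \<Omega>'"
  shows "integrable lebesgue (\<lambda>x. zero_outside K f x * \<phi> x)"
proof -
  obtain L where "\<And>x. \<bar>\<phi> x\<bar> \<le> L" by (rule test_functions_bound[OF assms(4)]) blast
  then show ?thesis
    by (intro integrable_mult_bounded[OF locally_integrable_zero_outside[OF assms(1-3)]]
         borel_measurable_lebesgue_continuous test_functions_continuous[OF assms(4)])
qed

lemma reflect_zero_outside_ball:
  assumes "\<And>z. \<not> norm z < \<epsilon> \<Longrightarrow> \<psi> z = 0" "cball x \<epsilon> \<subseteq> K" "y \<notin> K"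
  shows "\<psi> (x - y) = (0::real)"
proof (rule assms(1))
  show "\<not> norm (x - y) < \<epsilon>" using assms(2,3) by (auto simp: dist_norm subset_iff)
qed

lemma test_functions_reflect_ball:
  fixes \<psi> :: "real^'n \<Rightarrow> real"
  assumes "\<psi> \<in> test_functions UNIV" "\<And>z. \<not> norm z < \<epsilon> \<Longrightarrow> \<psi> z = 0" "cball x \<epsilon> \<subseteq> \<Omega>"
  shows "(\<lambda>y. \<psi> (x - y)) \<in> test_functions \<Omega>"
  by (rule test_functionsI[of _ "cball x \<epsilon>"])
     (use assms test_functions_Ck[OF test_functions_reflect[OF assms(1)]] in \<open>auto simp: dist_norm\<close>)

lemma mi_deriv_zero_outside:
  assumes "closed K" "\<And>x. x \<notin> K \<Longrightarrow> f x = 0" "x \<notin> K"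
  shows "mi_deriv \<nu> f x = 0"
proof -
  have "\<forall>x. x \<notin> K \<longrightarrow> foldr partial_deriv is f x = 0" for "is"
    by (induction "is") (auto simp: assms(2) intro: partial_deriv_zero_outside[OF assms(1)])
  then show ?thesis using assms(3) by (simp add: mi_deriv_eq_foldr)
qed

text \<open>Away from the boundary of \<open>K\<close>, mollification commutes with weak differentiation: the derivative
  of the convolution falls on the mollifier, which is an admissible test function.\<close>

lemma mi_deriv_convolution_weak:
  fixes v g :: "real^'n \<Rightarrow> real"
  assumes "locally_integrable_on v \<Omega>" "g \<in> weak_derivs \<Omega> \<mu> v" "compact K" "K \<subseteq> \<Omega>" "\<epsilon> > 0" "cball x \<epsilon> \<subseteq> K"
  shows "mi_deriv \<mu> (convolution (zero_outside K v) (mollifier \<epsilon>)) x = convolution (zero_outside K g) (mollifier \<epsilon>) x"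
proof -
  let ?\<rho> = "mollifier \<epsilon> :: real^'n \<Rightarrow> real" and ?s = "(-1::real) ^ mi_order \<mu>"
  have \<rho>: "?\<rho> \<in> test_functions UNIV" by (rule mollifier_test[OF assms(5)])
  have t: "(\<lambda>y. ?\<rho> (x - y)) \<in> test_functions \<Omega>"
    by (rule test_functions_reflect_ball[OF \<rho>]) (use mollifier_zero[OF assms(5)] assms in auto)
  have vi: "integrable lebesgue (zero_outside K v)" by (rule locally_integrable_zero_outside[OF assms(1,3,4)])
  have z: "mollifier \<epsilon> (x - y) = 0" if "y \<notin> K" for y
    by (rule reflect_zero_outside_ball[OF mollifier_zero[OF assms(5)] assms(6) that])
  have zd: "mi_deriv \<mu> (\<lambda>y. ?\<rho> (x - y)) y = 0" if "y \<notin> K" for y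
    using z by (rule mi_deriv_zero_outside[OF compact_imp_closed[OF assms(3)] _ that])
  have "mi_deriv \<mu> (convolution (zero_outside K v) ?\<rho>) x = convolution (zero_outside K v) (mi_deriv \<mu> ?\<rho>) x"
    by (simp add: mi_deriv_convolution[OF vi \<rho>])
  also have "\<dots> = (LINT y|lebesgue. ?s * (zero_outside K v y * mi_deriv \<mu> (\<lambda>y. ?\<rho> (x - y)) y))"
    unfolding convolution_def mi_deriv_reflect[OF \<rho>] by (simp add: mult_ac flip: power_mult_distrib)
  also have "\<dots> = ?s * regular_distribution \<Omega> v (mi_deriv \<mu> (\<lambda>y. ?\<rho> (x - y)))"
    by (simp add: regular_distribution_zero_outside[OF assms(4) zd])
  also have "\<dots> = regular_distribution \<Omega> g (\<lambda>y. ?\<rho> (x - y))"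
    using assms(2) t by (simp add: weak_derivs_def)
  also have "\<dots> = convolution (zero_outside K g) ?\<rho> x"
    unfolding convolution_def by (rule regular_distribution_zero_outside[OF assms(4) z])
  finally show ?thesis .
qed

lemma zero_outside_bounded_support:
  fixes f :: "'a::euclidean_space \<Rightarrow> real"
  assumes "compact K" obtains R where "\<And>x. norm x \<ge> R \<Longrightarrow> zero_outside K f x = 0"
proof -
  obtain B where "\<And>x. x \<in> K \<Longrightarrow> norm x \<le> B" using compact_imp_bounded[OF assms] by (auto simp: bounded_iff)
  then have "zero_outside K f x = 0" if "norm x \<ge> B + 1" for x using that by (cases "x \<in> K") force+
  then show ?thesis by (rule that)
qed

text \<open>The fundamental lemma of the calculus of variations: the mollifications of \<open>g\<close> are values of the distribution \<open>g\<close> at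
  translated mollifiers, so they vanish near a compact subset, and they converge to \<open>g\<close> in \<open>L\<^sup>1\<close>.\<close>

lemma AE_zero_if_distribution_zero:
  fixes g :: "real^'n \<Rightarrow> real"
  assumes "open \<Omega>" "locally_integrable_on g \<Omega>" "\<And>\<phi>. \<phi> \<in> test_functions \<Omega> \<Longrightarrow> regular_distribution \<Omega> g \<phi> = 0"
  shows "AE x in lebesgue. x \<in> \<Omega> \<longrightarrow> g x = 0"
proof -
  have K: "AE x in lebesgue. x \<in> K \<longrightarrow> g x = 0" if cK0: "compact K" and KS: "K \<subseteq> \<Omega>" for K
  proof -
    obtain \<delta> where \<delta>: "\<delta> > 0" "(\<Union>x\<in>K. cball x \<delta>) \<subseteq> \<Omega>"
      using compact_open_thickening[OF cK0 assms(1) KS] by metis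
    let ?K = "\<Union>x\<in>K. cball x \<delta>"
    have cK: "compact ?K" by (rule compact_thickening[OF cK0])
    let ?f = "zero_outside ?K g"
    have fi: "integrable lebesgue ?f" by (rule locally_integrable_zero_outside[OF assms(2) cK \<delta>(2)])
    obtain R where R: "\<And>x. norm x \<ge> R \<Longrightarrow> ?f x = 0" by (rule zero_outside_bounded_support[OF cK]) blast
    have Ks: "K \<in> sets lebesgue" using cK0 by (simp add: compact_imp_closed)
    have "(\<integral>\<^sup>+x. ennreal \<bar>?f x\<bar> * indicator K x \<partial>lborel) \<le> 0 + ennreal e" if "e > 0" for e
    proof -
      obtain d where d: "d > 0" "\<And>\<epsilon>. 0 < \<epsilon> \<Longrightarrow> \<epsilon> < d \<Longrightarrow> (\<integral>\<^sup>+x. ennreal \<bar>convolution ?f (mollifier \<epsilon>) x - ?f x\<bar> \<partial>lborel) \<le> ennreal e"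
        using mollifier_tendsto_L1[OF fi R \<open>e > 0\<close>] by blast
      define \<epsilon> where "\<epsilon> = min \<delta> d / 2"
      have e: "\<epsilon> > 0" "\<epsilon> < d" "\<epsilon> \<le> \<delta>" using d(1) \<delta>(1) by (auto simp: \<epsilon>_def)
      have "convolution ?f (mollifier \<epsilon>) x = 0" if "x \<in> K" for x
      proof -
        have sub: "cball x \<epsilon> \<subseteq> ?K" using that e by force
        have "convolution ?f (mollifier \<epsilon>) x = regular_distribution \<Omega> g (\<lambda>y. mollifier \<epsilon> (x - y))"
          unfolding convolution_def
          by (rule regular_distribution_zero_outside[OF \<delta>(2), symmetric])
             (rule reflect_zero_outside_ball[OF mollifier_zero[OF e(1)] sub])
        also have "\<dots> = 0"
          by (rule assms(3), rule test_functions_reflect_ball[OF mollifier_test[OF e(1)] mollifier_zero[OF e(1)]])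
             (use sub \<delta>(2) in auto)
        finally show ?thesis .
      qed
      then have "(\<integral>\<^sup>+x. ennreal \<bar>?f x\<bar> * indicator K x \<partial>lborel) \<le> (\<integral>\<^sup>+x. ennreal \<bar>convolution ?f (mollifier \<epsilon>) x - ?f x\<bar> \<partial>lborel)"
        by (intro nn_integral_mono) (simp split: split_indicator)
      also have "\<dots> \<le> ennreal e" by (rule d(2)[OF e(1,2)])
      finally show ?thesis by simp
    qed
    then have "(\<integral>\<^sup>+x. ennreal \<bar>?f x\<bar> * indicator K x \<partial>lborel) \<le> 0" by (rule ennreal_le_epsilon) 
    then have "(\<integral>\<^sup>+x. ennreal \<bar>?f x\<bar> * indicator K x \<partial>lebesgue) = 0" by (simp add: nn_integral_completion)
    then have "AE x in lebesgue. ennreal \<bar>?f x\<bar> * indicator K x = 0"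
      using fi Ks by (subst (asm) nn_integral_0_iff_AE) auto
    then show ?thesis
    proof eventually_elim
      case (elim x)
      show ?case
      proof
        assume x: "x \<in> K"
        then have "x \<in> ?K" using \<delta>(1) by force
        then show "g x = 0" using elim x by simp
      qed
    qed
  qed
  obtain C where C: "\<And>n::nat. compact (C n)" "\<And>n. C n \<subseteq> \<Omega>" "(\<Union>n. C n) = \<Omega>"
    using open_Union_compact_subsets[OF assms(1)] by metis
  have "AE x in lebesgue. \<forall>n. x \<in> C n \<longrightarrow> g x = 0"
    unfolding AE_all_countable using K[OF C(1,2)] by blast
  then show ?thesis
  proof eventually_elim
    case (elim x)
    then show ?case using C(3) by blast
  qed
qed

lemma locally_integrable_diff:
  "locally_integrable_on f \<Omega> \<Longrightarrow> locally_integrable_on g \<Omega> \<Longrightarrow> locally_integrable_on (\<lambda>x. f x - g x) \<Omega>"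
  unfolding locally_integrable_on_def by (auto intro: set_integral_diff)

lemma regular_distribution_diff:
  assumes "locally_integrable_on f \<Omega>" "locally_integrable_on g \<Omega>" "\<phi> \<in> test_functions \<Omega>"
  shows "regular_distribution \<Omega> (\<lambda>x. f x - g x) \<phi> = regular_distribution \<Omega> f \<phi> - regular_distribution \<Omega> g \<phi>"
proof -
  obtain K where K: "compact K" "K \<subseteq> \<Omega>" "\<And>x. x \<notin> K \<Longrightarrow> \<phi> x = 0" by (rule test_functionsE[OF assms(3)]) blast
  have r: "regular_distribution \<Omega> h \<phi> = (LINT x|lebesgue. zero_outside K h x * \<phi> x)" for h
    by (rule regular_distribution_zero_outside[OF K(2,3)])
  have "(\<lambda>x. zero_outside K (\<lambda>x. f x - g x) x * \<phi> x) = (\<lambda>x. zero_outside K f x * \<phi> x - zero_outside K g x * \<phi> x)"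
    by (rule ext) (simp add: zero_outside_def algebra_simps)
  then show ?thesis unfolding r
    using Bochner_Integration.integral_diff[OF integrable_zero_outside_test[OF assms(1) K(1,2) assms(3)]
        integrable_zero_outside_test[OF assms(2) K(1,2) assms(3)]] by simp
qed

lemma weak_derivs_unique:
  assumes "open \<Omega>" "g \<in> weak_derivs \<Omega> \<nu> f" "h \<in> weak_derivs \<Omega> \<nu> f"
  shows "AE x in lebesgue. x \<in> \<Omega> \<longrightarrow> g x = h x"
proof -
  have "AE x in lebesgue. x \<in> \<Omega> \<longrightarrow> g x - h x = 0"
  proof (rule AE_zero_if_distribution_zero[OF assms(1)])
    show "locally_integrable_on (\<lambda>x. g x - h x) \<Omega>"
      using assms by (intro locally_integrable_diff) (auto simp: weak_derivs_def)
    fix \<phi> assume "\<phi> \<in> test_functions \<Omega>"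
    then show "regular_distribution \<Omega> (\<lambda>x. g x - h x) \<phi> = 0"
      using assms by (subst regular_distribution_diff) (auto simp: weak_derivs_def)
  qed
  then show ?thesis by eventually_elim simp
qed

text \<open>Mollify the indicator function of a thickening of \<open>K\<close>, the radii being \<open>\<delta>/3\<close> for the mollifier and \<open>2\<delta>/3\<close> for the
  thickening.\<close>

lemma smooth_cutoff:
  fixes K :: "(real^'n) set"
  assumes "compact K" "open U" "K \<subseteq> U"
  obtains \<eta> W where "\<eta> \<in> test_functions U" "open W" "K \<subseteq> W" "W \<subseteq> U" "\<And>x. x \<in> W \<Longrightarrow> \<eta> x = 1"
proof -
  obtain \<delta> where \<delta>: "\<delta> > 0" "(\<Union>x\<in>K. cball x \<delta>) \<subseteq> U"
    using compact_open_thickening[OF assms] by metis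
  define r where "r = \<delta> / 3"
  have r: "r > 0" using \<delta> by (simp add: r_def)
  let ?K = "\<Union>x\<in>K. cball x (2 * r)" and ?\<rho> = "mollifier r :: real^'n \<Rightarrow> real"
  have cK: "compact ?K" by (rule compact_thickening[OF assms(1)])
  then have "?K \<in> lmeasurable" by (rule lmeasurable_compact)
  then have fi: "integrable lebesgue (indicat_real ?K)" by (simp add: lmeasurable_iff_integrable)
  define \<eta> where "\<eta> = convolution (indicat_real ?K) ?\<rho>"
  show ?thesis
  proof (rule that[of \<eta> "\<Union>x\<in>K. ball x r"])
    show "\<eta> \<in> test_functions U"
    proof (rule test_functionsI[OF _ compact_thickening[OF assms(1), of \<delta>] \<delta>(2)])
      show "Ck_on k UNIV \<eta>" for k unfolding \<eta>_def by (rule Ck_on_convolution[OF fi mollifier_test[OF r]])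
      fix x assume x: "x \<notin> (\<Union>x\<in>K. cball x \<delta>)"
      have "indicat_real ?K y * ?\<rho> (x - y) = 0" for y
      proof (cases "y \<in> ?K")
        case True
        then obtain k where k: "k \<in> K" "dist k y \<le> 2 * r" by auto
        have "dist k x > \<delta>" using x k by auto
        then have "\<not> norm (x - y) < r" using k(2) dist_triangle[of k x y] by (simp add: r_def dist_norm norm_minus_commute)
        then show ?thesis using mollifier_zero[OF r, of "x - y"] by simp
      qed simp
      then have "(\<lambda>y. indicat_real ?K y * ?\<rho> (x - y)) = (\<lambda>y. 0)" by (rule ext)
      then show "\<eta> x = 0" unfolding \<eta>_def convolution_def by simp
    qed
    fix x assume "x \<in> (\<Union>x\<in>K. ball x r)"
    then obtain k where k: "k \<in> K" "dist k x < r" by auto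
    have "indicat_real ?K y * ?\<rho> (x - y) = ?\<rho> (x - y)" for y
    proof (cases "y \<in> ?K")
      case False
      then have "dist k y > 2 * r" using k by auto
      then have "\<not> norm (x - y) < r" using k(2) dist_triangle[of k y x] by (simp add: dist_norm)
      then show ?thesis using mollifier_zero[OF r, of "x - y"] by simp
    qed simp
    then have "(\<lambda>y. indicat_real ?K y * ?\<rho> (x - y)) = (\<lambda>y. ?\<rho> (x - y))" by (rule ext)
    then show "\<eta> x = 1" unfolding \<eta>_def convolution_def using integral_mollifier_reflect[OF r] by simp
  qed (use r \<delta> in \<open>force simp: r_def\<close>)+
qed

text \<open>The integral of \<open>w(y + te\<^sub>i)\<close> over \<open>y\<close> does not depend on \<open>t\<close>, and it can be differentiated under the integral sign
  because \<open>w\<close> is Lipschitz with compact support.\<close>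

lemma integral_partial_deriv_zero:
  fixes w :: "real^'n \<Rightarrow> real"
  assumes "Ck_on 1 UNIV w" "compact K" "\<And>x. x \<notin> K \<Longrightarrow> w x = 0"
  shows "(LINT x|lebesgue. partial_deriv i w x) = 0"
proof -
  obtain L where L: "L > 0" "\<And>x y. \<bar>w x - w y\<bar> \<le> L * min 1 (norm (x - y))"
    using C1_compact_support_bound[OF assms] by metis
  let ?K = "\<Union>x\<in>K. cball x 1"
  define X where "X n = 1 / real (Suc n)" for n
  have X: "X n > 0" "X n \<le> 1" for n by (auto simp: X_def)
  have Xne: "\<forall>n. X n \<in> UNIV - {0}" using X(1) by (auto simp: X_def)
  have X0: "X \<longlonglongrightarrow> 0" unfolding X_def
    using LIMSEQ_inverse_real_of_nat by (simp add: inverse_eq_divide)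
  let ?q = "\<lambda>n y. (w (y + X n *\<^sub>R axis i 1) - w y) / X n"
  have wc: "continuous_on UNIV w" by (rule Ck_on_imp_continuous[OF assms(1)])
  have wi: "integrable lebesgue w" by (rule integrable_continuous_compact_support[OF wc assms(2,3)])
  have sc: "continuous_on UNIV (\<lambda>y. w (y + c))" for c
    by (rule continuous_on_compose2[OF wc]) (auto intro!: continuous_intros)
  have wb: "w \<in> borel_measurable borel" by (rule borel_measurable_continuous_onI[OF wc])
  have si: "integrable lebesgue (\<lambda>y. w (y + c))" for c
  proof (rule integrable_continuous_compact_support[OF sc])
    show "compact ((\<lambda>x. x - c) ` K)" by (intro compact_continuous_image continuous_intros assms)
    show "w (x + c) = 0" if "x \<notin> (\<lambda>x. x - c) ` K" for x using that assms(3)[of "x + c"] by force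
  qed
  have shift: "(LINT y|lebesgue. w (y + c)) = (LINT y|lebesgue. w y)" for c
  proof -
    have "(LINT y|lborel. w y) = (LINT y|distr lborel borel ((+) c). w y)" by (simp only: lborel_distr_plus)
    also have "\<dots> = (LINT y|lborel. w (c + y))" using wb by (intro integral_distr) auto
    finally show ?thesis using wb borel_measurable_continuous_onI[OF sc, of c]
      by (simp add: integral_completion add.commute)
  qed
  have "(\<lambda>n. LINT y|lebesgue. ?q n y) \<longlonglongrightarrow> (LINT y|lebesgue. partial_deriv i w y)"
  proof (rule integral_dominated_convergence[where w = "\<lambda>y. L * indicator ?K y"])
    show "partial_deriv i w \<in> borel_measurable lebesgue"
      using assms(1) by (intro borel_measurable_lebesgue_continuous) simp
    show "?q n \<in> borel_measurable lebesgue" for n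
      by (intro borel_measurable_divide borel_measurable_diff borel_measurable_const
          borel_measurable_lebesgue_continuous[OF sc] borel_measurable_lebesgue_continuous[OF wc])
    have "?K \<in> lmeasurable" by (intro lmeasurable_compact compact_thickening assms)
    then show "integrable lebesgue (\<lambda>y. L * indicat_real ?K y)" by (simp add: lmeasurable_iff_integrable)
    show "AE y in lebesgue. (\<lambda>n. ?q n y) \<longlonglongrightarrow> partial_deriv i w y"
    proof (rule AE_I2)
      fix y
      have "((\<lambda>h. (w (y + h *\<^sub>R axis i 1) - w y) / h) \<longlongrightarrow> partial_deriv i w y) (at 0)"
        using Ck_on_has_partial[OF assms(1), of y i] unfolding has_partial_def DERIV_def by simp
      then show "(\<lambda>n. ?q n y) \<longlonglongrightarrow> partial_deriv i w y"
        using Xne X0 unfolding tendsto_at_iff_sequentially comp_def by blast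
    qed
    show "AE y in lebesgue. norm (?q n y) \<le> L * indicator ?K y" for n
    proof (rule AE_I2)
      fix y
      show "norm (?q n y) \<le> L * indicator ?K y"
      proof (cases "y \<in> ?K")
        case True
        have "\<bar>w (y + X n *\<^sub>R axis i 1) - w y\<bar> \<le> L * X n"
          using L(2)[of "y + X n *\<^sub>R axis i 1" y] X[of n] by simp
        then show ?thesis using True X(1)[of n] by (simp add: divide_le_eq)
      next
        case False
        then have "y \<notin> K" "y + X n *\<^sub>R axis i 1 \<notin> K" using X[of n] by (auto simp: dist_norm)
        then show ?thesis using assms(3) False by simp
      qed
    qed
  qed
  moreover have "(\<lambda>n. LINT y|lebesgue. ?q n y) = (\<lambda>n. 0)"
    using Bochner_Integration.integral_diff[OF si wi] shift by simp
  ultimately have "(\<lambda>n. 0) \<longlonglongrightarrow> (LINT y|lebesgue. partial_deriv i w y)" by (simp only:)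
  then show ?thesis by (simp add: LIMSEQ_const_iff)
qed

lemma integration_by_parts:
  fixes w \<phi> :: "real^'n \<Rightarrow> real"
  assumes "Ck_on (mi_order \<nu>) UNIV w" "\<phi> \<in> test_functions UNIV"
  shows "(LINT x|lebesgue. w x * mi_deriv \<nu> \<phi> x) = (-1) ^ mi_order \<nu> * (LINT x|lebesgue. mi_deriv \<nu> w x * \<phi> x)"
  using assms
proof (induction \<nu> arbitrary: \<phi> rule: mi_induct)
  case zero then show ?case by simp
next
  case (upd \<nu> i)
  have C: "Ck_on (Suc (mi_order \<nu>)) UNIV w" using upd.prems(1) unfolding mi_order_upd .
  define W where "W = mi_deriv \<nu> w"
  have W: "Ck_on 1 UNIV W" unfolding W_def by (rule Ck_on_mi_deriv) (use C in simp)
  have d: "mi_deriv (\<nu>(i := Suc (\<nu> i))) w x = partial_deriv i W x" for x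
    unfolding W_def by (rule mi_deriv_upd[OF open_UNIV C UNIV_I])
  have \<phi>': "mi_deriv (\<nu>(i := Suc (\<nu> i))) \<phi> x = mi_deriv \<nu> (partial_deriv i \<phi>) x" for x
    by (rule mi_deriv_upd'[OF open_UNIV test_functions_Ck[OF upd.prems(2)] UNIV_I])
  obtain K where K: "compact K" "\<And>x. x \<notin> K \<Longrightarrow> \<phi> x = 0" by (rule test_functionsE[OF upd.prems(2)]) blast
  have z: "partial_deriv i \<phi> x = 0" if "x \<notin> K" for x
    by (rule partial_deriv_zero_outside[OF compact_imp_closed[OF K(1)] K(2) that])
  have cont: "continuous_on UNIV W" "continuous_on UNIV (partial_deriv i W)" "continuous_on UNIV \<phi>"
     "continuous_on UNIV (partial_deriv i \<phi>)"
    using W Ck_on_imp_continuous[OF W] test_functions_continuous[OF upd.prems(2)]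
      test_functions_continuous[OF test_functions_partial[OF upd.prems(2)]] by auto
  have i1: "integrable lebesgue (\<lambda>x. partial_deriv i W x * \<phi> x)"
    by (rule integrable_continuous_compact_support[OF _ K(1)]) (auto intro!: continuous_intros cont simp: K(2))
  have i2: "integrable lebesgue (\<lambda>x. W x * partial_deriv i \<phi> x)"
    by (rule integrable_continuous_compact_support[OF _ K(1)]) (auto intro!: continuous_intros cont simp: z)
  have "0 = (LINT x|lebesgue. partial_deriv i (\<lambda>x. W x * \<phi> x) x)"
    by (rule integral_partial_deriv_zero[OF Ck_on_mult[OF open_UNIV W test_functions_Ck[OF upd.prems(2)]] K(1), symmetric])
       (simp add: K(2))
  also have "\<dots> = (LINT x|lebesgue. partial_deriv i W x * \<phi> x + W x * partial_deriv i \<phi> x)"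
  proof (intro Bochner_Integration.integral_cong refl has_partial_imp_eq has_partial_mult)
    fix x
    show "has_partial i W (partial_deriv i W x) x" by (rule Ck_on_has_partial[OF W]) auto
    show "has_partial i \<phi> (partial_deriv i \<phi> x) x"
      by (rule Ck_on_has_partial[of 1 UNIV, OF test_functions_Ck[OF upd.prems(2)]]) auto
  qed
  also have "\<dots> = (LINT x|lebesgue. partial_deriv i W x * \<phi> x) + (LINT x|lebesgue. W x * partial_deriv i \<phi> x)"
    by (rule Bochner_Integration.integral_add[OF i1 i2])
  finally have parts: "(LINT x|lebesgue. W x * partial_deriv i \<phi> x) = - (LINT x|lebesgue. partial_deriv i W x * \<phi> x)"
    by simp
  have "(LINT x|lebesgue. w x * mi_deriv \<nu> (partial_deriv i \<phi>) x)
      = (-1) ^ mi_order \<nu> * (LINT x|lebesgue. W x * partial_deriv i \<phi> x)"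
    unfolding W_def by (rule upd.IH[OF Ck_on_SucD[OF C] test_functions_partial[OF upd.prems(2)]])
  then show ?case unfolding mi_order_upd d \<phi>' using parts by simp
qed

section \<open>Change of variables for maps with Lipschitz inverse\<close>

text \<open>A map \<open>T\<close> that does not contract distances by more than a factor \<open>L\<close> pulls a cube back into a set
  of at most \<open>2DL\<close> times its size, \<open>D\<close> being the dimension; covering by dyadic cubes extends this to
  measurable sets.\<close>

lemma lipschitz_inverse_outer_measure:
  fixes T :: "'a::euclidean_space \<Rightarrow> 'a"
  assumes K: "compact K" "continuous_on K T" and "L > 0"
    and L: "\<And>x y. x \<in> K \<Longrightarrow> y \<in> K \<Longrightarrow> norm (x - y) \<le> L * norm (T x - T y)"
    and A: "A \<in> sets lebesgue" and "e > 0"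
  obtains W where "W \<in> lmeasurable" "{x\<in>K. T x \<in> A} \<subseteq> W"
    "emeasure lebesgue W \<le> ennreal ((2 * L * DIM('a)) ^ DIM('a)) * (emeasure lebesgue A + ennreal e)"
proof -
  let ?n = "real DIM('a)" and ?C = "(2 * L * DIM('a)) ^ DIM('a)"
  let ?A = "A \<inter> T ` K"
  have cTK: "compact (T ` K)" by (rule compact_continuous_image[OF K(2,1)])
  have A': "?A \<in> lmeasurable"
    using A lmeasurable_compact[OF cTK] by (metis fmeasurable_Int_fmeasurable inf_commute)
  obtain G where G: "open G" "?A \<subseteq> G" "G - ?A \<in> lmeasurable" "emeasure lebesgue (G - ?A) < ennreal e"
    using sets_lebesgue_outer_open[OF fmeasurableD[OF A'] \<open>e > 0\<close>] by metis
  have Gm: "G \<in> lmeasurable" using fmeasurable_Diff_D[OF G(3) A' G(2)] .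
  have Gle: "emeasure lebesgue G \<le> emeasure lebesgue A + ennreal e"
  proof -
    have "emeasure lebesgue G \<le> emeasure lebesgue ?A + emeasure lebesgue (G - ?A)"
    proof -
      have "G = ?A \<union> (G - ?A)" using G(2) by auto
      then show ?thesis using emeasure_subadditive[of ?A lebesgue "G - ?A"] A' G(3) by (metis fmeasurableD)
    qed
    also have "\<dots> \<le> emeasure lebesgue A + ennreal e"
      using A G(4) by (intro add_mono emeasure_mono) auto
    finally show ?thesis .
  qed
  obtain B where B: "\<And>x. x \<in> T ` K \<Longrightarrow> norm x \<le> B" using compact_imp_bounded[OF cTK] by (auto simp: bounded_iff)
  define b where "b = \<bar>B\<bar> + 1"
  have csub: "?A \<subseteq> cbox (- b *\<^sub>R One) (b *\<^sub>R One)"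
  proof
    fix x assume "x \<in> ?A"
    then have "norm x \<le> b" using B unfolding b_def by fastforce
    then have "\<bar>x \<bullet> i\<bar> \<le> b" if "i \<in> Basis" for i using Basis_le_norm[OF that, of x] by simp
    then show "x \<in> cbox (- b *\<^sub>R One) (b *\<^sub>R One)" by (auto simp: mem_box abs_le_iff) (metis minus_le_iff)
  qed
  have bne: "box (- b *\<^sub>R One) (b *\<^sub>R One :: 'a) \<noteq> {}" by (simp add: box_eq_empty b_def)
  have "\<exists>r>0. x \<in> ?A \<longrightarrow> ball x r \<subseteq> G" for x
    using G(1,2) by (cases "x \<in> ?A") (auto simp: open_contains_ball intro: exI[of _ 1])
  then obtain r where r: "\<And>x. r x > 0" "\<And>x. x \<in> ?A \<Longrightarrow> ball x (r x) \<subseteq> G" by metis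
  have gauge: "gauge (\<lambda>x. ball x (r x))" using r(1) by (simp add: gauge_def)
  \<comment> \<open>The covering lemma yields nonoverlapping dyadic cubes inside \<open>G\<close>, so their total volume is at most that of \<open>G\<close>.\<close>
  obtain \<D> where "countable \<D>"
     and cbox: "\<And>D. D \<in> \<D> \<Longrightarrow> interior D \<noteq> {} \<and> (\<exists>c d. D = cbox c d)"
     and pw: "pairwise (\<lambda>A B. interior A \<inter> interior B = {}) \<D>"
     and Dsub: "\<And>D. D \<in> \<D> \<Longrightarrow> \<exists>x \<in> ?A \<inter> D. D \<subseteq> ball x (r x)"
     and exN: "\<And>u v. cbox u v \<in> \<D> \<Longrightarrow> \<exists>m. \<forall>i \<in> Basis. v \<bullet> i - u \<bullet> i = (b *\<^sub>R One \<bullet> i - (- b *\<^sub>R One) \<bullet> i) / 2 ^ m"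
     and cover: "?A \<subseteq> \<Union>\<D>"
    by (rule covering_lemma[OF csub bne gauge]) blast
  have DG: "D \<subseteq> G" if "D \<in> \<D>" for D using Dsub[OF that] r(2) by blast
  have "\<exists>u h. D = cbox u (u + h *\<^sub>R One) \<and> h > 0" if D: "D \<in> \<D>" for D
  proof -
    obtain u v where uv: "D = cbox u v" using cbox[OF D] by blast
    obtain m where m: "\<And>i. i \<in> Basis \<Longrightarrow> v \<bullet> i - u \<bullet> i = (b *\<^sub>R One \<bullet> i - (- b *\<^sub>R One) \<bullet> i) / 2 ^ m"
      using exN D unfolding uv by blast
    have "v = u + (2 * b / 2 ^ m) *\<^sub>R One"
      by (rule euclidean_eqI) (use m in \<open>auto simp: inner_add_left algebra_simps\<close>)
    moreover have "2 * b / 2 ^ m > 0" by (simp add: b_def)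
    ultimately show ?thesis using uv by blast
  qed
  then obtain u h where uh: "\<And>D. D \<in> \<D> \<Longrightarrow> D = cbox (u D) (u D + h D *\<^sub>R One)" "\<And>D. D \<in> \<D> \<Longrightarrow> h D > 0" by metis
  have "\<exists>z. ({x\<in>K. T x \<in> D} \<noteq> {} \<longrightarrow> z \<in> {x\<in>K. T x \<in> D})" for D by blast
  then obtain z where z: "\<And>D. {x\<in>K. T x \<in> D} \<noteq> {} \<Longrightarrow> z D \<in> {x\<in>K. T x \<in> D}" by metis
  \<comment> \<open>Two points of the cube \<open>D\<close> differ by at most \<open>?n * h D\<close> in norm, so the preimage of \<open>D\<close> lies in the cube with centre
    \<open>z D\<close> and side length \<open>2 * L * ?n * h D\<close>.\<close>
  define W where "W D = cbox (z D - (L * ?n * h D) *\<^sub>R One) (z D + (L * ?n * h D) *\<^sub>R One)" for D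
  have inW: "x \<in> W D" if "D \<in> \<D>" "x \<in> K" "T x \<in> D" for x D
  proof -
    have zD: "z D \<in> K" "T (z D) \<in> D" using z[of D] that by auto
    have "norm (T x - T (z D)) \<le> (\<Sum>i\<in>Basis. \<bar>(T x - T (z D)) \<bullet> i\<bar>)" by (rule norm_le_l1)
    also have "\<dots> \<le> (\<Sum>i\<in>(Basis::'a set). h D)"
    proof (rule sum_mono)
      fix i :: 'a assume i: "i \<in> Basis"
      have "T x \<in> cbox (u D) (u D + h D *\<^sub>R One)" "T (z D) \<in> cbox (u D) (u D + h D *\<^sub>R One)"
        using uh(1)[OF that(1)] that(3) zD(2) by auto
      then have "u D \<bullet> i \<le> T x \<bullet> i" "T x \<bullet> i \<le> u D \<bullet> i + h D" "u D \<bullet> i \<le> T (z D) \<bullet> i" "T (z D) \<bullet> i \<le> u D \<bullet> i + h D"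
        using i by (auto simp: mem_box inner_add_left)
      then show "\<bar>(T x - T (z D)) \<bullet> i\<bar> \<le> h D" by (simp add: inner_diff_left abs_le_iff)
    qed
    finally have "norm (T x - T (z D)) \<le> ?n * h D" by simp
    then have "L * norm (T x - T (z D)) \<le> L * (?n * h D)" using \<open>L > 0\<close> by (intro mult_left_mono) auto
    with L[OF that(2) zD(1)] have "norm (x - z D) \<le> L * ?n * h D" by simp
    then have "\<bar>x \<bullet> i - z D \<bullet> i\<bar> \<le> L * ?n * h D" if "i \<in> Basis" for i
      using Basis_le_norm[OF that, of "x - z D"] by (simp add: inner_diff_left)
    then show ?thesis unfolding W_def
      by (auto simp: mem_box inner_diff_left inner_add_left abs_le_iff algebra_simps)
  qed
  have contW: "measure lebesgue (W D) = ?C * measure lborel D" if "D \<in> \<D>" for D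
  proof -
    have h: "h D > 0" by (rule uh(2)[OF that])
    have "measure lebesgue (W D) = (\<Prod>i\<in>(Basis::'a set). 2 * L * ?n * h D)"
      unfolding W_def using h \<open>L > 0\<close>
      by (simp add: content_cbox_cases inner_diff_left inner_add_left algebra_simps)
    also have "\<dots> = ?C * (\<Prod>i\<in>(Basis::'a set). h D)" by (simp add: power_mult_distrib)
    also have "(\<Prod>i\<in>(Basis::'a set). h D) = measure lborel D"
      using h by (subst uh(1)[OF that], subst content_cbox') (auto simp: inner_add_left box_eq_empty)
    finally show ?thesis .
  qed
  have fm: "W D \<in> lmeasurable" for D unfolding W_def by simp
  have bound: "measure lebesgue (\<Union>D\<in>\<D>'. W D) \<le> ?C * measure lebesgue G" if "\<D>' \<subseteq> \<D>" "finite \<D>'" for \<D>'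
  proof -
    have "measure lebesgue (\<Union>D\<in>\<D>'. W D) \<le> (\<Sum>D\<in>\<D>'. measure lebesgue (W D))"
      using that(2) fm by (intro measure_UNION_le) auto
    also have "\<dots> = ?C * (\<Sum>D\<in>\<D>'. measure lborel D)"
      using contW that(1) by (simp add: sum_distrib_left subset_iff)
    also have "(\<Sum>D\<in>\<D>'. measure lborel D) = measure lebesgue (\<Union>\<D>')"
    proof -
      have "\<And>K. K \<in> \<D>' \<Longrightarrow> \<exists>a b. K = cbox a b" "{} \<notin> \<D>'" using cbox that(1) by (blast, force)
      then have "\<D>' division_of \<Union>\<D>'"
        using pairwise_subset [OF pw \<open>\<D>' \<subseteq> \<D>\<close>] unfolding pairwise_def
        by (force simp: \<open>finite \<D>'\<close> division_of_def)
      then have "(\<Sum>D\<in>\<D>'. measure lebesgue D) = measure lebesgue (\<Union>\<D>')" by (rule content_division)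
      moreover have "(\<Sum>D\<in>\<D>'. measure lebesgue D) = (\<Sum>D\<in>\<D>'. measure lborel D)"
        using cbox that(1) by (force intro: sum.cong)
      ultimately show ?thesis by simp
    qed
    also have "measure lebesgue (\<Union>\<D>') \<le> measure lebesgue G"
    proof (rule measure_mono_fmeasurable)
      show "\<Union>\<D>' \<subseteq> G" using DG that(1) by blast
      show "\<Union>\<D>' \<in> sets lebesgue" using that cbox by (intro sets.finite_Union) force+
    qed (rule Gm)
    finally show ?thesis using \<open>L > 0\<close> by (simp add: mult_left_mono)
  qed
  have 1: "(\<Union>D\<in>\<D>. W D) \<in> lmeasurable" by (rule fmeasurable_UN_bound[OF \<open>countable \<D>\<close> fm bound])
  have 2: "measure lebesgue (\<Union>D\<in>\<D>. W D) \<le> ?C * measure lebesgue G" by (rule measure_UN_bound[OF \<open>countable \<D>\<close> fm bound])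
  show ?thesis
  proof (rule that[OF 1])
    show "{x\<in>K. T x \<in> A} \<subseteq> (\<Union>D\<in>\<D>. W D)" using inW cover by blast
    have "emeasure lebesgue (\<Union>D\<in>\<D>. W D) = ennreal (measure lebesgue (\<Union>D\<in>\<D>. W D))"
      by (rule emeasure_eq_measure2[OF 1])
    also have "\<dots> \<le> ennreal (?C * measure lebesgue G)" using 2 by (rule ennreal_leI)
    also have "\<dots> = ennreal ?C * emeasure lebesgue G"
      using \<open>L > 0\<close> by (simp add: ennreal_mult emeasure_eq_measure2[OF Gm])
    also have "\<dots> \<le> ennreal ?C * (emeasure lebesgue A + ennreal e)" by (intro mult_left_mono Gle) simp
    finally show "emeasure lebesgue (\<Union>D\<in>\<D>. W D) \<le> ennreal ?C * (emeasure lebesgue A + ennreal e)" .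
  qed
qed

text \<open>For measurability, a Lebesgue measurable set is split into a Borel set and a subset of a null set; the bound on outer
  measures shows that the preimage of the latter is a null set.\<close>

lemma lipschitz_inverse_preimage:
  fixes T :: "'a::euclidean_space \<Rightarrow> 'a"
  assumes K: "compact K" "continuous_on K T" and "L > 0"
    and L: "\<And>x y. x \<in> K \<Longrightarrow> y \<in> K \<Longrightarrow> norm (x - y) \<le> L * norm (T x - T y)"
    and A: "A \<in> sets lebesgue"
  shows "{x\<in>K. T x \<in> A} \<in> sets lebesgue"
    and "emeasure lebesgue {x\<in>K. T x \<in> A} \<le> ennreal ((2 * L * DIM('a)) ^ DIM('a)) * emeasure lebesgue A"
proof -
  let ?C = "(2 * L * DIM('a)) ^ DIM('a)"
  have C: "?C > 0" using \<open>L > 0\<close> by simp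
  have borel: "{x\<in>K. T x \<in> S} \<in> sets borel" if "S \<in> sets borel" for S
  proof -
    have "T \<in> borel_measurable (restrict_space borel K)" by (rule borel_measurable_continuous_on_restrict[OF K(2)])
    from measurable_sets[OF this that] have "T -` S \<inter> K \<in> sets (restrict_space borel K)" by (simp add: space_restrict_space)
    then have "T -` S \<inter> K \<in> sets borel" using K(1) by (subst (asm) sets_restrict_space_iff) (auto dest: compact_imp_closed)
    moreover have "T -` S \<inter> K = {x\<in>K. T x \<in> S}" by auto
    ultimately show ?thesis by simp
  qed
  show m: "{x\<in>K. T x \<in> A} \<in> sets lebesgue"
  proof -
    obtain S N N' where SN: "A = S \<union> N" "N \<subseteq> N'" "N' \<in> null_sets lborel" "S \<in> sets lborel"
      using A by (rule sets_completionE)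
    have N': "N' \<in> sets lebesgue" "emeasure lebesgue N' = 0" using SN(3) by (auto simp: null_sets_def)
    have "negligible {x\<in>K. T x \<in> N}"
      unfolding negligible_outer_le
    proof (intro allI impI)
      fix e :: real assume e: "e > 0"
      have eC: "e / ?C > 0" using e C by (rule divide_pos_pos)
      obtain W where W: "W \<in> lmeasurable" "{x\<in>K. T x \<in> N'} \<subseteq> W"
         "emeasure lebesgue W \<le> ennreal ?C * (emeasure lebesgue N' + ennreal (e / ?C))"
        by (rule lipschitz_inverse_outer_measure[OF K \<open>L > 0\<close> L N'(1) eC]) blast
      have "ennreal ?C * ennreal (e / ?C) = ennreal e" using C eC \<open>L > 0\<close> by (subst ennreal_mult[symmetric]) auto
      then have "emeasure lebesgue W \<le> ennreal e" using W(3) N'(2) by simp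
      then have "measure lebesgue W \<le> e" using e W(1) by (simp add: emeasure_eq_measure2)
      then show "\<exists>T'. {x \<in> K. T x \<in> N} \<subseteq> T' \<and> T' \<in> lmeasurable \<and> measure lebesgue T' \<le> e"
        using W SN(2) by blast
    qed
    then have "{x\<in>K. T x \<in> N} \<in> sets lebesgue" by (simp add: negligible_iff_null_sets null_sets_def)
    moreover have "{x\<in>K. T x \<in> S} \<in> sets lebesgue" using borel SN(4) by auto
    moreover have "{x\<in>K. T x \<in> A} = {x\<in>K. T x \<in> S} \<union> {x\<in>K. T x \<in> N}" using SN(1) by auto
    ultimately show ?thesis by simp
  qed
  show "emeasure lebesgue {x\<in>K. T x \<in> A} \<le> ennreal ?C * emeasure lebesgue A"
  proof (rule ennreal_le_epsilon)
    fix e :: real assume e: "e > 0"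
    have eC: "e / ?C > 0" using e C by (rule divide_pos_pos)
    obtain W where W: "W \<in> lmeasurable" "{x\<in>K. T x \<in> A} \<subseteq> W"
       "emeasure lebesgue W \<le> ennreal ?C * (emeasure lebesgue A + ennreal (e / ?C))"
      by (rule lipschitz_inverse_outer_measure[OF K \<open>L > 0\<close> L A eC]) blast
    have c: "ennreal ?C * ennreal (e / ?C) = ennreal e" using C eC \<open>L > 0\<close> by (subst ennreal_mult[symmetric]) auto
    have "emeasure lebesgue {x\<in>K. T x \<in> A} \<le> emeasure lebesgue W" using W by (intro emeasure_mono) auto
    also have "\<dots> \<le> ennreal ?C * emeasure lebesgue A + ennreal e" using W(3) unfolding distrib_left c .
    finally show "emeasure lebesgue {x\<in>K. T x \<in> A} \<le> ennreal ?C * emeasure lebesgue A + ennreal e" .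
  qed
qed

lemma nn_integral_lipschitz_inverse:
  fixes T :: "'a::euclidean_space \<Rightarrow> 'a" and g :: "'a \<Rightarrow> ennreal"
  assumes K: "compact K" "continuous_on K T" and "L > 0"
    and L: "\<And>x y. x \<in> K \<Longrightarrow> y \<in> K \<Longrightarrow> norm (x - y) \<le> L * norm (T x - T y)"
    and g: "g \<in> borel_measurable lebesgue"
  shows "(\<lambda>x. g (T x) * indicator K x) \<in> borel_measurable lebesgue \<and>
    (\<integral>\<^sup>+x. g (T x) * indicator K x \<partial>lebesgue) \<le> ennreal ((2 * L * DIM('a)) ^ DIM('a)) * (\<integral>\<^sup>+x. g x \<partial>lebesgue)"
  using g
proof (induction rule: borel_measurable_induct)
  case (cong f g)
  then have "f = g" by auto
  then show ?case using cong by simp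
next
  case (set A)
  have "(\<lambda>x. indicator A (T x) * indicator K x :: ennreal) = indicator {x\<in>K. T x \<in> A}"
    by (auto simp: indicator_def)
  then show ?case using lipschitz_inverse_preimage[OF assms(1-4) set] set by simp
next
  case (mult u c)
  have m [measurable]: "(\<lambda>x. u (T x) * indicator K x) \<in> borel_measurable lebesgue" using mult by auto
  have e: "(\<lambda>x. c * u (T x) * indicator K x) = (\<lambda>x. c * (u (T x) * indicator K x))" by (simp add: mult.assoc)
  have "(\<integral>\<^sup>+x. c * u (T x) * indicator K x \<partial>lebesgue) = c * (\<integral>\<^sup>+x. u (T x) * indicator K x \<partial>lebesgue)"
    unfolding e using mult by (intro nn_integral_cmult) auto
  also have "\<dots> \<le> c * (ennreal ((2 * L * DIM('a)) ^ DIM('a)) * (\<integral>\<^sup>+x. u x \<partial>lebesgue))"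
    using mult by (intro mult_left_mono) auto
  also have "\<dots> = ennreal ((2 * L * DIM('a)) ^ DIM('a)) * (\<integral>\<^sup>+x. c * u x \<partial>lebesgue)"
    using mult by (simp add: nn_integral_cmult mult_ac)
  finally have "(\<integral>\<^sup>+x. c * u (T x) * indicator K x \<partial>lebesgue) \<le> ennreal ((2 * L * DIM('a)) ^ DIM('a)) * (\<integral>\<^sup>+x. c * u x \<partial>lebesgue)" .
  moreover have "(\<lambda>x. c * u (T x) * indicator K x) \<in> borel_measurable lebesgue"
    unfolding e by measurable
  ultimately show ?case by blast
next
  case (add u v)
  have m [measurable]: "(\<lambda>x. u (T x) * indicator K x) \<in> borel_measurable lebesgue"
    "(\<lambda>x. v (T x) * indicator K x) \<in> borel_measurable lebesgue" using add by auto
  have e: "(\<lambda>x. (v (T x) + u (T x)) * indicator K x) = (\<lambda>x. v (T x) * indicator K x + u (T x) * indicator K x)"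
    by (simp add: distrib_right)
  have "(\<integral>\<^sup>+x. (v (T x) + u (T x)) * indicator K x \<partial>lebesgue)
      = (\<integral>\<^sup>+x. v (T x) * indicator K x \<partial>lebesgue) + (\<integral>\<^sup>+x. u (T x) * indicator K x \<partial>lebesgue)"
    unfolding e using add by (intro nn_integral_add) auto
  also have "\<dots> \<le> ennreal ((2 * L * DIM('a)) ^ DIM('a)) * (\<integral>\<^sup>+x. v x \<partial>lebesgue) + ennreal ((2 * L * DIM('a)) ^ DIM('a)) * (\<integral>\<^sup>+x. u x \<partial>lebesgue)"
    using add by (intro add_mono) auto
  also have "\<dots> = ennreal ((2 * L * DIM('a)) ^ DIM('a)) * (\<integral>\<^sup>+x. v x + u x \<partial>lebesgue)"
    using add by (subst nn_integral_add) (auto simp: distrib_left)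
  finally have "(\<integral>\<^sup>+x. (v (T x) + u (T x)) * indicator K x \<partial>lebesgue) \<le> ennreal ((2 * L * DIM('a)) ^ DIM('a)) * (\<integral>\<^sup>+x. v x + u x \<partial>lebesgue)" .
  moreover have "(\<lambda>x. (v (T x) + u (T x)) * indicator K x) \<in> borel_measurable lebesgue"
    unfolding e by measurable
  ultimately show ?case by blast
next
  case (seq U)
  have e: "(\<lambda>x. (SUP i. U i) (T x) * indicator K x) = (\<lambda>x. SUP i. U i (T x) * indicator K x)"
    by (simp add: SUP_mult_right_ennreal[symmetric] SUP_apply image_image)
  have inc: "incseq (\<lambda>i x. U i (T x) * indicator K x)"
    using \<open>incseq U\<close> by (auto simp: incseq_def le_fun_def intro!: mult_right_mono)
  have "(\<integral>\<^sup>+x. (SUP i. U i) (T x) * indicator K x \<partial>lebesgue) = (SUP i. \<integral>\<^sup>+x. U i (T x) * indicator K x \<partial>lebesgue)"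
    unfolding e using seq.IH inc by (intro nn_integral_monotone_convergence_SUP) auto
  also have "\<dots> \<le> (SUP i. ennreal ((2 * L * DIM('a)) ^ DIM('a)) * (\<integral>\<^sup>+x. U i x \<partial>lebesgue))"
    using seq.IH by (intro SUP_mono) blast
  also have "\<dots> = ennreal ((2 * L * DIM('a)) ^ DIM('a)) * (\<integral>\<^sup>+x. (SUP i. U i) x \<partial>lebesgue)"
    using seq.hyps(1) \<open>incseq U\<close> by (simp add: SUP_mult_left_ennreal nn_integral_monotone_convergence_SUP SUP_apply image_image)
  finally have "(\<integral>\<^sup>+x. (SUP i. U i) (T x) * indicator K x \<partial>lebesgue)
      \<le> ennreal ((2 * L * DIM('a)) ^ DIM('a)) * (\<integral>\<^sup>+x. (SUP i. U i) x \<partial>lebesgue)" .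
  moreover have "(\<lambda>x. (SUP i. U i) (T x) * indicator K x) \<in> borel_measurable lebesgue"
    unfolding e using seq.IH by (intro borel_measurable_SUP) auto
  ultimately show ?case by blast
qed

section \<open>The singular kernel\<close>

text \<open>For a bounded Lipschitz function \<open>c\<close>, the quotient \<open>|c(x) - c(y)|\<^sup>p / |x - y|\<^sup>n\<^sup>+\<^sup>\<theta>\<^sup>p\<close> is at most a constant times this
  function of \<open>x - y\<close>.\<close>

definition slobodeckij_kernel :: "real \<Rightarrow> real \<Rightarrow> real^'n \<Rightarrow> real" where
  "slobodeckij_kernel \<theta> p z = min 1 (norm z) powr p / norm z powr (real CARD('n) + \<theta> * p)"

lemma slobodeckij_kernel_nonneg: "slobodeckij_kernel \<theta> p z \<ge> 0"
  by (simp add: slobodeckij_kernel_def)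

lemma slobodeckij_kernel_measurable [measurable]: "slobodeckij_kernel \<theta> p \<in> borel_measurable borel"
  unfolding slobodeckij_kernel_def[abs_def] by measurable

lemma term_le_suminf_ennreal: "f j \<le> (\<Sum>i. f i)" for f :: "nat \<Rightarrow> ennreal"
  using sum_le_suminf[of f "{j}"] by simp

lemma dyadic_interval:
  assumes "(x::real) \<ge> 1" obtains j where "2 ^ j \<le> x" "x < 2 ^ Suc j"
proof -
  obtain m where m: "x < 2 ^ m" using real_arch_pow[of 2 x] by auto
  define k where "k = (LEAST k. x < (2::real) ^ k)"
  have k: "x < 2 ^ k" unfolding k_def using m by (rule LeastI)
  have "k \<noteq> 0" using k assms by (intro notI) simp
  then obtain j where j: "k = Suc j" by (cases k) auto
  have "\<not> x < 2 ^ j" using not_less_Least[of j "\<lambda>k. x < (2::real) ^ k"] j by (simp add: k_def)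
  then show ?thesis by (intro that[of j]) (use k j in auto)
qed

text \<open>On each of the shells between consecutive powers of two, the bound for the kernel times the volume of
  the ball is a term of a geometric series: with ratio \<open>2\<^bsup>-p(1-\<theta>)\<^esup>\<close> inside the unit ball and ratio
  \<open>2\<^bsup>-p\<theta>\<^esup>\<close> outside.\<close>

lemma slobodeckij_kernel_integrable:
  assumes "0 < \<theta>" "\<theta> < 1" "1 < p"
  shows "(\<integral>\<^sup>+z. ennreal (slobodeckij_kernel \<theta> p (z :: real^'n)) \<partial>lborel) < \<infinity>"
proof -
  define n where "n = real CARD('n)"
  have n: "n > 0" by (simp add: n_def)
  define \<alpha> \<beta> where "\<alpha> = p * (1 - \<theta>)" and "\<beta> = p * \<theta>"
  have ab: "\<alpha> > 0" "\<beta> > 0" using assms by (auto simp: \<alpha>_def \<beta>_def)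
  define w where "w = unit_ball_vol n"
  have w: "w \<ge> 0" by (simp add: w_def n_def)
  define B where "B r = cball (0 :: real^'n) r" for r
  have emB: "emeasure lborel (B (2 powr t)) = ennreal (w * 2 powr (t * n))" for t
    unfolding B_def by (subst emeasure_cball) (simp_all add: w_def n_def powr_powr flip: powr_realpow)
  define a b where "a j = 2 powr (- real j * (\<alpha> - n) + n)" and "b j = 2 powr (- real j * (n + \<beta>))" for j :: nat
  have kb: "ennreal (slobodeckij_kernel \<theta> p z) \<le> (\<Sum>j. ennreal (a j) * indicator (B (2 powr (- real j))) z)
      + (\<Sum>j. ennreal (b j) * indicator (B (2 powr (real j + 1))) z)" (is "_ \<le> ?A + ?B") for z :: "real^'n"
  proof (cases "z = 0")
    case False
    define r where "r = norm z"
    have r: "r > 0" using False by (simp add: r_def)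
    show ?thesis
    proof (cases "r \<le> 1")
      case True
      then obtain j where j: "2 ^ j \<le> 1 / r" "1 / r < 2 ^ Suc j" using dyadic_interval[of "1 / r"] r by auto
      have j1: "r \<le> 2 powr (- real j)" using j(1) r by (simp add: powr_minus powr_realpow field_simps)
      have j2: "2 powr (- real j - 1) \<le> r"
        using j(2) r by (simp add: powr_minus powr_realpow powr_diff field_simps)
      have "slobodeckij_kernel \<theta> p z = r powr \<alpha> * r powr (- n)"
        using True r by (simp add: slobodeckij_kernel_def r_def[symmetric] n_def[symmetric] \<alpha>_def powr_diff[symmetric] powr_add[symmetric] algebra_simps)
      also have "\<dots> \<le> (2 powr (- real j)) powr \<alpha> * (2 powr (- real j - 1)) powr (- n)"
        using j1 j2 r ab n by (intro mult_mono powr_mono2 powr_mono2') auto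
      also have "\<dots> = a j" by (simp add: a_def powr_powr powr_add[symmetric] algebra_simps)
      finally have "ennreal (slobodeckij_kernel \<theta> p z) \<le> ennreal (a j) * indicator (B (2 powr (- real j))) z"
        using j1 by (simp add: B_def r_def ennreal_leI)
      also have "\<dots> \<le> ?A"
        by (rule term_le_suminf_ennreal)
      finally show ?thesis by (simp add: add_increasing2)
    next
      case False
      then obtain j where j: "2 ^ j \<le> r" "r < 2 ^ Suc j" using dyadic_interval[of r] by auto
      have j1: "2 powr real j \<le> r" "r \<le> 2 powr (real j + 1)"
        using j by (simp_all add: powr_realpow powr_add)
      have "slobodeckij_kernel \<theta> p z = 1 / r powr (n + \<beta>)"
        using False r by (simp add: slobodeckij_kernel_def r_def[symmetric] n_def[symmetric] \<beta>_def mult.commute)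
      also have "\<dots> = r powr (- (n + \<beta>))" by (rule powr_minus_divide[symmetric])
      also have "\<dots> \<le> (2 powr real j) powr (- (n + \<beta>))"
        using j1 n ab by (intro powr_mono2') auto
      also have "\<dots> = b j" by (simp add: b_def powr_powr algebra_simps)
      finally have "ennreal (slobodeckij_kernel \<theta> p z) \<le> ennreal (b j) * indicator (B (2 powr (real j + 1))) z"
        using j1 by (simp add: B_def r_def ennreal_leI)
      also have "\<dots> \<le> ?B"
        by (rule term_le_suminf_ennreal)
      finally show ?thesis by (simp add: add_increasing)
    qed
  qed (simp add: slobodeckij_kernel_def)
  have BS: "B r \<in> sets borel" for r by (simp add: B_def)
  have "(\<integral>\<^sup>+z. ennreal (slobodeckij_kernel \<theta> p (z :: real^'n)) \<partial>lborel) \<le> (\<integral>\<^sup>+z. (\<Sum>j. ennreal (a j) * indicator (B (2 powr (- real j))) z)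
      + (\<Sum>j. ennreal (b j) * indicator (B (2 powr (real j + 1))) z) \<partial>lborel)"
    by (intro nn_integral_mono kb)
  also have "\<dots> = (\<integral>\<^sup>+z. (\<Sum>j. ennreal (a j) * indicator (B (2 powr (- real j))) z) \<partial>lborel)
      + (\<integral>\<^sup>+z. (\<Sum>j. ennreal (b j) * indicator (B (2 powr (real j + 1))) z) \<partial>lborel)"
    using BS by (intro nn_integral_add) auto
  also have "\<dots> = (\<Sum>j. ennreal (a j) * emeasure lborel (B (2 powr (- real j))))
      + (\<Sum>j. ennreal (b j) * emeasure lborel (B (2 powr (real j + 1))))"
    using BS by (subst (1 2) nn_integral_suminf) (auto simp: nn_integral_cmult_indicator)
  also have "\<dots> = (\<Sum>j. ennreal (w * 2 powr n * (2 powr (- \<alpha>)) ^ j)) + (\<Sum>j. ennreal (w * 2 powr n * (2 powr (- \<beta>)) ^ j))"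
  proof -
    have "ennreal (a j) * emeasure lborel (B (2 powr (- real j))) = ennreal (w * 2 powr n * (2 powr (- \<alpha>)) ^ j)" for j
      unfolding emB using w
      by (simp add: a_def powr_powr powr_add[symmetric] algebra_simps flip: ennreal_mult powr_realpow)
    moreover have "ennreal (b j) * emeasure lborel (B (2 powr (real j + 1))) = ennreal (w * 2 powr n * (2 powr (- \<beta>)) ^ j)" for j
      unfolding emB using w
      by (simp add: b_def powr_powr powr_add[symmetric] algebra_simps flip: ennreal_mult powr_realpow)
    ultimately show ?thesis by simp
  qed
  also have "\<dots> < \<infinity>"
  proof -
    have "(\<Sum>j. ennreal (w * 2 powr n * (2 powr (- c)) ^ j)) < \<infinity>" if "c > 0" for c
    proof -
      have "2 powr (- c) < 1" using that powr_less_mono[of "- c" 0 2] by simp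
      then have "summable (\<lambda>j. w * 2 powr n * (2 powr (- c)) ^ j)" by (intro summable_mult summable_geometric) simp
      then have "(\<Sum>j. ennreal (w * 2 powr n * (2 powr (- c)) ^ j)) = ennreal (\<Sum>j. w * 2 powr n * (2 powr (- c)) ^ j)"
        using w by (intro suminf_ennreal2) auto
      then show ?thesis by simp
    qed
    from this[OF ab(1)] this[OF ab(2)] show ?thesis by simp
  qed
  finally show ?thesis .
qed

section \<open>Integral estimates for compositions\<close>

text \<open>The \<open>p\<close>-th powers of the norms, as integrals over the whole space with an indicator function, to which the theorems on
  changes of variables and on products apply directly.\<close>

definition Lp_power :: "(real^'n) set \<Rightarrow> real \<Rightarrow> (real^'n \<Rightarrow> real) \<Rightarrow> ennreal" where
  "Lp_power \<Omega> p f = (\<integral>\<^sup>+x. ennreal (\<bar>f x\<bar> powr p) * indicator \<Omega> x \<partial>lborel)"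

definition gagliardo_power :: "(real^'n) set \<Rightarrow> real \<Rightarrow> real \<Rightarrow> (real^'n \<Rightarrow> real) \<Rightarrow> ennreal" where
  "gagliardo_power \<Omega> \<theta> p f = (\<integral>\<^sup>+z. ennreal (\<bar>f (fst z) - f (snd z)\<bar> powr p
      / norm (fst z - snd z) powr (real CARD('n) + \<theta> * p)) * indicator (\<Omega> \<times> \<Omega>) z \<partial>lborel)"

lemma Lp_norm_eq_root: "\<Omega> \<in> sets borel \<Longrightarrow> Lp_norm \<Omega> p f = ennreal_root p (Lp_power \<Omega> p f)"
  unfolding Lp_norm_def Lp_power_def by (subst nn_integral_restrict_space) (auto simp: nn_integral_completion)

lemma gagliardo_eq_root: "\<Omega> \<in> sets borel \<Longrightarrow> gagliardo \<Omega> \<theta> p f = ennreal_root p (gagliardo_power \<Omega> \<theta> p f)"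
  unfolding gagliardo_def gagliardo_power_def
  by (subst nn_integral_restrict_space) (auto simp: nn_integral_completion case_prod_unfold borel_Times)

lemma Lp_power_mono: "\<Omega> \<subseteq> \<Omega>' \<Longrightarrow> Lp_power \<Omega> p f \<le> Lp_power \<Omega>' p f"
  unfolding Lp_power_def by (intro nn_integral_mono mult_left_mono) (auto simp: indicator_def)

lemma gagliardo_power_mono: "\<Omega> \<subseteq> \<Omega>' \<Longrightarrow> gagliardo_power \<Omega> \<theta> p f \<le> gagliardo_power \<Omega>' \<theta> p f"
  unfolding gagliardo_power_def by (intro nn_integral_mono mult_left_mono) (auto simp: indicator_def)

lemma AE_fst_lebesgue:
  assumes "AE x in lebesgue. P (x :: 'a::euclidean_space)"
  shows "AE z in (lebesgue :: ('a \<times> 'b::euclidean_space) measure). P (fst z)"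
proof -
  obtain N where N: "N \<in> null_sets lebesgue" "{x. \<not> P x} \<subseteq> N" using assms unfolding eventually_ae_filter by auto
  have [measurable]: "N \<in> sets lebesgue" using N by (simp add: null_sets_def)
  have m: "(\<lambda>z::'a\<times>'b. indicator N (fst z) :: ennreal) \<in> borel_measurable lebesgue" by measurable
  have "AE x in lborel. x \<notin> N" using N(1) AE_not_in[of N lebesgue] by (simp add: AE_completion_iff)
  then have "(\<integral>\<^sup>+x. \<integral>\<^sup>+(y::'b). indicator N x \<partial>lborel \<partial>lborel) = (\<integral>\<^sup>+(x::'a). 0 \<partial>lborel)"
    by (intro nn_integral_cong_AE) (auto elim!: eventually_mono)
  then have "(\<integral>\<^sup>+z. indicator N (fst (z :: 'a \<times> 'b)) \<partial>lebesgue) = 0"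
    using nn_integral_lebesgue_prod(1)[OF m] by (simp add: nn_integral_completion)
  then have "AE z in (lebesgue :: ('a \<times> 'b) measure). indicator N (fst z) = (0::ennreal)"
    using m by (simp add: nn_integral_0_iff_AE)
  then show ?thesis
  proof eventually_elim
    case (elim z) then show ?case using N(2) by (auto simp: indicator_def split: if_splits)
  qed
qed

lemma AE_snd_lebesgue:
  assumes "AE x in lebesgue. P (x :: 'b::euclidean_space)"
  shows "AE z in (lebesgue :: ('a::euclidean_space \<times> 'b) measure). P (snd z)"
proof -
  obtain N where N: "N \<in> null_sets lebesgue" "{x. \<not> P x} \<subseteq> N" using assms unfolding eventually_ae_filter by auto
  have [measurable]: "N \<in> sets lebesgue" using N by (simp add: null_sets_def)
  have m: "(\<lambda>z::'a\<times>'b. indicator N (snd z) :: ennreal) \<in> borel_measurable lebesgue" by measurable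
  have "AE x in lborel. x \<notin> N" using N(1) AE_not_in[of N lebesgue] by (simp add: AE_completion_iff)
  then have "(\<integral>\<^sup>+y. \<integral>\<^sup>+(x::'a). indicator N y \<partial>lborel \<partial>lborel) = (\<integral>\<^sup>+(y::'b). 0 \<partial>lborel)"
    by (intro nn_integral_cong_AE) (auto elim!: eventually_mono)
  then have "(\<integral>\<^sup>+z. indicator N (snd (z :: 'a \<times> 'b)) \<partial>lebesgue) = 0"
    using nn_integral_lebesgue_prod(2)[OF m] by (simp add: nn_integral_completion)
  then have "AE z in (lebesgue :: ('a \<times> 'b) measure). indicator N (snd z) = (0::ennreal)"
    using m by (simp add: nn_integral_0_iff_AE)
  then show ?thesis
  proof eventually_elim
    case (elim z) then show ?case using N(2) by (auto simp: indicator_def split: if_splits)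
  qed
qed

lemma Lp_power_cong_AE:
  assumes "AE x in lebesgue. x \<in> \<Omega> \<longrightarrow> f x = g x" shows "Lp_power \<Omega> p f = Lp_power \<Omega> p g"
proof -
  have "(\<integral>\<^sup>+x. ennreal (\<bar>f x\<bar> powr p) * indicator \<Omega> x \<partial>lebesgue) = (\<integral>\<^sup>+x. ennreal (\<bar>g x\<bar> powr p) * indicator \<Omega> x \<partial>lebesgue)"
    using assms by (intro nn_integral_cong_AE) (auto elim!: eventually_mono simp: indicator_def)
  then show ?thesis by (simp add: Lp_power_def nn_integral_completion)
qed

lemma gagliardo_power_cong_AE:
  fixes f g :: "real^'n \<Rightarrow> real"
  assumes "AE x in lebesgue. x \<in> \<Omega> \<longrightarrow> f x = g x"
  shows "gagliardo_power \<Omega> \<theta> p f = gagliardo_power \<Omega> \<theta> p g"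
proof -
  let ?h = "\<lambda>f z. ennreal (\<bar>f (fst z) - f (snd z)\<bar> powr p
      / norm (fst z - snd z) powr (real CARD('n) + \<theta> * p)) * indicator (\<Omega> \<times> \<Omega>) (z :: (real^'n) \<times> (real^'n))"
  have "AE z in lebesgue. ?h f z = ?h g z"
    using AE_fst_lebesgue[OF assms, where 'b = "real^'n"] AE_snd_lebesgue[OF assms, where 'a = "real^'n"]
    by eventually_elim (auto simp: indicator_def)
  then have "(\<integral>\<^sup>+z. ?h f z \<partial>lebesgue) = (\<integral>\<^sup>+z. ?h g z \<partial>lebesgue)" by (rule nn_integral_cong_AE)
  then show ?thesis by (simp add: gagliardo_power_def nn_integral_completion)
qed

lemma powr_add_le:
  assumes "a \<ge> 0" "b \<ge> 0" "p > 0" shows "(a + b) powr p \<le> 2 powr p * (a powr p + b powr (p::real))"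
proof -
  have "(a + b) powr p \<le> (2 * max a b) powr p" using assms by (intro powr_mono2) auto
  also have "\<dots> = 2 powr p * max a b powr p" using assms by (simp add: powr_mult)
  also have "max a b powr p \<le> a powr p + b powr p" by (cases "a \<le> b") (auto simp: max_def)
  finally show ?thesis by (simp add: mult_left_mono)
qed

lemma powr_sum_le:
  fixes a :: "'i \<Rightarrow> real"
  assumes "finite I" "\<And>i. i \<in> I \<Longrightarrow> a i \<ge> 0" "p > 0"
  shows "(\<Sum>i\<in>I. a i) powr p \<le> real (card I) powr p * (\<Sum>i\<in>I. a i powr p)"
proof (cases "I = {}")
  case False
  let ?m = "Max (a ` I)"
  have m: "?m \<in> a ` I" using assms False by (intro Max_in) auto
  have "(\<Sum>i\<in>I. a i) \<le> real (card I) * ?m" using assms by (intro sum_bounded_above) simp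
  then have "(\<Sum>i\<in>I. a i) powr p \<le> (real (card I) * ?m) powr p"
    using assms by (intro powr_mono2 sum_nonneg) auto
  also have "\<dots> = real (card I) powr p * ?m powr p" using m assms by (subst powr_mult) auto
  also have "?m powr p \<le> (\<Sum>i\<in>I. a i powr p)"
  proof -
    obtain i where i: "i \<in> I" "?m = a i" using m by auto
    then show ?thesis using assms member_le_sum[of i I "\<lambda>i. a i powr p"] by simp
  qed
  finally show ?thesis by (simp add: mult_left_mono)
qed simp

definition bilipschitz_on :: "'a::real_normed_vector set \<Rightarrow> ('a \<Rightarrow> 'b::real_normed_vector) \<Rightarrow> real \<Rightarrow> bool" where
  "bilipschitz_on K T L \<longleftrightarrow> L > 0 \<and> (\<forall>x\<in>K. \<forall>y\<in>K. norm (x - y) \<le> L * norm (T x - T y) \<and> norm (T x - T y) \<le> L * norm (x - y))"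

lemma bilipschitz_continuous: "bilipschitz_on K T L \<Longrightarrow> continuous_on K T"
  unfolding bilipschitz_on_def
  by (rule lipschitz_on_continuous_on[of L]) (auto intro!: lipschitz_onI simp: dist_norm)

lemma bilipschitz_Times:
  assumes "bilipschitz_on K T L"
  shows "bilipschitz_on (K \<times> K) (map_prod T T) L"
proof -
  have L: "L > 0" and b: "\<And>x y. x \<in> K \<Longrightarrow> y \<in> K \<Longrightarrow> norm (x - y) \<le> L * norm (T x - T y)"
    "\<And>x y. x \<in> K \<Longrightarrow> y \<in> K \<Longrightarrow> norm (T x - T y) \<le> L * norm (x - y)"
    using assms by (auto simp: bilipschitz_on_def)
  have *: "sqrt (a\<^sup>2 + b\<^sup>2) \<le> L * sqrt (c\<^sup>2 + d\<^sup>2)" if "0 \<le> a" "0 \<le> b" "a \<le> L * c" "b \<le> L * d" for a b c d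
  proof -
    have "a\<^sup>2 \<le> (L * c)\<^sup>2" "b\<^sup>2 \<le> (L * d)\<^sup>2" using that by (auto intro: power_mono)
    then have "sqrt (a\<^sup>2 + b\<^sup>2) \<le> sqrt (L\<^sup>2 * (c\<^sup>2 + d\<^sup>2))"
      by (intro real_sqrt_le_mono) (simp add: power_mult_distrib distrib_left)
    then show ?thesis using L by (simp add: real_sqrt_mult)
  qed
  show ?thesis unfolding bilipschitz_on_def using L b by (auto simp: norm_Pair intro!: *)
qed

lemma bilipschitz_measurable:
  fixes T :: "'a::euclidean_space \<Rightarrow> 'a" and g :: "'a \<Rightarrow> real"
  assumes "compact K" "bilipschitz_on K T L" "zero_outside (T ` K) g \<in> borel_measurable lebesgue"
  shows "zero_outside K (\<lambda>x. g (T x)) \<in> borel_measurable lebesgue"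
proof -
  have Ks: "K \<in> sets lebesgue" using assms(1) by (simp add: compact_imp_closed)
  have "T \<in> lebesgue_on K \<rightarrow>\<^sub>M lebesgue"
  proof (rule measurableI)
    fix A :: "'a set" assume "A \<in> sets lebesgue"
    then have "{x\<in>K. T x \<in> A} \<in> sets lebesgue"
      using assms(2) by (intro lipschitz_inverse_preimage[OF assms(1) bilipschitz_continuous[OF assms(2)], of L])
        (auto simp: bilipschitz_on_def)
    moreover have "T -` A \<inter> space (lebesgue_on K) = {x\<in>K. T x \<in> A}" by auto
    ultimately show "T -` A \<inter> space (lebesgue_on K) \<in> sets (lebesgue_on K)"
      using Ks by (subst sets_restrict_space_iff) auto
  qed simp
  from measurable_comp[OF this assms(3)]
  have "(\<lambda>x. zero_outside (T ` K) g (T x)) \<in> borel_measurable (lebesgue_on K)" by (simp add: comp_def)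
  then have "(\<lambda>x. indicator K x *\<^sub>R zero_outside (T ` K) g (T x)) \<in> borel_measurable lebesgue"
    using Ks by (subst (asm) borel_measurable_restrict_space_iff) auto
  moreover have "(\<lambda>x. indicator K x *\<^sub>R zero_outside (T ` K) g (T x)) = zero_outside K (\<lambda>x. g (T x))"
    by (rule ext) (auto simp: zero_outside_def indicator_def)
  ultimately show ?thesis by simp
qed

lemma bilipschitz_nn_integral:
  fixes T :: "'a::euclidean_space \<Rightarrow> 'a" and g :: "'a \<Rightarrow> ennreal"
  assumes "compact K" "bilipschitz_on K T L" "g \<in> borel_measurable lebesgue"
  shows "(\<lambda>x. g (T x) * indicator K x) \<in> borel_measurable lebesgue"
    "(\<integral>\<^sup>+x. g (T x) * indicator K x \<partial>lborel) \<le> ennreal ((2 * L * DIM('a)) ^ DIM('a)) * (\<integral>\<^sup>+x. g x \<partial>lborel)"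
  using nn_integral_lipschitz_inverse[OF assms(1) bilipschitz_continuous[OF assms(2)], of L g] assms
  by (auto simp: bilipschitz_on_def nn_integral_completion)

lemma Lp_power_compose:
  fixes T :: "real^'n \<Rightarrow> real^'n"
  assumes K: "compact K" and T: "bilipschitz_on K T L" and g: "zero_outside (T ` K) g \<in> borel_measurable lebesgue"
  shows "(\<lambda>x. ennreal (\<bar>g (T x)\<bar> powr p) * indicator K x) \<in> borel_measurable lebesgue"
    "Lp_power K p (\<lambda>x. g (T x)) \<le> ennreal ((2 * L * CARD('n)) ^ CARD('n)) * Lp_power (T ` K) p g"
proof -
  let ?G = "zero_outside (T ` K) g"
  let ?h = "\<lambda>y. ennreal (\<bar>?G y\<bar> powr p) * indicator (T ` K) y"
  have "compact (T ` K)" by (rule compact_continuous_image[OF bilipschitz_continuous[OF T] K])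
  then have TK: "T ` K \<in> sets lebesgue" by (simp add: compact_imp_closed)
  have h: "?h \<in> borel_measurable lebesgue" using g TK by measurable
  have e: "(\<lambda>x. ?h (T x) * indicator K x) = (\<lambda>x. ennreal (\<bar>g (T x)\<bar> powr p) * indicator K x)"
    by (rule ext) (auto simp: indicator_def)
  have e': "?h = (\<lambda>y. ennreal (\<bar>g y\<bar> powr p) * indicator (T ` K) y)" by (rule ext) (auto simp: indicator_def)
  show "(\<lambda>x. ennreal (\<bar>g (T x)\<bar> powr p) * indicator K x) \<in> borel_measurable lebesgue"
    using bilipschitz_nn_integral(1)[OF K T h] unfolding e .
  show "Lp_power K p (\<lambda>x. g (T x)) \<le> ennreal ((2 * L * CARD('n)) ^ CARD('n)) * Lp_power (T ` K) p g"
    using bilipschitz_nn_integral(2)[OF K T h] unfolding e e' Lp_power_def by simp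
qed

lemma Lp_power_mult_compose:
  fixes T :: "real^'n \<Rightarrow> real^'n"
  assumes "compact K" "bilipschitz_on K T L" "zero_outside (T ` K) g \<in> borel_measurable lebesgue"
    and c: "\<And>x. x \<notin> K \<Longrightarrow> c x = 0" "\<And>x. \<bar>c x\<bar> \<le> M" and "p > 0"
  shows "Lp_power \<Omega> p (\<lambda>x. c x * g (T x))
    \<le> ennreal (M powr p * (2 * L * CARD('n)) ^ CARD('n)) * Lp_power (T ` K) p g"
proof -
  have M: "M \<ge> 0" using c(2)[of undefined] by linarith
  have L: "L > 0" using assms(2) by (simp add: bilipschitz_on_def)
  have "Lp_power \<Omega> p (\<lambda>x. c x * g (T x)) \<le> (\<integral>\<^sup>+x. ennreal (M powr p) * (ennreal (\<bar>g (T x)\<bar> powr p) * indicator K x) \<partial>lborel)"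
    unfolding Lp_power_def
  proof (rule nn_integral_mono)
    fix x
    have "\<bar>c x * g (T x)\<bar> powr p \<le> M powr p * \<bar>g (T x)\<bar> powr p"
      using c(2)[of x] M \<open>p > 0\<close> by (simp add: abs_mult powr_mult mult_right_mono powr_mono2)
    then show "ennreal (\<bar>c x * g (T x)\<bar> powr p) * indicator \<Omega> x \<le> ennreal (M powr p) * (ennreal (\<bar>g (T x)\<bar> powr p) * indicator K x)"
      using c(1)[of x] by (cases "x \<in> K") (auto simp: indicator_def simp flip: ennreal_mult intro: ennreal_leI)
  qed
  also have "\<dots> = (\<integral>\<^sup>+x. ennreal (M powr p) * (ennreal (\<bar>g (T x)\<bar> powr p) * indicator K x) \<partial>lebesgue)"
    by (simp add: nn_integral_completion)
  also have "\<dots> = ennreal (M powr p) * Lp_power K p (\<lambda>x. g (T x))"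
    using Lp_power_compose(1)[OF assms(1-3)] by (subst nn_integral_cmult) (auto simp: Lp_power_def nn_integral_completion)
  also have "\<dots> \<le> ennreal (M powr p) * (ennreal ((2 * L * CARD('n)) ^ CARD('n)) * Lp_power (T ` K) p g)"
    by (intro mult_left_mono Lp_power_compose(2)[OF assms(1-3)]) simp
  also have "\<dots> = ennreal (M powr p * (2 * L * CARD('n)) ^ CARD('n)) * Lp_power (T ` K) p g"
    using L by (simp add: ennreal_mult mult.assoc)
  finally show ?thesis .
qed

text \<open>Tonelli's theorem and the invariance of Lebesgue measure under translations and reflections.\<close>

lemma nn_integral_kernel_product:
  fixes w :: "real^'n \<Rightarrow> ennreal" and \<theta> p :: real
  assumes w: "w \<in> borel_measurable lebesgue"
  defines "I \<equiv> (\<integral>\<^sup>+z. ennreal (slobodeckij_kernel \<theta> p (z :: real^'n)) \<partial>lborel)"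
  shows "(\<integral>\<^sup>+z. ennreal (slobodeckij_kernel \<theta> p (fst z - snd z)) * w (fst z) \<partial>lborel) = I * (\<integral>\<^sup>+x. w x \<partial>lborel)"
    and "(\<integral>\<^sup>+z. ennreal (slobodeckij_kernel \<theta> p (fst z - snd z)) * w (snd z) \<partial>lborel) = I * (\<integral>\<^sup>+x. w x \<partial>lborel)"
    and "(\<lambda>z::(real^'n)\<times>(real^'n). ennreal (slobodeckij_kernel \<theta> p (fst z - snd z)) * w (fst z)) \<in> borel_measurable lebesgue"
    and "(\<lambda>z::(real^'n)\<times>(real^'n). ennreal (slobodeckij_kernel \<theta> p (fst z - snd z)) * w (snd z)) \<in> borel_measurable lebesgue"
proof -
  let ?k = "\<lambda>z :: real^'n. ennreal (slobodeckij_kernel \<theta> p z)"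
  have k: "?k \<in> borel_measurable borel" by measurable
  have d: "(\<lambda>z::(real^'n)\<times>(real^'n). fst z - snd z) \<in> borel_measurable lebesgue"
    by (intro borel_measurable_lebesgue_continuous continuous_intros)
  have kd: "(\<lambda>z::(real^'n)\<times>(real^'n). ?k (fst z - snd z)) \<in> borel_measurable lebesgue"
    using measurable_comp[OF d k] by (simp add: comp_def)
  have wf: "(\<lambda>z::(real^'n)\<times>(real^'n). w (fst z)) \<in> borel_measurable lebesgue"
    "(\<lambda>z::(real^'n)\<times>(real^'n). w (snd z)) \<in> borel_measurable lebesgue"
    using measurable_comp[OF measurable_fst_lebesgue w] measurable_comp[OF measurable_snd_lebesgue w] by (simp_all add: comp_def)
  show m1: "(\<lambda>z::(real^'n)\<times>(real^'n). ?k (fst z - snd z) * w (fst z)) \<in> borel_measurable lebesgue"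
    and m2: "(\<lambda>z::(real^'n)\<times>(real^'n). ?k (fst z - snd z) * w (snd z)) \<in> borel_measurable lebesgue"
    using kd wf by measurable
  have wi: "(\<integral>\<^sup>+x. I * w x \<partial>lborel) = I * (\<integral>\<^sup>+x. w x \<partial>lborel)"
    using nn_integral_cmult[OF w, of I] by (simp add: nn_integral_completion)
  have s: "(\<integral>\<^sup>+y. ?k (x - y) * w x \<partial>lborel) = I * w x" for x
    using nn_integral_lborel_reflect[OF k, of x] by (subst nn_integral_multc) (auto simp: I_def)
  show "(\<integral>\<^sup>+z. ?k (fst z - snd z) * w (fst z) \<partial>lborel) = I * (\<integral>\<^sup>+x. w x \<partial>lborel)"
    unfolding nn_integral_lebesgue_prod(1)[OF m1] by (simp add: s wi)
  have s: "(\<integral>\<^sup>+x. ?k (x - y) * w y \<partial>lborel) = I * w y" for y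
    using nn_integral_lborel_shift[OF k, of y] by (subst nn_integral_multc) (auto simp: I_def)
  show "(\<integral>\<^sup>+z. ?k (fst z - snd z) * w (snd z) \<partial>lborel) = I * (\<integral>\<^sup>+x. w x \<partial>lborel)"
    unfolding nn_integral_lebesgue_prod(2)[OF m2] by (simp add: s wi)
qed

text \<open>If both points lie in \<open>K\<close>, the increment of \<open>c (g \<circ> T)\<close> splits into an increment of \<open>g \<circ> T\<close> and one of
  \<open>c\<close>; if only one does, it is an increment of \<open>c\<close> alone, times the value of \<open>g \<circ> T\<close> at that point.\<close>

lemma gagliardo_mult_compose_pointwise:
  fixes T :: "real^'n \<Rightarrow> real^'n" and g :: "real^'n \<Rightarrow> real"
  assumes T: "bilipschitz_on K T L" and c: "\<And>x. x \<notin> K \<Longrightarrow> c x = 0" "\<And>x. \<bar>c x\<bar> \<le> M"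
    "\<And>x y. \<bar>c x - c y\<bar> \<le> M * min 1 (norm (x - y))" and p: "0 < p" "0 < \<theta>"
  defines "m \<equiv> real CARD('n) + \<theta> * p"
  shows "\<bar>c x * g (T x) - c y * g (T y)\<bar> powr p / norm (x - y) powr m
    \<le> (2 powr p * M powr p * L powr m) * (indicator (K \<times> K) (x, y) * (\<bar>g (T x) - g (T y)\<bar> powr p / norm (T x - T y) powr m))
     + (2 powr p * M powr p) * (slobodeckij_kernel \<theta> p (x - y) * (indicator K x * \<bar>g (T x)\<bar> powr p)
        + slobodeckij_kernel \<theta> p (x - y) * (indicator K y * \<bar>g (T y)\<bar> powr p))"
proof -
  have L: "L > 0" using T by (simp add: bilipschitz_on_def)
  have M: "M \<ge> 0" using c(2)[of undefined] by linarith
  have m: "m > 0" using p unfolding m_def by (intro add_pos_pos) auto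
  let ?D = "norm (x - y)" and ?k = "slobodeckij_kernel \<theta> p (x - y)"
  have kd: "min 1 ?D powr p / ?D powr m = ?k" by (simp add: slobodeckij_kernel_def m_def)
  have k0: "?k \<ge> 0" by (rule slobodeckij_kernel_nonneg)
  have part: "(\<bar>c x - c y\<bar> * \<bar>t\<bar>) powr p / ?D powr m \<le> M powr p * (?k * \<bar>t\<bar> powr p)" for t
  proof -
    have "(\<bar>c x - c y\<bar> * \<bar>t\<bar>) powr p \<le> (M * min 1 ?D * \<bar>t\<bar>) powr p"
      using c(3)[of x y] p by (intro powr_mono2 mult_right_mono) auto
    also have "\<dots> = M powr p * min 1 ?D powr p * \<bar>t\<bar> powr p" using M by (simp add: powr_mult)
    finally have "(\<bar>c x - c y\<bar> * \<bar>t\<bar>) powr p / ?D powr m \<le> M powr p * min 1 ?D powr p * \<bar>t\<bar> powr p / ?D powr m"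
      by (rule divide_right_mono) simp
    also have "\<dots> = M powr p * ((min 1 ?D powr p / ?D powr m) * \<bar>t\<bar> powr p)" by simp
    finally show ?thesis unfolding kd .
  qed
  have two: "1 \<le> 2 powr p" using p by (simp add: ge_one_powr_ge_zero)
  show ?thesis
  proof (cases "x = y")
    case True
    then show ?thesis using M by (auto intro!: add_nonneg_nonneg mult_nonneg_nonneg slobodeckij_kernel_nonneg)
  next
    case False
    then have D: "?D > 0" by simp
    show ?thesis
    proof (cases "x \<in> K \<and> y \<in> K")
      case True
      then have xy: "x \<in> K" "y \<in> K" by auto
      have T1: "norm (T x - T y) \<le> L * ?D" "?D \<le> L * norm (T x - T y)" using T xy by (auto simp: bilipschitz_on_def)
      have T0: "norm (T x - T y) > 0" using T1(2) D L by (metis mult_zero_right not_less norm_ge_zero order_le_less)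
      let ?a = "M * \<bar>g (T x) - g (T y)\<bar>" and ?b = "\<bar>c x - c y\<bar> * \<bar>g (T y)\<bar>"
      have "c x * g (T x) - c y * g (T y) = c x * (g (T x) - g (T y)) + (c x - c y) * g (T y)" by (simp add: algebra_simps)
      then have "\<bar>c x * g (T x) - c y * g (T y)\<bar> \<le> \<bar>c x\<bar> * \<bar>g (T x) - g (T y)\<bar> + ?b"
        by (metis abs_mult abs_triangle_ineq)
      also have "\<dots> \<le> ?a + ?b" using c(2) by (intro add_mono mult_right_mono) auto
      finally have "\<bar>c x * g (T x) - c y * g (T y)\<bar> powr p \<le> (?a + ?b) powr p" using p by (intro powr_mono2) auto
      also have "\<dots> \<le> 2 powr p * (?a powr p + ?b powr p)" using M p by (intro powr_add_le) auto
      finally have "\<bar>c x * g (T x) - c y * g (T y)\<bar> powr p / ?D powr m \<le> 2 powr p * (?a powr p + ?b powr p) / ?D powr m"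
        by (rule divide_right_mono) simp
      also have "\<dots> = 2 powr p * (?a powr p / ?D powr m + ?b powr p / ?D powr m)"
        by (simp only: add_divide_distrib[symmetric] times_divide_eq_right)
      also have "\<dots> \<le> 2 powr p * (M powr p * L powr m * (\<bar>g (T x) - g (T y)\<bar> powr p / norm (T x - T y) powr m)
          + M powr p * (?k * \<bar>g (T y)\<bar> powr p))"
      proof (intro mult_left_mono add_mono part)
        have "norm (T x - T y) powr m \<le> L powr m * ?D powr m"
          using T1(1) L m powr_mono2[of m "norm (T x - T y)" "L * ?D"] by (simp add: powr_mult)
        then have "1 / ?D powr m \<le> L powr m / norm (T x - T y) powr m"
          using D T0 by (simp add: divide_simps mult.commute)
        then have "?a powr p * (1 / ?D powr m) \<le> ?a powr p * (L powr m / norm (T x - T y) powr m)"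
          by (rule mult_left_mono) simp
        then show "?a powr p / ?D powr m \<le> M powr p * L powr m * (\<bar>g (T x) - g (T y)\<bar> powr p / norm (T x - T y) powr m)"
          using M by (simp add: powr_mult mult_ac)
      qed simp
      also have "\<dots> \<le> (2 powr p * M powr p * L powr m) * (\<bar>g (T x) - g (T y)\<bar> powr p / norm (T x - T y) powr m)
          + (2 powr p * M powr p) * (?k * \<bar>g (T x)\<bar> powr p + ?k * \<bar>g (T y)\<bar> powr p)"
      proof -
        have "0 \<le> (2 powr p * M powr p) * (?k * \<bar>g (T x)\<bar> powr p)" by (intro mult_nonneg_nonneg k0) auto
        then show ?thesis by (simp add: algebra_simps)
      qed
      finally show ?thesis using xy by simp
    next
      case False
      have one: "\<bar>c x * g (T x) - c y * g (T y)\<bar> powr p / ?D powr m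
          \<le> (2 powr p * M powr p) * (?k * (indicator K x * \<bar>g (T x)\<bar> powr p) + ?k * (indicator K y * \<bar>g (T y)\<bar> powr p))"
      proof -
        have mono: "M powr p * (?k * \<bar>t\<bar> powr p) \<le> (2 powr p * M powr p) * (?k * \<bar>t\<bar> powr p)" for t
          using mult_right_mono[OF two, of "M powr p * (?k * \<bar>t\<bar> powr p)"] k0 by (simp add: mult.assoc)
        consider "x \<in> K" "y \<notin> K" | "x \<notin> K" "y \<in> K" | "x \<notin> K" "y \<notin> K" using False by blast
        then show ?thesis
        proof cases
          case 1
          then show ?thesis using order_trans[OF part mono, of "g (T x)"] c(1)[of y] by (simp add: abs_mult)
        next
          case 2
          then show ?thesis using order_trans[OF part mono, of "g (T y)"] c(1)[of x] by (simp add: abs_mult)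
        next
          case 3
          then show ?thesis using c(1) by simp
        qed
      qed
      moreover have "indicator (K \<times> K) (x, y) = (0::real)" using False by simp
      ultimately show ?thesis by (simp only: mult_zero_left mult_zero_right add_0)
    qed
  qed
qed

text \<open>The first term of the pointwise bound is integrated by the change of variables \<open>(x, y) \<mapsto> (T x, T y)\<close>, which is
  bi-Lipschitz on \<open>K \<times> K\<close>. In the others the kernel is integrated first.\<close>

lemma gagliardo_power_mult_compose:
  fixes T :: "real^'n \<Rightarrow> real^'n"
  assumes K: "compact K" and T: "bilipschitz_on K T L"
    and c: "\<And>x. x \<notin> K \<Longrightarrow> c x = 0" "\<And>x. \<bar>c x\<bar> \<le> M" "\<And>x y. \<bar>c x - c y\<bar> \<le> M * min 1 (norm (x - y))"
    and p: "1 < p" "0 < \<theta>" "\<theta> < 1"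
  shows "\<exists>C\<ge>0. \<forall>g. zero_outside (T ` K) g \<in> borel_measurable lebesgue \<longrightarrow>
    gagliardo_power \<Omega> \<theta> p (\<lambda>x. c x * g (T x)) \<le> ennreal C * (gagliardo_power (T ` K) \<theta> p g + Lp_power (T ` K) p g)"
proof -
  let ?m = "real CARD('n) + \<theta> * p"
  define A B where "A = 2 powr p * M powr p * L powr ?m" and "B = 2 powr p * M powr p"
  have AB: "A \<ge> 0" "B \<ge> 0" by (simp_all add: A_def B_def)
  define I where "I = (\<integral>\<^sup>+z. ennreal (slobodeckij_kernel \<theta> p (z :: real^'n)) \<partial>lborel)"
  have I: "I < \<infinity>" unfolding I_def by (rule slobodeckij_kernel_integrable) (use p in auto)
  define i where "i = enn2real I"
  have Ii: "I = ennreal i" and i0: "i \<ge> 0" using I by (auto simp: i_def)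
  have L: "L > 0" using T by (simp add: bilipschitz_on_def)
  define C1 where "C1 = (2 * L * real (DIM((real^'n) \<times> (real^'n)))) ^ DIM((real^'n) \<times> (real^'n))"
  define C2 where "C2 = (2 * L * CARD('n)) ^ CARD('n)"
  have C12: "C1 \<ge> 0" "C2 \<ge> 0" using L by (auto simp: C1_def C2_def)
  define C where "C = A * C1 + B * (i * C2 + i * C2)"
  have C0: "C \<ge> 0" unfolding C_def using AB C12 i0 by (intro add_nonneg_nonneg mult_nonneg_nonneg) auto
  have "gagliardo_power \<Omega> \<theta> p (\<lambda>x. c x * g (T x)) \<le> ennreal C * (gagliardo_power (T ` K) \<theta> p g + Lp_power (T ` K) p g)"
    if g: "zero_outside (T ` K) g \<in> borel_measurable lebesgue" for g
  proof -
    let ?G = "zero_outside (T ` K) g"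
    define H where "H w = ennreal (\<bar>?G (fst w) - ?G (snd w)\<bar> powr p / norm (fst w - snd w) powr ?m) * indicator (T ` K \<times> T ` K) w"
      for w :: "(real^'n) \<times> (real^'n)"
    define h where "h x = ennreal (\<bar>g (T x)\<bar> powr p) * indicator K x" for x
    have cTK: "compact (T ` K)" by (rule compact_continuous_image[OF bilipschitz_continuous[OF T] K])
    have KK: "compact (K \<times> K)" by (rule compact_Times[OF K K])
    have TKs: "T ` K \<times> T ` K \<in> sets lebesgue" using compact_Times[OF cTK cTK] by (simp add: compact_imp_closed)
    have m1: "(\<lambda>w::(real^'n)\<times>(real^'n). ?G (fst w)) \<in> borel_measurable lebesgue"
      "(\<lambda>w::(real^'n)\<times>(real^'n). ?G (snd w)) \<in> borel_measurable lebesgue"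
      using measurable_comp[OF measurable_fst_lebesgue g] measurable_comp[OF measurable_snd_lebesgue g] by (simp_all add: comp_def)
    have m2: "(\<lambda>w::(real^'n)\<times>(real^'n). norm (fst w - snd w)) \<in> borel_measurable lebesgue"
      by (intro borel_measurable_lebesgue_continuous continuous_intros)
    have Hm: "H \<in> borel_measurable lebesgue" unfolding H_def[abs_def] using m1 m2 TKs by measurable
    have hm: "h \<in> borel_measurable lebesgue" unfolding h_def[abs_def] by (rule Lp_power_compose(1)[OF K T g])
    note HT = bilipschitz_nn_integral[OF KK bilipschitz_Times[OF T] Hm]
    have Hg: "H = (\<lambda>w. ennreal (\<bar>g (fst w) - g (snd w)\<bar> powr p / norm (fst w - snd w) powr ?m) * indicator (T ` K \<times> T ` K) w)"
      unfolding H_def by (rule ext) (auto simp: indicator_def)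
    let ?k = "\<lambda>z::(real^'n)\<times>(real^'n). ennreal (slobodeckij_kernel \<theta> p (fst z - snd z))"
    note kp = nn_integral_kernel_product[OF hm, of \<theta> p, folded I_def]
    have "gagliardo_power \<Omega> \<theta> p (\<lambda>x. c x * g (T x))
       \<le> (\<integral>\<^sup>+z. ennreal A * (H (map_prod T T z) * indicator (K \<times> K) z) + ennreal B * (?k z * h (fst z) + ?k z * h (snd z)) \<partial>lborel)"
      unfolding gagliardo_power_def
    proof (rule nn_integral_mono)
      fix z :: "(real^'n) \<times> (real^'n)"
      obtain x y where z: "z = (x, y)" by (cases z)
      let ?q = "\<bar>g (T x) - g (T y)\<bar> powr p / norm (T x - T y) powr ?m"
      let ?l = "slobodeckij_kernel \<theta> p (x - y)"
      have l0: "?l \<ge> 0" by (rule slobodeckij_kernel_nonneg)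
      have "ennreal (\<bar>c x * g (T x) - c y * g (T y)\<bar> powr p / norm (x - y) powr ?m) * indicator (\<Omega> \<times> \<Omega>) z
         \<le> ennreal (\<bar>c x * g (T x) - c y * g (T y)\<bar> powr p / norm (x - y) powr ?m)"
        by (simp add: indicator_def)
      also have "\<dots> \<le> ennreal (A * (indicator (K \<times> K) (x, y) * ?q)
          + B * (?l * (indicator K x * \<bar>g (T x)\<bar> powr p) + ?l * (indicator K y * \<bar>g (T y)\<bar> powr p)))"
        unfolding A_def B_def using p by (intro ennreal_leI gagliardo_mult_compose_pointwise[OF T c]) auto
      also have "\<dots> = ennreal (A * (indicator (K \<times> K) (x, y) * ?q))
          + ennreal (B * (?l * (indicator K x * \<bar>g (T x)\<bar> powr p) + ?l * (indicator K y * \<bar>g (T y)\<bar> powr p)))"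
        using AB l0 by (intro ennreal_plus) auto
      also have "ennreal (A * (indicator (K \<times> K) (x, y) * ?q)) = ennreal A * (H (map_prod T T z) * indicator (K \<times> K) z)"
        unfolding Hg z using AB by (auto simp: indicator_def simp flip: ennreal_mult)
      also have "ennreal (B * (?l * (indicator K x * \<bar>g (T x)\<bar> powr p) + ?l * (indicator K y * \<bar>g (T y)\<bar> powr p)))
          = ennreal B * (?k z * h (fst z) + ?k z * h (snd z))"
        unfolding z h_def using AB l0 by (auto simp: indicator_def simp flip: ennreal_mult ennreal_plus)
      finally show "ennreal (\<bar>c (fst z) * g (T (fst z)) - c (snd z) * g (T (snd z))\<bar> powr p / norm (fst z - snd z) powr ?m) * indicator (\<Omega> \<times> \<Omega>) z
         \<le> ennreal A * (H (map_prod T T z) * indicator (K \<times> K) z) + ennreal B * (?k z * h (fst z) + ?k z * h (snd z))"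
        unfolding z by simp
    qed
    also have "\<dots> = (\<integral>\<^sup>+z. ennreal A * (H (map_prod T T z) * indicator (K \<times> K) z) + ennreal B * (?k z * h (fst z) + ?k z * h (snd z)) \<partial>lebesgue)"
      by (simp add: nn_integral_completion)
    also have "\<dots> = ennreal A * (\<integral>\<^sup>+z. H (map_prod T T z) * indicator (K \<times> K) z \<partial>lebesgue)
       + ennreal B * ((\<integral>\<^sup>+z. ?k z * h (fst z) \<partial>lebesgue) + (\<integral>\<^sup>+z. ?k z * h (snd z) \<partial>lebesgue))"
    proof -
      note [measurable] = HT(1) kp(3,4)
      show ?thesis
        by (subst nn_integral_add, measurable, subst nn_integral_cmult, measurable, subst nn_integral_cmult, measurable,
            subst nn_integral_add, measurable)
    qed
    also have "\<dots> = ennreal A * (\<integral>\<^sup>+z. H (map_prod T T z) * indicator (K \<times> K) z \<partial>lborel)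
       + ennreal B * (I * (\<integral>\<^sup>+x. h x \<partial>lborel) + I * (\<integral>\<^sup>+x. h x \<partial>lborel))"
      by (simp only: nn_integral_completion kp(1,2))
    also have "\<dots> \<le> ennreal A * (ennreal C1 * gagliardo_power (T ` K) \<theta> p g)
       + ennreal B * (I * (ennreal C2 * Lp_power (T ` K) p g) + I * (ennreal C2 * Lp_power (T ` K) p g))"
    proof -
      have "(\<integral>\<^sup>+z. H (map_prod T T z) * indicator (K \<times> K) z \<partial>lborel) \<le> ennreal C1 * gagliardo_power (T ` K) \<theta> p g"
        using HT(2) unfolding C1_def gagliardo_power_def Hg .
      moreover have "(\<integral>\<^sup>+x. h x \<partial>lborel) \<le> ennreal C2 * Lp_power (T ` K) p g"
        using Lp_power_compose(2)[OF K T g, of p] unfolding C2_def h_def Lp_power_def .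
      ultimately show ?thesis by (intro add_mono mult_left_mono) auto
    qed
    also have "\<dots> = ennreal (A * C1) * gagliardo_power (T ` K) \<theta> p g + ennreal (B * (i * C2 + i * C2)) * Lp_power (T ` K) p g"
    proof -
      have "ennreal (B * (i * C2 + i * C2)) = ennreal B * (I * ennreal C2 + I * ennreal C2)"
        unfolding Ii by (simp only: ennreal_mult ennreal_plus mult_nonneg_nonneg add_nonneg_nonneg AB C12 i0)
      moreover have "ennreal (A * C1) = ennreal A * ennreal C1" using AB C12 by (intro ennreal_mult) auto
      ultimately show ?thesis by (simp only: distrib_left distrib_right mult.assoc)
    qed
    also have "\<dots> \<le> ennreal C * gagliardo_power (T ` K) \<theta> p g + ennreal C * Lp_power (T ` K) p g"
      unfolding C_def using AB C12 i0 by (intro add_mono mult_right_mono ennreal_leI) auto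
    finally show ?thesis by (simp add: distrib_left)
  qed
  then show ?thesis using C0 by blast
qed

section \<open>First order weak derivatives control the fractional seminorm locally\<close>

text \<open>For fixed \<open>t\<close>, substituting \<open>u = x - y\<close> turns the point \<open>x + t(y - x)\<close> into a translate \<open>x - tu\<close> of \<open>x\<close>, so the integral
  factorizes, and the product does not depend on \<open>t\<close>.\<close>

lemma nn_integral_kernel_segment:
  fixes h :: "real^'n \<Rightarrow> ennreal" and \<theta> p :: real
  assumes h [measurable]: "h \<in> borel_measurable borel"
  shows "(\<integral>\<^sup>+z. ennreal (slobodeckij_kernel \<theta> p (fst z - snd z)) *
      (\<integral>\<^sup>+t. h (fst z + t *\<^sub>R (snd z - fst z)) * indicator {0..1} t \<partial>lborel) \<partial>(lborel :: ((real^'n) \<times> (real^'n)) measure))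
    = (\<integral>\<^sup>+z. ennreal (slobodeckij_kernel \<theta> p (z :: real^'n)) \<partial>lborel) * (\<integral>\<^sup>+x. h x \<partial>lborel)" (is "?L = ?I * ?H")
proof -
  let ?k = "\<lambda>z :: real^'n. ennreal (slobodeckij_kernel \<theta> p z)"
  let ?f = "\<lambda>z t. ?k (fst z - snd z) * (h (fst z + t *\<^sub>R (snd z - fst z)) * indicator {0..1} t)"
  have fm: "(\<lambda>(z, t). ?f z t) \<in> borel_measurable (lborel \<Otimes>\<^sub>M lborel)"
  proof -
    have "(\<lambda>w::((real^'n)\<times>(real^'n))\<times>real. fst (fst w) + snd w *\<^sub>R (snd (fst w) - fst (fst w))) \<in> borel_measurable borel"
      by (intro borel_measurable_continuous_onI continuous_intros)
    then have 1: "(\<lambda>w::((real^'n)\<times>(real^'n))\<times>real. h (fst (fst w) + snd w *\<^sub>R (snd (fst w) - fst (fst w)))) \<in> borel_measurable borel"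
      by measurable
    have "(\<lambda>w::((real^'n)\<times>(real^'n))\<times>real. fst (fst w) - snd (fst w)) \<in> borel_measurable borel"
      by (intro borel_measurable_continuous_onI continuous_intros)
    then have 2: "(\<lambda>w::((real^'n)\<times>(real^'n))\<times>real. ?k (fst (fst w) - snd (fst w))) \<in> borel_measurable borel"
      by measurable
    have "(snd :: ((real^'n)\<times>(real^'n))\<times>real \<Rightarrow> real) \<in> borel_measurable borel"
      by (intro borel_measurable_continuous_onI continuous_intros)
    then have 3: "(\<lambda>w::((real^'n)\<times>(real^'n))\<times>real. indicator {0..1} (snd w) :: ennreal) \<in> borel_measurable borel"
      by measurable
    have "(\<lambda>w. ?f (fst w) (snd w)) \<in> borel_measurable borel" using 1 2 3 by measurable
    then show ?thesis by (simp add: lborel_prod case_prod_unfold)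
  qed
  have "?L = (\<integral>\<^sup>+z. (\<integral>\<^sup>+t. ?f z t \<partial>lborel) \<partial>lborel)"
    by (intro nn_integral_cong nn_integral_cmult[symmetric]) measurable
  also have "\<dots> = (\<integral>\<^sup>+t. (\<integral>\<^sup>+z. ?f z t \<partial>lborel) \<partial>lborel)" by (rule lborel_pair.Fubini'[OF fm, symmetric])
  also have "\<dots> = (\<integral>\<^sup>+t. (?I * ?H) * indicator {0..1} (t::real) \<partial>lborel)"
  proof (rule nn_integral_cong)
    fix t :: real
    let ?g = "\<lambda>z. ?k (fst z - snd z) * h (fst z + t *\<^sub>R (snd z - fst z))"
    have gm: "?g \<in> borel_measurable borel"
    proof -
      have "(\<lambda>w::(real^'n)\<times>(real^'n). fst w + t *\<^sub>R (snd w - fst w)) \<in> borel_measurable borel"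
        "(\<lambda>w::(real^'n)\<times>(real^'n). fst w - snd w) \<in> borel_measurable borel"
        by (intro borel_measurable_continuous_onI continuous_intros)+
      then show ?thesis by measurable
    qed
    have gl: "?g \<in> borel_measurable lebesgue" using gm by (intro measurable_completion) simp
    have "(\<integral>\<^sup>+z. ?g z \<partial>lborel) = (\<integral>\<^sup>+x. \<integral>\<^sup>+y. ?k (x - y) * h (x + t *\<^sub>R (y - x)) \<partial>lborel \<partial>lborel)"
      unfolding nn_integral_lebesgue_prod(1)[OF gl] by simp
    also have "\<dots> = (\<integral>\<^sup>+x. \<integral>\<^sup>+u. ?k u * h (x - t *\<^sub>R u) \<partial>lborel \<partial>lborel)"
    proof (rule nn_integral_cong)
      fix x :: "real^'n"
      have m: "(\<lambda>u. ?k u * h (x - t *\<^sub>R u)) \<in> borel_measurable borel" by measurable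
      have "x + t *\<^sub>R (y - x) = x - t *\<^sub>R (x - y)" for y by (simp add: algebra_simps)
      then show "(\<integral>\<^sup>+y. ?k (x - y) * h (x + t *\<^sub>R (y - x)) \<partial>lborel) = (\<integral>\<^sup>+u. ?k u * h (x - t *\<^sub>R u) \<partial>lborel)"
        using nn_integral_lborel_reflect[OF m, of x] by simp
    qed
    also have "\<dots> = (\<integral>\<^sup>+u. \<integral>\<^sup>+x. ?k u * h (x - t *\<^sub>R u) \<partial>lborel \<partial>lborel)"
    proof (rule lborel_pair.Fubini')
      have "(\<lambda>w::(real^'n)\<times>(real^'n). snd w - t *\<^sub>R fst w) \<in> borel_measurable borel"
        "(fst::(real^'n)\<times>(real^'n) \<Rightarrow> real^'n) \<in> borel_measurable borel"
        by (intro borel_measurable_continuous_onI continuous_intros)+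
      then have "(\<lambda>w::(real^'n)\<times>(real^'n). ?k (fst w) * h (snd w - t *\<^sub>R fst w)) \<in> borel_measurable borel" by measurable
      then show "(\<lambda>(u, x). ?k u * h (x - t *\<^sub>R u)) \<in> borel_measurable (lborel \<Otimes>\<^sub>M lborel)"
        by (simp add: lborel_prod case_prod_unfold)
    qed
    also have "\<dots> = (\<integral>\<^sup>+u. ?k u * ?H \<partial>lborel)"
    proof (rule nn_integral_cong)
      fix u :: "real^'n"
      have "(\<lambda>x. h (x - t *\<^sub>R u)) \<in> borel_measurable lborel" by measurable
      then have "(\<integral>\<^sup>+x. ?k u * h (x - t *\<^sub>R u) \<partial>lborel) = ?k u * (\<integral>\<^sup>+x. h (x - t *\<^sub>R u) \<partial>lborel)"
        by (rule nn_integral_cmult)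
      then show "(\<integral>\<^sup>+x. ?k u * h (x - t *\<^sub>R u) \<partial>lborel) = ?k u * ?H"
        unfolding nn_integral_lborel_shift[OF h] .
    qed
    also have "\<dots> = ?I * ?H" by (rule nn_integral_multc) measurable
    finally have e: "(\<integral>\<^sup>+z. ?g z \<partial>lborel) = ?I * ?H" .
    have "(\<integral>\<^sup>+z. ?f z t \<partial>lborel) = (\<integral>\<^sup>+z. ?g z * indicator {0..1} t \<partial>lborel)" by (simp add: mult.assoc)
    also have "\<dots> = (\<integral>\<^sup>+z. ?g z \<partial>lborel) * indicator {0..1} t" using gm by (intro nn_integral_multc) simp
    finally show "(\<integral>\<^sup>+z. ?f z t \<partial>lborel) = (?I * ?H) * indicator {0..1} t" unfolding e .
  qed
  also have "\<dots> = ?I * ?H" by (simp add: nn_integral_cmult_indicator)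
  finally show ?thesis .
qed

text \<open>The increment along a segment is the integral of the directional derivative; Jensen's inequality
  moves the \<open>p\<close>-th power inside. The function \<open>d i\<close> may differ from the partial derivative off the segment.\<close>

lemma segment_increment_bound:
  fixes f :: "real^'n \<Rightarrow> real" and d :: "'n \<Rightarrow> real^'n \<Rightarrow> real"
  assumes "\<And>i. continuous_on UNIV (d i)" "p \<ge> 1" "\<And>k. Ck_on k UNIV f"
    and seg: "\<And>t i. 0 \<le> t \<Longrightarrow> t \<le> 1 \<Longrightarrow> partial_deriv i f (x + t *\<^sub>R (y - x)) = d i (x + t *\<^sub>R (y - x))"
  shows "ennreal (\<bar>f x - f y\<bar> powr p) \<le> ennreal (norm (x - y) powr p) *
    (\<integral>\<^sup>+t. ennreal (real CARD('n) powr p * (\<Sum>i\<in>UNIV. \<bar>d i (x + t *\<^sub>R (y - x))\<bar> powr p)) * indicator {0..1} t \<partial>lborel)"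
proof -
  let ?\<gamma> = "\<lambda>t::real. x + t *\<^sub>R (y - x)"
  let ?g = "\<lambda>t. \<Sum>i\<in>UNIV. d i (?\<gamma> t) * (y - x) $ i"
  let ?s = "\<lambda>t. \<Sum>i\<in>UNIV. \<bar>d i (?\<gamma> t)\<bar>"
  let ?D = "norm (x - y)"
  have dc: "continuous_on UNIV (\<lambda>t. d i (?\<gamma> t))" for i
    by (rule continuous_on_compose2[OF assms(1)]) (auto intro!: continuous_intros)
  have gc: "continuous_on UNIV ?g" by (intro continuous_intros dc)
  have sc: "continuous_on UNIV ?s" by (intro continuous_intros dc)
  have ftc: "(\<integral>t. ?g t * indicator {0..1} t \<partial>lborel) = f (?\<gamma> 1) - f (?\<gamma> 0)"
  proof (rule integral_FTC_Icc_real)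
    fix t :: real assume t: "0 \<le> t" "t \<le> 1"
    have "(f has_derivative (\<lambda>h. \<Sum>i\<in>UNIV. partial_deriv i f (?\<gamma> t) * h $ i)) (at (?\<gamma> t))"
      using C1_has_derivative[OF open_UNIV assms(3)] by simp
    moreover have "(?\<gamma> has_derivative (\<lambda>h. h *\<^sub>R (y - x))) (at t)" by (auto intro!: derivative_eq_intros)
    ultimately have "((\<lambda>t. f (?\<gamma> t)) has_derivative (\<lambda>h. \<Sum>i\<in>UNIV. partial_deriv i f (?\<gamma> t) * (h *\<^sub>R (y - x)) $ i)) (at t)"
      using has_derivative_compose by blast
    moreover have "(\<lambda>h. \<Sum>i\<in>UNIV. partial_deriv i f (?\<gamma> t) * (h *\<^sub>R (y - x)) $ i) = (*) (?g t)"
      by (rule ext) (simp add: seg[OF t] sum_distrib_left mult_ac)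
    ultimately show "((\<lambda>t. f (?\<gamma> t)) has_real_derivative ?g t) (at t)" by (simp add: has_field_derivative_def)
    show "isCont ?g t" using gc by (simp add: continuous_on_eq_continuous_at)
  qed simp
  have gi: "integrable lborel (\<lambda>t. indicator {0..1::real} t *\<^sub>R ?g t)" "integrable lborel (\<lambda>t. indicator {0..1::real} t *\<^sub>R ?s t)"
    by (rule borel_integrable_compact[OF compact_Icc continuous_on_subset[OF gc subset_UNIV]],
        rule borel_integrable_compact[OF compact_Icc continuous_on_subset[OF sc subset_UNIV]])
  then have si: "integrable lborel (\<lambda>t. ?s t * indicator {0..1} t)" by (simp add: mult.commute)
  have "\<bar>f x - f y\<bar> = \<bar>\<integral>t. ?g t * indicator {0..1} t \<partial>lborel\<bar>" unfolding ftc by simp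
  also have "\<dots> \<le> (\<integral>t. \<bar>?g t * indicator {0..1} t\<bar> \<partial>lborel)" by (rule integral_abs_bound)
  also have "\<dots> \<le> (\<integral>t. ?D * (?s t * indicator {0..1} t) \<partial>lborel)"
  proof (rule Bochner_Integration.integral_mono)
    show "integrable lborel (\<lambda>t. \<bar>?g t * indicator {0..1} t\<bar>)" using gi(1) by (intro integrable_abs) (simp add: mult.commute)
    show "integrable lborel (\<lambda>t. ?D * (?s t * indicator {0..1} t))" using si by simp
    fix t :: real
    have cb: "\<bar>(y - x) $ i\<bar> \<le> ?D" for i
      using component_le_norm_cart[of "y - x" i] by (simp only: norm_minus_commute)
    have "\<bar>?g t\<bar> \<le> (\<Sum>i\<in>UNIV. \<bar>d i (?\<gamma> t)\<bar> * ?D)"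
      by (rule order_trans[OF sum_abs]) (auto intro!: sum_mono mult_left_mono cb simp: abs_mult simp del: vector_minus_component)
    then have "\<bar>?g t\<bar> \<le> ?D * ?s t" by (simp add: sum_distrib_left mult.commute)
    then show "\<bar>?g t * indicator {0..1} t\<bar> \<le> ?D * (?s t * indicator {0..1} t)" by (simp add: indicator_def)
  qed
  also have "\<dots> = ?D * (\<integral>t. ?s t * indicator {0..1} t \<partial>lborel)" by simp
  finally have "\<bar>f x - f y\<bar> powr p \<le> (?D * (\<integral>t. ?s t * indicator {0..1} t \<partial>lborel)) powr p"
    using assms(2) by (intro powr_mono2) auto
  also have "\<dots> = ?D powr p * (\<integral>t. ?s t * indicator {0..1} t \<partial>lborel) powr p"
    by (intro powr_mult)
  finally have "ennreal (\<bar>f x - f y\<bar> powr p) \<le> ennreal (?D powr p) * ennreal ((\<integral>t. ?s t * indicator {0..1} t \<partial>lborel) powr p)"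
    by (simp add: ennreal_leI flip: ennreal_mult)
  also have "\<dots> \<le> ennreal (?D powr p) * (\<integral>\<^sup>+t. ennreal (?s t powr p * indicator {0..1} t) \<partial>lborel)"
  proof (intro mult_left_mono jensen_powr assms(2) si)
    show "?s \<in> borel_measurable lborel" using sc by (simp add: borel_measurable_continuous_onI)
  qed (auto intro: sum_nonneg)
  also have "\<dots> \<le> ennreal (?D powr p) *
    (\<integral>\<^sup>+t. ennreal (real CARD('n) powr p * (\<Sum>i\<in>UNIV. \<bar>d i (?\<gamma> t)\<bar> powr p)) * indicator {0..1} t \<partial>lborel)"
  proof (intro mult_left_mono nn_integral_mono)
    fix t :: real
    have "?s t powr p \<le> real CARD('n) powr p * (\<Sum>i\<in>UNIV. \<bar>d i (?\<gamma> t)\<bar> powr p)"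
      using assms(2) by (intro powr_sum_le) auto
    then show "ennreal (?s t powr p * indicator {0..1} t) \<le> ennreal (real CARD('n) powr p * (\<Sum>i\<in>UNIV. \<bar>d i (?\<gamma> t)\<bar> powr p)) * indicator {0..1} t"
      by (auto simp: indicator_def intro: ennreal_leI)
  qed simp
  finally show ?thesis .
qed

definition mi_unit :: "'n \<Rightarrow> 'n \<Rightarrow> nat" where
  "mi_unit i = (\<lambda>_. 0)(i := Suc 0)"

lemma mi_order_unit: "mi_order (mi_unit i) = 1"
  using mi_order_upd[of "\<lambda>_. 0" i] by (simp add: mi_unit_def)

lemma mi_deriv_unit: "Ck_on 1 UNIV f \<Longrightarrow> mi_deriv (mi_unit i) f x = partial_deriv i f x"
  using mi_deriv_upd[of UNIV "\<lambda>_. 0" f x i] by (simp add: mi_unit_def)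

lemma convolution_zero_outside_Lp:
  fixes f :: "real^'n \<Rightarrow> real"
  assumes "integrable lebesgue (zero_outside K f)" "K \<subseteq> \<Omega>" "\<epsilon> > 0" "p \<ge> 1"
  shows "(\<integral>\<^sup>+x. ennreal (\<bar>convolution (zero_outside K f) (mollifier \<epsilon>) x\<bar> powr p) \<partial>lborel) \<le> Lp_power \<Omega> p f"
proof -
  have "(\<integral>\<^sup>+x. ennreal (\<bar>convolution (zero_outside K f) (mollifier \<epsilon>) x\<bar> powr p) \<partial>lborel)
      \<le> (\<integral>\<^sup>+x. ennreal (\<bar>zero_outside K f x\<bar> powr p) \<partial>lborel)"
    by (rule convolution_mollifier_Lp[OF assms(1,3,4)])
  also have "\<dots> \<le> Lp_power \<Omega> p f"
    unfolding Lp_power_def using assms(2) by (intro nn_integral_mono) (auto simp: zero_outside_def indicator_def)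
  finally show ?thesis .
qed

text \<open>For a mollified function, near pairs of points are handled by the segment estimate and far pairs
  by the triangle inequality.\<close>

lemma gagliardo_power_mollified:
  fixes Q V :: "(real^'n) set"
  assumes Q: "compact Q" and \<delta>: "0 < \<delta>" "\<delta> \<le> 1" "(\<Union>x\<in>Q. cball x \<delta>) \<subseteq> V"
    and p: "1 < p" "0 < \<theta>" "\<theta> < 1" and \<epsilon>: "0 < \<epsilon>" "\<epsilon> < \<delta> / 2"
    and g: "locally_integrable_on g V" and d: "\<And>i. d i \<in> weak_derivs V (mi_unit i) g"
  defines "K \<equiv> (\<Union>x\<in>Q. cball x \<delta>)"
    and "B \<equiv> 2 powr p * (\<delta> / 2) powr (- p) * real CARD('n) powr p"
    and "I \<equiv> (\<integral>\<^sup>+z. ennreal (slobodeckij_kernel \<theta> p (z :: real^'n)) \<partial>lborel)"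
  shows "gagliardo_power Q \<theta> p (convolution (zero_outside K g) (mollifier \<epsilon>))
    \<le> ennreal B * I * ((\<Sum>i\<in>UNIV. Lp_power V p (d i)) + 2 * Lp_power V p g)"
proof -
  let ?m = "real CARD('n) + \<theta> * p"
  let ?k = "\<lambda>z :: real^'n. slobodeckij_kernel \<theta> p z"
  define r where "r = \<delta> / 2"
  have r: "0 < r" "r < 1" using \<delta> by (auto simp: r_def)
  define f where "f = convolution (zero_outside K g) (mollifier \<epsilon>)"
  define D where "D i = convolution (zero_outside K (d i)) (mollifier \<epsilon>)" for i
  define N where "N = real CARD('n) powr p"
  define A where "A = 2 powr p * r powr (- p)"
  have N1: "N \<ge> 1" unfolding N_def using p by (intro ge_one_powr_ge_zero) auto
  have A1: "A \<ge> 1"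
  proof -
    have "1 \<le> 2 powr p" "1 \<le> r powr (- p)" using p r ge_one_powr_ge_zero[of 2 p] powr_mono'[of "- p" 0 r] by auto
    then have "1 * 1 \<le> 2 powr p * r powr (- p)" by (intro mult_mono) auto
    then show ?thesis by (simp add: A_def)
  qed
  have BAN: "B = A * N" by (simp add: B_def A_def N_def r_def)
  have cK: "compact K" unfolding K_def by (rule compact_thickening[OF Q])
  have KV: "K \<subseteq> V" using \<delta>(3) by (simp add: K_def)
  have dl: "locally_integrable_on (d i) V" for i using d[of i] by (simp add: weak_derivs_def)
  have gi: "integrable lebesgue (zero_outside K g)" by (rule locally_integrable_zero_outside[OF g cK KV])
  have di: "integrable lebesgue (zero_outside K (d i))" for i by (rule locally_integrable_zero_outside[OF dl cK KV])
  have \<rho>: "(mollifier \<epsilon> :: real^'n \<Rightarrow> real) \<in> test_functions UNIV" by (rule mollifier_test[OF \<epsilon>(1)])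
  have fC: "Ck_on k UNIV f" for k unfolding f_def by (rule Ck_on_convolution[OF gi \<rho>])
  have Dc: "continuous_on UNIV (D i)" for i unfolding D_def by (rule convolution_continuous[OF di \<rho>])
  \<comment> \<open>Up to distance \<open>r = \<delta> / 2\<close> from \<open>Q\<close>, the support of the translated mollifier stays in \<open>K\<close>.\<close>
  have fD: "partial_deriv i f x = D i x" if xr: "x \<in> (\<Union>x\<in>Q. cball x r)" for i x
  proof -
    obtain q where q: "q \<in> Q" "dist q x \<le> r" using xr by auto
    have "cball x \<epsilon> \<subseteq> K"
    proof
      fix w assume "w \<in> cball x \<epsilon>"
      then have "dist q w \<le> \<delta>" using q(2) \<epsilon>(2) dist_triangle[of q w x] by (simp add: r_def)
      then show "w \<in> K" using q(1) by (auto simp: K_def)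
    qed
    from mi_deriv_convolution_weak[OF g d cK KV \<epsilon>(1) this, of i]
    show ?thesis unfolding f_def[symmetric] D_def using mi_deriv_unit[OF fC, of i x] by simp
  qed
  define H where "H x = ennreal (N * (\<Sum>i\<in>UNIV. \<bar>D i x\<bar> powr p))" for x
  have Hm [measurable]: "H \<in> borel_measurable borel"
    unfolding H_def[abs_def] using borel_measurable_continuous_onI[OF Dc] by measurable
  \<comment> \<open>The factor \<open>S x y\<close> comes from pairs at distance less than \<open>r\<close>, and \<open>w x\<close> and \<open>w y\<close> from the other pairs.\<close>
  define S where "S x y = (\<integral>\<^sup>+t. H (x + t *\<^sub>R (y - x)) * indicator {0..1} t \<partial>lborel)" for x y
  define w where "w x = ennreal (\<bar>f x\<bar> powr p)" for x
  have fm: "f \<in> borel_measurable borel" by (rule borel_measurable_continuous_onI[OF Ck_on_imp_continuous[OF fC]])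
  have wm: "w \<in> borel_measurable lebesgue" unfolding w_def[abs_def] using fm by (intro measurable_completion) simp
  have k0: "?k z \<ge> 0" for z by (rule slobodeckij_kernel_nonneg)
  have pt: "ennreal (\<bar>f x - f y\<bar> powr p / norm (x - y) powr ?m) \<le> ennreal A * (ennreal (?k (x - y)) * S x y
      + (ennreal (?k (x - y)) * w x + ennreal (?k (x - y)) * w y))" if xy: "x \<in> Q" "y \<in> Q" for x y
  proof (cases "norm (x - y) < r")
    case True
    let ?D = "norm (x - y)"
    have "ennreal (\<bar>f x - f y\<bar> powr p) \<le> ennreal (?D powr p) * S x y"
      unfolding S_def H_def N_def
    proof (rule segment_increment_bound)
      fix t :: real and i assume t: "0 \<le> t" "t \<le> 1"
      have "norm (t *\<^sub>R (y - x)) \<le> 1 * norm (y - x)" unfolding norm_scaleR using t by (intro mult_right_mono) auto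
      then have "dist x (x + t *\<^sub>R (y - x)) \<le> r" using True by (simp add: dist_norm norm_minus_commute)
      then show "partial_deriv i f (x + t *\<^sub>R (y - x)) = D i (x + t *\<^sub>R (y - x))" using xy by (intro fD) auto
    qed (use Dc fC p in auto)
    then have "ennreal (1 / ?D powr ?m) * ennreal (\<bar>f x - f y\<bar> powr p) \<le> ennreal (1 / ?D powr ?m) * (ennreal (?D powr p) * S x y)"
      by (rule mult_left_mono) simp
    also have "\<dots> = ennreal (?k (x - y)) * S x y"
      using True r by (simp add: slobodeckij_kernel_def mult.assoc[symmetric] flip: ennreal_mult)
    also have "\<dots> \<le> ennreal (?k (x - y)) * S x y + (ennreal (?k (x - y)) * w x + ennreal (?k (x - y)) * w y)" by simp
    also have "\<dots> = 1 * \<dots>" by simp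
    also have "\<dots> \<le> ennreal A * (ennreal (?k (x - y)) * S x y + (ennreal (?k (x - y)) * w x + ennreal (?k (x - y)) * w y))"
      using A1 by (intro mult_right_mono) (auto simp: ennreal_leI simp flip: ennreal_1)
    finally show ?thesis by (simp flip: ennreal_mult)
  next
    case False
    let ?D = "norm (x - y)"
    have "\<bar>f x - f y\<bar> powr p \<le> (\<bar>f x\<bar> + \<bar>f y\<bar>) powr p" using p by (intro powr_mono2) auto
    also have "\<dots> \<le> 2 powr p * (\<bar>f x\<bar> powr p + \<bar>f y\<bar> powr p)" using p by (intro powr_add_le) auto
    finally have 1: "\<bar>f x - f y\<bar> powr p / ?D powr ?m \<le> 2 powr p * (\<bar>f x\<bar> powr p + \<bar>f y\<bar> powr p) / ?D powr ?m"
      by (rule divide_right_mono) simp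
    \<comment> \<open>Pairs at distance at least \<open>r\<close> lose only the factor \<open>r\<^sup>-\<^sup>p\<close> when \<open>1\<close> is replaced by \<open>min(1, |x - y|)\<^sup>p\<close>.\<close>
    have "1 = r powr (- p) * r powr p" using r by (simp flip: powr_add)
    also have "\<dots> \<le> r powr (- p) * min 1 ?D powr p"
      using False r p by (intro mult_left_mono powr_mono2) auto
    finally have "1 / ?D powr ?m \<le> r powr (- p) * min 1 ?D powr p / ?D powr ?m" by (rule divide_right_mono) simp
    then have "1 / ?D powr ?m \<le> r powr (- p) * ?k (x - y)" by (simp add: slobodeckij_kernel_def)
    then have 2: "(2 powr p * (\<bar>f x\<bar> powr p + \<bar>f y\<bar> powr p)) * (1 / ?D powr ?m)
        \<le> (2 powr p * (\<bar>f x\<bar> powr p + \<bar>f y\<bar> powr p)) * (r powr (- p) * ?k (x - y))"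
      by (rule mult_left_mono) auto
    have "\<bar>f x - f y\<bar> powr p / ?D powr ?m \<le> (2 powr p * (\<bar>f x\<bar> powr p + \<bar>f y\<bar> powr p)) * (1 / ?D powr ?m)"
      using 1 by simp
    also note 2
    also have "(2 powr p * (\<bar>f x\<bar> powr p + \<bar>f y\<bar> powr p)) * (r powr (- p) * ?k (x - y))
        = A * (?k (x - y) * \<bar>f x\<bar> powr p + ?k (x - y) * \<bar>f y\<bar> powr p)"
      unfolding A_def by (simp add: algebra_simps)
    finally have "\<bar>f x - f y\<bar> powr p / ?D powr ?m \<le> A * (?k (x - y) * \<bar>f x\<bar> powr p + ?k (x - y) * \<bar>f y\<bar> powr p)" .
    then have "ennreal (\<bar>f x - f y\<bar> powr p / ?D powr ?m) \<le> ennreal (A * (?k (x - y) * \<bar>f x\<bar> powr p + ?k (x - y) * \<bar>f y\<bar> powr p))"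
      by (rule ennreal_leI)
    also have "\<dots> = ennreal A * (ennreal (?k (x - y)) * w x + ennreal (?k (x - y)) * w y)"
      unfolding w_def using A1 k0 by (simp add: ennreal_mult ennreal_plus)
    also have "\<dots> \<le> ennreal A * (ennreal (?k (x - y)) * S x y + (ennreal (?k (x - y)) * w x + ennreal (?k (x - y)) * w y))"
      by (intro mult_left_mono) auto
    finally show ?thesis .
  qed
  let ?kz = "\<lambda>z::(real^'n)\<times>(real^'n). ennreal (?k (fst z - snd z))"
  note kp = nn_integral_kernel_product[OF wm, of \<theta> p, folded I_def]
  have Sm: "(\<lambda>z. ?kz z * S (fst z) (snd z)) \<in> borel_measurable lebesgue"
  proof -
    have c: "(\<lambda>u::((real^'n)\<times>(real^'n))\<times>real. fst (fst u) + snd u *\<^sub>R (snd (fst u) - fst (fst u))) \<in> borel_measurable borel"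
      "(snd::((real^'n)\<times>(real^'n))\<times>real \<Rightarrow> real) \<in> borel_measurable borel"
      by (intro borel_measurable_continuous_onI continuous_intros)+
    have "(\<lambda>u::((real^'n)\<times>(real^'n))\<times>real. H (fst (fst u) + snd u *\<^sub>R (snd (fst u) - fst (fst u))) * indicator {0..1} (snd u))
        \<in> borel_measurable borel" using c by measurable
    then have "(\<lambda>u::((real^'n)\<times>(real^'n))\<times>real. H (fst (fst u) + snd u *\<^sub>R (snd (fst u) - fst (fst u))) * indicator {0..1} (snd u))
        \<in> borel_measurable (lborel \<Otimes>\<^sub>M lborel)" by (simp add: lborel_prod)
    from lborel.borel_measurable_nn_integral_fst[OF this]
    have Sb: "(\<lambda>z. S (fst z) (snd z)) \<in> borel_measurable borel" by (simp add: S_def)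
    have "(\<lambda>z::(real^'n)\<times>(real^'n). fst z - snd z) \<in> borel_measurable borel"
      by (intro borel_measurable_continuous_onI continuous_intros)
    then have "(\<lambda>z. ?kz z * S (fst z) (snd z)) \<in> borel_measurable borel" using Sb by measurable
    then show ?thesis by (intro measurable_completion) simp
  qed
  have "gagliardo_power Q \<theta> p f \<le> (\<integral>\<^sup>+z. ennreal A * (?kz z * S (fst z) (snd z) + (?kz z * w (fst z) + ?kz z * w (snd z))) \<partial>lborel)"
    unfolding gagliardo_power_def
  proof (rule nn_integral_mono)
    fix z :: "(real^'n) \<times> (real^'n)"
    show "ennreal (\<bar>f (fst z) - f (snd z)\<bar> powr p / norm (fst z - snd z) powr ?m) * indicator (Q \<times> Q) z
      \<le> ennreal A * (?kz z * S (fst z) (snd z) + (?kz z * w (fst z) + ?kz z * w (snd z)))"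
      using pt[of "fst z" "snd z"] by (cases "z \<in> Q \<times> Q") (auto simp: mem_Times_iff)
  qed
  also have "\<dots> = ennreal A * ((\<integral>\<^sup>+z. ?kz z * S (fst z) (snd z) \<partial>lebesgue)
      + ((\<integral>\<^sup>+z. ?kz z * w (fst z) \<partial>lebesgue) + (\<integral>\<^sup>+z. ?kz z * w (snd z) \<partial>lebesgue)))"
  proof -
    note [measurable] = Sm kp(3,4)
    show ?thesis unfolding nn_integral_completion[symmetric, of lborel "\<lambda>z. ennreal A * _ z"]
      by (subst nn_integral_cmult, measurable, subst nn_integral_add, measurable, subst nn_integral_add, measurable)
  qed
  also have "\<dots> = ennreal A * (I * (\<integral>\<^sup>+x. H x \<partial>lborel) + (I * (\<integral>\<^sup>+x. w x \<partial>lborel) + I * (\<integral>\<^sup>+x. w x \<partial>lborel)))"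
    unfolding nn_integral_completion kp(1,2) S_def I_def nn_integral_kernel_segment[OF Hm] ..
  also have "\<dots> \<le> ennreal A * (I * (ennreal N * (\<Sum>i\<in>UNIV. Lp_power V p (d i)))
      + (I * (ennreal N * Lp_power V p g) + I * (ennreal N * Lp_power V p g)))"
  proof -
    have "(\<integral>\<^sup>+x. H x \<partial>lborel) = ennreal N * (\<Sum>i\<in>UNIV. \<integral>\<^sup>+x. ennreal (\<bar>D i x\<bar> powr p) \<partial>lborel)"
      unfolding H_def using borel_measurable_continuous_onI[OF Dc] N1
      by (subst nn_integral_sum[symmetric], measurable)
         (simp add: ennreal_mult sum_nonneg nn_integral_cmult flip: sum_ennreal)
    also have "\<dots> \<le> ennreal N * (\<Sum>i\<in>UNIV. Lp_power V p (d i))"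
      unfolding D_def using p by (intro mult_left_mono sum_mono convolution_zero_outside_Lp[OF di KV \<epsilon>(1)]) auto
    finally have 1: "(\<integral>\<^sup>+x. H x \<partial>lborel) \<le> ennreal N * (\<Sum>i\<in>UNIV. Lp_power V p (d i))" .
    have "(\<integral>\<^sup>+x. w x \<partial>lborel) \<le> 1 * Lp_power V p g"
      unfolding w_def f_def using p convolution_zero_outside_Lp[OF gi KV \<epsilon>(1), of p] by simp
    also have "\<dots> \<le> ennreal N * Lp_power V p g"
      using N1 by (intro mult_right_mono) (auto simp: ennreal_leI simp flip: ennreal_1)
    finally have 2: "(\<integral>\<^sup>+x. w x \<partial>lborel) \<le> ennreal N * Lp_power V p g" .
    show ?thesis by (intro mult_left_mono add_mono 1 2) auto
  qed
  also have "\<dots> = ennreal B * I * ((\<Sum>i\<in>UNIV. Lp_power V p (d i)) + 2 * Lp_power V p g)"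
    unfolding BAN using A1 N1 by (simp add: ennreal_mult distrib_left mult_2 mult_ac)
  finally show ?thesis unfolding f_def .
qed

text \<open>The bound for the mollified functions is uniform, so it passes to the limit by Fatou's lemma.\<close>

lemma gagliardo_power_local_bound:
  fixes Q V :: "(real^'n) set"
  assumes Q: "compact Q" "open V" "Q \<subseteq> V" and p: "1 < p" "0 < \<theta>" "\<theta> < 1"
  shows "\<exists>C\<ge>0. \<forall>g d. locally_integrable_on g V \<and> (\<forall>i. d i \<in> weak_derivs V (mi_unit i) g) \<longrightarrow>
    gagliardo_power Q \<theta> p g \<le> ennreal C * ((\<Sum>i\<in>UNIV. Lp_power V p (d i)) + Lp_power V p g)"
proof -
  obtain \<delta> where \<delta>: "\<delta> > 0" "\<delta> \<le> 1" "(\<Union>x\<in>Q. cball x \<delta>) \<subseteq> V"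
    using compact_open_thickening[OF Q] by metis
  let ?K = "\<Union>x\<in>Q. cball x \<delta>"
  define I where "I = (\<integral>\<^sup>+z. ennreal (slobodeckij_kernel \<theta> p (z :: real^'n)) \<partial>lborel)"
  have I: "I < \<infinity>" unfolding I_def by (rule slobodeckij_kernel_integrable) (use p in auto)
  define B where "B = 2 powr p * (\<delta> / 2) powr (- p) * real CARD('n) powr p"
  have B0: "B \<ge> 0" by (simp add: B_def)
  define C where "C = 2 * (B * enn2real I)"
  have "gagliardo_power Q \<theta> p g \<le> ennreal C * ((\<Sum>i\<in>UNIV. Lp_power V p (d i)) + Lp_power V p g)"
    if g: "locally_integrable_on g V" and d: "\<And>i. d i \<in> weak_derivs V (mi_unit i) g" for g and d :: "'n \<Rightarrow> real^'n \<Rightarrow> real"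
  proof -
    let ?G = "zero_outside ?K g"
    let ?R = "ennreal C * ((\<Sum>i\<in>UNIV. Lp_power V p (d i)) + Lp_power V p g)"
    have cK: "compact ?K" by (rule compact_thickening[OF Q(1)])
    have Gi: "integrable lebesgue ?G" by (rule locally_integrable_zero_outside[OF g cK \<delta>(3)])
    obtain R where R: "\<And>x. norm x \<ge> R \<Longrightarrow> ?G x = 0" by (rule zero_outside_bounded_support[OF cK]) blast
    let ?m = "\<lambda>\<epsilon>. convolution ?G (mollifier \<epsilon>)"
    have "\<forall>n. \<exists>\<epsilon>. 0 < \<epsilon> \<and> \<epsilon> < \<delta> / 2 \<and> (\<integral>\<^sup>+x. ennreal \<bar>?m \<epsilon> x - ?G x\<bar> \<partial>lborel) \<le> ennreal (1 / real (Suc n))"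
    proof
      fix n
      have "1 / real (Suc n) > 0" by simp
      from mollifier_tendsto_L1[OF Gi R this]
      obtain e where e: "e > 0" "\<And>\<epsilon>. 0 < \<epsilon> \<Longrightarrow> \<epsilon> < e \<Longrightarrow> (\<integral>\<^sup>+x. ennreal \<bar>?m \<epsilon> x - ?G x\<bar> \<partial>lborel) \<le> ennreal (1 / real (Suc n))"
        by blast
      then show "\<exists>\<epsilon>. 0 < \<epsilon> \<and> \<epsilon> < \<delta> / 2 \<and> (\<integral>\<^sup>+x. ennreal \<bar>?m \<epsilon> x - ?G x\<bar> \<partial>lborel) \<le> ennreal (1 / real (Suc n))"
        using \<delta>(1) e(2)[of "min e (\<delta> / 2) / 2"] by (intro exI[of _ "min e (\<delta> / 2) / 2"]) auto
    qed
    from choice[OF this] obtain \<epsilon> where "\<forall>n. 0 < \<epsilon> n \<and> \<epsilon> n < \<delta> / 2 \<and>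
        (\<integral>\<^sup>+x. ennreal \<bar>?m (\<epsilon> n) x - ?G x\<bar> \<partial>lborel) \<le> ennreal (1 / real (Suc n))" ..
    then have \<epsilon>: "\<And>n. \<epsilon> n > 0" "\<And>n. \<epsilon> n < \<delta> / 2"
      "\<And>n. (\<integral>\<^sup>+x. ennreal \<bar>?m (\<epsilon> n) x - ?G x\<bar> \<partial>lborel) \<le> ennreal (1 / real (Suc n))" by blast+
    let ?u = "\<lambda>n x. ?m (\<epsilon> n) x - ?G x"
    have mc: "continuous_on UNIV (?m (\<epsilon> n))" for n by (rule convolution_continuous[OF Gi mollifier_test[OF \<epsilon>(1)]])
    have um: "?u n \<in> borel_measurable lebesgue" for n
      using borel_measurable_lebesgue_continuous[OF mc] Gi by (intro borel_measurable_diff) auto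
    have ub: "(\<integral>\<^sup>+x. ennreal (norm (?u n x)) \<partial>lebesgue) \<le> ennreal (1 / real (Suc n))" for n
      using \<epsilon>(3)[of n] by (simp add: nn_integral_completion)
    have ui: "integrable lebesgue (?u n)" for n
      using um ub[of n] by (intro integrableI_bounded) (auto intro: le_less_trans)
    have "(\<lambda>n. LINT x|lebesgue. norm (?u n x)) \<longlonglongrightarrow> 0"
    proof (rule Lim_null_comparison)
      have "(LINT x|lebesgue. norm (?u n x)) \<le> 1 / real (Suc n)" for n
      proof -
        have "ennreal (LINT x|lebesgue. norm (?u n x)) \<le> ennreal (1 / real (Suc n))"
          using ub[of n] ui[of n] by (subst nn_integral_eq_integral[symmetric]) auto
        then show ?thesis by (subst (asm) ennreal_le_iff) auto
      qed
      then show "\<forall>\<^sub>F n in sequentially. norm (LINT x|lebesgue. norm (?u n x)) \<le> 1 / real (Suc n)"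
        by (intro always_eventually allI) simp
      show "(\<lambda>n. 1 / real (Suc n)) \<longlonglongrightarrow> 0" using LIMSEQ_inverse_real_of_nat by (simp add: inverse_eq_divide)
    qed
    \<comment> \<open>Convergence in \<open>L\<^sup>1\<close> gives convergence almost everywhere along a subsequence, hence of the integrand of the double
      integral for almost all pairs.\<close>
    from tendsto_L1_AE_subseq[OF ui this]
    obtain s where "AE x in lebesgue. (\<lambda>n. ?u (s n) x) \<longlonglongrightarrow> 0" by blast
    then have ae: "AE x in lebesgue. (\<lambda>n. ?m (\<epsilon> (s n)) x) \<longlonglongrightarrow> ?G x"
      by eventually_elim (rule LIM_zero_cancel)
    let ?e = "real CARD('n) + \<theta> * p"
    let ?h = "\<lambda>f z. ennreal (\<bar>f (fst z) - f (snd z)\<bar> powr p / norm (fst z - snd z) powr ?e) * indicator (Q \<times> Q) (z :: (real^'n) \<times> (real^'n))"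
    have QQ: "Q \<times> Q \<in> sets lebesgue" using compact_Times[OF Q(1) Q(1)] by (simp add: compact_imp_closed)
    have hm: "?h (?m (\<epsilon> n)) \<in> borel_measurable lebesgue" for n
    proof -
      have "(\<lambda>z::(real^'n)\<times>(real^'n). ?m (\<epsilon> n) (fst z) - ?m (\<epsilon> n) (snd z)) \<in> borel_measurable lebesgue"
        by (intro borel_measurable_lebesgue_continuous continuous_intros continuous_on_compose2[OF mc]) auto
      moreover have "(\<lambda>z::(real^'n)\<times>(real^'n). norm (fst z - snd z)) \<in> borel_measurable lebesgue"
        by (intro borel_measurable_lebesgue_continuous continuous_intros)
      ultimately show ?thesis using QQ by measurable
    qed
    have "AE z in lebesgue. ?h g z \<le> liminf (\<lambda>n. ?h (?m (\<epsilon> (s n))) z)"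
      using AE_fst_lebesgue[OF ae, where 'b = "real^'n"] AE_snd_lebesgue[OF ae, where 'a = "real^'n"]
    proof eventually_elim
      case (elim z)
      show ?case
      proof (cases "z \<in> Q \<times> Q")
        case True
        then have "fst z \<in> ?K" "snd z \<in> ?K" using \<delta>(1) by (force simp: mem_Times_iff)+
        then have l: "(\<lambda>n. ?m (\<epsilon> (s n)) (fst z)) \<longlonglongrightarrow> g (fst z)" "(\<lambda>n. ?m (\<epsilon> (s n)) (snd z)) \<longlonglongrightarrow> g (snd z)"
          using elim by simp_all
        have "(\<lambda>n. ?h (?m (\<epsilon> (s n))) z) \<longlonglongrightarrow> ?h g z"
        proof (cases "norm (fst z - snd z) = 0")
          case False
          have "(\<lambda>n. ennreal (\<bar>?m (\<epsilon> (s n)) (fst z) - ?m (\<epsilon> (s n)) (snd z)\<bar> powr p / norm (fst z - snd z) powr ?e))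
             \<longlonglongrightarrow> ennreal (\<bar>g (fst z) - g (snd z)\<bar> powr p / norm (fst z - snd z) powr ?e)"
            using l p False by (intro tendsto_ennrealI tendsto_divide tendsto_powr' tendsto_rabs tendsto_diff tendsto_const) auto
          then show ?thesis using True by simp
        qed simp
        then have "liminf (\<lambda>n. ?h (?m (\<epsilon> (s n))) z) = ?h g z" by (intro lim_imp_Liminf) auto
        then show ?thesis by simp
      qed simp
    qed
    then have "(\<integral>\<^sup>+z. ?h g z \<partial>lebesgue) \<le> (\<integral>\<^sup>+z. liminf (\<lambda>n. ?h (?m (\<epsilon> (s n))) z) \<partial>lebesgue)"
      by (rule nn_integral_mono_AE)
    also have "\<dots> \<le> liminf (\<lambda>n. \<integral>\<^sup>+z. ?h (?m (\<epsilon> (s n))) z \<partial>lebesgue)" by (rule nn_integral_liminf[OF hm])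
    also have "\<dots> \<le> ?R"
    proof (rule Liminf_le)
      have "(\<integral>\<^sup>+z. ?h (?m (\<epsilon> (s n))) z \<partial>lebesgue) \<le> ?R" for n
      proof -
        have "(\<integral>\<^sup>+z. ?h (?m (\<epsilon> (s n))) z \<partial>lebesgue) = gagliardo_power Q \<theta> p (?m (\<epsilon> (s n)))"
          by (simp add: gagliardo_power_def nn_integral_completion)
        also have "\<dots> \<le> ennreal B * I * ((\<Sum>i\<in>UNIV. Lp_power V p (d i)) + 2 * Lp_power V p g)"
          unfolding B_def I_def by (rule gagliardo_power_mollified[OF Q(1) \<delta> p \<epsilon>(1,2) g d])
        also have "\<dots> \<le> ennreal B * I * (2 * ((\<Sum>i\<in>UNIV. Lp_power V p (d i)) + Lp_power V p g))"
          by (intro mult_left_mono) (auto simp: distrib_left mult_2 intro: add_mono)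
        also have "\<dots> = ?R"
        proof -
          have "ennreal C = 2 * (ennreal B * I)"
            unfolding C_def using B0 I by (simp add: ennreal_mult)
          then show ?thesis by (simp add: mult_ac)
        qed
        finally show ?thesis .
      qed
      then show "\<forall>\<^sub>F n in sequentially. (\<integral>\<^sup>+z. ?h (?m (\<epsilon> (s n))) z \<partial>lebesgue) \<le> ?R"
        by (intro always_eventually allI)
    qed simp
    finally show ?thesis by (simp add: gagliardo_power_def nn_integral_completion)
  qed
  moreover have "C \<ge> 0" unfolding C_def using B0 by simp
  ultimately show ?thesis by blast
qed

section \<open>From integrals to norms\<close>

lemma ennreal_root_mono:
  assumes "a \<le> b" "p > 0" shows "ennreal_root p a \<le> ennreal_root p b"
proof (cases "b = \<infinity>")
  case False
  then have "a \<noteq> \<infinity>" "b < \<infinity>" using assms(1) by (auto simp: top_unique less_top)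
  then show ?thesis using False assms unfolding ennreal_root_def
    by (auto intro!: ennreal_leI powr_mono2 enn2real_mono)
qed (simp add: ennreal_root_def)

lemma ennreal_root_cmult:
  assumes "C \<ge> 0" "p > 0" shows "ennreal_root p (ennreal C * a) = ennreal (C powr (1 / p)) * ennreal_root p a"
proof (cases "a = \<infinity>")
  case True
  then show ?thesis using assms by (cases "C = 0") (auto simp: ennreal_root_def ennreal_mult_top)
next
  case False
  then have f: "ennreal C * a \<noteq> \<infinity>" by (simp add: ennreal_mult_eq_top_iff)
  have "enn2real (ennreal C * a) powr (1 / p) = C powr (1 / p) * enn2real a powr (1 / p)"
    using assms by (simp add: enn2real_mult powr_mult)
  then show ?thesis using f False by (simp add: ennreal_root_def ennreal_mult)
qed

text \<open>The \<open>p\<close>-th root is subadditive because \<open>u\<^sup>p + v\<^sup>p \<le> (u + v)\<^sup>p\<close> for \<open>p \<ge> 1\<close>.\<close>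

lemma ennreal_root_add:
  assumes "p \<ge> 1" shows "ennreal_root p (a + b) \<le> ennreal_root p a + ennreal_root p b"
proof (cases "a = \<infinity> \<or> b = \<infinity>")
  case False
  define x y where "x = enn2real a" and "y = enn2real b"
  have ab: "a = ennreal x" "b = ennreal y" "x \<ge> 0" "y \<ge> 0" using False by (auto simp: x_def y_def less_top)
  define u v where "u = x powr (1 / p)" and "v = y powr (1 / p)"
  have uv: "u \<ge> 0" "v \<ge> 0" "u powr p = x" "v powr p = y" using ab assms by (auto simp: u_def v_def powr_powr)
  have "u powr p + v powr p \<le> (u + v) powr p"
  proof (cases "u + v = 0")
    case True
    then have "u = 0" "v = 0" using uv(1,2) by auto
    then show ?thesis by simp
  next
    case False
    then have uvp: "u + v > 0" using uv(1,2) by simp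
    have s: "t powr p = t * t powr (p - 1)" if "t \<ge> 0" for t
      using that by (cases "t = 0") (auto simp: powr_mult_base)
    have "u * u powr (p - 1) + v * v powr (p - 1) \<le> u * (u + v) powr (p - 1) + v * (u + v) powr (p - 1)"
      using uv(1,2) assms by (intro add_mono mult_left_mono powr_mono2) auto
    also have "\<dots> = (u + v) * (u + v) powr (p - 1)" by (simp add: distrib_right)
    finally show ?thesis using s[of u] s[of v] s[of "u + v"] uv(1,2) by simp
  qed
  then have "x + y \<le> (u + v) powr p" using uv(3,4) by simp
  then have "(x + y) powr (1 / p) \<le> ((u + v) powr p) powr (1 / p)" using ab assms by (intro powr_mono2) auto
  also have "\<dots> = u + v" using uv(1,2) assms by (simp add: powr_powr)
  finally have "(x + y) powr (1 / p) \<le> u + v" .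
  moreover have "a + b = ennreal (x + y)" "x + y \<ge> 0" using ab by simp_all
  ultimately show ?thesis unfolding ennreal_root_def ab(1,2) u_def v_def
    using ab(3,4) by (simp add: ennreal_leI flip: ennreal_plus)
qed (auto simp: ennreal_root_def)

lemma ennreal_root_sum:
  assumes "p \<ge> 1" "finite I" shows "ennreal_root p (\<Sum>i\<in>I. a i) \<le> (\<Sum>i\<in>I. ennreal_root p (a i))"
  using assms(2)
proof induction
  case empty then show ?case by (simp add: ennreal_root_def)
next
  case (insert i I)
  have "ennreal_root p (a i + (\<Sum>i\<in>I. a i)) \<le> ennreal_root p (a i) + ennreal_root p (\<Sum>i\<in>I. a i)"
    by (rule ennreal_root_add[OF assms(1)])
  also have "\<dots> \<le> ennreal_root p (a i) + (\<Sum>i\<in>I. ennreal_root p (a i))"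
    using insert by (intro add_mono) auto
  finally show ?case using insert by simp
qed

lemma ennreal_root_finite_iff: "ennreal_root p a < \<infinity> \<longleftrightarrow> a < \<infinity>"
  by (auto simp: ennreal_root_def less_top)

text \<open>The cardinality as a factor makes this follow from the pointwise inequality \<open>(\<Sum> a\<^sub>i)\<^sup>p \<le> |I|\<^sup>p \<Sum> a\<^sub>i\<^sup>p\<close>.\<close>

lemma Lp_norm_sum:
  fixes f :: "'i \<Rightarrow> real^'n \<Rightarrow> real"
  assumes "finite I" "\<And>i. i \<in> I \<Longrightarrow> f i \<in> borel_measurable lebesgue" "p \<ge> 1" and \<Omega>: "\<Omega> \<in> sets borel"
  shows "Lp_norm \<Omega> p (\<lambda>x. \<Sum>i\<in>I. f i x) \<le> ennreal (real (card I)) * (\<Sum>i\<in>I. Lp_norm \<Omega> p (f i))"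
proof -
  let ?c = "real (card I) powr p"
  have \<Omega>': "\<Omega> \<in> sets lebesgue" using \<Omega> by simp
  have "Lp_power \<Omega> p (\<lambda>x. \<Sum>i\<in>I. f i x) \<le> (\<integral>\<^sup>+x. ennreal ?c * (\<Sum>i\<in>I. ennreal (\<bar>f i x\<bar> powr p) * indicator \<Omega> x) \<partial>lborel)"
    unfolding Lp_power_def
  proof (rule nn_integral_mono)
    fix x
    have "\<bar>\<Sum>i\<in>I. f i x\<bar> powr p \<le> (\<Sum>i\<in>I. \<bar>f i x\<bar>) powr p" using assms by (intro powr_mono2) auto
    also have "\<dots> \<le> ?c * (\<Sum>i\<in>I. \<bar>f i x\<bar> powr p)" using assms by (intro powr_sum_le) auto
    finally have "ennreal (\<bar>\<Sum>i\<in>I. f i x\<bar> powr p) \<le> ennreal ?c * (\<Sum>i\<in>I. ennreal (\<bar>f i x\<bar> powr p))"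
      by (simp add: ennreal_leI sum_nonneg flip: ennreal_mult)
    then show "ennreal (\<bar>\<Sum>i\<in>I. f i x\<bar> powr p) * indicator \<Omega> x \<le> ennreal ?c * (\<Sum>i\<in>I. ennreal (\<bar>f i x\<bar> powr p) * indicator \<Omega> x)"
      by (simp add: indicator_def)
  qed
  also have "\<dots> = (\<integral>\<^sup>+x. ennreal ?c * (\<Sum>i\<in>I. ennreal (\<bar>f i x\<bar> powr p) * indicator \<Omega> x) \<partial>lebesgue)"
    by (simp only: nn_integral_completion)
  also have "\<dots> = ennreal ?c * (\<Sum>i\<in>I. \<integral>\<^sup>+x. ennreal (\<bar>f i x\<bar> powr p) * indicator \<Omega> x \<partial>lebesgue)"
    using assms(2) \<Omega>' by (subst nn_integral_cmult) (auto intro!: nn_integral_sum arg_cong2[where f = times])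
  also have "\<dots> = ennreal ?c * (\<Sum>i\<in>I. Lp_power \<Omega> p (f i))"
    by (simp add: Lp_power_def nn_integral_completion)
  finally have "ennreal_root p (Lp_power \<Omega> p (\<lambda>x. \<Sum>i\<in>I. f i x)) \<le> ennreal_root p (ennreal ?c * (\<Sum>i\<in>I. Lp_power \<Omega> p (f i)))"
    using assms(3) by (intro ennreal_root_mono) auto
  also have "\<dots> = ennreal (real (card I)) * ennreal_root p (\<Sum>i\<in>I. Lp_power \<Omega> p (f i))"
    using assms(3) by (subst ennreal_root_cmult) (auto simp: powr_powr)
  also have "\<dots> \<le> ennreal (real (card I)) * (\<Sum>i\<in>I. ennreal_root p (Lp_power \<Omega> p (f i)))"
    using assms by (intro mult_left_mono ennreal_root_sum) auto
  finally show ?thesis by (simp add: Lp_norm_eq_root[OF \<Omega>])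
qed

lemma gagliardo_sum:
  fixes f :: "'i \<Rightarrow> real^'n \<Rightarrow> real"
  assumes "finite I" "\<And>i. i \<in> I \<Longrightarrow> f i \<in> borel_measurable lebesgue" "p \<ge> 1" and \<Omega>: "\<Omega> \<in> sets borel"
  shows "gagliardo \<Omega> \<theta> p (\<lambda>x. \<Sum>i\<in>I. f i x) \<le> ennreal (real (card I)) * (\<Sum>i\<in>I. gagliardo \<Omega> \<theta> p (f i))"
proof -
  let ?c = "real (card I) powr p" and ?m = "real CARD('n) + \<theta> * p"
  let ?h = "\<lambda>f z. ennreal (\<bar>f (fst z) - f (snd z)\<bar> powr p / norm (fst z - snd z) powr ?m) * indicator (\<Omega> \<times> \<Omega>) (z :: (real^'n) \<times> (real^'n))"
  have \<Omega>': "\<Omega> \<times> \<Omega> \<in> sets lebesgue" using \<Omega> by (intro sets_completionI_sets) (simp add: borel_Times)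
  have hm: "?h (f i) \<in> borel_measurable lebesgue" if "i \<in> I" for i
  proof -
    have "(\<lambda>w::(real^'n)\<times>(real^'n). f i (fst w)) \<in> borel_measurable lebesgue"
      "(\<lambda>w::(real^'n)\<times>(real^'n). f i (snd w)) \<in> borel_measurable lebesgue"
      using measurable_comp[OF measurable_fst_lebesgue assms(2)[OF that]]
        measurable_comp[OF measurable_snd_lebesgue assms(2)[OF that]] by (simp_all add: comp_def)
    moreover have "(\<lambda>w::(real^'n)\<times>(real^'n). norm (fst w - snd w)) \<in> borel_measurable lebesgue"
      by (intro borel_measurable_lebesgue_continuous continuous_intros)
    ultimately show ?thesis using \<Omega>' by measurable
  qed
  have "gagliardo_power \<Omega> \<theta> p (\<lambda>x. \<Sum>i\<in>I. f i x) \<le> (\<integral>\<^sup>+z. ennreal ?c * (\<Sum>i\<in>I. ?h (f i) z) \<partial>lborel)"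
    unfolding gagliardo_power_def
  proof (rule nn_integral_mono)
    fix z :: "(real^'n) \<times> (real^'n)"
    let ?d = "\<lambda>i. f i (fst z) - f i (snd z)" and ?D = "norm (fst z - snd z) powr ?m"
    have "\<bar>(\<Sum>i\<in>I. f i (fst z)) - (\<Sum>i\<in>I. f i (snd z))\<bar> powr p = \<bar>\<Sum>i\<in>I. ?d i\<bar> powr p" by (simp add: sum_subtractf)
    also have "\<dots> \<le> (\<Sum>i\<in>I. \<bar>?d i\<bar>) powr p" using assms by (intro powr_mono2) auto
    also have "\<dots> \<le> ?c * (\<Sum>i\<in>I. \<bar>?d i\<bar> powr p)" using assms by (intro powr_sum_le) auto
    finally have "\<bar>(\<Sum>i\<in>I. f i (fst z)) - (\<Sum>i\<in>I. f i (snd z))\<bar> powr p / ?D \<le> ?c * (\<Sum>i\<in>I. \<bar>?d i\<bar> powr p) / ?D"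
      by (rule divide_right_mono) simp
    also have "\<dots> = ?c * (\<Sum>i\<in>I. \<bar>?d i\<bar> powr p / ?D)"
      by (simp only: sum_divide_distrib[symmetric] times_divide_eq_right)
    finally have "ennreal (\<bar>(\<Sum>i\<in>I. f i (fst z)) - (\<Sum>i\<in>I. f i (snd z))\<bar> powr p / ?D) \<le> ennreal ?c * (\<Sum>i\<in>I. ennreal (\<bar>?d i\<bar> powr p / ?D))"
      by (simp add: ennreal_leI sum_nonneg flip: ennreal_mult)
    then show "ennreal (\<bar>(\<Sum>i\<in>I. f i (fst z)) - (\<Sum>i\<in>I. f i (snd z))\<bar> powr p / ?D) * indicator (\<Omega> \<times> \<Omega>) z
        \<le> ennreal ?c * (\<Sum>i\<in>I. ?h (f i) z)"
      by (simp add: indicator_def)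
  qed
  also have "\<dots> = (\<integral>\<^sup>+z. ennreal ?c * (\<Sum>i\<in>I. ?h (f i) z) \<partial>lebesgue)"
    by (simp only: nn_integral_completion)
  also have "\<dots> = ennreal ?c * (\<integral>\<^sup>+z. (\<Sum>i\<in>I. ?h (f i) z) \<partial>lebesgue)"
    using hm by (intro nn_integral_cmult borel_measurable_sum) auto
  also have "\<dots> = ennreal ?c * (\<Sum>i\<in>I. gagliardo_power \<Omega> \<theta> p (f i))"
    using hm by (subst nn_integral_sum) (auto simp: gagliardo_power_def nn_integral_completion)
  finally have "ennreal_root p (gagliardo_power \<Omega> \<theta> p (\<lambda>x. \<Sum>i\<in>I. f i x)) \<le> ennreal_root p (ennreal ?c * (\<Sum>i\<in>I. gagliardo_power \<Omega> \<theta> p (f i)))"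
    using assms(3) by (intro ennreal_root_mono) auto
  also have "\<dots> = ennreal (real (card I)) * ennreal_root p (\<Sum>i\<in>I. gagliardo_power \<Omega> \<theta> p (f i))"
    using assms(3) by (subst ennreal_root_cmult) (auto simp: powr_powr)
  also have "\<dots> \<le> ennreal (real (card I)) * (\<Sum>i\<in>I. ennreal_root p (gagliardo_power \<Omega> \<theta> p (f i)))"
    using assms by (intro mult_left_mono ennreal_root_sum) auto
  finally show ?thesis by (simp add: gagliardo_eq_root[OF \<Omega>])
qed

lemma Lp_norm_mult_compose:
  fixes T :: "real^'n \<Rightarrow> real^'n"
  assumes K: "compact K" "bilipschitz_on K T L" "T ` K \<subseteq> V" and "open \<Omega>" "open V"
    and c: "Ck_on 1 UNIV c" "\<And>x. x \<notin> K \<Longrightarrow> c x = 0" and "1 < p"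
  shows "\<exists>C\<ge>0. \<forall>g. zero_outside (T ` K) g \<in> borel_measurable lebesgue \<longrightarrow>
    Lp_norm \<Omega> p (\<lambda>x. c x * g (T x)) \<le> ennreal C * Lp_norm V p g"
proof -
  obtain M where M: "M > 0" "\<And>x. \<bar>c x\<bar> \<le> M" using C1_compact_support_bound[OF c(1) K(1) c(2)] by metis
  have L: "L > 0" using K(2) by (simp add: bilipschitz_on_def)
  define C where "C = M powr p * (2 * L * CARD('n)) ^ CARD('n)"
  have C: "C \<ge> 0" using L by (simp add: C_def)
  have "Lp_norm \<Omega> p (\<lambda>x. c x * g (T x)) \<le> ennreal (C powr (1 / p)) * Lp_norm V p g"
    if g: "zero_outside (T ` K) g \<in> borel_measurable lebesgue" for g
  proof -
    have "Lp_power \<Omega> p (\<lambda>x. c x * g (T x)) \<le> ennreal C * Lp_power (T ` K) p g"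
      unfolding C_def using \<open>1 < p\<close> by (intro Lp_power_mult_compose[OF K(1,2) g c(2) M(2)]) auto
    also have "\<dots> \<le> ennreal C * Lp_power V p g" by (intro mult_left_mono Lp_power_mono K(3)) simp
    finally have "ennreal_root p (Lp_power \<Omega> p (\<lambda>x. c x * g (T x))) \<le> ennreal_root p (ennreal C * Lp_power V p g)"
      using \<open>1 < p\<close> by (intro ennreal_root_mono) auto
    then show ?thesis using C \<open>1 < p\<close> \<open>open \<Omega>\<close> \<open>open V\<close> by (simp add: ennreal_root_cmult Lp_norm_eq_root)
  qed
  then show ?thesis by (intro exI[of _ "C powr (1 / p)"]) auto
qed

lemma gagliardo_mult_compose_local:
  fixes T :: "real^'n \<Rightarrow> real^'n"
  assumes K: "compact K" "bilipschitz_on K T L" "T ` K \<subseteq> V" and "open \<Omega>" "open V"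
    and c: "Ck_on 1 UNIV c" "\<And>x. x \<notin> K \<Longrightarrow> c x = 0" and p: "1 < p" "0 < \<theta>" "\<theta> < 1"
  shows "\<exists>C\<ge>0. \<forall>g. zero_outside (T ` K) g \<in> borel_measurable lebesgue \<longrightarrow>
    gagliardo \<Omega> \<theta> p (\<lambda>x. c x * g (T x)) \<le> ennreal C * (gagliardo (T ` K) \<theta> p g + Lp_norm V p g)"
proof -
  obtain M where M: "M > 0" "\<And>x. \<bar>c x\<bar> \<le> M" "\<And>x y. \<bar>c x - c y\<bar> \<le> M * min 1 (norm (x - y))"
    using C1_compact_support_bound[OF c(1) K(1) c(2)] by metis
  have "compact (T ` K)" by (rule compact_continuous_image[OF bilipschitz_continuous[OF K(2)] K(1)])
  then have TK: "T ` K \<in> sets borel" by (simp add: compact_imp_closed)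
  obtain C where C: "C \<ge> 0" "\<And>g. zero_outside (T ` K) g \<in> borel_measurable lebesgue \<Longrightarrow>
    gagliardo_power \<Omega> \<theta> p (\<lambda>x. c x * g (T x)) \<le> ennreal C * (gagliardo_power (T ` K) \<theta> p g + Lp_power (T ` K) p g)"
    using gagliardo_power_mult_compose[OF K(1,2) c(2) M(2,3) p, of \<Omega>] by blast
  have "gagliardo \<Omega> \<theta> p (\<lambda>x. c x * g (T x)) \<le> ennreal (C powr (1 / p)) * (gagliardo (T ` K) \<theta> p g + Lp_norm V p g)"
    if g: "zero_outside (T ` K) g \<in> borel_measurable lebesgue" for g
  proof -
    have "gagliardo_power \<Omega> \<theta> p (\<lambda>x. c x * g (T x)) \<le> ennreal C * (gagliardo_power (T ` K) \<theta> p g + Lp_power V p g)"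
      by (rule order_trans[OF C(2)[OF g]]) (intro mult_left_mono add_left_mono Lp_power_mono K(3), simp)
    then have "ennreal_root p (gagliardo_power \<Omega> \<theta> p (\<lambda>x. c x * g (T x)))
        \<le> ennreal_root p (ennreal C * (gagliardo_power (T ` K) \<theta> p g + Lp_power V p g))"
      using p by (intro ennreal_root_mono) auto
    also have "\<dots> = ennreal (C powr (1 / p)) * ennreal_root p (gagliardo_power (T ` K) \<theta> p g + Lp_power V p g)"
      using C p by (intro ennreal_root_cmult) auto
    also have "\<dots> \<le> ennreal (C powr (1 / p)) * (ennreal_root p (gagliardo_power (T ` K) \<theta> p g) + ennreal_root p (Lp_power V p g))"
      using p by (intro mult_left_mono ennreal_root_add) auto
    finally show ?thesis using TK \<open>open \<Omega>\<close> \<open>open V\<close> by (simp add: Lp_norm_eq_root gagliardo_eq_root)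
  qed
  then show ?thesis by (intro exI[of _ "C powr (1 / p)"]) auto
qed

lemma gagliardo_mono:
  assumes "\<Omega> \<subseteq> \<Omega>'" "\<Omega> \<in> sets borel" "\<Omega>' \<in> sets borel" "p > 0"
  shows "gagliardo \<Omega> \<theta> p f \<le> gagliardo \<Omega>' \<theta> p f"
  using assms by (simp add: gagliardo_eq_root ennreal_root_mono gagliardo_power_mono)

lemma gagliardo_local_bound:
  fixes Q V :: "(real^'n) set"
  assumes Q: "compact Q" "open V" "Q \<subseteq> V" and p: "1 < p" "0 < \<theta>" "\<theta> < 1"
  shows "\<exists>C\<ge>0. \<forall>g d. locally_integrable_on g V \<and> (\<forall>i. d i \<in> weak_derivs V (mi_unit i) g) \<longrightarrow>
    gagliardo Q \<theta> p g \<le> ennreal C * ((\<Sum>i\<in>UNIV. Lp_norm V p (d i)) + Lp_norm V p g)"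
proof -
  have Qs: "Q \<in> sets borel" using Q(1) by (simp add: compact_imp_closed)
  obtain C where C: "C \<ge> 0" "\<And>g d. locally_integrable_on g V \<Longrightarrow> (\<And>i. d i \<in> weak_derivs V (mi_unit i) g) \<Longrightarrow>
    gagliardo_power Q \<theta> p g \<le> ennreal C * ((\<Sum>i\<in>UNIV. Lp_power V p (d i)) + Lp_power V p g)"
    using gagliardo_power_local_bound[OF Q p] by blast
  have "gagliardo Q \<theta> p g \<le> ennreal (C powr (1 / p)) * ((\<Sum>i\<in>UNIV. Lp_norm V p (d i)) + Lp_norm V p g)"
    if g: "locally_integrable_on g V" and d: "\<And>i. d i \<in> weak_derivs V (mi_unit i) g" for g d
  proof -
    have "ennreal_root p (gagliardo_power Q \<theta> p g) \<le> ennreal_root p (ennreal C * ((\<Sum>i\<in>UNIV. Lp_power V p (d i)) + Lp_power V p g))"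
      using p by (intro ennreal_root_mono C(2) g d) auto
    also have "\<dots> = ennreal (C powr (1 / p)) * ennreal_root p ((\<Sum>i\<in>UNIV. Lp_power V p (d i)) + Lp_power V p g)"
      using C p by (intro ennreal_root_cmult) auto
    also have "\<dots> \<le> ennreal (C powr (1 / p)) * (ennreal_root p (\<Sum>i\<in>UNIV. Lp_power V p (d i)) + ennreal_root p (Lp_power V p g))"
      using p by (intro mult_left_mono ennreal_root_add) auto
    also have "\<dots> \<le> ennreal (C powr (1 / p)) * ((\<Sum>i\<in>UNIV. ennreal_root p (Lp_power V p (d i))) + ennreal_root p (Lp_power V p g))"
      using p by (intro mult_left_mono add_right_mono ennreal_root_sum) auto
    finally show ?thesis using Qs \<open>open V\<close> by (simp add: Lp_norm_eq_root gagliardo_eq_root)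
  qed
  then show ?thesis by (intro exI[of _ "C powr (1 / p)"]) auto
qed

section \<open>The chain rule for weak derivatives\<close>

text \<open>On a compact set, \<open>|f| \<le> 1 + |f|\<^sup>p\<close> is integrable.\<close>

lemma Lp_space_locally_integrable:
  assumes "f \<in> Lp_space \<Omega> p" "open \<Omega>" "1 < p"
  shows "locally_integrable_on f \<Omega>"
  unfolding locally_integrable_on_def
proof (intro allI impI, elim conjE)
  fix K assume K: "compact K" "K \<subseteq> \<Omega>"
  have \<Omega>: "\<Omega> \<in> sets lebesgue" using assms(2) by simp
  have Ks: "K \<in> sets lebesgue" using K(1) by (simp add: compact_imp_closed)
  have f\<Omega>: "f \<in> borel_measurable (lebesgue_on \<Omega>)" using assms(1) by (simp add: Lp_space_def)
  then have "f \<in> borel_measurable (lebesgue_on K)" by (rule measurable_restrict_mono[OF _ K(2)])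
  then have m: "(\<lambda>x. indicator K x *\<^sub>R f x) \<in> borel_measurable lebesgue"
    using Ks by (subst (asm) borel_measurable_restrict_space_iff) auto
  have Lp: "Lp_power \<Omega> p f < \<infinity>"
    using assms(1) Lp_norm_eq_root[of \<Omega> p f] ennreal_root_finite_iff[of p "Lp_power \<Omega> p f"] assms(2) by (simp add: Lp_space_def)
  have pt: "\<bar>t\<bar> \<le> 1 + \<bar>t\<bar> powr p" for t :: real
  proof (cases "\<bar>t\<bar> \<le> 1")
    case True
    have "0 \<le> \<bar>t\<bar> powr p" by simp
    then show ?thesis using True by linarith
  next
    case False
    then have "\<bar>t\<bar> powr 1 \<le> \<bar>t\<bar> powr p" using assms(3) by (intro powr_mono) auto
    then show ?thesis using False by simp
  qed
  have "(\<integral>\<^sup>+x. ennreal (norm (indicator K x *\<^sub>R f x)) \<partial>lborel)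
      \<le> (\<integral>\<^sup>+x. indicator K x + ennreal (\<bar>f x\<bar> powr p) * indicator \<Omega> x \<partial>lborel)"
  proof (rule nn_integral_mono)
    fix x
    show "ennreal (norm (indicator K x *\<^sub>R f x)) \<le> indicator K x + ennreal (\<bar>f x\<bar> powr p) * indicator \<Omega> x"
    proof (cases "x \<in> K")
      case True
      have "ennreal \<bar>f x\<bar> \<le> ennreal (1 + \<bar>f x\<bar> powr p)" by (rule ennreal_leI[OF pt])
      also have "\<dots> = 1 + ennreal (\<bar>f x\<bar> powr p)" by (subst ennreal_plus) auto
      finally show ?thesis using True K(2) by (auto simp: subset_iff)
    qed simp
  qed
  also have "\<dots> = (\<integral>\<^sup>+x. indicator K x + ennreal (\<bar>f x\<bar> powr p) * indicator \<Omega> x \<partial>lebesgue)"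
    by (simp only: nn_integral_completion)
  also have "\<dots> = emeasure lebesgue K + Lp_power \<Omega> p f"
  proof -
    have "(\<lambda>x. indicator \<Omega> x *\<^sub>R f x) \<in> borel_measurable lebesgue"
      using f\<Omega> \<Omega> by (subst (asm) borel_measurable_restrict_space_iff) auto
    then have "(\<lambda>x. ennreal (\<bar>indicator \<Omega> x *\<^sub>R f x\<bar> powr p)) \<in> borel_measurable lebesgue" by measurable
    moreover have "(\<lambda>x. ennreal (\<bar>indicator \<Omega> x *\<^sub>R f x\<bar> powr p)) = (\<lambda>x. ennreal (\<bar>f x\<bar> powr p) * indicator \<Omega> x)"
      by (rule ext) (simp add: indicator_def)
    ultimately have m2: "(\<lambda>x. ennreal (\<bar>f x\<bar> powr p) * indicator \<Omega> x) \<in> borel_measurable lebesgue" by (simp only:)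
    show ?thesis
      using nn_integral_add[OF borel_measurable_indicator[OF Ks] m2] nn_integral_indicator[OF Ks]
      by (simp only: Lp_power_def nn_integral_completion)
  qed
  also have "\<dots> < \<infinity>" using Lp emeasure_bounded_finite[OF compact_imp_bounded[OF K(1)]] K(1)
    by (simp add: less_top compact_imp_closed)
  finally show "f absolutely_integrable_on K"
    unfolding set_integrable_def using m by (intro integrableI_bounded) (auto simp: nn_integral_completion)
qed

lemma integrable_zero_outside_continuous:
  fixes f :: "'a::euclidean_space \<Rightarrow> real"
  assumes "compact Q" "continuous_on Q f" shows "integrable lebesgue (zero_outside Q f)"
proof -
  have "integrable lborel (zero_outside Q f)"
    using borel_integrable_compact[OF assms] by (simp add: zero_outside_def[abs_def])
  then show ?thesis using integrable_completion[of "zero_outside Q f" lborel] by (metis borel_measurable_integrable)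
qed

lemma mult_compose_measurable:
  fixes T :: "real^'n \<Rightarrow> real^'n"
  assumes K: "compact K" "bilipschitz_on K T L" and c: "c \<in> borel_measurable lebesgue" "\<And>x. x \<notin> K \<Longrightarrow> c x = 0"
    and g: "zero_outside (T ` K) g \<in> borel_measurable lebesgue"
  shows "(\<lambda>x. c x * g (T x)) \<in> borel_measurable lebesgue"
proof -
  have "(\<lambda>x. c x * zero_outside K (\<lambda>x. g (T x)) x) \<in> borel_measurable lebesgue"
    using c(1) bilipschitz_measurable[OF K g] by measurable
  moreover have "(\<lambda>x. c x * zero_outside K (\<lambda>x. g (T x)) x) = (\<lambda>x. c x * g (T x))"
    by (rule ext) (use c(2) in \<open>auto simp: zero_outside_def indicator_def\<close>)
  ultimately show ?thesis by simp
qed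

lemma integrable_mult_compose:
  fixes T :: "real^'n \<Rightarrow> real^'n"
  assumes K: "compact K" "bilipschitz_on K T L" and c: "c \<in> borel_measurable lebesgue" "\<And>x. x \<notin> K \<Longrightarrow> c x = 0" "\<And>x. \<bar>c x\<bar> \<le> M"
    and g: "integrable lebesgue (zero_outside (T ` K) g)"
  shows "integrable lebesgue (\<lambda>x. c x * g (T x))"
proof (rule integrableI_bounded)
  have gm: "zero_outside (T ` K) g \<in> borel_measurable lebesgue" using g by auto
  show "(\<lambda>x. c x * g (T x)) \<in> borel_measurable lebesgue" by (rule mult_compose_measurable[OF K c(1,2) gm])
  have "(\<integral>\<^sup>+x. ennreal (norm (c x * g (T x))) \<partial>lebesgue) = Lp_power UNIV 1 (\<lambda>x. c x * g (T x))"
    by (simp add: Lp_power_def nn_integral_completion)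
  also have "\<dots> \<le> ennreal (M powr 1 * (2 * L * CARD('n)) ^ CARD('n)) * Lp_power (T ` K) 1 g"
    by (rule Lp_power_mult_compose[OF K gm c(2,3)]) simp_all
  also have "Lp_power (T ` K) 1 g = (\<integral>\<^sup>+x. ennreal (norm (zero_outside (T ` K) g x)) \<partial>lebesgue)"
    unfolding Lp_power_def nn_integral_completion by (rule nn_integral_cong) (auto simp: zero_outside_def indicator_def)
  also have "ennreal (M powr 1 * (2 * L * CARD('n)) ^ CARD('n)) * \<dots> < \<infinity>"
    using g by (simp add: integrable_iff_bounded ennreal_mult_less_top)
  finally show "(\<integral>\<^sup>+x. ennreal (norm (c x * g (T x))) \<partial>lebesgue) < \<infinity>" .
qed

text \<open>The map \<open>g \<mapsto> c (g \<circ> T)\<close> is bounded in \<open>L\<^sup>1\<close>, by the change of variables with exponent one.\<close>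

lemma mollified_compose_tendsto:
  fixes T :: "real^'n \<Rightarrow> real^'n" and w :: "real^'n \<Rightarrow> real"
  assumes K: "compact K" "bilipschitz_on K T L" and c: "c \<in> borel_measurable lebesgue" "\<And>x. x \<notin> K \<Longrightarrow> c x = 0" "\<And>x. \<bar>c x\<bar> \<le> M"
    and K1: "compact K1" "T ` K \<subseteq> K1" "K1 \<subseteq> V" and w: "locally_integrable_on w V"
  shows "((\<lambda>\<epsilon>. LINT x|lebesgue. c x * convolution (zero_outside K1 w) (mollifier \<epsilon>) (T x))
    \<longlongrightarrow> (LINT x|lebesgue. c x * w (T x))) (at_right 0)"
proof (rule tendstoI)
  fix e :: real assume e: "e > 0"
  have M: "M \<ge> 0" using c(3)[of undefined] by linarith
  have L: "L > 0" using K(2) by (simp add: bilipschitz_on_def)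
  define C where "C = M powr 1 * (2 * L * CARD('n)) ^ CARD('n)"
  have C: "C \<ge> 0" using L by (simp add: C_def)
  let ?W = "zero_outside K1 w"
  have Wi: "integrable lebesgue ?W" by (rule locally_integrable_zero_outside[OF w K1(1,3)])
  obtain R where R: "\<And>x. norm x \<ge> R \<Longrightarrow> ?W x = 0" by (rule zero_outside_bounded_support[OF K1(1)]) blast
  have cTK: "compact (T ` K)" by (rule compact_continuous_image[OF bilipschitz_continuous[OF K(2)] K(1)])
  define e' where "e' = e / (2 * (C + 1))"
  have e': "e' > 0" using e C by (simp add: e'_def)
  obtain \<delta> where \<delta>: "\<delta> > 0"
    "\<And>\<epsilon>. 0 < \<epsilon> \<Longrightarrow> \<epsilon> < \<delta> \<Longrightarrow> (\<integral>\<^sup>+x. ennreal \<bar>convolution ?W (mollifier \<epsilon>) x - ?W x\<bar> \<partial>lborel) \<le> ennreal e'"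
    using mollifier_tendsto_L1[OF Wi R e'] by blast
  have "dist (LINT x|lebesgue. c x * convolution ?W (mollifier \<epsilon>) (T x)) (LINT x|lebesgue. c x * w (T x)) < e"
    if \<epsilon>: "0 < \<epsilon>" "\<epsilon> < \<delta>" for \<epsilon>
  proof -
    let ?m = "convolution ?W (mollifier \<epsilon>)"
    let ?g = "\<lambda>y. ?m y - w y"
    have mc: "continuous_on A ?m" for A by (rule convolution_continuous[OF Wi mollifier_test[OF \<epsilon>(1)]])
    have mi: "integrable lebesgue (zero_outside (T ` K) ?m)" by (rule integrable_zero_outside_continuous[OF cTK mc])
    have wi: "integrable lebesgue (zero_outside (T ` K) w)"
      using K1 by (intro locally_integrable_zero_outside[OF w cTK]) auto
    have "zero_outside (T ` K) ?g = (\<lambda>x. zero_outside (T ` K) ?m x - zero_outside (T ` K) w x)"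
      by (rule ext) (simp add: zero_outside_def right_diff_distrib)
    then have gi: "integrable lebesgue (zero_outside (T ` K) ?g)" using mi wi by simp
    then have gm: "zero_outside (T ` K) ?g \<in> borel_measurable lebesgue" by auto
    have i: "integrable lebesgue (\<lambda>x. c x * g (T x))" if "integrable lebesgue (zero_outside (T ` K) g)" for g
      by (rule integrable_mult_compose[OF K c that])
    have "(LINT x|lebesgue. c x * ?m (T x)) - (LINT x|lebesgue. c x * w (T x)) = (LINT x|lebesgue. c x * ?g (T x))"
      using Bochner_Integration.integral_diff[OF i[OF mi] i[OF wi]] by (simp add: right_diff_distrib)
    moreover have "ennreal \<bar>LINT x|lebesgue. c x * ?g (T x)\<bar> \<le> ennreal (C * e')"
    proof -
      have "ennreal \<bar>LINT x|lebesgue. c x * ?g (T x)\<bar> \<le> (\<integral>\<^sup>+x. ennreal (norm (c x * ?g (T x))) \<partial>lebesgue)"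
        using integral_norm_bound_ennreal[OF i[OF gi]] by simp
      also have "\<dots> = Lp_power UNIV 1 (\<lambda>x. c x * ?g (T x))"
        by (simp add: Lp_power_def nn_integral_completion)
      also have "\<dots> \<le> ennreal C * Lp_power (T ` K) 1 ?g"
        unfolding C_def by (rule Lp_power_mult_compose[OF K gm c(2,3)]) simp_all
      also have "Lp_power (T ` K) 1 ?g \<le> (\<integral>\<^sup>+x. ennreal \<bar>?m x - ?W x\<bar> \<partial>lborel)"
        unfolding Lp_power_def using K1(2) by (intro nn_integral_mono) (auto simp: indicator_def)
      also have "\<dots> \<le> ennreal e'" by (rule \<delta>(2)[OF \<epsilon>])
      finally show ?thesis using C e' by (simp add: ennreal_mult mult_left_mono)
    qed
    ultimately have "\<bar>(LINT x|lebesgue. c x * ?m (T x)) - (LINT x|lebesgue. c x * w (T x))\<bar> \<le> C * e'"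
      using C e' by (subst (asm) ennreal_le_iff) auto
    also have "C * e' < e"
    proof -
      have "0 \<le> C * e" using C e by simp
      then have "C * e < e * (2 * (C + 1))" using e by (simp add: algebra_simps)
      then show ?thesis using C by (simp add: e'_def divide_less_eq)
    qed
    finally show ?thesis by (simp add: dist_real_def)
  qed
  then show "\<forall>\<^sub>F \<epsilon> in at_right 0. dist (LINT x|lebesgue. c x * convolution ?W (mollifier \<epsilon>) (T x)) (LINT x|lebesgue. c x * w (T x)) < e"
    using \<delta>(1) by (auto simp: eventually_at_right[of 0 1] intro!: exI[of _ \<delta>])
qed

text \<open>The classical formula holds for mollifications of \<open>v\<close>, integration by parts puts the derivatives on
  the test function, and both sides pass to the limit in \<open>L\<^sup>1\<close>.\<close>

lemma weak_deriv_mult_compose: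
  fixes T :: "real^'n \<Rightarrow> real^'n" and a :: "real^'n \<Rightarrow> real"
  assumes UV: "open U" "open V" "T ` U \<subseteq> V" and K: "compact K" "K \<subseteq> U" "bilipschitz_on K T L"
    and T: "\<And>j. Ck_on m U (\<lambda>x. T x $ j)" and a: "Ck_on m U a" "\<And>x. x \<notin> K \<Longrightarrow> a x = 0"
    and \<nu>: "mi_order \<nu> \<le> m"
    and c: "\<And>\<mu>. continuous_on UNIV (c \<mu>)" "\<And>\<mu> x. x \<notin> K \<Longrightarrow> c \<mu> x = 0"
    and formula: "\<And>f x. (\<And>k. Ck_on k V f) \<Longrightarrow> x \<in> U \<Longrightarrow> mi_deriv \<nu> (\<lambda>x. a x * f (T x)) x =
      (\<Sum>\<mu> | mi_order \<mu> \<le> mi_order \<nu>. c \<mu> x * mi_deriv \<mu> f (T x))"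
    and v: "locally_integrable_on v V" "\<And>\<mu>. mi_order \<mu> \<le> mi_order \<nu> \<Longrightarrow> w \<mu> \<in> weak_derivs V \<mu> v"
  shows "(\<lambda>x. \<Sum>\<mu> | mi_order \<mu> \<le> mi_order \<nu>. c \<mu> x * w \<mu> (T x)) \<in> weak_derivs U \<nu> (\<lambda>x. a x * v (T x))"
proof -
  let ?I = "{\<mu> :: 'n \<Rightarrow> nat. mi_order \<mu> \<le> mi_order \<nu>}" and ?s = "(-1::real) ^ mi_order \<nu>"
  let ?F = "\<lambda>x. a x * v (T x)" and ?G = "\<lambda>x. \<Sum>\<mu>\<in>?I. c \<mu> x * w \<mu> (T x)"
  have cK: "closed K" by (rule compact_imp_closed[OF K(1)])
  have cTK: "compact (T ` K)" by (rule compact_continuous_image[OF bilipschitz_continuous[OF K(3)] K(1)])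
  have TKV: "T ` K \<subseteq> V" using UV(3) K(2) by blast
  obtain \<delta> where \<delta>: "\<delta> > 0" "(\<Union>y\<in>T ` K. cball y \<delta>) \<subseteq> V"
    using compact_open_thickening[OF cTK UV(2) TKV] by metis
  define K1 where "K1 = (\<Union>y\<in>T ` K. cball y \<delta>)"
  have K1: "compact K1" "T ` K \<subseteq> K1" "K1 \<subseteq> V"
    using compact_thickening[OF cTK] \<delta> by (auto simp: K1_def)
  have wl: "locally_integrable_on (w \<mu>) V" if "\<mu> \<in> ?I" for \<mu> using v(2)[of \<mu>] that by (simp add: weak_derivs_def)
  have ac: "Ck_on m UNIV a" by (rule Ck_on_zero_extension[OF UV(1) cK K(2) a])
  have b: "\<exists>M. \<forall>x. \<bar>f x\<bar> \<le> M" if fc: "continuous_on UNIV f" and f0: "\<And>x. x \<notin> K \<Longrightarrow> f x = 0" for f :: "real^'n \<Rightarrow> real"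
  proof -
    obtain M where "M \<ge> 0" "\<And>x. x \<in> K \<Longrightarrow> norm (f x) \<le> M"
      using continuous_on_compact_bound[OF K(1) continuous_on_subset[OF fc subset_UNIV]] by metis
    then have "\<bar>f x\<bar> \<le> M" for x using f0[of x] by (cases "x \<in> K") auto
    then show ?thesis by blast
  qed
  have gi: "integrable lebesgue (zero_outside (T ` K) g)" if "locally_integrable_on g V" for g
    by (rule locally_integrable_zero_outside[OF that cTK TKV])
  have ci: "integrable lebesgue (\<lambda>x. c \<mu> x * w \<mu> (T x) * \<phi> x)" if "\<mu> \<in> ?I" "continuous_on UNIV \<phi>" for \<mu> \<phi>
  proof -
    have cc: "continuous_on UNIV (\<lambda>x. c \<mu> x * \<phi> x)" by (intro continuous_intros c that)
    obtain M where "\<And>x. \<bar>c \<mu> x * \<phi> x\<bar> \<le> M" using b[OF cc] c(2) by fastforce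
    then have "integrable lebesgue (\<lambda>x. (c \<mu> x * \<phi> x) * w \<mu> (T x))"
      using c(2) by (intro integrable_mult_compose[OF K(1,3)] borel_measurable_lebesgue_continuous cc gi wl that) auto
    then show ?thesis by (simp add: mult_ac)
  qed
  have Gi: "integrable lebesgue ?G"
    using ci[of _ "\<lambda>x. 1"] by (intro Bochner_Integration.integrable_sum) simp
  have Gl: "locally_integrable_on ?G U"
    unfolding locally_integrable_on_def set_integrable_def
  proof (intro allI impI, elim conjE)
    fix S :: "(real^'n) set" assume "compact S"
    then have "S \<in> sets lebesgue" by (simp add: compact_imp_closed)
    then show "integrable lebesgue (\<lambda>x. indicator S x *\<^sub>R ?G x)" by (rule integrable_mult_indicator[OF _ Gi])
  qed
  have "regular_distribution U ?G \<phi> = ?s * regular_distribution U ?F (mi_deriv \<nu> \<phi>)" if \<phi>U: "\<phi> \<in> test_functions U" for \<phi>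
  proof -
    have \<phi>: "\<phi> \<in> test_functions UNIV" by (rule test_functions_mono[OF \<phi>U]) simp
    have \<psi>: "mi_deriv \<nu> \<phi> \<in> test_functions UNIV" by (rule test_functions_mi_deriv[OF \<phi>])
    let ?m = "\<lambda>g \<epsilon>. convolution (zero_outside K1 g) (mollifier \<epsilon>)"
    have lim: "((\<lambda>\<epsilon>. LINT x|lebesgue. (b x * \<psi> x) * ?m g \<epsilon> (T x)) \<longlongrightarrow> (LINT x|lebesgue. (b x * \<psi> x) * g (T x))) (at_right 0)"
      if bc: "continuous_on UNIV b" and b0: "\<And>x. x \<notin> K \<Longrightarrow> b x = 0" and \<psi>: "\<psi> \<in> test_functions UNIV" and g: "locally_integrable_on g V" for b \<psi> g
    proof -
      have cc: "continuous_on UNIV (\<lambda>x. b x * \<psi> x)" by (intro continuous_intros bc test_functions_continuous[OF \<psi>])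
      obtain M where "\<And>x. \<bar>b x * \<psi> x\<bar> \<le> M" using b[OF cc] b0 by fastforce
      then show ?thesis
        using b0 by (intro mollified_compose_tendsto[OF K(1,3) _ _ _ K1 g] borel_measurable_lebesgue_continuous cc) auto
    qed
    have l1: "((\<lambda>\<epsilon>. LINT x|lebesgue. (a x * mi_deriv \<nu> \<phi> x) * ?m v \<epsilon> (T x))
        \<longlongrightarrow> (LINT x|lebesgue. (a x * mi_deriv \<nu> \<phi> x) * v (T x))) (at_right 0)"
      by (rule lim[OF Ck_on_imp_continuous[OF ac] a(2) \<psi> v(1)])
    have l2: "((\<lambda>\<epsilon>. ?s * (\<Sum>\<mu>\<in>?I. LINT x|lebesgue. (c \<mu> x * \<phi> x) * ?m (w \<mu>) \<epsilon> (T x)))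
        \<longlongrightarrow> ?s * (\<Sum>\<mu>\<in>?I. LINT x|lebesgue. (c \<mu> x * \<phi> x) * w \<mu> (T x))) (at_right 0)"
    proof (rule tendsto_mult[OF tendsto_const tendsto_sum])
      fix \<mu> assume "\<mu> \<in> ?I"
      then have "locally_integrable_on (w \<mu>) V" by (rule wl)
      from lim[of "c \<mu>", OF c(1) _ \<phi> this] c(2)
      show "((\<lambda>\<epsilon>. LINT x|lebesgue. (c \<mu> x * \<phi> x) * ?m (w \<mu>) \<epsilon> (T x))
        \<longlongrightarrow> (LINT x|lebesgue. (c \<mu> x * \<phi> x) * w \<mu> (T x))) (at_right 0)" by blast
    qed
    have eq: "(LINT x|lebesgue. (a x * mi_deriv \<nu> \<phi> x) * ?m v \<epsilon> (T x))
        = ?s * (\<Sum>\<mu>\<in>?I. LINT x|lebesgue. (c \<mu> x * \<phi> x) * ?m (w \<mu>) \<epsilon> (T x))" if \<epsilon>: "0 < \<epsilon>" "\<epsilon> < \<delta>" for \<epsilon>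
    proof -
      have vi: "integrable lebesgue (zero_outside K1 v)" by (rule locally_integrable_zero_outside[OF v(1) K1(1,3)])
      have fC: "Ck_on k A (?m v \<epsilon>)" for k A
        by (rule Ck_on_subset[OF Ck_on_convolution[OF vi mollifier_test[OF \<epsilon>(1)]] subset_UNIV])
      let ?Fe = "\<lambda>x. a x * ?m v \<epsilon> (T x)" and ?Ge = "\<lambda>x. \<Sum>\<mu>\<in>?I. c \<mu> x * ?m (w \<mu>) \<epsilon> (T x)"
      have "Ck_on m U ?Fe" by (rule Ck_on_mult[OF UV(1) a(1) Ck_on_compose[OF UV fC T]])
      then have "Ck_on m UNIV ?Fe" using a(2) by (intro Ck_on_zero_extension[OF UV(1) cK K(2)]) auto
      then have FC: "Ck_on (mi_order \<nu>) UNIV ?Fe" by (rule Ck_on_mono[OF _ \<nu>])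
      \<comment> \<open>On \<open>K\<close> the derivatives of the mollification of \<open>v\<close> are the mollifications of the weak derivatives; off \<open>K\<close> both sides
        vanish.\<close>
      have D: "mi_deriv \<nu> ?Fe x = ?Ge x" for x
      proof (cases "x \<in> K")
        case True
        have "cball (T x) \<epsilon> \<subseteq> cball (T x) \<delta>" using \<epsilon> by (intro subset_cball) simp
        also have "\<dots> \<subseteq> K1" unfolding K1_def using True by blast
        finally have "cball (T x) \<epsilon> \<subseteq> K1" .
        then have "mi_deriv \<mu> (?m v \<epsilon>) (T x) = ?m (w \<mu>) \<epsilon> (T x)" if "\<mu> \<in> ?I" for \<mu>
          using that by (intro mi_deriv_convolution_weak[OF v K1(1,3) \<epsilon>(1)]) auto
        then show ?thesis using True K(2) by (subst formula[OF fC]) (auto intro!: sum.cong)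
      next
        case False
        then show ?thesis using mi_deriv_zero_outside[OF cK _ False, of ?Fe] a(2) c(2) by simp
      qed
      have ci': "integrable lebesgue (\<lambda>x. (c \<mu> x * \<phi> x) * ?m (w \<mu>) \<epsilon> (T x))" if "\<mu> \<in> ?I" for \<mu>
      proof -
        have wi: "integrable lebesgue (zero_outside K1 (w \<mu>))" by (rule locally_integrable_zero_outside[OF wl[OF that] K1(1,3)])
        have cc: "continuous_on UNIV (\<lambda>x. c \<mu> x * \<phi> x)" by (intro continuous_intros c test_functions_continuous[OF \<phi>])
        obtain M where M: "\<And>x. \<bar>c \<mu> x * \<phi> x\<bar> \<le> M" using b[OF cc] c(2) by fastforce
        have "integrable lebesgue (zero_outside (T ` K) (?m (w \<mu>) \<epsilon>))"
          by (rule integrable_zero_outside_continuous[OF cTK convolution_continuous[OF wi mollifier_test[OF \<epsilon>(1)]]])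
        then show ?thesis
          using M c(2) by (intro integrable_mult_compose[OF K(1,3)] borel_measurable_lebesgue_continuous cc) auto
      qed
      have "(LINT x|lebesgue. (a x * mi_deriv \<nu> \<phi> x) * ?m v \<epsilon> (T x)) = (LINT x|lebesgue. ?Fe x * mi_deriv \<nu> \<phi> x)"
        by (simp add: mult_ac)
      also have "\<dots> = ?s * (LINT x|lebesgue. ?Ge x * \<phi> x)"
        using integration_by_parts[OF FC \<phi>] by (simp only: D)
      also have "(LINT x|lebesgue. ?Ge x * \<phi> x) = (LINT x|lebesgue. (\<Sum>\<mu>\<in>?I. (c \<mu> x * \<phi> x) * ?m (w \<mu>) \<epsilon> (T x)))"
        by (simp add: sum_distrib_left sum_distrib_right mult_ac)
      also have "\<dots> = (\<Sum>\<mu>\<in>?I. LINT x|lebesgue. (c \<mu> x * \<phi> x) * ?m (w \<mu>) \<epsilon> (T x))"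
        by (rule Bochner_Integration.integral_sum[OF ci'])
      finally show ?thesis .
    qed
    have "\<forall>\<^sub>F \<epsilon> in at_right 0. (LINT x|lebesgue. (a x * mi_deriv \<nu> \<phi> x) * ?m v \<epsilon> (T x))
        = ?s * (\<Sum>\<mu>\<in>?I. LINT x|lebesgue. (c \<mu> x * \<phi> x) * ?m (w \<mu>) \<epsilon> (T x))"
      using \<delta>(1) eq by (auto simp: eventually_at_right[of 0 1] intro!: exI[of _ \<delta>])
    from Lim_transform_eventually[OF l1 this]
    have E: "(LINT x|lebesgue. (a x * mi_deriv \<nu> \<phi> x) * v (T x)) = ?s * (\<Sum>\<mu>\<in>?I. LINT x|lebesgue. (c \<mu> x * \<phi> x) * w \<mu> (T x))"
      by (rule tendsto_unique[OF trivial_limit_at_right_real _ l2])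
    have rF: "regular_distribution U ?F (mi_deriv \<nu> \<phi>) = (LINT x|lebesgue. (a x * mi_deriv \<nu> \<phi> x) * v (T x))"
      unfolding regular_distribution_def set_lebesgue_integral_def
    proof (rule Bochner_Integration.integral_cong[OF refl])
      fix x show "indicator U x *\<^sub>R (?F x * mi_deriv \<nu> \<phi> x) = (a x * mi_deriv \<nu> \<phi> x) * v (T x)"
        using a(2)[of x] K(2) by (cases "x \<in> U") auto
    qed
    have "regular_distribution U ?G \<phi> = (LINT x|lebesgue. (\<Sum>\<mu>\<in>?I. (c \<mu> x * \<phi> x) * w \<mu> (T x)))"
      unfolding regular_distribution_def set_lebesgue_integral_def
    proof (rule Bochner_Integration.integral_cong[OF refl])
      fix x show "indicator U x *\<^sub>R (?G x * \<phi> x) = (\<Sum>\<mu>\<in>?I. (c \<mu> x * \<phi> x) * w \<mu> (T x))"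
      proof (cases "x \<in> U")
        case False
        then have "c \<mu> x = 0" for \<mu> using c(2)[of x \<mu>] K(2) by blast
        then show ?thesis by simp
      qed (simp add: sum_distrib_left sum_distrib_right mult_ac)
    qed
    also have "\<dots> = (\<Sum>\<mu>\<in>?I. LINT x|lebesgue. (c \<mu> x * \<phi> x) * w \<mu> (T x))"
      using ci[OF _ test_functions_continuous[OF \<phi>]] by (intro Bochner_Integration.integral_sum) (simp add: mult_ac)
    finally have "regular_distribution U ?G \<phi> = (\<Sum>\<mu>\<in>?I. LINT x|lebesgue. (c \<mu> x * \<phi> x) * w \<mu> (T x))" .
    moreover have "?s * ?s = 1" by (simp flip: power_mult_distrib)
    ultimately show ?thesis unfolding rF E by (simp flip: mult.assoc)
  qed
  then show ?thesis using Gl by (simp add: weak_derivs_def)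
qed

section \<open>The multiplication-composition operator on Sobolev spaces\<close>

lemma weak_derivs_upd:
  assumes "open V" "g \<in> weak_derivs V \<mu> v" "h \<in> weak_derivs V (\<mu>(i := Suc (\<mu> i))) v"
  shows "h \<in> weak_derivs V (mi_unit i) g"
proof -
  have "regular_distribution V h \<phi> = (-1) ^ mi_order (mi_unit i) * regular_distribution V g (mi_deriv (mi_unit i) \<phi>)"
    if \<phi>: "\<phi> \<in> test_functions V" for \<phi>
  proof -
    have 1: "mi_deriv (mi_unit i) \<phi> = partial_deriv i \<phi>"
      by (rule ext) (rule mi_deriv_unit[OF test_functions_Ck[OF \<phi>]])
    have 2: "mi_deriv (\<mu>(i := Suc (\<mu> i))) \<phi> = mi_deriv \<mu> (partial_deriv i \<phi>)"
      by (rule ext) (rule mi_deriv_upd'[OF open_UNIV test_functions_Ck[OF \<phi>] UNIV_I])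
    have "regular_distribution V h \<phi> = (-1) ^ Suc (mi_order \<mu>) * regular_distribution V v (mi_deriv \<mu> (partial_deriv i \<phi>))"
      using assms(3) \<phi> unfolding weak_derivs_def mem_Collect_eq mi_order_upd by (simp add: 2)
    also have "\<dots> = - ((-1) ^ mi_order \<mu> * regular_distribution V v (mi_deriv \<mu> (partial_deriv i \<phi>)))" by simp
    also have "(-1) ^ mi_order \<mu> * regular_distribution V v (mi_deriv \<mu> (partial_deriv i \<phi>)) = regular_distribution V g (partial_deriv i \<phi>)"
      using assms(2) test_functions_partial[OF \<phi>] by (simp add: weak_derivs_def)
    finally show ?thesis by (simp add: 1 mi_order_unit)
  qed
  then show ?thesis using assms(3) by (simp add: weak_derivs_def)
qed

lemma Lp_norm_cong_AE:
  assumes "open \<Omega>" "AE x in lebesgue. x \<in> \<Omega> \<longrightarrow> f x = g x" shows "Lp_norm \<Omega> p f = Lp_norm \<Omega> p g"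
  using Lp_power_cong_AE[OF assms(2)] assms(1) by (simp add: Lp_norm_eq_root)

lemma gagliardo_cong_AE:
  assumes "open \<Omega>" "AE x in lebesgue. x \<in> \<Omega> \<longrightarrow> f x = g x" shows "gagliardo \<Omega> \<theta> p f = gagliardo \<Omega> \<theta> p g"
  using gagliardo_power_cong_AE[OF assms(2)] assms(1) by (simp add: gagliardo_eq_root)

text \<open>Weak derivatives are unique almost everywhere, so the infima in the definition of the norm are attained by any choice.\<close>

lemma INF_weak_derivs:
  assumes "open \<Omega>" "g \<in> weak_derivs \<Omega> \<nu> f"
    and cong: "\<And>h. AE x in lebesgue. x \<in> \<Omega> \<longrightarrow> g x = h x \<Longrightarrow> N g = (N h :: ennreal)"
  shows "(INF h\<in>weak_derivs \<Omega> \<nu> f. N h) = N g"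
proof (rule antisym)
  show "(INF h\<in>weak_derivs \<Omega> \<nu> f. N h) \<le> N g" by (rule INF_lower[OF assms(2)])
  show "N g \<le> (INF h\<in>weak_derivs \<Omega> \<nu> f. N h)"
    by (rule INF_greatest) (use cong weak_derivs_unique[OF assms(1,2)] in \<open>metis order_refl\<close>)
qed

text \<open>The norm computed with a given choice \<open>w \<nu>\<close> of the weak derivatives.\<close>

definition sobolev_sum :: "(real^'n) set \<Rightarrow> real \<Rightarrow> real \<Rightarrow> (('n \<Rightarrow> nat) \<Rightarrow> real^'n \<Rightarrow> real) \<Rightarrow> ennreal" where
  "sobolev_sum \<Omega> s p w = (\<Sum>\<nu> | mi_order \<nu> \<le> nat \<lfloor>s\<rfloor>. Lp_norm \<Omega> p (w \<nu>)) +
     (if s \<in> \<int> then 0 else \<Sum>\<nu> | mi_order \<nu> = nat \<lfloor>s\<rfloor>. gagliardo \<Omega> (frac s) p (w \<nu>))"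

lemma sobolev_norm_eq_sum:
  assumes "open \<Omega>" "\<And>\<mu>. mi_order \<mu> \<le> nat \<lfloor>s\<rfloor> \<Longrightarrow> w \<mu> \<in> weak_derivs \<Omega> \<mu> u"
  shows "sobolev_norm \<Omega> s p u = sobolev_sum \<Omega> s p w"
proof -
  have "(INF g\<in>weak_derivs \<Omega> \<mu> u. Lp_norm \<Omega> p g) = Lp_norm \<Omega> p (w \<mu>)"
    "(INF g\<in>weak_derivs \<Omega> \<mu> u. gagliardo \<Omega> (frac s) p g) = gagliardo \<Omega> (frac s) p (w \<mu>)"
    if "mi_order \<mu> \<le> nat \<lfloor>s\<rfloor>" for \<mu>
    using INF_weak_derivs[OF assms(1) assms(2)[OF that]] Lp_norm_cong_AE[OF assms(1)] gagliardo_cong_AE[OF assms(1)] by blast+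
  then show ?thesis unfolding sobolev_norm_def sobolev_sum_def by simp
qed

lemma sobolev_weak_derivs_exist:
  assumes "sobolev_norm \<Omega> s p u < \<infinity>"
  obtains w where "\<And>\<mu>. mi_order \<mu> \<le> nat \<lfloor>s\<rfloor> \<Longrightarrow> w \<mu> \<in> weak_derivs \<Omega> \<mu> u"
proof -
  have "weak_derivs \<Omega> \<mu> u \<noteq> {}" if "mi_order \<mu> \<le> nat \<lfloor>s\<rfloor>" for \<mu>
  proof
    assume e: "weak_derivs \<Omega> \<mu> u = {}"
    have "(INF g\<in>weak_derivs \<Omega> \<mu> u. Lp_norm \<Omega> p g) \<le> (\<Sum>\<nu> | mi_order \<nu> \<le> nat \<lfloor>s\<rfloor>. INF g\<in>weak_derivs \<Omega> \<nu> u. Lp_norm \<Omega> p g)"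
      using that by (intro member_le_sum[of \<mu>]) (auto simp: finite_mi_order_le)
    also have "\<dots> \<le> sobolev_norm \<Omega> s p u" unfolding sobolev_norm_def by (rule add_increasing2) simp_all
    finally show False using e assms by (simp add: less_top)
  qed
  then have "\<forall>\<mu>. \<exists>g. mi_order \<mu> \<le> nat \<lfloor>s\<rfloor> \<longrightarrow> g \<in> weak_derivs \<Omega> \<mu> u" by blast
  from choice[OF this] show ?thesis using that by blast
qed

lemma finite_mi_order_eq: "finite {\<nu> :: 'n::finite \<Rightarrow> nat. mi_order \<nu> = k}"
  by (rule finite_subset[OF _ finite_mi_order_le[of k]]) auto

lemma Lp_norm_le_sobolev_sum: "mi_order \<mu> \<le> nat \<lfloor>s\<rfloor> \<Longrightarrow> Lp_norm \<Omega> p (w \<mu>) \<le> sobolev_sum \<Omega> s p w"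
  unfolding sobolev_sum_def
  by (rule add_increasing2[OF _ member_le_sum]) (auto simp: finite_mi_order_le)

lemma gagliardo_le_sobolev_sum:
  "mi_order \<mu> = nat \<lfloor>s\<rfloor> \<Longrightarrow> s \<notin> \<int> \<Longrightarrow> gagliardo \<Omega> (frac s) p (w \<mu>) \<le> sobolev_sum \<Omega> s p w"
  unfolding sobolev_sum_def
  by (simp, rule add_increasing[OF _ member_le_sum]) (auto simp: finite_mi_order_eq)

text \<open>Bounds by a multiple of \<open>N w\<close>, uniformly in \<open>w\<close>, form a class that is closed under finite sums; the constants need not be
  tracked.\<close>

lemma bounded_by_multiple_sum:
  fixes f :: "'i \<Rightarrow> 'w \<Rightarrow> ennreal"
  assumes "finite I" "\<And>i. i \<in> I \<Longrightarrow> \<exists>C\<ge>0. \<forall>w. P w \<longrightarrow> f i w \<le> ennreal C * N w"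
  shows "\<exists>C\<ge>0. \<forall>w. P w \<longrightarrow> (\<Sum>i\<in>I. f i w) \<le> ennreal C * N w"
  using assms
proof (induction I rule: finite_induct)
  case empty then show ?case by (intro exI[of _ 0]) auto
next
  case (insert i I)
  obtain C where C: "C \<ge> 0" "\<And>w. P w \<Longrightarrow> (\<Sum>i\<in>I. f i w) \<le> ennreal C * N w" using insert by blast
  obtain D where D: "D \<ge> 0" "\<And>w. P w \<Longrightarrow> f i w \<le> ennreal D * N w" using insert.prems[of i] by blast
  have "(\<Sum>i\<in>insert i I. f i w) \<le> ennreal (D + C) * N w" if "P w" for w
    using insert.hyps C D add_mono[OF D(2)[OF that] C(2)[OF that]] by (simp add: ennreal_plus distrib_right)
  then show ?case using C(1) D(1) by (intro exI[of _ "D + C"]) auto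
qed

lemma bounded_by_multiple_trans:
  fixes f g N :: "'w \<Rightarrow> ennreal"
  assumes "\<exists>C\<ge>0. \<forall>w. P w \<longrightarrow> f w \<le> ennreal C * N w" "K \<ge> 0" "\<And>w. P w \<Longrightarrow> g w \<le> ennreal K * f w"
  shows "\<exists>C\<ge>0. \<forall>w. P w \<longrightarrow> g w \<le> ennreal C * N w"
proof -
  obtain C where C: "C \<ge> 0" "\<And>w. P w \<Longrightarrow> f w \<le> ennreal C * N w" using assms(1) by blast
  have "g w \<le> ennreal (K * C) * N w" if "P w" for w
  proof -
    have "g w \<le> ennreal K * (ennreal C * N w)" by (rule order_trans[OF assms(3)[OF that] mult_left_mono[OF C(2)[OF that]]]) simp
    then show ?thesis using assms(2) C(1) by (simp add: ennreal_mult mult.assoc)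
  qed
  then show ?thesis using assms(2) C(1) by (intro exI[of _ "K * C"]) auto
qed

text \<open>A term \<open>c (\<partial>\<^sup>\<mu>v \<circ> T)\<close> is estimated through the top order seminorm of \<open>v\<close> if \<open>|\<mu>|\<close> is maximal. If it
  is not, then \<open>\<partial>\<^sup>\<mu>v\<close> has one more weak derivative, and this controls the fractional seminorm on
  the compact set \<open>T(K)\<close>.\<close>

lemma sobolev_terms_bound:
  fixes T :: "real^'n \<Rightarrow> real^'n"
  assumes UV: "open U" "open V" and K: "compact K" "bilipschitz_on K T L" "T ` K \<subseteq> V"
    and c: "Ck_on 1 UNIV c" "\<And>x. x \<notin> K \<Longrightarrow> c x = 0" and p: "1 < p" and \<mu>: "mi_order \<mu> \<le> nat \<lfloor>s\<rfloor>"
  defines "P \<equiv> \<lambda>w. \<exists>v. \<forall>\<mu>. mi_order \<mu> \<le> nat \<lfloor>s\<rfloor> \<longrightarrow> w \<mu> \<in> weak_derivs V \<mu> v"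
  shows "\<exists>C\<ge>0. \<forall>w. P w \<longrightarrow> Lp_norm U p (\<lambda>x. c x * w \<mu> (T x)) \<le> ennreal C * sobolev_sum V s p w"
    and "s \<notin> \<int> \<Longrightarrow> \<exists>C\<ge>0. \<forall>w. P w \<longrightarrow> gagliardo U (frac s) p (\<lambda>x. c x * w \<mu> (T x)) \<le> ennreal C * sobolev_sum V s p w"
proof -
  let ?N = "sobolev_sum V s p"
  have cTK: "compact (T ` K)" by (rule compact_continuous_image[OF bilipschitz_continuous[OF K(2)] K(1)])
  have wl: "locally_integrable_on (w \<mu>) V" if "P w" for w using that \<mu> by (auto simp: P_def weak_derivs_def)
  have wm: "zero_outside (T ` K) (w \<mu>) \<in> borel_measurable lebesgue" if "P w" for w
    using locally_integrable_zero_outside[OF wl[OF that] cTK K(3)] by auto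
  obtain C where C: "C \<ge> 0" "\<And>g. zero_outside (T ` K) g \<in> borel_measurable lebesgue \<Longrightarrow>
      Lp_norm U p (\<lambda>x. c x * g (T x)) \<le> ennreal C * Lp_norm V p g"
    using Lp_norm_mult_compose[OF K UV c p] by blast
  have "Lp_norm U p (\<lambda>x. c x * w \<mu> (T x)) \<le> ennreal C * ?N w" if "P w" for w
  proof -
    have "Lp_norm U p (\<lambda>x. c x * w \<mu> (T x)) \<le> ennreal C * Lp_norm V p (w \<mu>)" by (rule C(2)[OF wm[OF that]])
    also have "\<dots> \<le> ennreal C * ?N w" by (intro mult_left_mono Lp_norm_le_sobolev_sum \<mu>) simp
    finally show ?thesis .
  qed
  then show "\<exists>C\<ge>0. \<forall>w. P w \<longrightarrow> Lp_norm U p (\<lambda>x. c x * w \<mu> (T x)) \<le> ennreal C * ?N w" using C(1) by blast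
  assume s: "s \<notin> \<int>"
  have \<theta>: "0 < frac s" "frac s < 1" using s by (auto simp: frac_lt_1 frac_gt_0_iff)
  obtain D where D: "D \<ge> 0" "\<And>g. zero_outside (T ` K) g \<in> borel_measurable lebesgue \<Longrightarrow>
      gagliardo U (frac s) p (\<lambda>x. c x * g (T x)) \<le> ennreal D * (gagliardo (T ` K) (frac s) p g + Lp_norm V p g)"
    using gagliardo_mult_compose_local[OF K UV c p \<theta>] by blast
  have "\<exists>E\<ge>0. \<forall>w. P w \<longrightarrow> gagliardo (T ` K) (frac s) p (w \<mu>) \<le> ennreal E * ?N w"
  proof (cases "mi_order \<mu> = nat \<lfloor>s\<rfloor>")
    case True
    have "gagliardo (T ` K) (frac s) p (w \<mu>) \<le> ennreal 1 * ?N w" for w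
    proof -
      have "gagliardo (T ` K) (frac s) p (w \<mu>) \<le> gagliardo V (frac s) p (w \<mu>)"
        using cTK UV p by (intro gagliardo_mono K(3)) (auto simp: compact_imp_closed)
      also have "\<dots> \<le> ?N w" by (rule gagliardo_le_sobolev_sum[OF True s])
      finally show ?thesis by simp
    qed
    then show ?thesis by (intro exI[of _ 1]) auto
  next
    case False
    then have \<mu>': "mi_order (\<mu>(i := Suc (\<mu> i))) \<le> nat \<lfloor>s\<rfloor>" for i using \<mu> unfolding mi_order_upd by simp
    obtain E where E: "E \<ge> 0" "\<And>g d. locally_integrable_on g V \<Longrightarrow> (\<And>i. d i \<in> weak_derivs V (mi_unit i) g) \<Longrightarrow>
        gagliardo (T ` K) (frac s) p g \<le> ennreal E * ((\<Sum>i\<in>UNIV. Lp_norm V p (d i)) + Lp_norm V p g)"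
      using gagliardo_local_bound[OF cTK UV(2) K(3) p \<theta>] by blast
    have "gagliardo (T ` K) (frac s) p (w \<mu>) \<le> ennreal (E * (real CARD('n) + 1)) * ?N w" if "P w" for w
    proof -
      have d: "w (\<mu>(i := Suc (\<mu> i))) \<in> weak_derivs V (mi_unit i) (w \<mu>)" for i
        using \<open>P w\<close> \<mu> \<mu>' unfolding P_def by (blast intro: weak_derivs_upd[OF UV(2)])
      have "gagliardo (T ` K) (frac s) p (w \<mu>) \<le> ennreal E * ((\<Sum>i\<in>UNIV. Lp_norm V p (w (\<mu>(i := Suc (\<mu> i))))) + Lp_norm V p (w \<mu>))"
        by (rule E(2)[OF wl[OF that] d])
      also have "\<dots> \<le> ennreal E * ((\<Sum>i\<in>(UNIV :: 'n set). ?N w) + ?N w)"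
        by (intro mult_left_mono add_mono sum_mono Lp_norm_le_sobolev_sum \<mu> \<mu>') simp
      also have "(\<Sum>i\<in>(UNIV :: 'n set). ?N w) + ?N w = ennreal (real CARD('n) + 1) * ?N w"
        by (simp add: ennreal_plus distrib_right ennreal_of_nat_eq_real_of_nat)
      also have "ennreal E * \<dots> = ennreal (E * (real CARD('n) + 1)) * ?N w"
        using E(1) by (simp add: ennreal_mult mult.assoc)
      finally show ?thesis .
    qed
    then show ?thesis using E(1) by (intro exI[of _ "E * (real CARD('n) + 1)"]) auto
  qed
  then obtain E where E: "E \<ge> 0" "\<And>w. P w \<Longrightarrow> gagliardo (T ` K) (frac s) p (w \<mu>) \<le> ennreal E * ?N w" by blast
  have "gagliardo U (frac s) p (\<lambda>x. c x * w \<mu> (T x)) \<le> ennreal (D * (E + 1)) * ?N w" if "P w" for w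
  proof -
    have "gagliardo U (frac s) p (\<lambda>x. c x * w \<mu> (T x)) \<le> ennreal D * (gagliardo (T ` K) (frac s) p (w \<mu>) + Lp_norm V p (w \<mu>))"
      by (rule D(2)[OF wm[OF that]])
    also have "\<dots> \<le> ennreal D * (ennreal E * ?N w + ?N w)"
      by (intro mult_left_mono add_mono E(2)[OF that] Lp_norm_le_sobolev_sum \<mu>) simp
    also have "\<dots> = ennreal (D * (E + 1)) * ?N w"
      using D(1) E(1) by (simp add: ennreal_mult ennreal_plus distrib_left distrib_right mult.assoc)
    finally show ?thesis .
  qed
  then show "\<exists>C\<ge>0. \<forall>w. P w \<longrightarrow> gagliardo U (frac s) p (\<lambda>x. c x * w \<mu> (T x)) \<le> ennreal C * ?N w"
    using D(1) E(1) by (intro exI[of _ "D * (E + 1)"]) auto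
qed

text \<open>Both the map and its inverse are continuously differentiable, hence Lipschitz on the compact sets \<open>K\<close> and \<open>T(K)\<close>.\<close>

lemma Ck_diffeo_bilipschitz:
  assumes "Ck_diffeo k U V T" "1 \<le> k" "open U" "open V" "compact K" "K \<subseteq> U"
  obtains L where "bilipschitz_on K T L"
proof -
  let ?S = "inv_into U T"
  have bij: "bij_betw T U V" and Tk: "\<And>j. Ck_on k U (\<lambda>x. T x $ j)" and Sk: "\<And>j. Ck_on k V (\<lambda>y. ?S y $ j)"
    using assms(1) unfolding Ck_diffeo_def by blast+
  have T: "Ck_on 1 U (\<lambda>x. T x $ j)" and S: "Ck_on 1 V (\<lambda>y. ?S y $ j)" for j
    by (rule Ck_on_mono[OF Tk assms(2)] Ck_on_mono[OF Sk assms(2)])+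
  obtain L1 where L1: "L1 > 0" "\<And>x y. x \<in> K \<Longrightarrow> y \<in> K \<Longrightarrow> norm (T x - T y) \<le> L1 * norm (x - y)"
    using C1_map_lipschitz_on_compact[OF assms(3,5,6) T] by metis
  have "continuous_on K T"
    by (rule continuous_on_subset[OF continuous_on_components[OF Ck_on_imp_continuous[OF T]] assms(6)])
  then have cTK: "compact (T ` K)" using assms(5) by (rule compact_continuous_image)
  have TKV: "T ` K \<subseteq> V" using bij assms(6) by (auto simp: bij_betw_def)
  obtain L2 where L2: "L2 > 0" "\<And>x y. x \<in> T ` K \<Longrightarrow> y \<in> T ` K \<Longrightarrow> norm (?S x - ?S y) \<le> L2 * norm (x - y)"
    using C1_map_lipschitz_on_compact[OF assms(4) cTK TKV S] by metis
  have ST: "?S (T x) = x" if "x \<in> K" for x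
    using that bij assms(6) by (intro inv_into_f_f) (auto simp: bij_betw_def)
  have "norm (x - y) \<le> max L1 L2 * norm (T x - T y) \<and> norm (T x - T y) \<le> max L1 L2 * norm (x - y)"
    if "x \<in> K" "y \<in> K" for x y
  proof
    have "norm (x - y) \<le> L2 * norm (T x - T y)" using L2(2)[of "T x" "T y"] that ST by simp
    also have "\<dots> \<le> max L1 L2 * norm (T x - T y)" by (intro mult_right_mono) auto
    finally show "norm (x - y) \<le> max L1 L2 * norm (T x - T y)" .
    have "norm (T x - T y) \<le> L1 * norm (x - y)" by (rule L1(2)[OF that])
    also have "\<dots> \<le> max L1 L2 * norm (x - y)" by (intro mult_right_mono) auto
    finally show "norm (T x - T y) \<le> max L1 L2 * norm (x - y)" .
  qed
  then have "bilipschitz_on K T (max L1 L2)" using L1(1) by (auto simp: bilipschitz_on_def)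
  then show ?thesis by (rule that)
qed

text \<open>The weak derivatives of \<open>a (v \<circ> T)\<close> are the sums in the chain rule, and each summand is bounded by the norm of \<open>v\<close>. One
  derivative more than \<open>\<lfloor>s\<rfloor>\<close> is required of \<open>T\<close> and \<open>a\<close> so that all coefficients are still continuously differentiable, as
  the fractional seminorm demands.\<close>

theorem sobolev_mult_compose_bounded:
  fixes T :: "real^'n \<Rightarrow> real^'n" and a :: "real^'n \<Rightarrow> real" and s p :: real
  assumes UV: "open U" "open V" and T: "Ck_diffeo (nat \<lfloor>s\<rfloor> + 1) U V T" and K: "compact K" "K \<subseteq> U"
    and a: "Ck_on (nat \<lfloor>s\<rfloor> + 1) U a" "\<And>x. x \<notin> K \<Longrightarrow> a x = 0" and p: "1 < p"
  shows "\<exists>C>0. \<forall>v\<in>sobolev V s p. (\<lambda>x. a x * v (T x)) \<in> sobolev U s p \<and>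
    sobolev_norm U s p (\<lambda>x. a x * v (T x)) \<le> ennreal C * sobolev_norm V s p v"
proof -
  define k where "k = nat \<lfloor>s\<rfloor>"
  define M where "M = {\<mu> :: 'n \<Rightarrow> nat. mi_order \<mu> \<le> k}"
  let ?I = "\<lambda>\<nu> :: 'n \<Rightarrow> nat. {\<mu> :: 'n \<Rightarrow> nat. mi_order \<mu> \<le> mi_order \<nu>}"
  have fin: "finite M" "finite (?I \<nu>)" for \<nu> unfolding M_def by (rule finite_mi_order_le)+
  have bij: "bij_betw T U V" and Tk: "\<And>j. Ck_on (k + 1) U (\<lambda>x. T x $ j)"
    using T unfolding Ck_diffeo_def k_def by auto
  have TU: "T ` U \<subseteq> V" using bij by (auto simp: bij_betw_def)
  have TKV: "T ` K \<subseteq> V" using TU K(2) by blast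
  obtain L where L: "bilipschitz_on K T L" using Ck_diffeo_bilipschitz[OF T _ UV K] by auto
  have cK: "closed K" by (rule compact_imp_closed[OF K(1)])
  have cTK: "compact (T ` K)" by (rule compact_continuous_image[OF bilipschitz_continuous[OF L] K(1)])
  have "\<forall>\<nu>. \<exists>c. mi_order \<nu> \<le> k \<longrightarrow> (\<forall>\<mu>. Ck_on (k + 1 - mi_order \<nu>) U (c \<mu>) \<and> (\<forall>x. x \<notin> K \<longrightarrow> c \<mu> x = 0)) \<and>
    (\<forall>f. (\<forall>k. Ck_on k V f) \<longrightarrow> (\<forall>x\<in>U. mi_deriv \<nu> (\<lambda>x. a x * f (T x)) x = (\<Sum>\<mu>\<in>?I \<nu>. c \<mu> x * mi_deriv \<mu> f (T x))))"
  proof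
    fix \<nu> :: "'n \<Rightarrow> nat"
    show "\<exists>c. mi_order \<nu> \<le> k \<longrightarrow> (\<forall>\<mu>. Ck_on (k + 1 - mi_order \<nu>) U (c \<mu>) \<and> (\<forall>x. x \<notin> K \<longrightarrow> c \<mu> x = 0)) \<and>
      (\<forall>f. (\<forall>k. Ck_on k V f) \<longrightarrow> (\<forall>x\<in>U. mi_deriv \<nu> (\<lambda>x. a x * f (T x)) x = (\<Sum>\<mu>\<in>?I \<nu>. c \<mu> x * mi_deriv \<mu> f (T x))))"
    proof (cases "mi_order \<nu> \<le> k")
      case True
      then have "mi_order \<nu> \<le> k + 1" by simp
      from mi_deriv_mult_compose[OF UV TU cK K(2) Tk a[folded k_def] this] show ?thesis by blast
    qed blast
  qed
  from choice[OF this] obtain c where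
    c: "\<And>\<nu> \<mu>. mi_order \<nu> \<le> k \<Longrightarrow> Ck_on (k + 1 - mi_order \<nu>) U (c \<nu> \<mu>)" "\<And>\<nu> \<mu> x. mi_order \<nu> \<le> k \<Longrightarrow> x \<notin> K \<Longrightarrow> c \<nu> \<mu> x = 0"
    and cf: "\<And>\<nu> f x. mi_order \<nu> \<le> k \<Longrightarrow> (\<And>k. Ck_on k V f) \<Longrightarrow> x \<in> U \<Longrightarrow>
      mi_deriv \<nu> (\<lambda>x. a x * f (T x)) x = (\<Sum>\<mu>\<in>?I \<nu>. c \<nu> \<mu> x * mi_deriv \<mu> f (T x))" by blast
  have c1: "Ck_on 1 UNIV (c \<nu> \<mu>)" if "mi_order \<nu> \<le> k" for \<nu> \<mu>
  proof (rule Ck_on_zero_extension[OF UV(1) cK K(2)])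
    show "Ck_on 1 U (c \<nu> \<mu>)" by (rule Ck_on_mono[OF c(1)[OF that]]) (use that in simp)
  qed (rule c(2)[OF that])
  let ?N = "sobolev_sum V s p"
  let ?g = "\<lambda>\<nu> \<mu> w x. c \<nu> \<mu> x * w \<mu> (T x)"
  define G where "G w \<nu> = (\<lambda>x. \<Sum>\<mu>\<in>?I \<nu>. ?g \<nu> \<mu> w x)" for w :: "('n \<Rightarrow> nat) \<Rightarrow> real^'n \<Rightarrow> real" and \<nu>
  define P where "P = (\<lambda>w. \<exists>v. \<forall>\<mu>. mi_order \<mu> \<le> nat \<lfloor>s\<rfloor> \<longrightarrow> w \<mu> \<in> weak_derivs V \<mu> v)"
  have gm: "?g \<nu> \<mu> w \<in> borel_measurable lebesgue" if "P w" "mi_order \<nu> \<le> k" "mi_order \<mu> \<le> k" for w \<nu> \<mu>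
  proof -
    have "locally_integrable_on (w \<mu>) V" using that by (auto simp: P_def k_def weak_derivs_def)
    from locally_integrable_zero_outside[OF this cTK TKV]
    have m: "zero_outside (T ` K) (w \<mu>) \<in> borel_measurable lebesgue" by auto
    have c0: "\<And>x. x \<notin> K \<Longrightarrow> c \<nu> \<mu> x = 0" by (rule c(2)[OF that(2)])
    show ?thesis
      by (rule mult_compose_measurable[OF K(1) L borel_measurable_lebesgue_continuous[OF
        Ck_on_imp_continuous[OF c1[OF that(2)]]] c0 m])
  qed
  have terms: "\<exists>C\<ge>0. \<forall>w. P w \<longrightarrow> Lp_norm U p (?g \<nu> \<mu> w) \<le> ennreal C * ?N w"
    "s \<notin> \<int> \<Longrightarrow> \<exists>C\<ge>0. \<forall>w. P w \<longrightarrow> gagliardo U (frac s) p (?g \<nu> \<mu> w) \<le> ennreal C * ?N w"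
    if "mi_order \<nu> \<le> k" "mi_order \<mu> \<le> k" for \<nu> \<mu>
  proof -
    have c0: "\<And>x. x \<notin> K \<Longrightarrow> c \<nu> \<mu> x = 0" by (rule c(2)[OF that(1)])
    show "\<exists>C\<ge>0. \<forall>w. P w \<longrightarrow> Lp_norm U p (?g \<nu> \<mu> w) \<le> ennreal C * ?N w"
      unfolding P_def by (rule sobolev_terms_bound(1)[OF UV K(1) L TKV c1[OF that(1)] c0 p that(2)[unfolded k_def]])
    show "\<exists>C\<ge>0. \<forall>w. P w \<longrightarrow> gagliardo U (frac s) p (?g \<nu> \<mu> w) \<le> ennreal C * ?N w" if "s \<notin> \<int>"
      unfolding P_def by (rule sobolev_terms_bound(2)[OF UV K(1) L TKV c1 c0 p _ that]) (use \<open>mi_order \<nu> \<le> k\<close> \<open>mi_order \<mu> \<le> k\<close> in \<open>simp_all add: k_def\<close>)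
  qed
  have Us: "U \<in> sets borel" using UV(1) by simp
  have LpG: "\<exists>C\<ge>0. \<forall>w. P w \<longrightarrow> Lp_norm U p (G w \<nu>) \<le> ennreal C * ?N w" if \<nu>: "mi_order \<nu> \<le> k" for \<nu>
  proof (rule bounded_by_multiple_trans[OF bounded_by_multiple_sum])
    show "finite (?I \<nu>)" by (rule fin)
    show "\<exists>C\<ge>0. \<forall>w. P w \<longrightarrow> Lp_norm U p (?g \<nu> \<mu> w) \<le> ennreal C * ?N w" if "\<mu> \<in> ?I \<nu>" for \<mu>
      using that \<nu> by (intro terms) auto
    show "0 \<le> real (card (?I \<nu>))" by simp
    show "Lp_norm U p (G w \<nu>) \<le> ennreal (real (card (?I \<nu>))) * (\<Sum>\<mu>\<in>?I \<nu>. Lp_norm U p (?g \<nu> \<mu> w))" if "P w" for w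
      unfolding G_def using fin(2) gm[OF that] \<nu> p Us by (intro Lp_norm_sum) auto
  qed
  have gG: "\<exists>C\<ge>0. \<forall>w. P w \<longrightarrow> gagliardo U (frac s) p (G w \<nu>) \<le> ennreal C * ?N w" if \<nu>: "mi_order \<nu> \<le> k" and s: "s \<notin> \<int>" for \<nu>
  proof (rule bounded_by_multiple_trans[OF bounded_by_multiple_sum])
    show "finite (?I \<nu>)" by (rule fin)
    show "\<exists>C\<ge>0. \<forall>w. P w \<longrightarrow> gagliardo U (frac s) p (?g \<nu> \<mu> w) \<le> ennreal C * ?N w" if "\<mu> \<in> ?I \<nu>" for \<mu>
      using that \<nu> s by (intro terms) auto
    show "0 \<le> real (card (?I \<nu>))" by simp
    show "gagliardo U (frac s) p (G w \<nu>) \<le> ennreal (real (card (?I \<nu>))) * (\<Sum>\<mu>\<in>?I \<nu>. gagliardo U (frac s) p (?g \<nu> \<mu> w))" if "P w" for w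
      unfolding G_def using fin(2) gm[OF that] \<nu> p Us by (intro gagliardo_sum) auto
  qed
  have "\<exists>C\<ge>0. \<forall>w. P w \<longrightarrow> sobolev_sum U s p (G w) \<le> ennreal C * ?N w"
  proof -
    have "\<exists>C\<ge>0. \<forall>w. P w \<longrightarrow> (\<Sum>\<nu> | mi_order \<nu> \<le> k. Lp_norm U p (G w \<nu>)) \<le> ennreal C * ?N w"
      using finite_mi_order_le LpG by (intro bounded_by_multiple_sum) auto
    then obtain C1 where C1: "C1 \<ge> 0" "\<And>w. P w \<Longrightarrow> (\<Sum>\<nu> | mi_order \<nu> \<le> k. Lp_norm U p (G w \<nu>)) \<le> ennreal C1 * ?N w" by blast
    have "\<exists>C\<ge>0. \<forall>w. P w \<longrightarrow> (if s \<in> \<int> then 0 else \<Sum>\<nu> | mi_order \<nu> = k. gagliardo U (frac s) p (G w \<nu>)) \<le> ennreal C * ?N w"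
    proof (cases "s \<in> \<int>")
      case False
      have "\<exists>C\<ge>0. \<forall>w. P w \<longrightarrow> (\<Sum>\<nu> | mi_order \<nu> = k. gagliardo U (frac s) p (G w \<nu>)) \<le> ennreal C * ?N w"
        using finite_mi_order_eq gG[OF _ False] by (intro bounded_by_multiple_sum) auto
      then show ?thesis using False by simp
    qed auto
    then obtain C2 where C2: "C2 \<ge> 0" "\<And>w. P w \<Longrightarrow>
      (if s \<in> \<int> then 0 else \<Sum>\<nu> | mi_order \<nu> = k. gagliardo U (frac s) p (G w \<nu>)) \<le> ennreal C2 * ?N w" by blast
    have "sobolev_sum U s p (G w) \<le> ennreal (C1 + C2) * ?N w" if "P w" for w
      unfolding sobolev_sum_def[of U] k_def[symmetric]
      using add_mono[OF C1(2)[OF that] C2(2)[OF that]] C1(1) C2(1) by (simp add: ennreal_plus distrib_right)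
    then show ?thesis using C1(1) C2(1) by (intro exI[of _ "C1 + C2"]) auto
  qed
  then obtain C where C: "C \<ge> 0" "\<And>w. P w \<Longrightarrow> sobolev_sum U s p (G w) \<le> ennreal C * ?N w" by blast
  have a1: "Ck_on 1 UNIV a"
    by (rule Ck_on_zero_extension[OF UV(1) cK K(2)]) (use Ck_on_mono[OF a(1), of 1] a(2) in auto)
  obtain D where D: "\<And>g. zero_outside (T ` K) g \<in> borel_measurable lebesgue \<Longrightarrow>
      Lp_norm U p (\<lambda>x. a x * g (T x)) \<le> ennreal D * Lp_norm V p g"
    using Lp_norm_mult_compose[OF K(1) L TKV UV a1 a(2) p] by blast
  have "(\<lambda>x. a x * v (T x)) \<in> sobolev U s p \<and>
    sobolev_norm U s p (\<lambda>x. a x * v (T x)) \<le> ennreal (C + 1) * sobolev_norm V s p v" if v: "v \<in> sobolev V s p" for v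
  proof -
    let ?F = "\<lambda>x. a x * v (T x)"
    have vLp: "v \<in> Lp_space V p" and fin': "sobolev_norm V s p v < \<infinity>" using v by (auto simp: sobolev_def)
    have vl: "locally_integrable_on v V" by (rule Lp_space_locally_integrable[OF vLp UV(2) p])
    obtain w where w: "\<And>\<mu>. mi_order \<mu> \<le> nat \<lfloor>s\<rfloor> \<Longrightarrow> w \<mu> \<in> weak_derivs V \<mu> v"
      by (rule sobolev_weak_derivs_exist[OF fin']) blast
    have Pw: "P w" using w unfolding P_def by blast
    have Gw: "G w \<nu> \<in> weak_derivs U \<nu> ?F" if "mi_order \<nu> \<le> nat \<lfloor>s\<rfloor>" for \<nu>
      unfolding G_def
    proof (rule weak_deriv_mult_compose[OF UV TU K L Tk a[folded k_def]])
      show "continuous_on UNIV (c \<nu> \<mu>)" for \<mu> by (rule Ck_on_imp_continuous[OF c1]) (use that k_def in simp)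
    qed (use that c(2) cf vl w k_def in auto)
    have "sobolev_norm U s p ?F = sobolev_sum U s p (G w)" by (rule sobolev_norm_eq_sum[OF UV(1) Gw])
    also have "\<dots> \<le> ennreal C * ?N w" by (rule C(2)[OF Pw])
    also have "?N w = sobolev_norm V s p v" by (rule sobolev_norm_eq_sum[OF UV(2) w, symmetric])
    also have "ennreal C * \<dots> \<le> ennreal (C + 1) * sobolev_norm V s p v"
      by (intro mult_right_mono ennreal_leI) auto
    finally have n: "sobolev_norm U s p ?F \<le> ennreal (C + 1) * sobolev_norm V s p v" .
    have vm: "zero_outside (T ` K) v \<in> borel_measurable lebesgue"
      using locally_integrable_zero_outside[OF vl cTK TKV] by auto
    have "?F \<in> borel_measurable lebesgue"
      by (rule mult_compose_measurable[OF K(1) L borel_measurable_lebesgue_continuous[OF Ck_on_imp_continuous[OF a1]] a(2) vm])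
    then have "?F \<in> borel_measurable (lebesgue_on U)" by (rule measurable_restrict_space1)
    moreover have "Lp_norm U p ?F < \<infinity>"
      using D[OF vm] vLp by (auto simp: Lp_space_def ennreal_mult_less_top intro: le_less_trans)
    moreover have "sobolev_norm U s p ?F < \<infinity>"
      using n fin' by (auto simp: ennreal_mult_less_top intro: le_less_trans)
    ultimately show ?thesis using n by (simp add: sobolev_def Lp_space_def)
  qed
  then show ?thesis using C(1) by (intro exI[of _ "C + 1"]) auto
qed

section \<open>Functions with prescribed support and the estimate for nonnegative order\<close>

text \<open>The complement of the support is a union of open sets on which the distribution, and hence \<open>u\<close>, vanishes; by Lindelof's
  theorem, countably many of them suffice.\<close>

lemma AE_zero_outside_dist_support:
  assumes "open V" "locally_integrable_on u V"
  shows "AE y in lebesgue. y \<in> V \<and> y \<notin> dist_support V (regular_distribution V u) \<longrightarrow> u y = 0"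
proof -
  define F where "F = {W. open W \<and> W \<subseteq> V \<and> (\<forall>\<phi>\<in>test_functions W. regular_distribution V u \<phi> = 0)}"
  obtain F' where F': "F' \<subseteq> F" "countable F'" "\<Union>F' = \<Union>F"
    by (rule Lindelof[of F]) (auto simp: F_def)
  have "AE y in lebesgue. y \<in> W \<longrightarrow> u y = 0" if "W \<in> F'" for W
  proof (rule AE_zero_if_distribution_zero)
    have W: "open W" "W \<subseteq> V" "\<And>\<phi>. \<phi> \<in> test_functions W \<Longrightarrow> regular_distribution V u \<phi> = 0"
      using that F'(1) by (auto simp: F_def)
    show "open W" by (rule W(1))
    show "locally_integrable_on u W" using assms(2) W(2) by (auto simp: locally_integrable_on_def)
    show "regular_distribution W u \<phi> = 0" if \<phi>: "\<phi> \<in> test_functions W" for \<phi>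
    proof -
      have z: "\<And>x. x \<notin> W \<Longrightarrow> \<phi> x = 0" by (rule test_functions_outside[OF \<phi>])
      show ?thesis
        using W(3)[OF \<phi>] regular_distribution_zero_outside[where f = u and \<phi> = \<phi>, OF order_refl z]
          regular_distribution_zero_outside[where f = u and \<phi> = \<phi>, OF W(2) z] by simp
    qed
  qed
  then have "AE y in lebesgue. \<forall>W\<in>F'. y \<in> W \<longrightarrow> u y = 0" by (subst AE_ball_countable[OF F'(2)]) blast
  then show ?thesis
  proof (rule eventually_mono)
    fix y assume y: "\<forall>W\<in>F'. y \<in> W \<longrightarrow> u y = 0"
    show "y \<in> V \<and> y \<notin> dist_support V (regular_distribution V u) \<longrightarrow> u y = 0"
    proof
      assume "y \<in> V \<and> y \<notin> dist_support V (regular_distribution V u)"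
      then have "y \<in> \<Union>F" by (auto simp: dist_support_def F_def)
      then show "u y = 0" using y F'(3) by blast
    qed
  qed
qed

text \<open>The exceptional set is the image of a null set under the inverse map, which is locally Lipschitz.\<close>

lemma AE_compose_diffeo:
  fixes T :: "real^'n \<Rightarrow> real^'n"
  assumes "Ck_diffeo k U V T" "1 \<le> k" "open U" "open V" "AE y in lebesgue. y \<in> V \<longrightarrow> P y"
  shows "AE x in lebesgue. x \<in> U \<longrightarrow> P (T x)"
proof -
  let ?S = "inv_into U T" and ?N = "{y \<in> V. \<not> P y}"
  have bij: "bij_betw T U V" and Sk: "\<And>j. Ck_on k V (\<lambda>y. ?S y $ j)"
    using assms(1) unfolding Ck_diffeo_def by blast+
  have S: "Ck_on 1 V (\<lambda>y. ?S y $ j)" for j by (rule Ck_on_mono[OF Sk assms(2)])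
  obtain N' where N': "{y \<in> space lebesgue. \<not> (y \<in> V \<longrightarrow> P y)} \<subseteq> N'" "emeasure lebesgue N' = 0" "N' \<in> sets lebesgue"
    using AE_E[OF assms(5)] by blast
  have "negligible N'" unfolding negligible_iff_null_sets by (rule null_setsI[OF N'(2,3)])
  then have "negligible ?N" by (rule negligible_subset) (use N'(1) in auto)
  then have "negligible (?S ` ?N)"
  proof (rule negligible_locally_Lipschitz_image[OF order_refl])
    fix x assume "x \<in> ?N"
    then obtain r where r: "r > 0" "cball x r \<subseteq> V" using open_contains_cball[of V] assms(4) by blast
    obtain L where L: "\<And>y z. y \<in> cball x r \<Longrightarrow> z \<in> cball x r \<Longrightarrow> norm (?S y - ?S z) \<le> L * norm (y - z)"
      by (rule C1_map_lipschitz_on_compact[OF assms(4) compact_cball r(2) S]) blast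
    show "\<exists>W B. open W \<and> x \<in> W \<and> (\<forall>y\<in>?N \<inter> W. norm (?S y - ?S x) \<le> B * norm (y - x))"
      using r(1) L by (intro exI[of _ "ball x r"] exI[of _ L]) auto
  qed
  then have "AE x in lebesgue. x \<notin> ?S ` ?N" by (intro AE_not_in) (simp add: negligible_iff_null_sets)
  then show ?thesis
  proof (rule eventually_mono)
    fix x assume x: "x \<notin> ?S ` ?N"
    show "x \<in> U \<longrightarrow> P (T x)"
    proof (intro impI, rule ccontr)
      assume "x \<in> U" "\<not> P (T x)"
      moreover from this have "?S (T x) = x" "T x \<in> V" using bij by (auto simp: bij_betw_def)
      ultimately have "T x \<in> ?N" "x = ?S (T x)" by simp_all
      then show False using x by blast
    qed
  qed
qed

lemma borel_measurable_lebesgue_on_AE: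
  fixes f g :: "'a::euclidean_space \<Rightarrow> real"
  assumes "f \<in> borel_measurable (lebesgue_on \<Omega>)" "\<Omega> \<in> sets lebesgue" "AE x in lebesgue. x \<in> \<Omega> \<longrightarrow> f x = g x"
  shows "g \<in> borel_measurable (lebesgue_on \<Omega>)"
proof -
  obtain N where N': "{x \<in> space lebesgue. \<not> (x \<in> \<Omega> \<longrightarrow> f x = g x)} \<subseteq> N" "emeasure lebesgue N = 0" "N \<in> sets lebesgue"
    using AE_E[OF assms(3)] by blast
  have N: "negligible N" unfolding negligible_iff_null_sets by (rule null_setsI[OF N'(2,3)])
  have eq: "f x = g x" if "x \<in> \<Omega>" "x \<notin> N" for x using N'(1) that by auto
  have sub: "A \<in> sets lebesgue" if "A \<subseteq> N" for A
    using negligible_subset[OF N that] unfolding negligible_iff_null_sets by (rule null_setsD2)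
  have "{x \<in> \<Omega>. a < g x} \<in> sets lebesgue" for a
  proof -
    have *: "{x \<in> \<Omega>. a < f x} \<in> sets lebesgue"
      using borel_measurable_iff_greater[THEN iffD1, OF assms(1), rule_format, of a] assms(2)
      by (simp add: space_restrict_space sets_restrict_space_iff)
    have "{x \<in> \<Omega>. a < g x} = ({x \<in> \<Omega>. a < f x} - N) \<union> ({x \<in> \<Omega>. a < g x} \<inter> N)" using eq by auto
    moreover have "\<dots> \<in> sets lebesgue" by (rule sets.Un[OF sets.Diff[OF * sub] sub]) blast+
    ultimately show ?thesis by simp
  qed
  then show ?thesis
    using assms(2) by (simp add: borel_measurable_iff_greater space_restrict_space sets_restrict_space_iff)
qed

lemma sobolev_cong_AE:
  fixes f g :: "real^'n \<Rightarrow> real"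
  assumes \<Omega>: "open \<Omega>" and eq: "AE x in lebesgue. x \<in> \<Omega> \<longrightarrow> f x = g x" and f: "f \<in> sobolev \<Omega> s p"
  shows "g \<in> sobolev \<Omega> s p \<and> sobolev_norm \<Omega> s p g = sobolev_norm \<Omega> s p f"
proof -
  have fm: "f \<in> borel_measurable (lebesgue_on \<Omega>)" using f by (auto simp: sobolev_def Lp_space_def)
  have \<Omega>s: "\<Omega> \<in> sets lebesgue" using \<Omega> by (simp add: borel_open)
  have gm: "g \<in> borel_measurable (lebesgue_on \<Omega>)" by (rule borel_measurable_lebesgue_on_AE[OF fm \<Omega>s eq])
  have zm: "(\<lambda>x. indicator \<Omega> x *\<^sub>R h x) \<in> borel_measurable lebesgue" if "h \<in> borel_measurable (lebesgue_on \<Omega>)" for h :: "real^'n \<Rightarrow> real"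
    using that \<Omega>s by (simp add: borel_measurable_restrict_space_iff)
  have "regular_distribution \<Omega> f \<phi> = regular_distribution \<Omega> g \<phi>" if \<phi>: "\<phi> \<in> test_functions \<Omega>" for \<phi>
    unfolding regular_distribution_def set_lebesgue_integral_def
  proof (rule integral_cong_AE)
    have \<phi>m: "\<phi> \<in> borel_measurable lebesgue"
      by (rule borel_measurable_lebesgue_continuous[OF test_functions_continuous[OF \<phi>]])
    show "(\<lambda>x. indicator \<Omega> x *\<^sub>R (f x * \<phi> x)) \<in> borel_measurable lebesgue"
      using borel_measurable_times[OF zm[OF fm] \<phi>m] by (simp add: mult.assoc)
    show "(\<lambda>x. indicator \<Omega> x *\<^sub>R (g x * \<phi> x)) \<in> borel_measurable lebesgue"
      using borel_measurable_times[OF zm[OF gm] \<phi>m] by (simp add: mult.assoc)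
    show "AE x in lebesgue. indicator \<Omega> x *\<^sub>R (f x * \<phi> x) = indicator \<Omega> x *\<^sub>R (g x * \<phi> x)"
      using eq by (rule eventually_mono) (auto simp: indicator_def)
  qed
  then have "weak_derivs \<Omega> \<nu> f = weak_derivs \<Omega> \<nu> g" for \<nu>
    unfolding weak_derivs_def by (auto simp: test_functions_mi_deriv)
  then have "sobolev_norm \<Omega> s p g = sobolev_norm \<Omega> s p f" by (simp add: sobolev_norm_def)
  moreover have "Lp_norm \<Omega> p g = Lp_norm \<Omega> p f" by (rule Lp_norm_cong_AE[OF \<Omega>, symmetric, OF eq])
  ultimately show ?thesis using f gm by (simp add: sobolev_def Lp_space_def)
qed

text \<open>Multiplication by the cutoff function \<open>\<eta>\<close> changes \<open>u \<circ> T\<close> on a null set only.\<close>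

theorem composition_bounded_nonneg:
  fixes T :: "real^'n \<Rightarrow> real^'n"
  assumes "0 \<le> s" "1 < p" "open U" "open V" "Ck_diffeo (nat \<lfloor>s\<rfloor> + 1) U V T" "bounded B" "closure B \<subseteq> U"
  shows "composition_bounded s p U V T B"
proof -
  have "compact (closure B)" using assms(6) by simp
  then obtain \<eta> W where \<eta>: "\<eta> \<in> test_functions U" "closure B \<subseteq> W" "\<And>x. x \<in> W \<Longrightarrow> \<eta> x = 1"
    using smooth_cutoff[OF _ assms(3,7)] by metis
  obtain K where K: "compact K" "K \<subseteq> U" "\<And>x. x \<notin> K \<Longrightarrow> \<eta> x = 0" using test_functionsE[OF \<eta>(1)] by metis
  obtain C where C: "C > 0" "\<And>v. v \<in> sobolev V s p \<Longrightarrow> (\<lambda>x. \<eta> x * v (T x)) \<in> sobolev U s p \<and>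
      sobolev_norm U s p (\<lambda>x. \<eta> x * v (T x)) \<le> ennreal C * sobolev_norm V s p v"
    using sobolev_mult_compose_bounded[OF assms(3-5) K(1,2) test_functions_Ck[OF \<eta>(1)] K(3) assms(2)] by blast
  have "u \<circ> T \<in> sobolev U s p \<and> sobolev_norm U s p (u \<circ> T) \<le> ennreal C * sobolev_norm V s p u"
    if u: "u \<in> sobolev V s p" and supp: "dist_support V (regular_distribution V u) \<subseteq> T ` B" for u
  proof -
    have "u \<in> Lp_space V p" using u by (simp add: sobolev_def)
    then have "locally_integrable_on u V" by (rule Lp_space_locally_integrable[OF _ assms(4,2)])
    from AE_zero_outside_dist_support[OF assms(4) this]
    have "AE y in lebesgue. y \<in> V \<longrightarrow> y \<notin> T ` B \<longrightarrow> u y = 0" by (rule eventually_mono) (use supp in blast)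
    from AE_compose_diffeo[OF assms(5) _ assms(3,4) this]
    have "AE x in lebesgue. x \<in> U \<longrightarrow> T x \<notin> T ` B \<longrightarrow> u (T x) = 0" by simp
    then have "AE x in lebesgue. x \<in> U \<longrightarrow> \<eta> x * u (T x) = (u \<circ> T) x"
    proof (rule eventually_mono)
      fix x assume x: "x \<in> U \<longrightarrow> T x \<notin> T ` B \<longrightarrow> u (T x) = 0"
      show "x \<in> U \<longrightarrow> \<eta> x * u (T x) = (u \<circ> T) x"
      proof
        assume "x \<in> U"
        show "\<eta> x * u (T x) = (u \<circ> T) x"
        proof (cases "T x \<in> T ` B")
          case True
          then have "x \<in> B" using assms(5,7) \<open>x \<in> U\<close> closure_subset[of B]
            by (auto simp: Ck_diffeo_def bij_betw_def dest!: inj_onD)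
          then show ?thesis using \<eta>(2,3) closure_subset[of B] by auto
        qed (use x \<open>x \<in> U\<close> in simp)
      qed
    qed
    from sobolev_cong_AE[OF assms(3) this conjunct1[OF C(2)[OF u]]] C(2)[OF u] show ?thesis by (auto simp: comp_def)
  qed
  then show ?thesis using assms(1) unfolding composition_bounded_def by auto
qed

section \<open>The Jacobian determinant of a diffeomorphism\<close>

lemma Ck_diffeo_inverse:
  fixes T :: "real^'n \<Rightarrow> real^'n"
  assumes "Ck_diffeo k U V T" "open U"
  shows "Ck_diffeo k V U (inv_into U T)"
proof -
  have bij: "bij_betw T U V" and T: "\<And>j. Ck_on k U (\<lambda>x. T x $ j)" and S: "\<And>j. Ck_on k V (\<lambda>y. inv_into U T y $ j)"
    using assms(1) unfolding Ck_diffeo_def by blast+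
  have "T x = inv_into V (inv_into U T) x" if "x \<in> U" for x
    by (rule inv_into_inv_into_eq[OF bij that, symmetric])
  then have "Ck_on k U (\<lambda>x. inv_into V (inv_into U T) x $ j)" for j
    using Ck_on_cong[OF assms(2) _ T[of j]] by simp
  then show ?thesis unfolding Ck_diffeo_def using bij_betw_inv_into[OF bij] S by blast
qed

lemma jacobian_component:
  fixes S :: "real^'n \<Rightarrow> real^'n"
  assumes "open V" "\<And>j. Ck_on 1 V (\<lambda>y. S y $ j)" "y \<in> V"
  shows "jacobian S (at y) = (\<chi> i j. partial_deriv j (\<lambda>y. S y $ i) y)"
proof -
  have "(S has_derivative (\<lambda>h. \<chi> i. \<Sum>j\<in>UNIV. partial_deriv j (\<lambda>y. S y $ i) y * h $ j)) (at y)"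
  proof (rule has_derivative_componentwise_within[THEN iffD2], rule ballI)
    fix b :: "real^'n" assume "b \<in> Basis"
    then obtain i where b: "b = axis i 1" by (auto simp: Basis_vec_def)
    show "((\<lambda>y. S y \<bullet> b) has_derivative (\<lambda>h. (\<chi> i. \<Sum>j\<in>UNIV. partial_deriv j (\<lambda>y. S y $ i) y * h $ j) \<bullet> b)) (at y)"
      using C1_has_derivative[OF assms(1) assms(2)[of i] assms(3)] by (simp add: b inner_axis)
  qed
  from frechet_derivative_at[OF this] have "jacobian S (at y) = matrix (\<lambda>h. \<chi> i. \<Sum>j\<in>UNIV. partial_deriv j (\<lambda>y. S y $ i) y * h $ j)"
    by (simp add: jacobian_def)
  also have "\<dots> = (\<chi> i j. partial_deriv j (\<lambda>y. S y $ i) y)"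
    unfolding matrix_def by (simp add: vec_eq_iff axis_def if_distrib[where f = "\<lambda>z. _ * z"] cong: if_cong)
  finally show ?thesis .
qed

text \<open>The Jacobian determinant of a diffeomorphism has no zeros because the Jacobian of the inverse map is
  an inverse matrix; hence its absolute value is as smooth as the determinant itself.\<close>

lemma Ck_on_abs_det_jacobian:
  fixes S :: "real^'n \<Rightarrow> real^'n"
  assumes "Ck_diffeo (k + 1) V U S" "open U" "open V"
  shows "Ck_on k V (\<lambda>y. \<bar>det (jacobian S (at y))\<bar>)"
proof -
  let ?T = "inv_into V S" and ?d = "\<lambda>y. det (jacobian S (at y))"
  have bij: "bij_betw S V U" and Sk: "\<And>j. Ck_on (k + 1) V (\<lambda>y. S y $ j)" and Tk: "\<And>j. Ck_on (k + 1) U (\<lambda>x. ?T x $ j)"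
    using assms(1) unfolding Ck_diffeo_def by blast+
  have S1: "Ck_on 1 V (\<lambda>y. S y $ j)" for j by (rule Ck_on_mono[OF Sk]) simp
  have T1: "Ck_on 1 U (\<lambda>x. ?T x $ j)" for j by (rule Ck_on_mono[OF Tk]) simp
  have SV: "S y \<in> U" if "y \<in> V" for y using bij that by (auto simp: bij_betw_def)
  have TS: "?T (S y) = y" if "y \<in> V" for y using bij that by (simp add: bij_betw_def)
  have d: "?d y = (\<Sum>p | p permutes UNIV. of_int (sign p) * (\<Prod>i\<in>UNIV. partial_deriv (p i) (\<lambda>y. S y $ i) y))"
    if "y \<in> V" for y
    by (simp add: jacobian_component[OF assms(3) S1 that] det_def)
  have dk: "Ck_on k V ?d"
  proof (rule Ck_on_cong[OF assms(3)])
    show "Ck_on k V (\<lambda>y. \<Sum>p | p permutes UNIV. of_int (sign p) * (\<Prod>i\<in>UNIV. partial_deriv (p i) (\<lambda>y. S y $ i) y))"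
      by (intro Ck_on_sum Ck_on_cmult Ck_on_prod assms(3) Ck_on_partial Sk[unfolded Suc_eq_plus1[symmetric]])
  qed (simp add: d)
  have nz: "?d y \<noteq> 0" if y: "y \<in> V" for y
  proof
    assume "?d y = 0"
    moreover have "(\<chi> i m. partial_deriv m (\<lambda>x. ?T x $ i) (S y)) ** jacobian S (at y) = mat 1"
    proof -
      have "(\<Sum>m\<in>UNIV. partial_deriv m (\<lambda>x. ?T x $ i) (S y) * partial_deriv j (\<lambda>y. S y $ m) y) = (if j = i then 1 else 0)" for i j
      proof -
        have "has_partial j (\<lambda>y. ?T (S y) $ i) (\<Sum>m\<in>UNIV. partial_deriv m (\<lambda>x. ?T x $ i) (S y) * partial_deriv j (\<lambda>y. S y $ m) y) y"
          by (rule C1_chain_rule[OF assms(2) T1 Ck_on_has_partial[OF S1 _ y] SV[OF y]]) simp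
        from has_partial_cong[OF assms(3) y _ this, of "\<lambda>y. y $ i"] TS
        have "has_partial j (\<lambda>y. y $ i) (\<Sum>m\<in>UNIV. partial_deriv m (\<lambda>x. ?T x $ i) (S y) * partial_deriv j (\<lambda>y. S y $ m) y) y" by simp
        from has_partial_imp_eq[OF this] has_partial_imp_eq[OF has_partial_coord] show ?thesis by metis
      qed
      then show ?thesis
        by (simp add: jacobian_component[OF assms(3) S1 y] matrix_matrix_mult_def mat_def vec_eq_iff eq_commute)
    qed
    ultimately show False using det_mul[of "\<chi> i m. partial_deriv m (\<lambda>x. ?T x $ i) (S y)" "jacobian S (at y)"] by simp
  qed
  have dc: "continuous_on V ?d" by (rule Ck_on_imp_continuous[OF dk])
  let ?P = "{y \<in> V. ?d y > 0}" and ?N = "{y \<in> V. ?d y < 0}"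
  have "?P = ?d -` {0<..} \<inter> V" "?N = ?d -` {..<0} \<inter> V" by auto
  then have PN: "open ?P" "open ?N"
    using dc continuous_on_open_vimage[OF assms(3), of ?d] by simp_all
  have "Ck_on k ?P (\<lambda>y. \<bar>?d y\<bar>)"
    by (rule Ck_on_cong[OF PN(1) _ Ck_on_subset[OF dk]]) auto
  moreover have "Ck_on k ?N (\<lambda>y. \<bar>?d y\<bar>)"
    by (rule Ck_on_cong[OF PN(2) _ Ck_on_uminus[OF PN(2) Ck_on_subset[OF dk]]]) auto
  ultimately have "Ck_on k (?P \<union> ?N) (\<lambda>y. \<bar>?d y\<bar>)" by (rule Ck_on_Un[OF PN])
  moreover have "?P \<union> ?N = V" using nz by (auto simp: neq_iff)
  ultimately show ?thesis by simp
qed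

section \<open>Distributions and their supports\<close>

lemma distributions_linear:
  "u \<in> distributions \<Omega> \<Longrightarrow> \<phi> \<in> test_functions \<Omega> \<Longrightarrow> \<psi> \<in> test_functions \<Omega> \<Longrightarrow>
    u (\<lambda>x. a * \<phi> x + b * \<psi> x) = a * u \<phi> + b * u \<psi>"
  by (auto simp: distributions_def)

text \<open>A partition of unity argument: finitely many cutoff functions, each supported where \<open>u\<close> vanishes,
  are split off from the test function one after the other.\<close>

lemma distribution_zero_off_support:
  fixes u :: "(real^'n \<Rightarrow> real) \<Rightarrow> real"
  assumes "open V" "u \<in> distributions V" "\<phi> \<in> test_functions V" "compact K" "K \<subseteq> V"
    "\<And>x. x \<notin> K \<Longrightarrow> \<phi> x = 0" "K \<inter> dist_support V u = {}"
  shows "u \<phi> = 0"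
proof -
  define G where "G = {A. open A \<and> (\<exists>\<beta> W. W \<subseteq> V \<and> \<beta> \<in> test_functions W \<and> (\<forall>x\<in>A. \<beta> x = (1::real)) \<and> (\<forall>\<psi>\<in>test_functions W. u \<psi> = 0))}"
  have "\<exists>A\<in>G. x \<in> A" if "x \<in> K" for x
  proof -
    have "x \<in> V" "x \<notin> dist_support V u" using that assms(5,7) by auto
    then have "\<exists>W. open W \<and> x \<in> W \<and> W \<subseteq> V \<and> \<not> (\<exists>\<psi>\<in>test_functions W. u \<psi> \<noteq> 0)"
      by (simp add: dist_support_def)
    then obtain W where W: "open W" "x \<in> W" "W \<subseteq> V" "\<forall>\<psi>\<in>test_functions W. u \<psi> = 0" by auto
    have xW: "{x} \<subseteq> W" using W(2) by simp
    obtain \<beta> A where "\<beta> \<in> test_functions W" "open A" "{x} \<subseteq> A" "\<And>x. x \<in> A \<Longrightarrow> \<beta> x = 1"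
      using smooth_cutoff[OF compact_sing W(1) xW] by metis
    then have "A \<in> G" "x \<in> A" using W(3,4) unfolding G_def by blast+
    then show ?thesis by blast
  qed
  then have "K \<subseteq> \<Union>G" by blast
  moreover have "open A" if "A \<in> G" for A using that by (simp add: G_def)
  ultimately obtain \<A> where \<A>: "\<A> \<subseteq> G" "finite \<A>" "K \<subseteq> \<Union>\<A>"
    by (rule compactE[OF assms(4)])
  have "\<forall>\<phi>\<in>test_functions V. (\<forall>x. x \<notin> \<Union>\<A> \<longrightarrow> \<phi> x = 0) \<longrightarrow> u \<phi> = 0"
    using \<A>(2,1)
  proof (induction \<A> rule: finite_induct)
    case empty
    show ?case
    proof (intro ballI impI)
      fix \<phi> :: "real^'n \<Rightarrow> real" assume \<phi>: "\<phi> \<in> test_functions V" "\<forall>x. x \<notin> \<Union>{} \<longrightarrow> \<phi> x = 0"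
      then have "(\<lambda>x. 0 * \<phi> x + 0 * \<phi> x) = \<phi>" by auto
      then show "u \<phi> = 0" using distributions_linear[OF assms(2) \<phi>(1) \<phi>(1), of 0 0] by simp
    qed
  next
    case (insert A \<A>)
    from insert.prems have "A \<in> G" by simp
    then obtain \<beta> W where \<beta>: "W \<subseteq> V" "\<beta> \<in> test_functions W" "\<And>x. x \<in> A \<Longrightarrow> \<beta> x = 1" "\<And>\<psi>. \<psi> \<in> test_functions W \<Longrightarrow> u \<psi> = 0"
      unfolding G_def by blast
    show ?case
    proof (intro ballI impI)
      fix \<phi> :: "real^'n \<Rightarrow> real" assume \<phi>: "\<phi> \<in> test_functions V" "\<forall>x. x \<notin> \<Union>(insert A \<A>) \<longrightarrow> \<phi> x = 0"
      have 1: "(\<lambda>x. \<phi> x * \<beta> x) \<in> test_functions W" by (rule test_functions_mult[OF \<beta>(2) test_functions_Ck[OF \<phi>(1)]])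
      have h1: "(\<lambda>x. \<phi> x * \<beta> x) \<in> test_functions V" by (rule test_functions_mono[OF 1 \<beta>(1)])
      have 2: "(\<lambda>x. 1 * \<phi> x + (-1) * (\<phi> x * \<beta> x)) \<in> test_functions V" by (rule test_functions_lincomb[OF \<phi>(1) h1])
      have "1 * \<phi> x + (-1) * (\<phi> x * \<beta> x) = 0" if "x \<notin> \<Union>\<A>" for x
        using \<beta>(3)[of x] \<phi>(2) that by (cases "x \<in> A") auto
      then have "\<forall>x. x \<notin> \<Union>\<A> \<longrightarrow> 1 * \<phi> x + (-1) * (\<phi> x * \<beta> x) = 0" by blast
      moreover have "\<A> \<subseteq> G" using insert.prems by simp
      ultimately have "u (\<lambda>x. 1 * \<phi> x + (-1) * (\<phi> x * \<beta> x)) = 0" using bspec[OF insert.IH 2] by simp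
      then show "u \<phi> = 0" using distributions_linear[OF assms(2) \<phi>(1) h1, of 1 "-1"] \<beta>(4)[OF 1] by simp
    qed
  qed
  moreover have "\<phi> x = 0" if "x \<notin> \<Union>\<A>" for x using assms(6) \<A>(3) that by blast
  ultimately show ?thesis using assms(3) by blast
qed

section \<open>Homogeneity and the closure of the test functions\<close>

text \<open>For positive real constants, homogeneity of the upper integral holds for arbitrary functions, measurable or not. The
  weak derivatives in the definition of the norm come without a measurability assumption on the whole of \<open>\<Omega>\<close>.\<close>

lemma nn_integral_cmult_real:
  assumes "c > 0"
  shows "(\<integral>\<^sup>+x. ennreal c * f x \<partial>M) = ennreal c * (\<integral>\<^sup>+x. f x \<partial>M)"
proof -
  have le: "(\<integral>\<^sup>+x. ennreal b * f x \<partial>M) \<le> ennreal b * (\<integral>\<^sup>+x. f x \<partial>M)" if b: "b > 0" for b f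
    unfolding nn_integral_def[of M "\<lambda>x. ennreal b * f x"]
  proof (rule SUP_least)
    fix g assume "g \<in> {g. simple_function M g \<and> g \<le> (\<lambda>x. ennreal b * f x)}"
    then have g: "simple_function M g" "\<And>x. g x \<le> ennreal b * f x" by (auto simp: le_fun_def)
    have e: "ennreal b * (ennreal (1 / b) * y) = y" "ennreal (1 / b) * (ennreal b * y) = y" for y
      using b by (simp_all add: mult.assoc[symmetric] ennreal_mult[symmetric])
    have s: "simple_function M (\<lambda>x. ennreal (1 / b) * g x)" by (rule simple_function_compose1[OF g(1)])
    have "ennreal (1 / b) * integral\<^sup>S M g = integral\<^sup>S M (\<lambda>x. ennreal (1 / b) * g x)"
      using g(1) by simp
    also have "\<dots> = (\<integral>\<^sup>+x. ennreal (1 / b) * g x \<partial>M)" by (rule nn_integral_eq_simple_integral[OF s, symmetric])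
    also have "\<dots> \<le> (\<integral>\<^sup>+x. f x \<partial>M)"
      by (rule nn_integral_mono) (use g(2) e(2) in \<open>metis mult_left_mono zero_le\<close>)
    finally have "ennreal b * (ennreal (1 / b) * integral\<^sup>S M g) \<le> ennreal b * (\<integral>\<^sup>+x. f x \<partial>M)"
      by (rule mult_left_mono) simp
    then show "integral\<^sup>S M g \<le> ennreal b * (\<integral>\<^sup>+x. f x \<partial>M)" by (simp only: e)
  qed
  have e: "ennreal c * (ennreal (1 / c) * y) = y" "ennreal (1 / c) * (ennreal c * y) = y" for y
    using assms by (simp_all add: mult.assoc[symmetric] ennreal_mult[symmetric])
  show ?thesis
  proof (rule antisym[OF le[OF assms]])
    have "(\<integral>\<^sup>+x. f x \<partial>M) = (\<integral>\<^sup>+x. ennreal (1 / c) * (ennreal c * f x) \<partial>M)" by (simp only: e)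
    also have "\<dots> \<le> ennreal (1 / c) * (\<integral>\<^sup>+x. ennreal c * f x \<partial>M)" by (rule le) (use assms in simp)
    finally have "ennreal c * (\<integral>\<^sup>+x. f x \<partial>M) \<le> ennreal c * (ennreal (1 / c) * (\<integral>\<^sup>+x. ennreal c * f x \<partial>M))"
      by (rule mult_left_mono) simp
    then show "ennreal c * (\<integral>\<^sup>+x. f x \<partial>M) \<le> (\<integral>\<^sup>+x. ennreal c * f x \<partial>M)" by (simp only: e)
  qed
qed

lemma Lp_norm_cmult:
  assumes "c > 0" "p > 0"
  shows "Lp_norm \<Omega> p (\<lambda>x. c * f x) = ennreal c * Lp_norm \<Omega> p f"
proof -
  have "(\<integral>\<^sup>+x. ennreal (\<bar>c * f x\<bar> powr p) \<partial>lebesgue_on \<Omega>) = (\<integral>\<^sup>+x. ennreal (c powr p) * ennreal (\<bar>f x\<bar> powr p) \<partial>lebesgue_on \<Omega>)"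
    using assms by (simp add: abs_mult powr_mult ennreal_mult)
  also have "\<dots> = ennreal (c powr p) * (\<integral>\<^sup>+x. ennreal (\<bar>f x\<bar> powr p) \<partial>lebesgue_on \<Omega>)"
    by (rule nn_integral_cmult_real) (use assms in simp)
  finally show ?thesis unfolding Lp_norm_def using assms by (simp add: ennreal_root_cmult powr_powr)
qed

lemma gagliardo_cmult:
  fixes f :: "real^'n \<Rightarrow> real"
  assumes "c > 0" "p > 0"
  shows "gagliardo \<Omega> \<theta> p (\<lambda>x. c * f x) = ennreal c * gagliardo \<Omega> \<theta> p f"
proof -
  let ?m = "real CARD('n) + \<theta> * p"
  have "ennreal (\<bar>c * f x - c * f y\<bar> powr p / norm (x - y) powr ?m) = ennreal (c powr p) * ennreal (\<bar>f x - f y\<bar> powr p / norm (x - y) powr ?m)" for x y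
    using assms by (simp add: right_diff_distrib[symmetric] abs_mult powr_mult ennreal_mult[symmetric])
  then have "(\<integral>\<^sup>+(x, y). ennreal (\<bar>c * f x - c * f y\<bar> powr p / norm (x - y) powr ?m) \<partial>lebesgue_on (\<Omega> \<times> \<Omega>)) =
      (\<integral>\<^sup>+z. ennreal (c powr p) * (case z of (x, y) \<Rightarrow> ennreal (\<bar>f x - f y\<bar> powr p / norm (x - y) powr ?m)) \<partial>lebesgue_on (\<Omega> \<times> \<Omega>))"
    by (simp add: case_prod_unfold)
  also have "\<dots> = ennreal (c powr p) * (\<integral>\<^sup>+(x, y). ennreal (\<bar>f x - f y\<bar> powr p / norm (x - y) powr ?m) \<partial>lebesgue_on (\<Omega> \<times> \<Omega>))"
    by (rule nn_integral_cmult_real) (use assms in simp)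
  finally show ?thesis unfolding gagliardo_def using assms by (simp add: ennreal_root_cmult powr_powr)
qed

lemma weak_derivs_cmult:
  assumes "g \<in> weak_derivs \<Omega> \<nu> f"
  shows "(\<lambda>x. c * g x) \<in> weak_derivs \<Omega> \<nu> (\<lambda>x. c * f x)"
proof -
  have r: "regular_distribution \<Omega> (\<lambda>x. c * h x) \<phi> = c * regular_distribution \<Omega> h \<phi>" for h \<phi>
    by (simp add: regular_distribution_def mult.assoc)
  have "locally_integrable_on (\<lambda>x. c * g x) \<Omega>"
    using assms by (auto simp: weak_derivs_def locally_integrable_on_def intro: set_integrable_mult_right)
  then show ?thesis using assms by (auto simp: weak_derivs_def r)
qed

lemma sobolev_norm_cmult:
  assumes "open \<Omega>" "c > 0" "p > 0" "sobolev_norm \<Omega> s p u < \<infinity>"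
  shows "sobolev_norm \<Omega> s p (\<lambda>x. c * u x) = ennreal c * sobolev_norm \<Omega> s p u"
proof -
  obtain w where w: "\<And>\<mu>. mi_order \<mu> \<le> nat \<lfloor>s\<rfloor> \<Longrightarrow> w \<mu> \<in> weak_derivs \<Omega> \<mu> u"
    by (rule sobolev_weak_derivs_exist[OF assms(4)]) blast
  have "sobolev_norm \<Omega> s p (\<lambda>x. c * u x) = sobolev_sum \<Omega> s p (\<lambda>\<mu> x. c * w \<mu> x)"
    by (rule sobolev_norm_eq_sum[OF assms(1) weak_derivs_cmult[OF w]])
  also have "\<dots> = ennreal c * sobolev_sum \<Omega> s p w"
    unfolding sobolev_sum_def using assms(2,3)
    by (simp add: Lp_norm_cmult gagliardo_cmult sum_distrib_left distrib_left)
  also have "sobolev_sum \<Omega> s p w = sobolev_norm \<Omega> s p u" by (rule sobolev_norm_eq_sum[OF assms(1) w, symmetric])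
  finally show ?thesis .
qed

lemma sobolev_cmult:
  assumes "open \<Omega>" "c > 0" "p > 0" "u \<in> sobolev \<Omega> s p"
  shows "(\<lambda>x. c * u x) \<in> sobolev \<Omega> s p"
  using assms by (auto simp: sobolev_def Lp_space_def Lp_norm_cmult sobolev_norm_cmult ennreal_mult_less_top)

lemma sobolev0_cmult:
  assumes "open \<Omega>" "c > 0" "p > 0" "u \<in> sobolev0 \<Omega> s p"
  shows "(\<lambda>x. c * u x) \<in> sobolev0 \<Omega> s p"
  unfolding sobolev0_def mem_Collect_eq
proof (intro conjI allI impI)
  show "(\<lambda>x. c * u x) \<in> sobolev \<Omega> s p" using assms by (intro sobolev_cmult) (auto simp: sobolev0_def)
  fix e :: real assume "e > 0"
  then have "e / c > 0" using assms(2) by simp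
  then obtain \<phi> where \<phi>: "\<phi> \<in> test_functions \<Omega>" "sobolev_norm \<Omega> s p (\<lambda>x. u x - \<phi> x) < ennreal (e / c)"
    using assms(4) unfolding sobolev0_def by blast
  have fin: "sobolev_norm \<Omega> s p (\<lambda>x. u x - \<phi> x) < \<infinity>" using \<phi>(2) by (rule less_trans) simp
  have "(\<lambda>x. c * \<phi> x + 0 * \<phi> x) \<in> test_functions \<Omega>" by (rule test_functions_lincomb[OF \<phi>(1) \<phi>(1)])
  moreover have "sobolev_norm \<Omega> s p (\<lambda>x. c * u x - c * \<phi> x) < ennreal e"
  proof -
    have "sobolev_norm \<Omega> s p (\<lambda>x. c * u x - c * \<phi> x) = ennreal c * sobolev_norm \<Omega> s p (\<lambda>x. u x - \<phi> x)"
      using sobolev_norm_cmult[OF assms(1-3) fin] by (simp add: right_diff_distrib)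
    also have "\<dots> < ennreal c * ennreal (e / c)" using \<phi>(2) assms(2) by (intro ennreal_mult_strict_left_mono) auto
    also have "\<dots> = ennreal e" using assms(2) \<open>e > 0\<close> by (simp add: ennreal_mult[symmetric])
    finally show ?thesis .
  qed
  ultimately show "\<exists>\<phi>\<in>test_functions \<Omega>. sobolev_norm \<Omega> s p (\<lambda>x. c * u x - \<phi> x) < ennreal e"
    by (intro bexI[of _ "\<lambda>x. c * \<phi> x"]) simp_all
qed

lemma continuous_locally_integrable:
  fixes f :: "real^'n \<Rightarrow> real"
  assumes "continuous_on UNIV f" shows "locally_integrable_on f \<Omega>"
  unfolding locally_integrable_on_def
proof (intro allI impI)
  fix K assume "compact K \<and> K \<subseteq> \<Omega>"
  then have "integrable lebesgue (zero_outside K f)"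
    using integrable_zero_outside_continuous continuous_on_subset[OF assms subset_UNIV] by blast
  then show "f absolutely_integrable_on K" by (simp add: set_integrable_def zero_outside_def[abs_def])
qed

text \<open>A locally integrable function is its own weak derivative of order zero, so finiteness of the norm includes finiteness of the
  \<open>L\<^sup>p\<close> norm.\<close>

lemma sobolev_memI:
  fixes f :: "real^'n \<Rightarrow> real"
  assumes \<Omega>: "open \<Omega>" and f: "locally_integrable_on f \<Omega>" "f \<in> borel_measurable (lebesgue_on \<Omega>)" "sobolev_norm \<Omega> s p f < \<infinity>"
  shows "f \<in> sobolev \<Omega> s p"
proof -
  have w: "f \<in> weak_derivs \<Omega> (\<lambda>_. 0) f" using f(1) by (simp add: weak_derivs_def)
  have "Lp_norm \<Omega> p f = (INF g\<in>weak_derivs \<Omega> (\<lambda>_. 0) f. Lp_norm \<Omega> p g)"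
    by (rule INF_weak_derivs[OF \<Omega> w, symmetric], rule Lp_norm_cong_AE[OF \<Omega>])
  also have "\<dots> \<le> (\<Sum>\<nu> | mi_order \<nu> \<le> nat \<lfloor>s\<rfloor>. INF g\<in>weak_derivs \<Omega> \<nu> f. Lp_norm \<Omega> p g)"
    by (intro member_le_sum[of "\<lambda>_. 0"]) (auto simp: finite_mi_order_le)
  also have "\<dots> \<le> sobolev_norm \<Omega> s p f" unfolding sobolev_norm_def by (rule add_increasing2) simp_all
  finally have "Lp_norm \<Omega> p f < \<infinity>" using f(3) by (rule le_less_trans)
  then show ?thesis using f(2,3) by (simp add: sobolev_def Lp_space_def)
qed

lemma sobolev_diff_test:
  assumes "open \<Omega>" "1 < p" "v \<in> sobolev \<Omega> s p" "\<phi> \<in> test_functions \<Omega>" "sobolev_norm \<Omega> s p (\<lambda>x. v x - \<phi> x) < \<infinity>"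
  shows "(\<lambda>x. v x - \<phi> x) \<in> sobolev \<Omega> s p"
proof (rule sobolev_memI[OF assms(1) _ _ assms(5)])
  have v: "v \<in> Lp_space \<Omega> p" using assms(3) by (simp add: sobolev_def)
  have c: "continuous_on UNIV \<phi>" by (rule test_functions_continuous[OF assms(4)])
  show "locally_integrable_on (\<lambda>x. v x - \<phi> x) \<Omega>"
    by (rule locally_integrable_diff[OF Lp_space_locally_integrable[OF v assms(1,2)] continuous_locally_integrable[OF c]])
  have "\<phi> \<in> borel_measurable (lebesgue_on \<Omega>)"
    by (rule measurable_restrict_space1[OF borel_measurable_lebesgue_continuous[OF c]])
  then show "(\<lambda>x. v x - \<phi> x) \<in> borel_measurable (lebesgue_on \<Omega>)" using v by (auto simp: Lp_space_def intro: borel_measurable_diff)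
qed

section \<open>Pullback of functionals and the composition estimate\<close>

lemma distributions_bound:
  assumes "u \<in> distributions \<Omega>" "compact K" "K \<subseteq> \<Omega>"
  obtains C N where "\<And>\<phi>. \<phi> \<in> test_functions \<Omega> \<Longrightarrow> closure {x. \<phi> x \<noteq> 0} \<subseteq> K \<Longrightarrow>
    \<bar>u \<phi>\<bar> \<le> C * (\<Sum>\<nu> | mi_order \<nu> \<le> N. SUP x. \<bar>mi_deriv \<nu> \<phi> x\<bar>)"
proof -
  have "\<exists>C N. \<forall>\<phi>\<in>test_functions \<Omega>. closure {x. \<phi> x \<noteq> 0} \<subseteq> K \<longrightarrow>
      \<bar>u \<phi>\<bar> \<le> C * (\<Sum>\<nu> | mi_order \<nu> \<le> N. SUP x. \<bar>mi_deriv \<nu> \<phi> x\<bar>)"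
    using assms unfolding distributions_def by simp
  then show ?thesis using that by blast
qed

lemma test_functions_SUP:
  assumes "\<phi> \<in> test_functions \<Omega>"
  shows "\<bar>mi_deriv \<nu> \<phi> x\<bar> \<le> (SUP x. \<bar>mi_deriv \<nu> \<phi> x\<bar>)" "0 \<le> (SUP x. \<bar>mi_deriv \<nu> \<phi> x\<bar>)"
proof -
  obtain L where "\<And>x. \<bar>mi_deriv \<nu> \<phi> x\<bar> \<le> L"
    by (rule test_functions_bound[OF test_functions_mi_deriv[OF assms]]) blast
  then have bdd: "bdd_above (range (\<lambda>x. \<bar>mi_deriv \<nu> \<phi> x\<bar>))" by (rule bdd_aboveI2)
  show "\<bar>mi_deriv \<nu> \<phi> x\<bar> \<le> (SUP x. \<bar>mi_deriv \<nu> \<phi> x\<bar>)" by (rule cSUP_upper[OF UNIV_I bdd])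
  show "0 \<le> (SUP x. \<bar>mi_deriv \<nu> \<phi> x\<bar>)" by (rule order_trans[OF abs_ge_zero cSUP_upper[OF UNIV_I bdd]])
qed

text \<open>The coefficients in the classical formula for the derivatives of \<open>a (\<phi> \<circ> S)\<close> are continuous with compact support, hence
  bounded.\<close>

lemma mi_deriv_mult_compose_bound:
  fixes S :: "real^'n \<Rightarrow> real^'n" and a :: "real^'n \<Rightarrow> real"
  assumes "open V" "open U" "S ` V \<subseteq> U" and S: "\<And>k j. Ck_on k V (\<lambda>y. S y $ j)" and a: "a \<in> test_functions V"
  shows "\<exists>C\<ge>0. \<forall>\<phi>\<in>test_functions U.
    (SUP y. \<bar>mi_deriv \<nu> (\<lambda>y. a y * \<phi> (S y)) y\<bar>) \<le> C * (\<Sum>\<mu> | mi_order \<mu> \<le> mi_order \<nu>. SUP x. \<bar>mi_deriv \<mu> \<phi> x\<bar>)"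
proof -
  let ?I = "{\<mu> :: 'n \<Rightarrow> nat. mi_order \<mu> \<le> mi_order \<nu>}"
  obtain K where K: "compact K" "K \<subseteq> V" "\<And>y. y \<notin> K \<Longrightarrow> a y = 0" using test_functionsE[OF a] by metis
  have cK: "closed K" by (rule compact_imp_closed[OF K(1)])
  obtain c where c: "\<And>\<mu>. Ck_on (mi_order \<nu> - mi_order \<nu>) V (c \<mu>)" "\<And>\<mu> y. y \<notin> K \<Longrightarrow> c \<mu> y = 0"
    and cf: "\<And>f y. (\<And>k. Ck_on k U f) \<Longrightarrow> y \<in> V \<Longrightarrow> mi_deriv \<nu> (\<lambda>y. a y * f (S y)) y = (\<Sum>\<mu>\<in>?I. c \<mu> y * mi_deriv \<mu> f (S y))"
    using mi_deriv_mult_compose[OF assms(1-3) cK K(2) S test_functions_Ck[OF a] K(3) order_refl[of "mi_order \<nu>"]] by blast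
  have "\<forall>\<mu>. \<exists>M\<ge>0. \<forall>y. \<bar>c \<mu> y\<bar> \<le> M"
  proof
    fix \<mu> :: "'n \<Rightarrow> nat"
    have "continuous_on K (c \<mu>)" by (rule continuous_on_subset[OF Ck_on_imp_continuous[OF c(1)] K(2)])
    then obtain M where M: "M \<ge> 0" "\<And>y. y \<in> K \<Longrightarrow> norm (c \<mu> y) \<le> M"
      by (rule continuous_on_compact_bound[OF K(1)]) blast
    have "\<bar>c \<mu> y\<bar> \<le> M" for y using M c(2)[of y \<mu>] by (cases "y \<in> K") auto
    then show "\<exists>M\<ge>0. \<forall>y. \<bar>c \<mu> y\<bar> \<le> M" using M(1) by blast
  qed
  from choice[OF this] obtain M where M: "\<And>\<mu>. M \<mu> \<ge> 0" "\<And>\<mu> y. \<bar>c \<mu> y\<bar> \<le> M \<mu>" by blast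
  have fin: "finite ?I" by (rule finite_mi_order_le)
  define C where "C = (\<Sum>\<mu>\<in>?I. M \<mu>)"
  have C: "C \<ge> 0" "\<mu> \<in> ?I \<Longrightarrow> M \<mu> \<le> C" for \<mu>
    unfolding C_def using fin M(1) by (auto intro: sum_nonneg member_le_sum)
  have "(SUP y. \<bar>mi_deriv \<nu> (\<lambda>y. a y * \<phi> (S y)) y\<bar>) \<le> C * (\<Sum>\<mu>\<in>?I. SUP x. \<bar>mi_deriv \<mu> \<phi> x\<bar>)"
    if \<phi>: "\<phi> \<in> test_functions U" for \<phi>
  proof (rule cSUP_least)
    fix y
    note sup = test_functions_SUP[OF \<phi>]
    show "\<bar>mi_deriv \<nu> (\<lambda>y. a y * \<phi> (S y)) y\<bar> \<le> C * (\<Sum>\<mu>\<in>?I. SUP x. \<bar>mi_deriv \<mu> \<phi> x\<bar>)"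
    proof (cases "y \<in> V")
      case True
      have "\<bar>mi_deriv \<nu> (\<lambda>y. a y * \<phi> (S y)) y\<bar> = \<bar>\<Sum>\<mu>\<in>?I. c \<mu> y * mi_deriv \<mu> \<phi> (S y)\<bar>"
        by (simp only: cf[OF test_functions_Ck[OF \<phi>] True])
      also have "\<dots> \<le> (\<Sum>\<mu>\<in>?I. \<bar>c \<mu> y * mi_deriv \<mu> \<phi> (S y)\<bar>)" by (rule sum_abs)
      also have "\<dots> \<le> (\<Sum>\<mu>\<in>?I. C * (SUP x. \<bar>mi_deriv \<mu> \<phi> x\<bar>))"
        unfolding abs_mult by (intro sum_mono mult_mono sup(1)) (use C M(2) in \<open>auto intro: order_trans\<close>)
      finally show ?thesis by (simp add: sum_distrib_left)
    next
      case False
      have "mi_deriv \<nu> (\<lambda>y. a y * \<phi> (S y)) y = 0"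
        by (rule mi_deriv_zero_outside[OF cK]) (use K False in auto)
      then show ?thesis using C(1) sup(2) by (simp add: sum_nonneg)
    qed
  qed simp
  then show ?thesis using C(1) by blast
qed

lemma smooth_mult_compose_test:
  fixes S :: "real^'n \<Rightarrow> real^'n"
  assumes "open V" "open U" "S ` V \<subseteq> U" and S: "\<And>k j. Ck_on k V (\<lambda>y. S y $ j)" and a: "a \<in> test_functions V"
    and f: "\<And>k. Ck_on k U f"
  shows "(\<lambda>y. a y * f (S y)) \<in> test_functions V"
proof -
  obtain K where K: "compact K" "K \<subseteq> V" "\<And>y. y \<notin> K \<Longrightarrow> a y = 0" using test_functionsE[OF a] by metis
  show ?thesis
  proof (rule test_functionsI[OF _ K(1,2)])
    show "Ck_on k UNIV (\<lambda>y. a y * f (S y))" for k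
    proof (rule Ck_on_zero_extension[OF assms(1) compact_imp_closed[OF K(1)] K(2)])
      show "Ck_on k V (\<lambda>y. a y * f (S y))"
        by (intro Ck_on_mult assms(1) test_functions_Ck[OF a] Ck_on_compose[OF assms(1-3) f S])
    qed (simp add: K(3))
  qed (simp add: K(3))
qed

text \<open>Multiplication-composition operators act on \<open>W\<^sub>0\<close>, because they map test functions to test
  functions.\<close>

lemma sobolev0_mult_compose:
  fixes S :: "real^'n \<Rightarrow> real^'n"
  assumes VU: "open V" "open U" "S ` V \<subseteq> U" "\<And>k j. Ck_on k V (\<lambda>y. S y $ j)" and a: "a \<in> test_functions V" and q: "1 < q"
    and C: "C > 0" "\<And>v. v \<in> sobolev U \<sigma> q \<Longrightarrow> (\<lambda>y. a y * v (S y)) \<in> sobolev V \<sigma> q \<and>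
      sobolev_norm V \<sigma> q (\<lambda>y. a y * v (S y)) \<le> ennreal C * sobolev_norm U \<sigma> q v"
    and v: "v \<in> sobolev0 U \<sigma> q"
  shows "(\<lambda>y. a y * v (S y)) \<in> sobolev0 V \<sigma> q"
  unfolding sobolev0_def mem_Collect_eq
proof (intro conjI allI impI)
  have vs: "v \<in> sobolev U \<sigma> q" using v by (simp add: sobolev0_def)
  show "(\<lambda>y. a y * v (S y)) \<in> sobolev V \<sigma> q" using C(2)[OF vs] by simp
  fix e :: real assume "e > 0"
  then have "e / C > 0" using C(1) by simp
  then obtain \<phi> where \<phi>: "\<phi> \<in> test_functions U" "sobolev_norm U \<sigma> q (\<lambda>x. v x - \<phi> x) < ennreal (e / C)"
    using v unfolding sobolev0_def by blast
  have "sobolev_norm U \<sigma> q (\<lambda>x. v x - \<phi> x) < \<infinity>" using \<phi>(2) by (rule less_trans) simp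
  from C(2)[OF sobolev_diff_test[OF VU(2) q vs \<phi>(1) this]]
  have "sobolev_norm V \<sigma> q (\<lambda>y. a y * v (S y) - a y * \<phi> (S y)) \<le> ennreal C * sobolev_norm U \<sigma> q (\<lambda>x. v x - \<phi> x)"
    by (simp add: right_diff_distrib)
  also have "\<dots> < ennreal C * ennreal (e / C)" using \<phi>(2) C(1) by (intro ennreal_mult_strict_left_mono) auto
  also have "\<dots> = ennreal e" using C(1) \<open>e > 0\<close> by (simp add: ennreal_mult[symmetric])
  finally show "\<exists>\<psi>\<in>test_functions V. sobolev_norm V \<sigma> q (\<lambda>y. a y * v (S y) - \<psi> y) < ennreal e"
    using smooth_mult_compose_test[OF VU a test_functions_Ck[OF \<phi>(1)]] by (intro bexI[of _ "\<lambda>y. a y * \<phi> (S y)"])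
qed

text \<open>A functional is pulled back along the operator \<open>v \<mapsto> a (v \<circ> S)\<close>. If its norm is at most \<open>C\<close> and \<open>v\<close> lies in the unit ball, then
  so does the image of \<open>v\<close> divided by \<open>C\<close>.\<close>

lemma sobolev0_dual_mult_compose:
  fixes S :: "real^'n \<Rightarrow> real^'n"
  assumes VU: "open V" "open U" "S ` V \<subseteq> U" "\<And>k j. Ck_on k V (\<lambda>y. S y $ j)" and a: "a \<in> test_functions V" and q: "1 < q"
    and C: "C > 0" "\<And>v. v \<in> sobolev U \<sigma> q \<Longrightarrow> (\<lambda>y. a y * v (S y)) \<in> sobolev V \<sigma> q \<and>
      sobolev_norm V \<sigma> q (\<lambda>y. a y * v (S y)) \<le> ennreal C * sobolev_norm U \<sigma> q v"
    and F: "F \<in> sobolev0_dual V \<sigma> q"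
  shows "(\<lambda>v. F (\<lambda>y. a y * v (S y))) \<in> sobolev0_dual U \<sigma> q"
    and "sobolev0_dual_norm U \<sigma> q (\<lambda>v. F (\<lambda>y. a y * v (S y))) \<le> ennreal C * sobolev0_dual_norm V \<sigma> q F"
proof -
  let ?M = "\<lambda>v y. a y * v (S y)"
  have lin: "F (\<lambda>x. \<alpha> * v x + \<beta> * w x) = \<alpha> * F v + \<beta> * F w" if "v \<in> sobolev0 V \<sigma> q" "w \<in> sobolev0 V \<sigma> q" for v w \<alpha> \<beta>
    using F that by (auto simp: sobolev0_dual_def)
  have fin: "sobolev0_dual_norm V \<sigma> q F < \<infinity>" using F by (auto simp: sobolev0_dual_def)
  have M0: "?M v \<in> sobolev0 V \<sigma> q" if "v \<in> sobolev0 U \<sigma> q" for v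
    by (rule sobolev0_mult_compose[OF VU a q C that])
  show n: "sobolev0_dual_norm U \<sigma> q (\<lambda>v. F (?M v)) \<le> ennreal C * sobolev0_dual_norm V \<sigma> q F"
    unfolding sobolev0_dual_norm_def[of U]
  proof (rule SUP_least)
    fix v assume v: "v \<in> {v \<in> sobolev0 U \<sigma> q. sobolev_norm U \<sigma> q v \<le> 1}"
    then have v0: "v \<in> sobolev0 U \<sigma> q" and v1: "sobolev_norm U \<sigma> q v \<le> 1" by auto
    have q0: "q > 0" and c0: "1 / C > 0" using q C(1) by simp_all
    have vM: "?M v \<in> sobolev V \<sigma> q" "sobolev_norm V \<sigma> q (?M v) \<le> ennreal C * sobolev_norm U \<sigma> q v"
      using C(2) v0 by (auto simp: sobolev0_def)
    let ?w = "\<lambda>y. (1 / C) * ?M v y"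
    have w0: "?w \<in> sobolev0 V \<sigma> q" by (rule sobolev0_cmult[OF VU(1) c0 q0 M0[OF v0]])
    have "sobolev_norm V \<sigma> q ?w = ennreal (1 / C) * sobolev_norm V \<sigma> q (?M v)"
      using vM(1) by (intro sobolev_norm_cmult VU(1) c0 q0) (simp add: sobolev_def)
    also have "\<dots> \<le> ennreal (1 / C) * (ennreal C * 1)"
      by (rule mult_left_mono[OF order_trans[OF vM(2) mult_left_mono[OF v1]]]) simp_all
    also have "\<dots> = 1" using C(1) by (simp add: ennreal_mult[symmetric])
    finally have "ennreal \<bar>F ?w\<bar> \<le> sobolev0_dual_norm V \<sigma> q F"
      unfolding sobolev0_dual_norm_def using w0 by (intro SUP_upper) simp
    moreover have "F (?M v) = C * F ?w"
      using lin[OF w0 w0, of C 0] C(1) by simp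
    ultimately show "ennreal \<bar>F (?M v)\<bar> \<le> ennreal C * sobolev0_dual_norm V \<sigma> q F"
      using C(1) by (simp add: abs_mult ennreal_mult mult_left_mono)
  qed
  have "F (?M (\<lambda>x. \<alpha> * v x + \<beta> * w x)) = \<alpha> * F (?M v) + \<beta> * F (?M w)"
    if "v \<in> sobolev0 U \<sigma> q" "w \<in> sobolev0 U \<sigma> q" for v w \<alpha> \<beta>
  proof -
    have "?M (\<lambda>x. \<alpha> * v x + \<beta> * w x) = (\<lambda>y. \<alpha> * ?M v y + \<beta> * ?M w y)" by (simp add: fun_eq_iff algebra_simps)
    then show ?thesis using lin[OF M0[OF that(1)] M0[OF that(2)]] by simp
  qed
  moreover have "sobolev0_dual_norm U \<sigma> q (\<lambda>v. F (?M v)) < \<infinity>"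
    by (rule le_less_trans[OF n]) (use fin in \<open>simp add: ennreal_mult_less_top\<close>)
  ultimately show "(\<lambda>v. F (?M v)) \<in> sobolev0_dual U \<sigma> q" by (simp add: sobolev0_dual_def)
qed

text \<open>The function \<open>?pull \<phi>\<close> is the argument of \<open>u\<close> in the definition of the pullback. It is a test function of the form
  \<open>\<rho> D (\<phi> \<circ> S)\<close> with a cutoff function \<open>\<rho>\<close> that depends on a compact set containing the support of \<open>\<phi>\<close> only, which gives the
  continuity of the pullback. The cutoff function \<open>\<eta>\<close> of the operator on \<open>W\<^sub>0\<close>, on the other hand, depends on \<open>B\<close> only.\<close>

theorem composition_bounded_neg:
  fixes T :: "real^'n \<Rightarrow> real^'n"
  assumes "s < 0" "1 < p" "open U" "open V" "smooth_diffeo U V T" "bounded B" "closure B \<subseteq> U"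
  shows "composition_bounded s p U V T B"
proof -
  define q where "q = p / (p - 1)"
  define S where "S = inv_into U T"
  define D where "D y = \<bar>det (jacobian S (at y))\<bar>" for y
  have q: "1 < q" using assms(2) by (simp add: q_def field_simps)
  have Tk: "Ck_diffeo k U V T" for k using assms(5) by (simp add: smooth_diffeo_def)
  have Sk: "Ck_diffeo k V U S" for k unfolding S_def by (rule Ck_diffeo_inverse[OF Tk assms(3)])
  have bij: "bij_betw T U V" using Tk by (simp add: Ck_diffeo_def)
  have Sc: "\<And>k j. Ck_on k V (\<lambda>y. S y $ j)" and Tc: "\<And>k j. Ck_on k U (\<lambda>x. T x $ j)"
    using Sk Tk unfolding Ck_diffeo_def by blast+
  have SV: "S ` V \<subseteq> U" using bij_betw_inv_into[OF bij] by (simp add: S_def bij_betw_def)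
  have TS: "T (S y) = y" if "y \<in> V" for y using bij that by (auto simp: S_def bij_betw_def f_inv_into_f)
  have Dk: "Ck_on k V D" for k unfolding D_def by (rule Ck_on_abs_det_jacobian[OF Sk assms(3,4)])
  have Tcont: "continuous_on U T" by (rule continuous_on_components[OF Ck_on_imp_continuous[OF Tc]])
  have TK: "compact (T ` K)" "T ` K \<subseteq> V" if "compact K" "K \<subseteq> U" for K
    using that bij by (auto simp: bij_betw_def intro!: compact_continuous_image continuous_on_subset[OF Tcont])
  have weight: "(\<lambda>y. \<rho> y * D y) \<in> test_functions V" if \<rho>: "\<rho> \<in> test_functions V" for \<rho>
  proof -
    obtain K where K: "compact K" "K \<subseteq> V" "\<And>y. y \<notin> K \<Longrightarrow> \<rho> y = 0" using test_functionsE[OF \<rho>] by metis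
    show ?thesis
    proof (rule test_functionsI[OF _ K(1,2)])
      show "Ck_on k UNIV (\<lambda>y. \<rho> y * D y)" for k
        by (rule Ck_on_zero_extension[OF assms(4) compact_imp_closed[OF K(1)] K(2)
              Ck_on_mult[OF assms(4) test_functions_Ck[OF \<rho>] Dk]]) (simp add: K(3))
    qed (simp add: K(3))
  qed
  let ?pull = "\<lambda>\<phi> y. if y \<in> V then D y * \<phi> (S y) else 0"
  have pull_eq: "?pull \<phi> = (\<lambda>y. \<rho> y * D y * \<phi> (S y))"
    if "\<rho> \<in> test_functions V" "\<And>x. x \<notin> K \<Longrightarrow> \<phi> x = 0" "\<And>y. y \<in> T ` K \<Longrightarrow> \<rho> y = 1" for \<phi> \<rho> K
  proof
    fix y
    show "?pull \<phi> y = \<rho> y * D y * \<phi> (S y)"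
    proof (cases "y \<in> V")
      case True
      show ?thesis
      proof (cases "S y \<in> K")
        case inK: True
        then have "\<rho> y = 1" using that(3) TS[OF True] by (metis imageI)
        then show ?thesis using True by simp
      next
        case False
        then show ?thesis using that(2) by simp
      qed
    qed (simp add: test_functions_outside[OF that(1)])
  qed
  have cutoff: "\<exists>\<rho>\<in>test_functions V. \<forall>y\<in>T ` K. \<rho> y = 1" if "compact K" "K \<subseteq> U" for K
    using smooth_cutoff[OF TK(1)[OF that] assms(4) TK(2)[OF that]] by (metis subsetD)
  have pull_test: "?pull \<phi> \<in> test_functions V" if \<phi>: "\<phi> \<in> test_functions U" for \<phi>
  proof -
    obtain K where K: "compact K" "K \<subseteq> U" "\<And>x. x \<notin> K \<Longrightarrow> \<phi> x = 0" using test_functionsE[OF \<phi>] by metis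
    obtain \<rho> where \<rho>: "\<rho> \<in> test_functions V" "\<And>y. y \<in> T ` K \<Longrightarrow> \<rho> y = 1" using cutoff[OF K(1,2)] by blast
    have eq: "?pull \<phi> = (\<lambda>y. \<rho> y * D y * \<phi> (S y))"
      by (rule pull_eq[OF \<rho>(1)]) (rule K(3) \<rho>(2), assumption)+
    show ?thesis unfolding eq
      by (rule smooth_mult_compose_test[OF assms(4,3) SV Sc weight[OF \<rho>(1)] test_functions_Ck[OF \<phi>]])
  qed
  have pullback: "dist_pullback U V T u = (\<lambda>\<phi>. u (?pull \<phi>))" for u
    unfolding D_def S_def by (rule ext) (rule dist_pullback_def)
  have pull_dist: "(\<lambda>\<phi>. u (?pull \<phi>)) \<in> distributions U" if u: "u \<in> distributions V" for u
    unfolding distributions_def mem_Collect_eq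
  proof (intro conjI ballI allI impI)
    fix \<phi> \<psi> a b assume \<phi>: "\<phi> \<in> test_functions U" and \<psi>: "\<psi> \<in> test_functions U"
    have "?pull (\<lambda>x. a * \<phi> x + b * \<psi> x) = (\<lambda>y. a * ?pull \<phi> y + b * ?pull \<psi> y)" by (simp add: fun_eq_iff algebra_simps)
    then show "u (?pull (\<lambda>x. a * \<phi> x + b * \<psi> x)) = a * u (?pull \<phi>) + b * u (?pull \<psi>)"
      by (simp only: distributions_linear[OF u pull_test[OF \<phi>] pull_test[OF \<psi>]])
  next
    fix K assume "compact K \<and> K \<subseteq> U"
    then have K: "compact K" "K \<subseteq> U" by auto
    obtain \<rho> where \<rho>: "\<rho> \<in> test_functions V" "\<And>y. y \<in> T ` K \<Longrightarrow> \<rho> y = 1" using cutoff[OF K] by blast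
    obtain C N where CN: "\<And>\<psi>. \<psi> \<in> test_functions V \<Longrightarrow> closure {y. \<psi> y \<noteq> 0} \<subseteq> T ` K \<Longrightarrow>
        \<bar>u \<psi>\<bar> \<le> C * (\<Sum>\<nu> | mi_order \<nu> \<le> N. SUP y. \<bar>mi_deriv \<nu> \<psi> y\<bar>)"
      by (rule distributions_bound[OF u TK[OF K]]) blast
    let ?I = "{\<nu> :: 'n \<Rightarrow> nat. mi_order \<nu> \<le> N}"
    have "\<forall>\<nu>. \<exists>E\<ge>0. \<forall>\<phi>\<in>test_functions U. (SUP y. \<bar>mi_deriv \<nu> (\<lambda>y. \<rho> y * D y * \<phi> (S y)) y\<bar>) \<le>
        E * (\<Sum>\<mu> | mi_order \<mu> \<le> mi_order \<nu>. SUP x. \<bar>mi_deriv \<mu> \<phi> x\<bar>)"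
      using mi_deriv_mult_compose_bound[OF assms(4,3) SV Sc weight[OF \<rho>(1)]] by blast
    from choice[OF this] obtain E where E: "\<And>\<nu>. E \<nu> \<ge> 0" "\<And>\<nu> \<phi>. \<phi> \<in> test_functions U \<Longrightarrow>
        (SUP y. \<bar>mi_deriv \<nu> (\<lambda>y. \<rho> y * D y * \<phi> (S y)) y\<bar>) \<le> E \<nu> * (\<Sum>\<mu> | mi_order \<mu> \<le> mi_order \<nu>. SUP x. \<bar>mi_deriv \<mu> \<phi> x\<bar>)"
      by blast
    have "\<bar>u (?pull \<phi>)\<bar> \<le> (\<bar>C\<bar> * (\<Sum>\<nu>\<in>?I. E \<nu>)) * (\<Sum>\<nu>\<in>?I. SUP x. \<bar>mi_deriv \<nu> \<phi> x\<bar>)"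
      if \<phi>: "\<phi> \<in> test_functions U" and supp: "closure {x. \<phi> x \<noteq> 0} \<subseteq> K" for \<phi>
    proof -
      have z: "\<phi> x = 0" if "x \<notin> K" for x using supp closure_subset[of "{x. \<phi> x \<noteq> 0}"] that by blast
      have eq: "?pull \<phi> = (\<lambda>y. \<rho> y * D y * \<phi> (S y))"
        by (rule pull_eq[OF \<rho>(1)]) (rule z \<rho>(2), assumption)+
      have "{y. ?pull \<phi> y \<noteq> 0} \<subseteq> T ` K"
      proof
        fix y assume "y \<in> {y. ?pull \<phi> y \<noteq> 0}"
        then have "y \<in> V" "\<phi> (S y) \<noteq> 0" by (auto split: if_splits)
        then show "y \<in> T ` K" using z[of "S y"] TS[of y] by (metis imageI)
      qed
      then have "closure {y. ?pull \<phi> y \<noteq> 0} \<subseteq> T ` K"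
        by (rule closure_minimal[OF _ compact_imp_closed[OF TK(1)[OF K]]])
      from CN[OF pull_test[OF \<phi>] this]
      have "\<bar>u (?pull \<phi>)\<bar> \<le> C * (\<Sum>\<nu>\<in>?I. SUP y. \<bar>mi_deriv \<nu> (?pull \<phi>) y\<bar>)" .
      also have "\<dots> \<le> \<bar>C\<bar> * (\<Sum>\<nu>\<in>?I. SUP y. \<bar>mi_deriv \<nu> (?pull \<phi>) y\<bar>)"
        by (intro mult_right_mono abs_ge_self sum_nonneg test_functions_SUP(2)[OF pull_test[OF \<phi>]])
      also have "(\<Sum>\<nu>\<in>?I. SUP y. \<bar>mi_deriv \<nu> (?pull \<phi>) y\<bar>) \<le> (\<Sum>\<nu>\<in>?I. E \<nu> * (\<Sum>\<mu>\<in>?I. SUP x. \<bar>mi_deriv \<mu> \<phi> x\<bar>))"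
      proof (rule sum_mono)
        fix \<nu> assume "\<nu> \<in> ?I"
        then have \<nu>: "mi_order \<nu> \<le> N" by simp
        have "(SUP y. \<bar>mi_deriv \<nu> (?pull \<phi>) y\<bar>) \<le> E \<nu> * (\<Sum>\<mu> | mi_order \<mu> \<le> mi_order \<nu>. SUP x. \<bar>mi_deriv \<mu> \<phi> x\<bar>)"
          unfolding eq by (rule E(2)[OF \<phi>])
        also have "\<dots> \<le> E \<nu> * (\<Sum>\<mu>\<in>?I. SUP x. \<bar>mi_deriv \<mu> \<phi> x\<bar>)"
          using \<nu> by (intro mult_left_mono[OF _ E(1)] sum_mono2 finite_mi_order_le) (auto intro: test_functions_SUP(2)[OF \<phi>])
        finally show "(SUP y. \<bar>mi_deriv \<nu> (?pull \<phi>) y\<bar>) \<le> E \<nu> * (\<Sum>\<mu>\<in>?I. SUP x. \<bar>mi_deriv \<mu> \<phi> x\<bar>)" .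
      qed
      finally show ?thesis by (simp add: sum_distrib_right mult.assoc mult_left_mono)
    qed
    then show "\<exists>C N. \<forall>\<phi>\<in>test_functions U. closure {x. \<phi> x \<noteq> 0} \<subseteq> K \<longrightarrow>
        \<bar>u (?pull \<phi>)\<bar> \<le> C * (\<Sum>\<nu> | mi_order \<nu> \<le> N. SUP x. \<bar>mi_deriv \<nu> \<phi> x\<bar>)" by blast
  qed
  have cB: "compact (closure B)" using assms(6) by simp
  obtain \<eta> W where \<eta>: "\<eta> \<in> test_functions V" "open W" "T ` closure B \<subseteq> W" "\<And>y. y \<in> W \<Longrightarrow> \<eta> y = 1"
    using smooth_cutoff[OF TK(1)[OF cB assms(7)] assms(4) TK(2)[OF cB assms(7)]] by metis
  define a where "a = (\<lambda>y. \<eta> y * D y)"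
  have a: "a \<in> test_functions V" unfolding a_def by (rule weight[OF \<eta>(1)])
  obtain Ka where Ka: "compact Ka" "Ka \<subseteq> V" "\<And>y. y \<notin> Ka \<Longrightarrow> a y = 0" using test_functionsE[OF a] by metis
  obtain C where C: "C > 0" "\<And>v. v \<in> sobolev U (-s) q \<Longrightarrow> (\<lambda>y. a y * v (S y)) \<in> sobolev V (-s) q \<and>
      sobolev_norm V (-s) q (\<lambda>y. a y * v (S y)) \<le> ennreal C * sobolev_norm U (-s) q v"
    using sobolev_mult_compose_bounded[OF assms(4,3) Sk Ka(1,2) test_functions_Ck[OF a] Ka(3) q] by blast
  have dual: "(\<lambda>v. F (\<lambda>y. a y * v (S y))) \<in> sobolev0_dual U (-s) q"
    "sobolev0_dual_norm U (-s) q (\<lambda>v. F (\<lambda>y. a y * v (S y))) \<le> ennreal C * sobolev0_dual_norm V (-s) q F"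
    if "F \<in> sobolev0_dual V (-s) q" for F
    by ((rule sobolev0_dual_mult_compose[OF assms(4,3) SV Sc a q C that], assumption)+)
  have "dist_pullback U V T u \<in> neg_sobolev U s p \<and>
      neg_sobolev_norm U s p (dist_pullback U V T u) \<le> ennreal C * neg_sobolev_norm V s p u"
    if u: "u \<in> neg_sobolev V s p" and supp: "dist_support V u \<subseteq> T ` B" for u
  proof -
    have ud: "u \<in> distributions V" using u by (simp add: neg_sobolev_def)
    \<comment> \<open>The two test functions differ only outside the neighbourhood \<open>W\<close> of the support of \<open>u\<close>.\<close>
    have agree: "u (\<lambda>y. a y * \<phi> (S y)) = u (?pull \<phi>)" if \<phi>: "\<phi> \<in> test_functions U" for \<phi>
    proof -
      obtain K where K: "compact K" "K \<subseteq> U" "\<And>x. x \<notin> K \<Longrightarrow> \<phi> x = 0" using test_functionsE[OF \<phi>] by metis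
      have t: "(\<lambda>y. a y * \<phi> (S y)) \<in> test_functions V"
        by (rule smooth_mult_compose_test[OF assms(4,3) SV Sc a test_functions_Ck[OF \<phi>]])
      have d: "(\<lambda>y. 1 * (a y * \<phi> (S y)) + (-1) * ?pull \<phi> y) \<in> test_functions V"
        by (rule test_functions_lincomb[OF t pull_test[OF \<phi>]])
      have "u (\<lambda>y. 1 * (a y * \<phi> (S y)) + (-1) * ?pull \<phi> y) = 0"
      proof (rule distribution_zero_off_support[OF assms(4) ud d])
        show "compact (T ` K - W)" by (rule compact_diff[OF TK(1)[OF K(1,2)] \<eta>(2)])
        show "T ` K - W \<subseteq> V" using TK(2)[OF K(1,2)] by blast
        show "(T ` K - W) \<inter> dist_support V u = {}" using supp \<eta>(3) closure_subset[of B] by blast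
        fix y assume y: "y \<notin> T ` K - W"
        show "1 * (a y * \<phi> (S y)) + (-1) * ?pull \<phi> y = 0"
        proof (cases "y \<in> V")
          case True
          show ?thesis
          proof (cases "y \<in> W")
            case True
            then show ?thesis using \<open>y \<in> V\<close> \<eta>(4) by (simp add: a_def)
          next
            case False
            then have "S y \<notin> K" using y TS[OF \<open>y \<in> V\<close>] by (metis DiffI imageI)
            then show ?thesis using K(3) by simp
          qed
        qed (simp add: test_functions_outside[OF a])
      qed
      then show ?thesis using distributions_linear[OF ud t pull_test[OF \<phi>], of 1 "-1"] by simp
    qed
    have ext: "(\<lambda>v. F (\<lambda>y. a y * v (S y))) \<in> dual_extensions U s p (dist_pullback U V T u)"
      if F: "F \<in> dual_extensions V s p u" for F
    proof -
      have F': "F \<in> sobolev0_dual V (-s) q" "\<And>\<phi>. \<phi> \<in> test_functions V \<Longrightarrow> F \<phi> = u \<phi>"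
        using F by (auto simp: dual_extensions_def q_def)
      have "F (\<lambda>y. a y * \<phi> (S y)) = dist_pullback U V T u \<phi>" if \<phi>: "\<phi> \<in> test_functions U" for \<phi>
        using F'(2)[OF smooth_mult_compose_test[OF assms(4,3) SV Sc a test_functions_Ck[OF \<phi>]]] agree[OF \<phi>]
        by (simp add: pullback)
      then show ?thesis using dual(1)[OF F'(1)] by (simp add: dual_extensions_def q_def)
    qed
    have le: "neg_sobolev_norm U s p (dist_pullback U V T u) \<le> ennreal C * sobolev0_dual_norm V (-s) q F"
      if F: "F \<in> dual_extensions V s p u" for F
    proof -
      have "neg_sobolev_norm U s p (dist_pullback U V T u) \<le> sobolev0_dual_norm U (-s) q (\<lambda>v. F (\<lambda>y. a y * v (S y)))"
        unfolding neg_sobolev_norm_def q_def by (rule INF_lower[OF ext[OF F]])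
      also have "\<dots> \<le> ennreal C * sobolev0_dual_norm V (-s) q F"
        using F by (intro dual(2)) (simp add: dual_extensions_def q_def)
      finally show ?thesis .
    qed
    have e: "ennreal C * (ennreal (1 / C) * y) = y" "ennreal (1 / C) * (ennreal C * y) = y" for y
      using C(1) by (simp_all add: mult.assoc[symmetric] ennreal_mult[symmetric])
    have "ennreal (1 / C) * neg_sobolev_norm U s p (dist_pullback U V T u) \<le> neg_sobolev_norm V s p u"
      unfolding neg_sobolev_norm_def[of V] q_def[symmetric]
    proof (rule INF_greatest)
      fix F assume "F \<in> dual_extensions V s p u"
      from mult_left_mono[OF le[OF this], of "ennreal (1 / C)"]
      show "ennreal (1 / C) * neg_sobolev_norm U s p (dist_pullback U V T u) \<le> sobolev0_dual_norm V (-s) q F"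
        by (simp add: e)
    qed
    from mult_left_mono[OF this, of "ennreal C"]
    have "neg_sobolev_norm U s p (dist_pullback U V T u) \<le> ennreal C * neg_sobolev_norm V s p u" by (simp add: e)
    moreover have "dist_pullback U V T u \<in> neg_sobolev U s p"
      using u ext pull_dist[OF ud] by (auto simp: neg_sobolev_def pullback)
    ultimately show ?thesis by simp
  qed
  then show ?thesis using assms(1) unfolding composition_bounded_def by (auto simp: not_le[symmetric])
qed

theorem theorem7p63:
  fixes s p :: real
    and U V B :: "(real^'n) set"
    and T :: "real^'n \<Rightarrow> real^'n"
  assumes "1 < p"
    and "open U" "U \<noteq> {}" "open V" "V \<noteq> {}"
    and "smooth_diffeo U V T \<or> (0 \<le> s \<and> Ck_diffeo (nat \<lfloor>s\<rfloor> + 1) U V T)"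
    and "open B" "B \<noteq> {}" "bounded B" "closure B \<subseteq> U"
  shows "(\<not> (s \<notin> \<int> \<and> s < -1) \<longrightarrow> composition_bounded s p U V T B) \<and>
    ((lipschitz_domain U \<or> U = UNIV) \<and> (lipschitz_domain V \<or> V = UNIV) \<longrightarrow>
       composition_bounded s p U V T B)"
proof -
  have "composition_bounded s p U V T B"
  proof (cases "0 \<le> s")
    case True
    then have "Ck_diffeo (nat \<lfloor>s\<rfloor> + 1) U V T" using assms(6) by (auto simp: smooth_diffeo_def)
    then show ?thesis by (rule composition_bounded_nonneg[OF True assms(1,2,4) _ assms(9,10)])
  next
    case False
    then have "s < 0" "smooth_diffeo U V T" using assms(6) by auto
    then show ?thesis using composition_bounded_neg assms(1,2,4,9,10) by blast
  qed
  then show ?thesis by blast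
qed

end
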